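(* Let $Y_t=e^{W_t-t/2}$, $t\in[0,T]$, be the geometric Brownian motion and, for $g\in C_Y$, let $G(t,y):=\mathbb E\,g(yY_{T-t})$, $\varphi_t:=\frac{\partial G}{\partial y}(t,Y_t)$ and $Z_t:=Y_t\frac{\partial G}{\partial y}(t,Y_t)$ for $t\in[0,T)$. (1) For $g\in C_Y$ the process $\varphi=(\varphi_t)_{t\in[0,T)}$ is of maximal oscillation. (2) Let $\theta\in(0,1)$ and $\Phi_t:=Y_t^\theta$. Then for all $p\in(0,\infty)$ the condition $g\in \mathrm{H\ddot{o}l}_{\theta,2}(\mathbb R)$ implies that (a) $\mathcal I^{\frac{1-\theta}{2}}Z-Z_0\in\mathrm{BMO}_p^\Phi([0,T))$, (b) the limit $\mathcal I_T^{\frac{1-\theta}{2}}Z:=\lim_{t\uparrow T}\mathcal I_t^{\frac{1-\theta}{2}}Z$ exists in $L_p$ and a.s.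
   Context: $T\in(0,\infty)$; $W=(W_t)_{t\in[0,T]}$ is a standard Brownian motion with continuous paths and $W_0\equiv0$ on a complete probability space $(\Omega,\mathcal F,\mathbb P)$, $(\mathcal F_t)_{t\in[0,T]}$ is the augmentation of its natural filtration, and $\mathcal F=\mathcal F_T$. $C_Y$ is the set of Borel functions $g:(0,\infty)\to\mathbb R$ for which there is an $m>0$ such that $\sup_{x\in\mathbb R}e^{-m|x|}\int_{\mathbb R}|g(e^{x+ty})|^2e^{-y^2}dy<\infty$ for all $t>0$. For such $g$ the function $G$ is smooth on $[0,T)\times(0,\infty)$. A function $g\in\mathrm{H\ddot ol}_{\theta,2}(\mathbb R)$ is used through its restriction to $(0,\infty)$, which belongs to $C_Y$. H\"older spaces: $C_b^0(\mathbb R)$ is the Banach space of bounded continuous functions on $\mathbb R$ vanishing at $0$ with the sup-norm; $\mathrm{H\ddot ol}_1^0(\mathbb R)$ is the Banach space of Lipschitz functions on $\mathbb R$ vanishing at $0$ with the Lipschitz constant as norm. For $v>0$ and $f\in C_b^0+\mathrm{H\ddot ol}_1^0$ let $K(v,f):=\inf\{\|f_0\|_{C_b^0}+v\|f_1\|_{\mathrm{H\ddot ol}_1^0}:f=f_0+f_1\}$. For $(\theta,q)\in(0,1)\times[1,\infty]$, $\mathrm{H\ddot ol}_{\theta,q}(\mathbb R):=(C_b^0(\mathbb R),\mathrm{H\ddot ol}_1^0(\mathbb R))_{\theta,q}$ is the space of those $f$ with $\|f\|_{\mathrm{H\ddot ol}_{\theta,q}}:=\|v\mapsto v^{-\theta}K(v,f)\|_{L_q((0,\infty),dv/v)}<\infty$.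 A process $\varphi$ is of maximal oscillation if there is a constant $c\ge1$ such that for all $t\in(0,T)$ one has $\underline{\mathrm{Osc}}_t(\varphi):=\inf_{s\in[0,t)}\|\varphi_t-\varphi_s\|_{L_\infty}\ge\frac1c\|\varphi_t-\varphi_0\|_{L_\infty}$. For a càdlàg $K:[0,T)\to\mathbb R$ (path-wise for processes) and $\alpha>0$: $\mathcal I_t^\alpha K:=\frac{\alpha}{T^\alpha}\int_0^T(T-u)^{\alpha-1}K_{u\wedge t}\,du$, $t\in[0,T)$, $\mathcal I^\alpha K:=(\mathcal I^\alpha_tK)_{t\in[0,T)}$. For adapted càdlàg $Y'=(Y'_t)_{t\in[0,T)}$ with $Y'_0\equiv 0$, adapted càdlàg $\Phi\ge0$ and $p\in(0,\infty)$, $Y'\in\mathrm{BMO}_p^\Phi([0,T))$ means that there is a $c\in[0,\infty)$ with $\mathbb E^{\mathcal F_\rho}[|Y'_t-Y'_{\rho-}|^p]\le c^p\Phi_\rho^p$ a.s. for all $t\in[0,T)$ and all stopping times $\rho:\Omega\to[0,t]$ ($Y'_{0-}:=Y'_0$). *)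

theory Defs
  imports "HOL-Probability.Probability"
begin

text \<open>Processes are functions of type \<open>real \<Rightarrow> 'a \<Rightarrow> real\<close>; only their values at times in
  \<open>[0, T]\<close> (for \<open>W\<close>) or \<open>[0, T)\<close> matter. Pathwise properties are required for every
  \<open>\<omega> \<in> space M\<close>, not merely almost surely.\<close>

text \<open>The root is taken on the real side because \<open>powr\<close> is not available on \<open>ennreal\<close>. For
  \<open>p < 1\<close> this is the usual quasi-norm.\<close>

definition Lp_norm :: "ennreal \<Rightarrow> 'a measure \<Rightarrow> ('a \<Rightarrow> real) \<Rightarrow> ennreal" where
  "Lp_norm p M f =
     (if p = \<infinity> then esssup M (\<lambda>x. ennreal \<bar>f x\<bar>)
      else let I = (\<integral>\<^sup>+ x. ennreal (\<bar>f x\<bar> powr enn2real p) \<partial>M)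
           in if I = \<infinity> then \<infinity> else ennreal (enn2real I powr (1 / enn2real p)))"

definition Lp_space :: "ennreal \<Rightarrow> 'a measure \<Rightarrow> ('a \<Rightarrow> real) set" where
  "Lp_space p M = {f \<in> borel_measurable M. Lp_norm p M f < \<infinity>}"

definition brownian_motion :: "'a measure \<Rightarrow> real \<Rightarrow> (real \<Rightarrow> 'a \<Rightarrow> real) \<Rightarrow> bool" where
  "brownian_motion M T W \<longleftrightarrow>
     prob_space M \<and>
     (\<forall>t\<in>{0..T}. W t \<in> borel_measurable M) \<and>
     (\<forall>\<omega>\<in>space M. W 0 \<omega> = 0 \<and> continuous_on {0..T} (\<lambda>t. W t \<omega>)) \<and>
     (\<forall>s t. 0 \<le> s \<and> s < t \<and> t \<le> T \<longrightarrow>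
        distributed M lborel (\<lambda>\<omega>. W t \<omega> - W s \<omega>) (normal_density 0 (sqrt (t - s)))) \<and>
     (\<forall>(n::nat) \<tau>. (\<forall>i\<le>n. \<tau> i \<in> {0..T}) \<and> (\<forall>i<n. \<tau> i \<le> \<tau> (Suc i)) \<longrightarrow>
        prob_space.indep_vars M (\<lambda>_. borel) (\<lambda>i \<omega>. W (\<tau> (Suc i)) \<omega> - W (\<tau> i) \<omega>) {..<n})"

text \<open>The index is an arbitrary real \<open>t\<close>, so that the library's stopping times and
  \<open>filtration.pre_sigma\<close> apply: for \<open>t < 0\<close> only the null sets generate, and the family is
  constant for \<open>t \<ge> T\<close>. Neither range matters for stopping times with values in \<open>[0, T]\<close>.
  On a complete space \<open>null_sets M\<close> contains all subsets of null sets.\<close>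

definition aug_filtration :: "'a measure \<Rightarrow> real \<Rightarrow> (real \<Rightarrow> 'a \<Rightarrow> real) \<Rightarrow> real \<Rightarrow> 'a measure" where
  "aug_filtration M T W t =
     sigma (space M)
       ({W s -` B \<inter> space M | s B. 0 \<le> s \<and> s \<le> t \<and> s \<le> T \<and> B \<in> sets borel} \<union> null_sets M)"

definition adapted :: "(real \<Rightarrow> 'a measure) \<Rightarrow> real \<Rightarrow> (real \<Rightarrow> 'a \<Rightarrow> real) \<Rightarrow> bool" where
  "adapted F T X \<longleftrightarrow> (\<forall>t\<in>{0..<T}. X t \<in> borel_measurable (F t))"

definition cadlag :: "real \<Rightarrow> (real \<Rightarrow> real) \<Rightarrow> bool" where
  "cadlag T x \<longleftrightarrow>
     (\<forall>t\<in>{0..<T}. (x \<longlongrightarrow> x t) (at_right t)) \<and>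
     (\<forall>t\<in>{0<..<T}. \<exists>l. (x \<longlongrightarrow> l) (at_left t))"

text \<open>The convention \<open>x(0-) = x(0)\<close> is in force.\<close>

definition left_lim :: "(real \<Rightarrow> real) \<Rightarrow> real \<Rightarrow> real" where
  "left_lim x t = (if t = 0 then x 0 else Lim (at_left t) x)"

definition adapted_cadlag ::
  "'a measure \<Rightarrow> (real \<Rightarrow> 'a measure) \<Rightarrow> real \<Rightarrow> (real \<Rightarrow> 'a \<Rightarrow> real) \<Rightarrow> bool" where
  "adapted_cadlag M F T X \<longleftrightarrow> adapted F T X \<and> (\<forall>\<omega>\<in>space M. cadlag T (\<lambda>t. X t \<omega>))"

definition lower_osc :: "'a measure \<Rightarrow> (real \<Rightarrow> 'a \<Rightarrow> real) \<Rightarrow> real \<Rightarrow> ennreal" where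
  "lower_osc M X t = (INF s\<in>{0..<t}. Lp_norm \<infinity> M (\<lambda>\<omega>. X t \<omega> - X s \<omega>))"

definition maximal_oscillation :: "'a measure \<Rightarrow> real \<Rightarrow> (real \<Rightarrow> 'a \<Rightarrow> real) \<Rightarrow> bool" where
  "maximal_oscillation M T X \<longleftrightarrow>
     (\<exists>c\<ge>1. \<forall>t\<in>{0<..<T}.
        lower_osc M X t \<ge> ennreal (1 / c) * Lp_norm \<infinity> M (\<lambda>\<omega>. X t \<omega> - X 0 \<omega>))"

text \<open>For times \<open>t < T\<close>; \<open>x\<close> is only evaluated on \<open>[0, t]\<close>.\<close>

definition frac_int :: "real \<Rightarrow> real \<Rightarrow> (real \<Rightarrow> real) \<Rightarrow> real \<Rightarrow> real" where
  "frac_int T \<alpha> x t =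
     \<alpha> / T powr \<alpha> * (LINT u:{0..T}|lborel. (T - u) powr (\<alpha> - 1) * x (min u t))"

definition frac_int_process ::
  "real \<Rightarrow> real \<Rightarrow> (real \<Rightarrow> 'a \<Rightarrow> real) \<Rightarrow> real \<Rightarrow> 'a \<Rightarrow> real" where
  "frac_int_process T \<alpha> X t \<omega> = frac_int T \<alpha> (\<lambda>u. X u \<omega>) t"

text \<open>The conditional expectation of the nonnegative variable is the extended one, which needs no
  integrability.\<close>

definition BMO ::
  "'a measure \<Rightarrow> (real \<Rightarrow> 'a measure) \<Rightarrow> real \<Rightarrow> real \<Rightarrow> (real \<Rightarrow> 'a \<Rightarrow> real)
     \<Rightarrow> (real \<Rightarrow> 'a \<Rightarrow> real) set" where
  "BMO M F T p \<Phi> = {X.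
     adapted_cadlag M F T X \<and> (\<forall>\<omega>\<in>space M. X 0 \<omega> = 0) \<and>
     adapted_cadlag M F T \<Phi> \<and> (\<forall>t\<in>{0..<T}. \<forall>\<omega>\<in>space M. 0 \<le> \<Phi> t \<omega>) \<and>
     (\<exists>c\<ge>0. \<forall>t\<in>{0..<T}. \<forall>\<rho>.
        stopping_time F \<rho> \<and> (\<forall>\<omega>\<in>space M. 0 \<le> \<rho> \<omega> \<and> \<rho> \<omega> \<le> t) \<longrightarrow>
        (AE \<omega> in M.
           nn_cond_exp M (filtration.pre_sigma (space M) F \<rho>)
             (\<lambda>\<omega>'. ennreal (\<bar>X t \<omega>' - left_lim (\<lambda>s. X s \<omega>') (\<rho> \<omega>')\<bar> powr p)) \<omega>
           \<le> ennreal (c powr p * \<Phi> (\<rho> \<omega>) \<omega> powr p)))}"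

definition Cb0 :: "(real \<Rightarrow> real) set" where
  "Cb0 = {f. continuous_on UNIV f \<and> bounded (range f) \<and> f 0 = 0}"

definition Cb0_norm :: "(real \<Rightarrow> real) \<Rightarrow> real" where
  "Cb0_norm f = (SUP x. \<bar>f x\<bar>)"

definition Lip0 :: "(real \<Rightarrow> real) set" where
  "Lip0 = {f. (\<exists>L. L-lipschitz_on UNIV f) \<and> f 0 = 0}"

definition Lip0_norm :: "(real \<Rightarrow> real) \<Rightarrow> real" where
  "Lip0_norm f = (SUP (x, y)\<in>{(x, y). x \<noteq> y}. \<bar>f x - f y\<bar> / \<bar>x - y\<bar>)"

definition K_functional :: "real \<Rightarrow> (real \<Rightarrow> real) \<Rightarrow> real" where
  "K_functional v f =
     Inf {Cb0_norm f0 + v * Lip0_norm f1 | f0 f1.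
            f0 \<in> Cb0 \<and> f1 \<in> Lip0 \<and> f = (\<lambda>x. f0 x + f1 x)}"

text \<open>The measure below is \<open>dv/v\<close> on \<open>(0, \<infinity>)\<close>.\<close>

definition Hoelder :: "real \<Rightarrow> ennreal \<Rightarrow> (real \<Rightarrow> real) set" where
  "Hoelder \<theta> q =
     {f. (\<exists>f0\<in>Cb0. \<exists>f1\<in>Lip0. f = (\<lambda>x. f0 x + f1 x)) \<and>
         Lp_norm q (density (restrict_space lborel {0<..}) (\<lambda>v. ennreal (1 / v)))
           (\<lambda>v. v powr (- \<theta>) * K_functional v f) < \<infinity>}"

definition gbm :: "(real \<Rightarrow> 'a \<Rightarrow> real) \<Rightarrow> real \<Rightarrow> 'a \<Rightarrow> real" where
  "gbm W t \<omega> = exp (W t \<omega> - t / 2)"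

text \<open>Functions on \<open>(0, \<infinity>)\<close> are represented by total functions whose values on
  \<open>(-\<infinity>, 0]\<close> are irrelevant.\<close>

definition C_Y :: "(real \<Rightarrow> real) set" where
  "C_Y = {g \<in> borel_measurable (restrict_space borel {0<..}).
     \<exists>m>0. \<forall>t>0.
       (SUP x::real. ennreal (exp (- m * \<bar>x\<bar>)) *
          (\<integral>\<^sup>+ y. ennreal (\<bar>g (exp (x + t * y))\<bar>\<^sup>2 * exp (- y\<^sup>2)) \<partial>lborel)) < \<infinity>}"

definition value_fun ::
  "'a measure \<Rightarrow> real \<Rightarrow> (real \<Rightarrow> 'a \<Rightarrow> real) \<Rightarrow> (real \<Rightarrow> real) \<Rightarrow> real \<Rightarrow> real \<Rightarrow> real" where
  "value_fun M T W g t y = (\<integral>\<omega>. g (y * gbm W (T - t) \<omega>) \<partial>M)"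

definition grad_process ::
  "'a measure \<Rightarrow> real \<Rightarrow> (real \<Rightarrow> 'a \<Rightarrow> real) \<Rightarrow> (real \<Rightarrow> real) \<Rightarrow> real \<Rightarrow> 'a \<Rightarrow> real" where
  "grad_process M T W g t \<omega> = deriv (value_fun M T W g t) (gbm W t \<omega>)"

definition Z_process ::
  "'a measure \<Rightarrow> real \<Rightarrow> (real \<Rightarrow> 'a \<Rightarrow> real) \<Rightarrow> (real \<Rightarrow> real) \<Rightarrow> real \<Rightarrow> 'a \<Rightarrow> real" where
  "Z_process M T W g t \<omega> = gbm W t \<omega> * deriv (value_fun M T W g t) (gbm W t \<omega>)"

end

theory Submission
  imports Defs
begin

text \<open>In the coordinate \<open>x = W\<^sub>t\<close> the process \<open>Z\<close> becomes \<open>v (T - t) (W\<^sub>t)\<close>, where \<open>v \<tau>\<close> is the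
  spatial derivative of the heat flow of \<open>h s = g (exp (s - T / 2))\<close>. It is a martingale, and
  splitting \<open>g\<close> into a bounded and a Lipschitz part bounds the modulus of \<open>v \<tau>\<close> near \<open>x\<close> by
  \<open>K (sqrt \<tau> * exp x, g) / \<tau>\<close>. An increment of \<open>\<I>Z\<close> from \<open>s\<close> to \<open>t\<close> is the limit of weighted sums
  \<open>\<Sum> w (Z c - Z u)\<close> over the cells \<open>[u, c]\<close> of a grid. The even conditional moments of such a sum
  are controlled one cell at a time, with Young's inequality in place of the
  Burkholder-Davis-Gundy inequality, by powers of the integral of \<open>(T - u)\<close> to the power
  \<open>- 1 - \<theta>\<close> times \<open>K (sqrt (T - u) * exp x, g)\<^sup>2\<close> over \<open>u \<ge> s\<close>. Membership in the
  Hoelder space with \<open>q = 2\<close> means, after a substitution, that this integral is at most a multiple of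
  \<open>exp (2 * \<theta> * x)\<close>, which is the weight \<open>\<Phi>\<^sup>2\<close>. Stopping times are approximated from above by grid
  times. The same bound with vanishing tails gives Cauchy convergence in every \<open>L\<^sub>p\<close>, and Doob's
  inequality together with the Borel-Cantelli lemma gives the almost sure limit.

  For maximal oscillation, an almost sure bound \<open>C\<close> on \<open>|\<phi>\<^sub>t - \<phi>\<^sub>s|\<close> transfers, by independence of the
  increment and equivalence of Gaussian laws, to \<open>|\<phi>\<^sub>t - c| \<le> C\<close> for a constant \<open>c\<close>, and
  \<open>\<phi>\<^sub>0\<close> is a weighted mean of \<open>\<phi>\<^sub>t\<close>; hence \<open>|\<phi>\<^sub>t - \<phi>\<^sub>0| \<le> 2 C\<close>.\<close>

section \<open>The heat flow and its gradient\<close>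

text \<open>The exponent \<open>(1 - \<theta>) / 2\<close> is dictated by a power count: the squared
  kernel weight at time c is ((T - c) / T) to the power 1 - \<theta>, the squared Lipschitz constant
  of the gradient is a multiple of K^2 / (T - c)^2, and their product has exactly the power - 1 -
  \<theta> that the Hoelder norm can absorb. The obstacle is that this local variance depends on the
  current position W_u, whereas the final bound may only involve the position W_a at the
  conditioning time a. The remedy is that K changes at most by the factor exp |b| when its argument
  is multiplied by exp b. Moving from W_u to W_a therefore costs exp (2 |W_u - W_a|) in the
  variance, and an independent Gaussian increment has all such exponential moments, uniformly on
  [0, T]. All weights of the moment recursion can thus be frozen at W_a; they are known at time a
  and merge into the test function. Conditioning is expressed throughout by integrating against an
  arbitrary nonnegative \<open>H\<close> measurable at time a, or over sets of \<open>F a\<close>,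
  so that the independence of increments enters only as a product formula for nonnegative
  integrals.\<close>

text \<open>The growth condition that makes all heat flows of \<open>h\<close> and their derivatives converge.\<close>

definition gauss_tame :: "(real \<Rightarrow> real) \<Rightarrow> bool" where
  "gauss_tame h \<longleftrightarrow> h \<in> borel_measurable borel \<and>
     (\<forall>a>0. integrable lborel (\<lambda>s. h s * exp (- a * s\<^sup>2)))"

definition heat :: "real \<Rightarrow> (real \<Rightarrow> real) \<Rightarrow> real \<Rightarrow> real" where
  "heat \<tau> h x = (LINT s|lborel. h s * normal_density x (sqrt \<tau>) s)"

text \<open>The factor \<open>(s - x) / \<tau>\<close> comes from differentiating the normal density
  in \<open>x\<close>. The derivative falls on the kernel, so that \<open>h\<close> may be any tame
  Borel function.\<close>

definition dheat :: "real \<Rightarrow> (real \<Rightarrow> real) \<Rightarrow> real \<Rightarrow> real" where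
  "dheat \<tau> h x = (LINT s|lborel. h s * ((s - x) / \<tau> * normal_density x (sqrt \<tau>) s))"

lemma gauss_tame_measurable: "gauss_tame h \<Longrightarrow> h \<in> borel_measurable borel"
  by (simp add: gauss_tame_def)

section \<open>Integrability against Gaussian kernels of polynomial and exponential growth\<close>

lemma power_le_fact_exp:
  fixes u :: real assumes "0 \<le> u" shows "u ^ k \<le> fact k * exp u"
proof -
  have s: "(\<lambda>n. u ^ n / fact n) sums exp u"
    using exp_converges[of u] by (simp add: divide_inverse mult.commute)
  have "sum (\<lambda>n. u ^ n / fact n) {k} \<le> suminf (\<lambda>n. u ^ n / fact n)"
    using sums_summable[OF s] assms by (intro sum_le_suminf) auto
  then show ?thesis using sums_unique[OF s] by (simp add: divide_le_eq mult.commute)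
qed

text \<open>The Gaussian exponent is cut in two halves. Completing the square, one half absorbs the
  polynomial and exponential growth; the other half, recentred from \<open>x\<close> to 0, leaves
  the decay rate \<open>1 / (8 * \<tau>)\<close>.\<close>

lemma normal_density_dominated:
  fixes x c :: real assumes t: "0 < \<tau>"
  obtains C where "0 \<le> C"
    "\<And>s. (1 + \<bar>s - x\<bar>) ^ k * exp (c * (1 + \<bar>s - x\<bar>)) * normal_density x (sqrt \<tau>) s
        \<le> C * exp (- (1 / (8 * \<tau>)) * s\<^sup>2)"
proof -
  define A where "A = 1 / sqrt (2 * pi * \<tau>)"
  have A: "0 \<le> A" using t by (simp add: A_def)
  define C where "C = fact k * exp (c + 1 + \<tau> * (c + 1)\<^sup>2 + x\<^sup>2 / (4 * \<tau>)) * A"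
  have "(1 + \<bar>s - x\<bar>) ^ k * exp (c * (1 + \<bar>s - x\<bar>)) * normal_density x (sqrt \<tau>) s
        \<le> C * exp (- (1 / (8 * \<tau>)) * s\<^sup>2)" for s
  proof -
    define b where "b = \<bar>s - x\<bar>"
    have b: "(s - x)\<^sup>2 = b\<^sup>2" and b0: "0 \<le> b" by (simp_all add: b_def)
    have 1: "(c + 1) * b \<le> b\<^sup>2 / (4 * \<tau>) + \<tau> * (c + 1)\<^sup>2"
    proof -
      have "0 \<le> (b - 2 * \<tau> * (c + 1))\<^sup>2 / (4 * \<tau>)" using t by simp
      also have "\<dots> = b\<^sup>2 / (4 * \<tau>) + \<tau> * (c + 1)\<^sup>2 - (c + 1) * b"
        using t by (simp add: field_simps power2_eq_square)
      finally show ?thesis by simp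
    qed
    have 2: "- b\<^sup>2 / (4 * \<tau>) \<le> - (1 / (8 * \<tau>)) * s\<^sup>2 + x\<^sup>2 / (4 * \<tau>)"
    proof -
      have "0 \<le> (s - 2 * x)\<^sup>2 / (8 * \<tau>)" using t by simp
      also have "\<dots> = (- (1 / (8 * \<tau>)) * s\<^sup>2 + x\<^sup>2 / (4 * \<tau>)) + b\<^sup>2 / (4 * \<tau>)"
        using t unfolding b[symmetric] by (simp add: field_simps power2_eq_square)
      finally show ?thesis by simp
    qed
    have "(1 + b) ^ k * exp (c * (1 + b)) * normal_density x (sqrt \<tau>) s
       \<le> (fact k * exp (1 + b)) * exp (c * (1 + b)) * (A * exp (- b\<^sup>2 / (2 * \<tau>)))"
      using t power_le_fact_exp[of "1 + b" k] A
      by (intro mult_mono) (auto simp: normal_density_def A_def b b0)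
    also have "\<dots> = fact k * A * exp ((1 + b) + c * (1 + b) - b\<^sup>2 / (2 * \<tau>))"
      by (simp add: exp_add exp_diff exp_minus field_simps)
    also have "\<dots> \<le> fact k * A * exp (c + 1 + \<tau> * (c + 1)\<^sup>2 + (- (1 / (8 * \<tau>)) * s\<^sup>2 + x\<^sup>2 / (4 * \<tau>)))"
    proof -
      have "(1 + b) + c * (1 + b) - b\<^sup>2 / (2 * \<tau>) = c + 1 + (c + 1) * b - b\<^sup>2 / (4 * \<tau>) - b\<^sup>2 / (4 * \<tau>)"
        using t by (simp add: field_simps)
      also have "\<dots> \<le> c + 1 + \<tau> * (c + 1)\<^sup>2 + (- (1 / (8 * \<tau>)) * s\<^sup>2 + x\<^sup>2 / (4 * \<tau>))"
        using 1 2 by linarith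
      finally show ?thesis using A by (intro mult_left_mono) auto
    qed
    also have "\<dots> = C * exp (- (1 / (8 * \<tau>)) * s\<^sup>2)"
      unfolding C_def exp_add by (simp only: mult_ac)
    finally show ?thesis by (simp add: b_def)
  qed
  moreover have "0 \<le> C" using A by (simp add: C_def)
  ultimately show ?thesis using that by blast
qed

text \<open>The common source of integrability: a kernel \<open>q\<close> with polynomial times
  exponential growth is dominated by a Gaussian weight centred at 0, and this is what
  \<open>gauss_tame\<close> controls.\<close>

lemma integrable_gauss_tame:
  fixes x c :: real
  assumes h: "gauss_tame h" and t: "0 < \<tau>" and q[measurable]: "q \<in> borel_measurable borel"
    and q_le: "\<And>s. \<bar>q s\<bar> \<le> K * ((1 + \<bar>s - x\<bar>) ^ k * exp (c * (1 + \<bar>s - x\<bar>)))"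
  shows "integrable lborel (\<lambda>s. h s * (q s * normal_density x (sqrt \<tau>) s))"
proof -
  note [measurable] = gauss_tame_measurable[OF h]
  obtain C where C: "0 \<le> C"
    "\<And>s. (1 + \<bar>s - x\<bar>) ^ k * exp (c * (1 + \<bar>s - x\<bar>)) * normal_density x (sqrt \<tau>) s
        \<le> C * exp (- (1 / (8 * \<tau>)) * s\<^sup>2)"
    using normal_density_dominated[OF t] by blast
  have i: "integrable lborel (\<lambda>s. \<bar>K\<bar> * C * \<bar>h s * exp (- (1 / (8 * \<tau>)) * s\<^sup>2)\<bar>)"
  proof (intro integrable_mult_right integrable_abs)
    have "0 < 1 / (8 * \<tau>)" using t by simp
    then show "integrable lborel (\<lambda>s. h s * exp (- (1 / (8 * \<tau>)) * s\<^sup>2))"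
      using h unfolding gauss_tame_def by blast
  qed
  have le: "\<bar>h s * (q s * normal_density x (sqrt \<tau>) s)\<bar>
      \<le> \<bar>K\<bar> * C * \<bar>h s * exp (- (1 / (8 * \<tau>)) * s\<^sup>2)\<bar>" for s
  proof -
    define P where "P = (1 + \<bar>s - x\<bar>) ^ k * exp (c * (1 + \<bar>s - x\<bar>))"
    have P: "0 \<le> P" by (auto simp: P_def)
    have "\<bar>q s\<bar> \<le> \<bar>K\<bar> * P"
      using q_le[of s] P unfolding P_def[symmetric] by (meson abs_ge_self mult_right_mono order_trans)
    then have "\<bar>h s * (q s * normal_density x (sqrt \<tau>) s)\<bar> \<le> \<bar>h s\<bar> * ((\<bar>K\<bar> * P) * normal_density x (sqrt \<tau>) s)"
      by (auto simp: abs_mult intro!: mult_mono)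
    also have "\<dots> = \<bar>h s\<bar> * \<bar>K\<bar> * (P * normal_density x (sqrt \<tau>) s)" by simp
    also have "\<dots> \<le> \<bar>h s\<bar> * \<bar>K\<bar> * (C * exp (- (1 / (8 * \<tau>)) * s\<^sup>2))"
      using C(2)[of s] unfolding P_def by (intro mult_left_mono) auto
    finally show ?thesis by (simp add: abs_mult mult_ac)
  qed
  show ?thesis
  proof (rule Bochner_Integration.integrable_bound[OF i])
    show "AE s in lborel. norm (h s * (q s * normal_density x (sqrt \<tau>) s))
        \<le> norm (\<bar>K\<bar> * C * \<bar>h s * exp (- (1 / (8 * \<tau>)) * s\<^sup>2)\<bar>)"
      unfolding real_norm_def by (rule AE_I2, rule order_trans[OF le abs_ge_self])
  qed measurable
qed

lemma integrable_heat:
  assumes "gauss_tame h" "0 < \<tau>"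
  shows "integrable lborel (\<lambda>s. h s * normal_density x (sqrt \<tau>) s)"
  using integrable_gauss_tame[OF assms, of "\<lambda>_. 1" 1 x 0 0] by simp

lemma integrable_dheat:
  assumes "gauss_tame h" "0 < \<tau>"
  shows "integrable lborel (\<lambda>s. h s * ((s - x) / \<tau> * normal_density x (sqrt \<tau>) s))"
proof (rule integrable_gauss_tame[OF assms, of _ "1 / \<tau>" x 1 0])
  show "\<bar>(s - x) / \<tau>\<bar> \<le> 1 / \<tau> * ((1 + \<bar>s - x\<bar>) ^ 1 * exp (0 * (1 + \<bar>s - x\<bar>)))" for s
    using assms(2) by (simp add: field_simps)
qed measurable

section \<open>Differentiation of the heat flow\<close>

lemma abs_exp_diff_le: "\<bar>exp r - 1\<bar> \<le> \<bar>r\<bar> * exp \<bar>r\<bar>" for r :: real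
proof -
  have "1 + r \<le> exp r" "1 - r \<le> exp (- r)" using exp_ge_add_one_self[of r] exp_ge_add_one_self[of "-r"] by auto
  then have 1: "exp r * (1 - r) \<le> 1" using mult_left_mono[of "1 - r" "exp (-r)" "exp r"] by (simp add: exp_minus)
  show ?thesis
  proof (cases "0 \<le> r")
    case True then show ?thesis using 1 \<open>1 + r \<le> exp r\<close> by (simp add: algebra_simps)
  next
    case False
    then have "exp r \<le> 1" by simp
    then have "\<bar>exp r - 1\<bar> \<le> \<bar>r\<bar>" using \<open>1 + r \<le> exp r\<close> by linarith
    also have "\<dots> \<le> \<bar>r\<bar> * exp \<bar>r\<bar>" using mult_left_mono[of 1 "exp \<bar>r\<bar>" "\<bar>r\<bar>"] by simp
    finally show ?thesis .
  qed
qed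

lemma abs_exp_taylor_le: "\<bar>exp r - 1 - r\<bar> \<le> r\<^sup>2 * exp \<bar>r\<bar>" for r :: real
proof -
  have "1 - r \<le> exp (- r)" using exp_ge_add_one_self[of "-r"] by auto
  then have "exp r * (1 - r) \<le> 1" using mult_left_mono[of "1 - r" "exp (-r)" "exp r"] by (simp add: exp_minus)
  then have "exp r - 1 - r \<le> r * (exp r - 1)" by (simp add: algebra_simps)
  also have "\<dots> \<le> \<bar>r\<bar> * \<bar>exp r - 1\<bar>" by (metis abs_ge_self abs_mult)
  also have "\<dots> \<le> \<bar>r\<bar> * (\<bar>r\<bar> * exp \<bar>r\<bar>)" by (intro mult_left_mono abs_exp_diff_le) auto
  also have "\<dots> = r\<^sup>2 * exp \<bar>r\<bar>" by (simp add: power2_eq_square flip: mult.assoc)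
  finally show ?thesis
    using exp_ge_add_one_self[of r] by linarith
qed

lemma normal_density_shift:
  assumes "0 < \<tau>"
  shows "normal_density (x + e) (sqrt \<tau>) s =
    normal_density x (sqrt \<tau>) s * exp ((2 * (s - x) * e - e\<^sup>2) / (2 * \<tau>))"
proof -
  have "- (s - (x + e))\<^sup>2 / (2 * \<tau>) = - (s - x)\<^sup>2 / (2 * \<tau>) + (2 * (s - x) * e - e\<^sup>2) / (2 * \<tau>)"
    using assms by (simp add: field_simps power2_eq_square)
  then show ?thesis using assms by (simp add: normal_density_def exp_add[symmetric])
qed

text \<open>The second-order Taylor remainder of the shifted density is at most
  \<open>e\<^sup>2\<close> times one integrable majorant, uniformly for
  \<open>\<bar>e\<bar> \<le> 1\<close>. Dividing by \<open>e\<close> leaves an error of order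
  \<open>e\<close>.\<close>

lemma heat_has_derivative:
  assumes h: "gauss_tame h" and t: "0 < \<tau>"
  shows "(heat \<tau> h has_real_derivative dheat \<tau> h x) (at x)"
proof -
  note [measurable] = gauss_tame_measurable[OF h]
  \<comment> \<open>With \<open>q\<close> the exponent of the density ratio, the first summand comes
    from bounding exp q - 1 - q by q^2 exp |q|, where |q| is at most |e| (1 + |s - x|) / \<tau>. The
    second summand pays for the part - e^2 / (2 \<tau>) of \<open>q\<close> that is not linear in
    \<open>e\<close>.\<close>
  define R where "R s = (1 + \<bar>s - x\<bar>)\<^sup>2 / \<tau>\<^sup>2 * exp ((1 / \<tau>) * (1 + \<bar>s - x\<bar>)) + 1 / (2 * \<tau>)" for s
  have [measurable]: "R \<in> borel_measurable borel" by (simp add: R_def[abs_def])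
  have R0: "0 \<le> R s" for s using t by (simp add: R_def)
  have iR: "integrable lborel (\<lambda>s. h s * (R s * normal_density x (sqrt \<tau>) s))"
  proof (rule integrable_gauss_tame[OF h t, of _ "1 / \<tau>\<^sup>2 + 1 / (2 * \<tau>)" x 2 "1 / \<tau>"])
    fix s
    define P where "P = (1 + \<bar>s - x\<bar>) ^ 2 * exp ((1 / \<tau>) * (1 + \<bar>s - x\<bar>))"
    have "1 * 1 \<le> P" unfolding P_def using t by (intro mult_mono) (auto intro!: one_le_power)
    then have "1 / (2 * \<tau>) * 1 \<le> 1 / (2 * \<tau>) * P" using t by (intro mult_left_mono) auto
    moreover have "R s = 1 / \<tau>\<^sup>2 * P + 1 / (2 * \<tau>)" by (simp add: R_def P_def)
    ultimately show "\<bar>R s\<bar> \<le> (1 / \<tau>\<^sup>2 + 1 / (2 * \<tau>)) * P"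
      using R0[of s] by (simp add: algebra_simps)
  qed measurable
  define B where "B = (LINT s|lborel. \<bar>h s * (R s * normal_density x (sqrt \<tau>) s)\<bar>)"
  have B0: "0 \<le> B" by (simp add: B_def)
  have key: "\<bar>heat \<tau> h (x + e) - heat \<tau> h x - e * dheat \<tau> h x\<bar> \<le> e\<^sup>2 * B" if e: "\<bar>e\<bar> \<le> 1" for e
  proof -
    let ?n = "\<lambda>s. normal_density x (sqrt \<tau>) s"
    have pt: "\<bar>normal_density (x + e) (sqrt \<tau>) s - ?n s - e * ((s - x) / \<tau> * ?n s)\<bar> \<le> e\<^sup>2 * (R s * ?n s)" for s
    proof -
      define q where "q = (2 * (s - x) * e - e\<^sup>2) / (2 * \<tau>)"
      have q: "\<bar>q\<bar> \<le> \<bar>e\<bar> * ((1 + \<bar>s - x\<bar>) / \<tau>)"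
      proof -
        have "\<bar>2 * (s - x) * e - e\<^sup>2\<bar> \<le> 2 * \<bar>s - x\<bar> * \<bar>e\<bar> + \<bar>e\<bar> * \<bar>e\<bar>"
          by (rule order_trans[OF abs_triangle_ineq4]) (simp add: abs_mult power2_eq_square del: right_diff_distrib_numeral)
        also have "\<dots> \<le> 2 * \<bar>s - x\<bar> * \<bar>e\<bar> + 2 * \<bar>e\<bar>"
          using mult_right_mono[OF e, of "\<bar>e\<bar>"] by simp
        finally have "\<bar>2 * (s - x) * e - e\<^sup>2\<bar> / (2 * \<tau>) \<le> (2 * \<bar>s - x\<bar> * \<bar>e\<bar> + 2 * \<bar>e\<bar>) / (2 * \<tau>)"
          using t by (intro divide_right_mono) auto
        then show ?thesis using t by (simp add: q_def abs_divide field_simps)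
      qed
      have qe: "exp \<bar>q\<bar> \<le> exp ((1 / \<tau>) * (1 + \<bar>s - x\<bar>))"
        using q mult_right_mono[OF e, of "(1 + \<bar>s - x\<bar>) / \<tau>"] t by auto
      have q2: "q\<^sup>2 \<le> e\<^sup>2 * ((1 + \<bar>s - x\<bar>)\<^sup>2 / \<tau>\<^sup>2)"
        using power_mono[OF q, of 2] by (simp add: power_mult_distrib power_divide)
      have "normal_density (x + e) (sqrt \<tau>) s - ?n s - e * ((s - x) / \<tau> * ?n s)
         = ?n s * ((exp q - 1 - q) - e\<^sup>2 / (2 * \<tau>))"
        unfolding normal_density_shift[OF t] q_def[symmetric]
        using t by (simp add: q_def field_simps power2_eq_square)
      then have "\<bar>normal_density (x + e) (sqrt \<tau>) s - ?n s - e * ((s - x) / \<tau> * ?n s)\<bar>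
         = ?n s * \<bar>(exp q - 1 - q) - e\<^sup>2 / (2 * \<tau>)\<bar>" by (simp add: abs_mult)
      also have "\<dots> \<le> ?n s * (q\<^sup>2 * exp \<bar>q\<bar> + e\<^sup>2 / (2 * \<tau>))"
      proof (intro mult_left_mono)
        have "0 \<le> e\<^sup>2 / (2 * \<tau>)" using t by simp
        then show "\<bar>(exp q - 1 - q) - e\<^sup>2 / (2 * \<tau>)\<bar> \<le> q\<^sup>2 * exp \<bar>q\<bar> + e\<^sup>2 / (2 * \<tau>)"
          using abs_exp_taylor_le[of q] by linarith
      qed simp
      also have "\<dots> \<le> ?n s * ((e\<^sup>2 * ((1 + \<bar>s - x\<bar>)\<^sup>2 / \<tau>\<^sup>2)) * exp ((1 / \<tau>) * (1 + \<bar>s - x\<bar>)) + e\<^sup>2 / (2 * \<tau>))"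
        by (intro mult_left_mono add_mono mult_mono q2 qe) auto
      also have "\<dots> = e\<^sup>2 * (R s * ?n s)"
        unfolding R_def using t by (simp only: distrib_left distrib_right) (simp only: mult_ac times_divide_eq_right times_divide_eq_left mult_1_right)
      finally show ?thesis .
    qed
    define D where "D s = normal_density (x + e) (sqrt \<tau>) s - ?n s - e * ((s - x) / \<tau> * ?n s)" for s
    have eq: "(\<lambda>s. h s * D s) = (\<lambda>s. h s * normal_density (x + e) (sqrt \<tau>) s - h s * ?n s
        - e * (h s * ((s - x) / \<tau> * ?n s)))"
      by (auto simp: D_def algebra_simps)
    note i = integrable_heat[OF h t, of "x + e"] integrable_heat[OF h t, of x] integrable_dheat[OF h t, of x]
    have "heat \<tau> h (x + e) - heat \<tau> h x - e * dheat \<tau> h x = (LINT s|lborel. h s * D s)"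
      unfolding eq heat_def dheat_def using i
      by (simp add: Bochner_Integration.integral_diff Bochner_Integration.integrable_diff integrable_mult_right
          del: times_divide_eq_left times_divide_eq_right)
    also have "\<bar>\<dots>\<bar> \<le> (LINT s|lborel. e\<^sup>2 * \<bar>h s * (R s * ?n s)\<bar>)"
    proof (rule integral_abs_bound_integral)
      show "integrable lborel (\<lambda>s. h s * D s)"
        unfolding eq by (intro Bochner_Integration.integrable_diff integrable_mult_right i)
      show "integrable lborel (\<lambda>s. e\<^sup>2 * \<bar>h s * (R s * ?n s)\<bar>)"
        by (intro integrable_mult_right integrable_abs iR)
      fix s
      have "\<bar>h s * D s\<bar> \<le> \<bar>h s\<bar> * (e\<^sup>2 * (R s * ?n s))"
        unfolding abs_mult D_def by (intro mult_left_mono pt) auto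
      also have "\<dots> = e\<^sup>2 * \<bar>h s * (R s * ?n s)\<bar>"
        using R0[of s] by (simp add: abs_mult)
      finally show "\<bar>h s * D s\<bar> \<le> e\<^sup>2 * \<bar>h s * (R s * ?n s)\<bar>" .
    qed
    also have "\<dots> = e\<^sup>2 * B" by (simp add: B_def)
    finally show ?thesis .
  qed
  have "((\<lambda>e. (heat \<tau> h (x + e) - heat \<tau> h x) / e - dheat \<tau> h x) \<longlongrightarrow> 0) (at 0)"
  proof (rule tendsto_0_le[where K = 1])
    show "((\<lambda>e. \<bar>e\<bar> * B) \<longlongrightarrow> 0) (at 0)" by (auto intro!: tendsto_eq_intros)
    show "\<forall>\<^sub>F e in at 0. norm ((heat \<tau> h (x + e) - heat \<tau> h x) / e - dheat \<tau> h x) \<le> norm (\<bar>e\<bar> * B) * 1"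
      unfolding eventually_at
    proof (intro exI[of _ 1] conjI ballI impI)
      fix e :: real assume e: "e \<noteq> 0 \<and> dist e 0 < 1"
      have "(heat \<tau> h (x + e) - heat \<tau> h x) / e - dheat \<tau> h x =
         (heat \<tau> h (x + e) - heat \<tau> h x - e * dheat \<tau> h x) / e" using e by (simp add: field_simps)
      then have "\<bar>(heat \<tau> h (x + e) - heat \<tau> h x) / e - dheat \<tau> h x\<bar> \<le> e\<^sup>2 * B / \<bar>e\<bar>"
        using key[of e] e by (simp add: abs_divide divide_right_mono)
      also have "\<dots> = \<bar>e\<bar> * B" using e by (simp add: power2_eq_square field_simps abs_if)
      finally show "norm ((heat \<tau> h (x + e) - heat \<tau> h x) / e - dheat \<tau> h x) \<le> norm (\<bar>e\<bar> * B) * 1"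
        using B0 by simp
    qed simp
  qed
  then show ?thesis unfolding DERIV_def by (rule LIM_zero_cancel)
qed

lemma borel_measurable_normal_density_comp [measurable (raw)]:
  assumes [measurable]: "f \<in> borel_measurable N" "g \<in> borel_measurable N"
  shows "(\<lambda>x. normal_density (f x) c (g x)) \<in> borel_measurable N"
  unfolding normal_density_def by measurable

lemma borel_measurable_dheat [measurable]:
  assumes [measurable]: "h \<in> borel_measurable borel"
  shows "dheat \<tau> h \<in> borel_measurable borel"
  unfolding dheat_def[abs_def] by measurable

lemma integrable_exp_minus_square:
  fixes a :: real assumes "0 < a" shows "integrable lborel (\<lambda>s. exp (- a * s\<^sup>2))"
proof -
  have "integrable lborel (\<lambda>s. sqrt (pi / a) * normal_density 0 (sqrt (1 / (2 * a))) s)"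
    using assms by (intro integrable_mult_right integrable_normal_density) simp
  also have "(\<lambda>s. sqrt (pi / a) * normal_density 0 (sqrt (1 / (2 * a))) s) = (\<lambda>s. exp (- a * s\<^sup>2))"
    using assms by (auto simp: normal_density_def fun_eq_iff real_sqrt_divide field_simps)
  finally show ?thesis .
qed

lemma gauss_tameI_exp_bound:
  fixes c :: real
  assumes [measurable]: "h \<in> borel_measurable borel" and le: "\<And>s. \<bar>h s\<bar> \<le> C * exp (c * \<bar>s\<bar>)"
  shows "gauss_tame h"
  unfolding gauss_tame_def
proof (intro conjI allI impI)
  fix a :: real assume a: "0 < a"
  have C: "0 \<le> C" using le[of 0] by simp
  have i: "integrable lborel (\<lambda>s. (C * exp (c\<^sup>2 / (2 * a))) * exp (- (a / 2) * s\<^sup>2))"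
    using a by (intro integrable_mult_right integrable_exp_minus_square) simp
  show "integrable lborel (\<lambda>s. h s * exp (- a * s\<^sup>2))"
  proof (rule Bochner_Integration.integrable_bound[OF i])
    show "AE s in lborel. norm (h s * exp (- a * s\<^sup>2)) \<le> norm ((C * exp (c\<^sup>2 / (2 * a))) * exp (- (a / 2) * s\<^sup>2))"
    proof (rule AE_I2)
      fix s :: real
      have "0 \<le> (c - a * \<bar>s\<bar>)\<^sup>2 / (2 * a)" using a by simp
      also have "\<dots> = c\<^sup>2 / (2 * a) - (a / 2) * s\<^sup>2 - (c * \<bar>s\<bar> - a * s\<^sup>2)"
        using a by (simp add: field_simps power2_eq_square)
      finally have e: "c * \<bar>s\<bar> + - a * s\<^sup>2 \<le> c\<^sup>2 / (2 * a) + - (a / 2) * s\<^sup>2" by simp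
      have "norm (h s * exp (- a * s\<^sup>2)) \<le> (C * exp (c * \<bar>s\<bar>)) * exp (- a * s\<^sup>2)"
        unfolding norm_mult using le[of s] by (intro mult_mono) auto
      also have "\<dots> = C * exp (c * \<bar>s\<bar> + - a * s\<^sup>2)" by (simp only: exp_add mult.assoc)
      also have "\<dots> \<le> C * exp (c\<^sup>2 / (2 * a) + - (a / 2) * s\<^sup>2)"
        using e C by (intro mult_left_mono) auto
      also have "\<dots> = (C * exp (c\<^sup>2 / (2 * a))) * exp (- (a / 2) * s\<^sup>2)" by (simp only: exp_add mult.assoc)
      also have "\<dots> \<le> norm \<dots>" by simp
      finally show "norm (h s * exp (- a * s\<^sup>2)) \<le> norm ((C * exp (c\<^sup>2 / (2 * a))) * exp (- (a / 2) * s\<^sup>2))" .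
    qed
  qed measurable
qed fact

lemma gauss_tameI_bounded:
  assumes "h \<in> borel_measurable borel" "\<And>s. \<bar>h s\<bar> \<le> B"
  shows "gauss_tame h"
  using gauss_tameI_exp_bound[of h B 0] assms by simp

text \<open>The Gaussian bridge: given the endpoints \<open>x\<close> and \<open>s\<close>, the intermediate point is normal around
  the interpolated mean.\<close>

lemma normal_density_bridge:
  assumes "0 < \<sigma>" "0 < \<tau>"
  shows "normal_density y (sqrt \<tau>) s * normal_density x (sqrt \<sigma>) y =
    normal_density x (sqrt (\<sigma> + \<tau>)) s *
    normal_density ((\<tau> * x + \<sigma> * s) / (\<sigma> + \<tau>)) (sqrt (\<sigma> * \<tau> / (\<sigma> + \<tau>))) y"
proof -
  define m where "m = (\<tau> * x + \<sigma> * s) / (\<sigma> + \<tau>)"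
  have p: "0 < \<sigma> + \<tau>" using assms by simp
  have sm: "s - m = \<tau> * (s - x) / (\<sigma> + \<tau>)" and mx: "m - x = \<sigma> * (s - x) / (\<sigma> + \<tau>)"
    using p by (simp_all add: m_def field_simps)
  have "- (s - y)\<^sup>2 / (2 * \<tau>) + - (y - x)\<^sup>2 / (2 * \<sigma>)
     = - ((s - m) - (y - m))\<^sup>2 / (2 * \<tau>) + - ((y - m) + (m - x))\<^sup>2 / (2 * \<sigma>)" by simp
  also have "\<dots> = - (s - x)\<^sup>2 / (2 * (\<sigma> + \<tau>)) + - (y - m)\<^sup>2 / (2 * (\<sigma> * \<tau> / (\<sigma> + \<tau>)))"
  proof -
    define w D S where "w = y - m" "D = s - x" "S = \<sigma> + \<tau>"
    have S: "0 < S" "\<sigma> = S - \<tau>" using p by (auto simp: w_D_S_def)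
    have ne: "S - \<tau> \<noteq> 0" using assms S by simp
    show ?thesis unfolding sm mx w_D_S_def[symmetric] using assms S(1) ne unfolding S(2)
      by (simp add: field_simps power2_eq_square)
  qed
  finally have e: "exp (- (s - y)\<^sup>2 / (2 * \<tau>)) * exp (- (y - x)\<^sup>2 / (2 * \<sigma>)) =
    exp (- (s - x)\<^sup>2 / (2 * (\<sigma> + \<tau>))) * exp (- (y - m)\<^sup>2 / (2 * (\<sigma> * \<tau> / (\<sigma> + \<tau>))))"
    by (simp only: exp_add[symmetric])
  have c: "sqrt (2 * pi * \<tau>) * sqrt (2 * pi * \<sigma>) = sqrt (2 * pi * (\<sigma> + \<tau>)) * sqrt (2 * pi * (\<sigma> * \<tau> / (\<sigma> + \<tau>)))"
    unfolding real_sqrt_mult[symmetric] using p by (simp add: field_simps)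
  have "normal_density y (sqrt \<tau>) s * normal_density x (sqrt \<sigma>) y =
     (exp (- (s - y)\<^sup>2 / (2 * \<tau>)) * exp (- (y - x)\<^sup>2 / (2 * \<sigma>))) / (sqrt (2 * pi * \<tau>) * sqrt (2 * pi * \<sigma>))"
    using assms by (simp add: normal_density_def)
  also have "\<dots> = (exp (- (s - x)\<^sup>2 / (2 * (\<sigma> + \<tau>))) * exp (- (y - m)\<^sup>2 / (2 * (\<sigma> * \<tau> / (\<sigma> + \<tau>))))) /
     (sqrt (2 * pi * (\<sigma> + \<tau>)) * sqrt (2 * pi * (\<sigma> * \<tau> / (\<sigma> + \<tau>))))"
    unfolding e c ..
  also have "\<dots> = normal_density x (sqrt (\<sigma> + \<tau>)) s * normal_density m (sqrt (\<sigma> * \<tau> / (\<sigma> + \<tau>))) y"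
    using assms by (simp add: normal_density_def)
  finally show ?thesis by (simp add: m_def)
qed

section \<open>Semigroup property and smoothing estimates of the gradient flow\<close>

lemma abs_moment_normal:
  assumes "0 < \<sigma>"
  shows "integrable lborel (\<lambda>y. normal_density m \<sigma> y * \<bar>y - m\<bar>)"
    and "(LINT y|lborel. normal_density m \<sigma> y * \<bar>y - m\<bar>) \<le> \<sigma>"
proof -
  show "integrable lborel (\<lambda>y. normal_density m \<sigma> y * \<bar>y - m\<bar>)"
    using integrable_normal_moment_abs[OF assms, of m 1] by simp
  have "sqrt (2 / pi) \<le> 1" using pi_ge_two by simp
  then show "(LINT y|lborel. normal_density m \<sigma> y * \<bar>y - m\<bar>) \<le> \<sigma>"
    using integral_normal_moment_abs_odd[OF assms, of m 0] assms mult_left_mono[of _ 1 \<sigma>] by simp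
qed

text \<open>By Fubini and the bridge decomposition the inner integral is the mean of
  \<open>s - y\<close> under the bridge law, that is
  \<open>\<tau> * (s - x) / (\<sigma> + \<tau>)\<close>. This turns the kernel for \<tau> into the
  kernel for \<sigma> + \<tau>. In probabilistic terms it is the martingale property of the gradient
  along Brownian motion.\<close>

lemma dheat_semigroup:
  assumes h: "gauss_tame h" and s: "0 < \<sigma>" and t: "0 < \<tau>"
  shows "integrable lborel (\<lambda>y. dheat \<tau> h y * normal_density x (sqrt \<sigma>) y)"
    and "heat \<sigma> (dheat \<tau> h) x = dheat (\<sigma> + \<tau>) h x"
proof -
  note [measurable] = gauss_tame_measurable[OF h]
  define m where "m s = (\<tau> * x + \<sigma> * s) / (\<sigma> + \<tau>)" for s
  define \<rho> where "\<rho> = sqrt (\<sigma> * \<tau> / (\<sigma> + \<tau>))"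
  have [measurable]: "m \<in> borel_measurable borel" by (simp add: m_def[abs_def])
  have st: "0 < \<sigma> + \<tau>" and \<rho>: "0 < \<rho>" using s t by (auto simp: \<rho>_def)
  have sm: "s - m s = \<tau> * (s - x) / (\<sigma> + \<tau>)" for s using st by (simp add: m_def field_simps)
  let ?N = "\<lambda>s. normal_density x (sqrt (\<sigma> + \<tau>)) s"
  let ?B = "\<lambda>s y. normal_density (m s) \<rho> y"
  let ?f = "\<lambda>s y. h s * ((s - y) / \<tau> * normal_density y (sqrt \<tau>) s) * normal_density x (sqrt \<sigma>) y"
  have f_eq: "?f s y = h s * ?N s / \<tau> * ((s - y) * ?B s y)" for s y
  proof -
    have "?f s y = h s * ((s - y) / \<tau>) * (normal_density y (sqrt \<tau>) s * normal_density x (sqrt \<sigma>) y)" by simp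
    then show ?thesis unfolding normal_density_bridge[OF s t] by (simp add: m_def \<rho>_def)
  qed
  have iB: "integrable lborel (\<lambda>y. (s - y) * ?B s y)" for s
  proof -
    have "(\<lambda>y. (s - y) * ?B s y) = (\<lambda>y. s * ?B s y - ?B s y * y)" by (auto simp: algebra_simps)
    then show ?thesis using integrable_normal_density[OF \<rho>] integrable_normal_moment_nz_1[OF \<rho>]
      by (auto intro!: Bochner_Integration.integrable_diff)
  qed
  have IB: "(LINT y|lborel. (s - y) * ?B s y) = s - m s" for s
  proof -
    have "(\<lambda>y. (s - y) * ?B s y) = (\<lambda>y. s * ?B s y - ?B s y * y)" by (auto simp: algebra_simps)
    then show ?thesis
      using integrable_normal_density[OF \<rho>] integrable_normal_moment_nz_1[OF \<rho>]
        integral_normal_density[OF \<rho>] integral_normal_moment_nz_1[OF \<rho>]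
      by (simp add: Bochner_Integration.integral_diff)
  qed
  \<comment> \<open>The absolute inner integral. It grows only linearly in
    \<open>\<bar>s - x\<bar>\<close>, so that the outer integrand is covered by
    \<open>integrable_gauss_tame\<close> and Fubini applies.\<close>
  define q where "q s = (LINT y|lborel. \<bar>(s - y) * ?B s y\<bar>) / \<tau>" for s
  have [measurable]: "q \<in> borel_measurable borel" unfolding q_def[abs_def] by measurable
  have q: "\<bar>q s\<bar> \<le> ((\<rho> + 1) / \<tau>) * ((1 + \<bar>s - x\<bar>) ^ 1 * exp (0 * (1 + \<bar>s - x\<bar>)))" for s
  proof -
    note a = abs_moment_normal[OF \<rho>, of "m s"]
    have "(LINT y|lborel. \<bar>(s - y) * ?B s y\<bar>) \<le> (LINT y|lborel. \<bar>s - m s\<bar> * ?B s y + ?B s y * \<bar>y - m s\<bar>)"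
    proof (rule integral_mono)
      show "integrable lborel (\<lambda>y. \<bar>(s - y) * ?B s y\<bar>)" using iB by (rule integrable_abs)
      show "integrable lborel (\<lambda>y. \<bar>s - m s\<bar> * ?B s y + ?B s y * \<bar>y - m s\<bar>)"
        using a \<rho> by (intro Bochner_Integration.integrable_add integrable_mult_right) auto
      fix y
      have "\<bar>s - y\<bar> * ?B s y \<le> (\<bar>s - m s\<bar> + \<bar>y - m s\<bar>) * ?B s y"
        by (intro mult_right_mono) auto
      then show "\<bar>(s - y) * ?B s y\<bar> \<le> \<bar>s - m s\<bar> * ?B s y + ?B s y * \<bar>y - m s\<bar>"
        unfolding abs_mult by (simp add: distrib_left distrib_right mult.commute)
    qed
    also have "\<dots> = \<bar>s - m s\<bar> + (LINT y|lborel. ?B s y * \<bar>y - m s\<bar>)"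
      using a \<rho> by (subst Bochner_Integration.integral_add) auto
    also have "\<dots> \<le> \<bar>s - x\<bar> + \<rho>"
    proof -
      have "\<bar>s - m s\<bar> = \<tau> / (\<sigma> + \<tau>) * \<bar>s - x\<bar>" unfolding sm using s t by (simp add: abs_mult)
      also have "\<dots> \<le> 1 * \<bar>s - x\<bar>" using s t by (intro mult_right_mono) auto
      finally show ?thesis using a by simp
    qed
    also have "\<dots> \<le> (\<rho> + 1) * (1 + \<bar>s - x\<bar>)" using \<rho> by (simp add: algebra_simps)
    finally have "(LINT y|lborel. \<bar>(s - y) * ?B s y\<bar>) / \<tau> \<le> (\<rho> + 1) * (1 + \<bar>s - x\<bar>) / \<tau>"
      using t by (intro divide_right_mono) auto
    moreover have "0 \<le> q s" using t by (simp add: q_def)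
    ultimately show ?thesis by (simp add: q_def)
  qed
  have int: "integrable (lborel \<Otimes>\<^sub>M lborel) (case_prod ?f)"
  proof (rule lborel_pair.Fubini_integrable)
    show "AE s in lborel. integrable lborel (\<lambda>y. case_prod ?f (s, y))"
      unfolding case_prod_conv f_eq by (intro AE_I2 integrable_mult_right iB)
    have "(\<lambda>s. LINT y|lborel. norm (case_prod ?f (s, y))) = (\<lambda>s. \<bar>h s * (q s * ?N s)\<bar>)"
    proof
      fix s
      have "(LINT y|lborel. norm (case_prod ?f (s, y))) = (LINT y|lborel. \<bar>h s * ?N s / \<tau>\<bar> * \<bar>(s - y) * ?B s y\<bar>)"
        unfolding case_prod_conv f_eq by (simp only: real_norm_def abs_mult[symmetric])
      also have "\<dots> = \<bar>h s * ?N s / \<tau>\<bar> * (LINT y|lborel. \<bar>(s - y) * ?B s y\<bar>)" by simp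
      also have "\<dots> = \<bar>h s * (q s * ?N s)\<bar>"
        using t by (simp add: q_def abs_mult)
      finally show "(LINT y|lborel. norm (case_prod ?f (s, y))) = \<bar>h s * (q s * ?N s)\<bar>" .
    qed
    then show "integrable lborel (\<lambda>s. LINT y|lborel. norm (case_prod ?f (s, y)))"
      using integrable_gauss_tame[OF h st _ q] by simp
  qed measurable
  have eq1: "(LINT s|lborel. ?f s y) = dheat \<tau> h y * normal_density x (sqrt \<sigma>) y" for y
    unfolding dheat_def by simp
  show "integrable lborel (\<lambda>y. dheat \<tau> h y * normal_density x (sqrt \<sigma>) y)"
    using lborel_pair.integrable_snd[OF int] unfolding eq1 .
  have "heat \<sigma> (dheat \<tau> h) x = (LINT y|lborel. LINT s|lborel. ?f s y)"
    unfolding heat_def eq1 ..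
  also have "\<dots> = (LINT s|lborel. LINT y|lborel. ?f s y)"
    by (rule lborel_pair.Fubini_integral[OF int])
  also have "\<dots> = (LINT s|lborel. h s * ((s - x) / (\<sigma> + \<tau>) * ?N s))"
    unfolding f_eq integral_mult_right_zero IB sm
    using t by (intro Bochner_Integration.integral_cong) simp_all
  also have "\<dots> = dheat (\<sigma> + \<tau>) h x" by (simp add: dheat_def)
  finally show "heat \<sigma> (dheat \<tau> h) x = dheat (\<sigma> + \<tau>) h x" .
qed

text \<open>The kernel carries \<open>1 / \<tau>\<close>, and the first absolute moment of the
  normal law is at most \<open>sqrt \<tau>\<close>.\<close>

lemma dheat_bounded:
  assumes [measurable]: "h \<in> borel_measurable borel" and B: "\<And>s. \<bar>h s\<bar> \<le> B" and t: "0 < \<tau>"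
  shows "\<bar>dheat \<tau> h x\<bar> \<le> B / sqrt \<tau>"
proof -
  have st: "0 < sqrt \<tau>" using t by simp
  have B0: "0 \<le> B" using B[of 0] by simp
  note a = abs_moment_normal[OF st, of x]
  have "\<bar>dheat \<tau> h x\<bar> \<le> (LINT s|lborel. B / \<tau> * (normal_density x (sqrt \<tau>) s * \<bar>s - x\<bar>))"
    unfolding dheat_def
  proof (rule integral_abs_bound_integral)
    show "integrable lborel (\<lambda>s. h s * ((s - x) / \<tau> * normal_density x (sqrt \<tau>) s))"
      using gauss_tameI_bounded[OF assms(1,2)] t by (rule integrable_dheat)
    show "integrable lborel (\<lambda>s. B / \<tau> * (normal_density x (sqrt \<tau>) s * \<bar>s - x\<bar>))"
      using a by (intro integrable_mult_right)
    show "\<bar>h s * ((s - x) / \<tau> * normal_density x (sqrt \<tau>) s)\<bar> \<le> B / \<tau> * (normal_density x (sqrt \<tau>) s * \<bar>s - x\<bar>)" for s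
    proof -
      have "\<bar>h s\<bar> * (\<bar>s - x\<bar> / \<tau> * normal_density x (sqrt \<tau>) s) \<le> B * (\<bar>s - x\<bar> / \<tau> * normal_density x (sqrt \<tau>) s)"
        using B t by (intro mult_right_mono) auto
      then show ?thesis using t by (simp add: abs_mult mult_ac)
    qed
  qed
  also have "\<dots> \<le> B / \<tau> * sqrt \<tau>"
    using a B0 t by (subst integral_mult_right_zero) (intro mult_left_mono, auto)
  also have "\<dots> = B / sqrt \<tau>" using t by (simp add: field_simps flip: real_sqrt_mult)
  finally show ?thesis .
qed

text \<open>The time is halved: by the semigroup property the gradient flow is the heat flow over
  \<open>\<tau> / 2\<close> of a bounded function, so its derivative is an iterated gradient flow.
  Each half contributes the factor \<open>1 / sqrt (\<tau> / 2)\<close>, and the mean value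
  inequality concludes.\<close>

lemma dheat_lipschitz_bounded:
  assumes m[measurable]: "h \<in> borel_measurable borel" and B: "\<And>s. \<bar>h s\<bar> \<le> B" and t: "0 < \<tau>"
  shows "\<bar>dheat \<tau> h (x + r) - dheat \<tau> h x\<bar> \<le> 2 * B / \<tau> * \<bar>r\<bar>"
proof -
  have t2: "0 < \<tau> / 2" using t by simp
  let ?v = "dheat (\<tau> / 2) h"
  have b: "\<bar>?v s\<bar> \<le> B / sqrt (\<tau> / 2)" for s by (rule dheat_bounded[OF m B t2])
  have tame: "gauss_tame ?v" by (rule gauss_tameI_bounded[OF _ b]) measurable
  have "heat (\<tau> / 2) ?v = dheat \<tau> h"
    using dheat_semigroup(2)[OF gauss_tameI_bounded[OF m B] t2 t2] by auto
  then have D: "(dheat \<tau> h has_field_derivative dheat (\<tau> / 2) ?v y) (at y)" for y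
    using heat_has_derivative[OF tame t2, of y] by simp
  have n: "norm (dheat (\<tau> / 2) ?v y) \<le> 2 * B / \<tau>" for y
  proof -
    have "\<bar>dheat (\<tau> / 2) ?v y\<bar> \<le> B / sqrt (\<tau> / 2) / sqrt (\<tau> / 2)"
      by (rule dheat_bounded[OF _ b t2]) measurable
    also have "\<dots> = 2 * B / \<tau>" using t by (simp add: field_simps flip: real_sqrt_mult)
    finally show ?thesis by simp
  qed
  have "norm (dheat \<tau> h (x + r) - dheat \<tau> h x) \<le> 2 * B / \<tau> * norm (x + r - x)"
    by (rule field_differentiable_bound[where S = UNIV, OF _ _ n])
      (auto intro: DERIV_subset[OF D])
  then show ?thesis by simp
qed

section \<open>Gaussian moments, exponential Lipschitz estimate and joint continuity\<close>

definition normal_exp_moment :: "nat \<Rightarrow> real \<Rightarrow> real" where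
  "normal_exp_moment k c = (LINT n|lborel. \<bar>n\<bar> ^ k * exp (c * \<bar>n\<bar>) * std_normal_density n)"

lemma integrable_normal_exp_moment:
  assumes "0 \<le> c"
  shows "integrable lborel (\<lambda>n. \<bar>n\<bar> ^ k * exp (c * \<bar>n\<bar>) * std_normal_density n)"
proof -
  have "integrable lborel (\<lambda>n. 1 * (\<bar>n\<bar> ^ k * exp (c * \<bar>n\<bar>) * normal_density 0 (sqrt 1) n))"
  proof (rule integrable_gauss_tame[where K = 1 and k = k and c = c])
    show "gauss_tame (\<lambda>_. 1)" by (rule gauss_tameI_bounded[where B = 1]) auto
    show "\<bar>\<bar>s\<bar> ^ k * exp (c * \<bar>s\<bar>)\<bar> \<le> 1 * ((1 + \<bar>s - 0\<bar>) ^ k * exp (c * (1 + \<bar>s - 0\<bar>)))" for s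
      using assms by (auto simp: abs_mult intro!: mult_mono power_mono mult_left_mono)
  qed auto
  then show ?thesis by simp
qed

lemma normal_exp_moment_nonneg: "0 \<le> normal_exp_moment k c"
  unfolding normal_exp_moment_def by (rule Bochner_Integration.integral_nonneg) auto

text \<open>Rescaling by \<open>sqrt \<delta>\<close> extracts the power
  \<open>sqrt \<delta> ^ k\<close>. In the exponential, \<open>sqrt \<delta>\<close> is replaced by
  \<open>sqrt T\<close>, which makes the remaining constant independent of the length of the
  increment.\<close>

lemma nn_integral_normal_exp_moment:
  assumes c: "0 \<le> c" and d: "0 < \<delta>" "\<delta> \<le> T"
  shows "(\<integral>\<^sup>+w. ennreal (\<bar>w\<bar> ^ k * exp (c * \<bar>w\<bar>) * normal_density 0 (sqrt \<delta>) w) \<partial>lborel)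
     \<le> ennreal (sqrt \<delta> ^ k * normal_exp_moment k (c * sqrt T))"
proof -
  have s: "0 < sqrt \<delta>" using d by simp
  have sT: "0 \<le> c * sqrt T" using c d by simp
  have nd: "normal_density 0 (sqrt \<delta>) (sqrt \<delta> * n) = std_normal_density n / sqrt \<delta>" for n
    using d by (simp add: normal_density_def power_mult_distrib real_sqrt_mult field_simps)
  have "(\<integral>\<^sup>+w. ennreal (\<bar>w\<bar> ^ k * exp (c * \<bar>w\<bar>) * normal_density 0 (sqrt \<delta>) w) \<partial>lborel)
     = ennreal (sqrt \<delta>) * (\<integral>\<^sup>+n. ennreal (\<bar>sqrt \<delta> * n\<bar> ^ k * exp (c * \<bar>sqrt \<delta> * n\<bar>) * (std_normal_density n / sqrt \<delta>)) \<partial>lborel)"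
    using s by (subst nn_integral_real_affine[where t = 0 and c = "sqrt \<delta>"]) (auto simp: nd)
  also have "\<dots> = (\<integral>\<^sup>+n. ennreal (sqrt \<delta> * (\<bar>sqrt \<delta> * n\<bar> ^ k * exp (c * \<bar>sqrt \<delta> * n\<bar>) * (std_normal_density n / sqrt \<delta>))) \<partial>lborel)"
    using d by (subst nn_integral_cmult[symmetric]) (auto simp del: times_divide_eq_left times_divide_eq_right simp add: ennreal_mult'[symmetric] intro!: nn_integral_cong)
  also have "\<dots> \<le> (\<integral>\<^sup>+n. ennreal (sqrt \<delta> ^ k * (\<bar>n\<bar> ^ k * exp (c * sqrt T * \<bar>n\<bar>) * std_normal_density n)) \<partial>lborel)"
  proof (intro nn_integral_mono ennreal_leI)
    fix n :: real
    have e: "exp (c * \<bar>sqrt \<delta> * n\<bar>) \<le> exp (c * sqrt T * \<bar>n\<bar>)"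
      using c d by (auto simp: abs_mult mult.assoc intro!: mult_left_mono mult_right_mono)
    have "sqrt \<delta> * (\<bar>sqrt \<delta> * n\<bar> ^ k * exp (c * \<bar>sqrt \<delta> * n\<bar>) * (std_normal_density n / sqrt \<delta>))
       = sqrt \<delta> ^ k * \<bar>n\<bar> ^ k * exp (c * \<bar>sqrt \<delta> * n\<bar>) * std_normal_density n"
      using s by (simp add: abs_mult power_mult_distrib)
    also have "\<dots> \<le> sqrt \<delta> ^ k * \<bar>n\<bar> ^ k * exp (c * sqrt T * \<bar>n\<bar>) * std_normal_density n"
      using d by (intro mult_right_mono mult_left_mono e) auto
    finally show "sqrt \<delta> * (\<bar>sqrt \<delta> * n\<bar> ^ k * exp (c * \<bar>sqrt \<delta> * n\<bar>) * (std_normal_density n / sqrt \<delta>))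
      \<le> sqrt \<delta> ^ k * (\<bar>n\<bar> ^ k * exp (c * sqrt T * \<bar>n\<bar>) * std_normal_density n)" by (simp add: mult_ac)
  qed
  also have "\<dots> = ennreal (sqrt \<delta> ^ k * normal_exp_moment k (c * sqrt T))"
    unfolding normal_exp_moment_def using integrable_normal_exp_moment[OF sT, of k] d
    by (subst nn_integral_eq_integral) (auto intro!: integrable_mult_right)
  finally show ?thesis .
qed

text \<open>The substitution \<open>s = x + sqrt \<tau> * n\<close> moves \<open>x\<close> and
  \<open>\<tau>\<close> out of the density into the argument of \<open>h\<close>, where translation
  bounds and continuity of \<open>h\<close> can be used.\<close>

lemma dheat_std:
  assumes t: "0 < \<tau>"
  shows "dheat \<tau> h x = (LINT n|lborel. h (x + sqrt \<tau> * n) * (n * std_normal_density n)) / sqrt \<tau>"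
proof -
  have s: "sqrt \<tau> \<noteq> 0" using t by simp
  have nd: "normal_density x (sqrt \<tau>) (x + sqrt \<tau> * n) = std_normal_density n / sqrt \<tau>" for n
    using t by (simp add: normal_density_def power_mult_distrib real_sqrt_mult field_simps)
  have "dheat \<tau> h x = sqrt \<tau> * (LINT n|lborel. h (x + sqrt \<tau> * n) * (sqrt \<tau> * n / \<tau> * (std_normal_density n / sqrt \<tau>)))"
    unfolding dheat_def using t
    by (subst lborel_integral_real_affine[OF s, of _ x]) (simp add: nd)
  also have "\<dots> = (LINT n|lborel. sqrt \<tau> * (h (x + sqrt \<tau> * n) * (sqrt \<tau> * n / \<tau> * (std_normal_density n / sqrt \<tau>))))"
    by simp
  also have "(\<lambda>n. sqrt \<tau> * (h (x + sqrt \<tau> * n) * (sqrt \<tau> * n / \<tau> * (std_normal_density n / sqrt \<tau>))))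
     = (\<lambda>n. h (x + sqrt \<tau> * n) * (n * std_normal_density n) / sqrt \<tau>)"
    using t by (auto simp: fun_eq_iff field_simps simp flip: real_sqrt_mult)
  finally show ?thesis by simp
qed

text \<open>A translation bound for \<open>h\<close> passes directly under the integral, so only one
  factor \<open>1 / sqrt \<tau>\<close> is lost, against \<open>1 / \<tau>\<close> for a merely
  bounded function. The quotient of the two bounds, \<open>sqrt \<tau> * exp x\<close>, becomes the
  argument of the K-functional.\<close>

lemma dheat_exp_lipschitz:
  assumes h: "gauss_tame h" and A: "\<And>y. \<bar>h (y + r) - h y\<bar> \<le> A * exp y" and t: "0 < \<tau>" "\<tau> \<le> T"
  shows "\<bar>dheat \<tau> h (x + r) - dheat \<tau> h x\<bar> \<le> A * exp x * normal_exp_moment 1 (sqrt T) / sqrt \<tau>"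
proof -
  have A0: "0 \<le> A" using A[of 0] by simp
  have s: "sqrt \<tau> \<noteq> 0" using t by simp
  have i: "integrable lborel (\<lambda>n. h (x + sqrt \<tau> * n) * (n * std_normal_density n))" for x
  proof -
    have nd: "normal_density x (sqrt \<tau>) (x + sqrt \<tau> * n) = std_normal_density n / sqrt \<tau>" for n
      using t by (simp add: normal_density_def power_mult_distrib real_sqrt_mult field_simps)
    have "integrable lborel (\<lambda>n. \<tau> * (h (x + sqrt \<tau> * n) * ((sqrt \<tau> * n) / \<tau> * (std_normal_density n / sqrt \<tau>))))"
      using integrable_dheat[OF h t(1), of x]
      by (subst (asm) lborel_integrable_real_affine_iff[symmetric, OF s, of _ x])
        (auto intro!: integrable_mult_right simp: nd)
    then show ?thesis using t by simp
  qed
  have "\<bar>(LINT n|lborel. h (x + r + sqrt \<tau> * n) * (n * std_normal_density n)) -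
      (LINT n|lborel. h (x + sqrt \<tau> * n) * (n * std_normal_density n))\<bar>
    = \<bar>LINT n|lborel. (h (x + r + sqrt \<tau> * n) - h (x + sqrt \<tau> * n)) * (n * std_normal_density n)\<bar>"
    using i by (subst Bochner_Integration.integral_diff[symmetric]) (auto simp: left_diff_distrib)
  also have "\<dots> \<le> (LINT n|lborel. A * exp x * (\<bar>n\<bar> ^ 1 * exp (sqrt T * \<bar>n\<bar>) * std_normal_density n))"
  proof (rule integral_abs_bound_integral)
    show "integrable lborel (\<lambda>n. (h (x + r + sqrt \<tau> * n) - h (x + sqrt \<tau> * n)) * (n * std_normal_density n))"
      using Bochner_Integration.integrable_diff[OF i[of "x + r"] i[of x]] by (simp add: left_diff_distrib)
    show "integrable lborel (\<lambda>n. A * exp x * (\<bar>n\<bar> ^ 1 * exp (sqrt T * \<bar>n\<bar>) * std_normal_density n))"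
      using t by (intro integrable_mult_right integrable_normal_exp_moment) auto
    fix n :: real
    have "sqrt \<tau> * n \<le> sqrt T * \<bar>n\<bar>"
      using mult_left_mono[of n "\<bar>n\<bar>" "sqrt \<tau>"] mult_right_mono[of "sqrt \<tau>" "sqrt T" "\<bar>n\<bar>"] t
      by (meson abs_ge_self abs_ge_zero less_imp_le order_trans real_sqrt_ge_zero real_sqrt_le_iff)
    then have "exp (x + sqrt \<tau> * n) \<le> exp x * exp (sqrt T * \<bar>n\<bar>)" by (simp flip: exp_add)
    then have "A * exp (x + sqrt \<tau> * n) \<le> A * (exp x * exp (sqrt T * \<bar>n\<bar>))" using A0 by (rule mult_left_mono)
    then have "\<bar>h (x + r + sqrt \<tau> * n) - h (x + sqrt \<tau> * n)\<bar> \<le> A * (exp x * exp (sqrt T * \<bar>n\<bar>))"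
      using A[of "x + sqrt \<tau> * n"] by (simp add: ac_simps)
    then have "\<bar>h (x + r + sqrt \<tau> * n) - h (x + sqrt \<tau> * n)\<bar> * (\<bar>n\<bar> * std_normal_density n)
       \<le> A * (exp x * exp (sqrt T * \<bar>n\<bar>)) * (\<bar>n\<bar> * std_normal_density n)"
      by (rule mult_right_mono) simp
    then show "\<bar>(h (x + r + sqrt \<tau> * n) - h (x + sqrt \<tau> * n)) * (n * std_normal_density n)\<bar>
      \<le> A * exp x * (\<bar>n\<bar> ^ 1 * exp (sqrt T * \<bar>n\<bar>) * std_normal_density n)"
      by (simp add: abs_mult mult_ac)
  qed
  also have "\<dots> = A * exp x * normal_exp_moment 1 (sqrt T)" by (simp add: normal_exp_moment_def)
  finally show ?thesis
    unfolding dheat_std[OF t(1)] diff_divide_distrib[symmetric] using t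
    by (simp add: abs_divide divide_right_mono)
qed

text \<open>Dominated convergence along sequences; a convergent sequence of times keeps
  \<open>x\<close> and \<open>sqrt \<tau>\<close> bounded, which yields a single majorant. With
  \<open>x\<close> a Brownian path and \<open>\<tau>\<close> the remaining time this gives
  continuous paths of \<open>Z\<close>.\<close>

lemma continuous_on_dheat:
  fixes \<tau> x :: "real \<Rightarrow> real"
  assumes h: "continuous_on UNIV h" and le: "\<And>s. \<bar>h s\<bar> \<le> C * exp \<bar>s\<bar>"
    and \<tau>: "continuous_on A \<tau>" and x: "continuous_on A x" and pos: "\<And>t. t \<in> A \<Longrightarrow> 0 < \<tau> t"
  shows "continuous_on A (\<lambda>t. dheat (\<tau> t) h (x t))"
proof -
  have [measurable]: "h \<in> borel_measurable borel" using h by (rule borel_measurable_continuous_onI)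
  have C0: "0 \<le> C" using le[of 0] by simp
  have "continuous_on A (\<lambda>t. (LINT n|lborel. h (x t + sqrt (\<tau> t) * n) * (n * std_normal_density n)))"
    unfolding continuous_on_sequentially
  proof (intro allI ballI impI, elim conjE)
    fix u t assume t: "t \<in> A" and u: "\<forall>n. u n \<in> A" "u \<longlonglongrightarrow> t"
    have xu: "(\<lambda>i. x (u i)) \<longlonglongrightarrow> x t" and \<tau>u: "(\<lambda>i. \<tau> (u i)) \<longlonglongrightarrow> \<tau> t"
      using x \<tau> t u unfolding continuous_on_sequentially by (auto simp: o_def)
    obtain X where X: "\<And>i. \<bar>x (u i)\<bar> \<le> X" "0 < X"
      using convergent_imp_Bseq[OF convergentI[OF xu]] by (auto simp: Bseq_def)
    have "(\<lambda>i. sqrt (\<tau> (u i))) \<longlonglongrightarrow> sqrt (\<tau> t)" by (intro tendsto_intros \<tau>u)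
    then obtain S where S: "\<And>i. \<bar>sqrt (\<tau> (u i))\<bar> \<le> S" "0 < S"
      using convergent_imp_Bseq[OF convergentI[of "\<lambda>i. sqrt (\<tau> (u i))"]] by (auto simp: Bseq_def)
    have "(\<lambda>i. (LINT n|lborel. h (x (u i) + sqrt (\<tau> (u i)) * n) * (n * std_normal_density n)))
       \<longlonglongrightarrow> (LINT n|lborel. h (x t + sqrt (\<tau> t) * n) * (n * std_normal_density n))"
    proof (rule integral_dominated_convergence[where w = "\<lambda>n. C * exp X * (\<bar>n\<bar> ^ 1 * exp (S * \<bar>n\<bar>) * std_normal_density n)"])
      show "integrable lborel (\<lambda>n. C * exp X * (\<bar>n\<bar> ^ 1 * exp (S * \<bar>n\<bar>) * std_normal_density n))"
        using S by (intro integrable_mult_right integrable_normal_exp_moment) auto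
      have "(\<lambda>i. h (x (u i) + sqrt (\<tau> (u i)) * n)) \<longlonglongrightarrow> h (x t + sqrt (\<tau> t) * n)" for n
        by (rule continuous_on_tendsto_compose[OF h]) (auto intro!: tendsto_intros xu \<tau>u)
      then show "AE n in lborel. (\<lambda>i. h (x (u i) + sqrt (\<tau> (u i)) * n) * (n * std_normal_density n))
         \<longlonglongrightarrow> h (x t + sqrt (\<tau> t) * n) * (n * std_normal_density n)"
        by (intro AE_I2 tendsto_intros)
      show "AE n in lborel. norm (h (x (u i) + sqrt (\<tau> (u i)) * n) * (n * std_normal_density n))
         \<le> C * exp X * (\<bar>n\<bar> ^ 1 * exp (S * \<bar>n\<bar>) * std_normal_density n)" for i
      proof (rule AE_I2)
        fix n :: real
        have "\<bar>x (u i) + sqrt (\<tau> (u i)) * n\<bar> \<le> \<bar>x (u i)\<bar> + \<bar>sqrt (\<tau> (u i))\<bar> * \<bar>n\<bar>"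
          by (metis abs_mult abs_triangle_ineq)
        also have "\<dots> \<le> X + S * \<bar>n\<bar>" using X(1)[of i] S(1)[of i] by (intro add_mono mult_right_mono) auto
        finally have "exp \<bar>x (u i) + sqrt (\<tau> (u i)) * n\<bar> \<le> exp X * exp (S * \<bar>n\<bar>)" by (simp flip: exp_add)
        then have "C * exp \<bar>x (u i) + sqrt (\<tau> (u i)) * n\<bar> \<le> C * (exp X * exp (S * \<bar>n\<bar>))"
          using C0 by (rule mult_left_mono)
        then have "\<bar>h (x (u i) + sqrt (\<tau> (u i)) * n)\<bar> \<le> C * (exp X * exp (S * \<bar>n\<bar>))"
          using le order_trans by blast
        then have "\<bar>h (x (u i) + sqrt (\<tau> (u i)) * n)\<bar> * (\<bar>n\<bar> * std_normal_density n)
          \<le> C * (exp X * exp (S * \<bar>n\<bar>)) * (\<bar>n\<bar> * std_normal_density n)" by (rule mult_right_mono) simp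
        then show "norm (h (x (u i) + sqrt (\<tau> (u i)) * n) * (n * std_normal_density n))
          \<le> C * exp X * (\<bar>n\<bar> ^ 1 * exp (S * \<bar>n\<bar>) * std_normal_density n)"
          by (simp add: abs_mult mult_ac)
      qed
    qed measurable
    then show "((\<lambda>t. LINT n|lborel. h (x t + sqrt (\<tau> t) * n) * (n * std_normal_density n)) \<circ> u)
      \<longlonglongrightarrow> (LINT n|lborel. h (x t + sqrt (\<tau> t) * n) * (n * std_normal_density n))" by (simp add: o_def)
  qed
  then have "continuous_on A (\<lambda>t. (LINT n|lborel. h (x t + sqrt (\<tau> t) * n) * (n * std_normal_density n)) / sqrt (\<tau> t))"
    using pos by (intro continuous_intros \<tau>) force+
  then show ?thesis
    by (rule continuous_on_cong[THEN iffD1, rotated 2]) (auto simp: dheat_std pos)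
qed

section \<open>Brownian motion and its filtration\<close>

locale brownian = prob_space M for M :: "'a measure" +
  fixes T :: real and W :: "real \<Rightarrow> 'a \<Rightarrow> real"
  assumes T_pos: "0 < T" and brownian: "brownian_motion M T W"
begin

abbreviation F :: "real \<Rightarrow> 'a measure" where "F \<equiv> aug_filtration M T W"

lemma measurable_W [measurable]: "0 \<le> t \<Longrightarrow> t \<le> T \<Longrightarrow> W t \<in> borel_measurable M"
  using brownian by (auto simp: brownian_motion_def)

lemma W_0: "\<omega> \<in> space M \<Longrightarrow> W 0 \<omega> = 0"
  using brownian by (auto simp: brownian_motion_def)

lemma continuous_W: "\<omega> \<in> space M \<Longrightarrow> continuous_on {0..T} (\<lambda>t. W t \<omega>)"
  using brownian by (auto simp: brownian_motion_def)

lemma distributed_increment: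
  "0 \<le> s \<Longrightarrow> s < t \<Longrightarrow> t \<le> T \<Longrightarrow>
    distributed M lborel (\<lambda>\<omega>. W t \<omega> - W s \<omega>) (normal_density 0 (sqrt (t - s)))"
  using brownian by (auto simp: brownian_motion_def)

lemma space_F: "space (F t) = space M"
  unfolding aug_filtration_def by (intro space_measure_of) (auto dest: sets.sets_into_space)

lemma sets_F:
  "sets (F t) = sigma_sets (space M)
    ({W s -` B \<inter> space M | s B. 0 \<le> s \<and> s \<le> t \<and> s \<le> T \<and> B \<in> sets borel} \<union> null_sets M)"
  unfolding aug_filtration_def by (intro sets_measure_of) (auto dest: sets.sets_into_space)

lemma sets_F_subset: "sets (F t) \<subseteq> sets M"
  unfolding sets_F by (intro sets.sigma_sets_subset) (auto intro: measurable_sets measurable_W)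

lemma subalgebra_F: "subalgebra M (F t)"
  using sets_F_subset space_F by (auto simp: subalgebra_def)

lemma filtration_F: "filtration (space M) F"
proof
  show "sets (F i) \<subseteq> sets (F j)" if "i \<le> j" for i j
    unfolding sets_F using that by (intro sigma_sets_mono') fastforce
qed (rule space_F)

lemma sets_F_mono: "s \<le> t \<Longrightarrow> sets (F s) \<subseteq> sets (F t)"
  using filtration.sets_F_mono[OF filtration_F] .

lemma measurable_F_mono: "s \<le> t \<Longrightarrow> f \<in> measurable (F s) N \<Longrightarrow> f \<in> measurable (F t) N"
  using measurable_mono[of N N "F s" "F t"] sets_F_mono[of s t] by (auto simp: space_F)

lemma measurable_F_M: "f \<in> measurable (F s) N \<Longrightarrow> f \<in> measurable M N"
  using measurable_from_subalg[OF subalgebra_F] .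

lemma measurable_W_F: "0 \<le> s \<Longrightarrow> s \<le> t \<Longrightarrow> s \<le> T \<Longrightarrow> W s \<in> borel_measurable (F t)"
proof (rule measurableI)
  fix B :: "real set" assume *: "B \<in> sets borel" "0 \<le> s" "s \<le> t" "s \<le> T"
  then show "W s -` B \<inter> space (F t) \<in> sets (F t)"
    unfolding space_F sets_F by (intro sigma_sets.Basic) auto
qed auto

section \<open>Independence of Brownian increments from the augmented filtration\<close>

definition cylinders :: "real \<Rightarrow> 'a set set" where
  "cylinders s = {C. \<exists>S D. finite S \<and> S \<subseteq> {0..s} \<and> D \<in> sets (\<Pi>\<^sub>M r\<in>S. borel) \<and>
     C = (\<lambda>\<omega>. \<lambda>r\<in>S. W r \<omega>) -` D \<inter> space M}"

text \<open>Enlarging the index set by pulling back along the restriction map allows two cylinders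
  to be written over the same times, which makes them an intersection-stable family.\<close>

lemma cylinder_mono:
  assumes "finite S'" "S \<subseteq> S'" "S' \<subseteq> {0..s}" "D \<in> sets (\<Pi>\<^sub>M r\<in>S. borel)"
  shows "\<exists>D'\<in>sets (\<Pi>\<^sub>M r\<in>S'. borel).
    (\<lambda>\<omega>. \<lambda>r\<in>S. W r \<omega>) -` D \<inter> space M = (\<lambda>\<omega>. \<lambda>r\<in>S'. W r \<omega>) -` D' \<inter> space M"
proof (intro bexI)
  let ?D = "(\<lambda>f. restrict f S) -` D \<inter> space (\<Pi>\<^sub>M r\<in>S'. (borel :: real measure))"
  show "?D \<in> sets (\<Pi>\<^sub>M r\<in>S'. borel)"
    using assms by (intro measurable_sets[OF measurable_restrict_subset])
  have "restrict (\<lambda>r\<in>S'. W r \<omega>) S = (\<lambda>r\<in>S. W r \<omega>)" for \<omega>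
    using assms by (auto simp: restrict_def fun_eq_iff)
  then show "(\<lambda>\<omega>. \<lambda>r\<in>S. W r \<omega>) -` D \<inter> space M = (\<lambda>\<omega>. \<lambda>r\<in>S'. W r \<omega>) -` ?D \<inter> space M"
    by (auto simp: space_PiM)
qed

lemma Int_cylinders:
  assumes "C1 \<in> cylinders s" "C2 \<in> cylinders s"
  shows "C1 \<inter> C2 \<in> cylinders s"
proof -
  from assms obtain S1 D1 S2 D2 where 1: "finite S1" "S1 \<subseteq> {0..s}" "D1 \<in> sets (\<Pi>\<^sub>M r\<in>S1. borel)"
      "C1 = (\<lambda>\<omega>. \<lambda>r\<in>S1. W r \<omega>) -` D1 \<inter> space M"
    and 2: "finite S2" "S2 \<subseteq> {0..s}" "D2 \<in> sets (\<Pi>\<^sub>M r\<in>S2. borel)"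
      "C2 = (\<lambda>\<omega>. \<lambda>r\<in>S2. W r \<omega>) -` D2 \<inter> space M"
    unfolding cylinders_def by blast
  let ?S = "S1 \<union> S2"
  obtain E1 where E1: "E1 \<in> sets (\<Pi>\<^sub>M r\<in>?S. borel)" "C1 = (\<lambda>\<omega>. \<lambda>r\<in>?S. W r \<omega>) -` E1 \<inter> space M"
    using cylinder_mono[of ?S S1 s D1] 1 2 by auto
  obtain E2 where E2: "E2 \<in> sets (\<Pi>\<^sub>M r\<in>?S. borel)" "C2 = (\<lambda>\<omega>. \<lambda>r\<in>?S. W r \<omega>) -` E2 \<inter> space M"
    using cylinder_mono[of ?S S2 s D2] 1 2 by auto
  have "C1 \<inter> C2 = (\<lambda>\<omega>. \<lambda>r\<in>?S. W r \<omega>) -` (E1 \<inter> E2) \<inter> space M" unfolding E1(2) E2(2) by blast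
  moreover have "E1 \<inter> E2 \<in> sets (\<Pi>\<^sub>M r\<in>?S. borel)" by (rule sets.Int[OF E1(1) E2(1)])
  moreover have "finite ?S" using 1(1) 2(1) by (rule finite_UnI)
  moreover have "?S \<subseteq> {0..s}" using 1(2) 2(2) by (rule Un_least)
  ultimately show ?thesis unfolding cylinders_def by blast
qed

text \<open>Along the sorted times every value of \<open>W\<close> is a partial sum of increments,
  so a cylinder up to \<open>s\<close> is an event of the first \<open>n\<close> increments, and the
  increment from \<open>s\<close> to \<open>t\<close> is the next one.\<close>

lemma prob_cylinder_increment:
  assumes C: "C \<in> cylinders s" and s: "0 \<le> s" "s < t" "t \<le> T" and B: "B \<in> sets borel"
  shows "prob (C \<inter> {\<omega>\<in>space M. W t \<omega> - W s \<omega> \<in> B}) = prob C * prob {\<omega>\<in>space M. W t \<omega> - W s \<omega> \<in> B}"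
proof -
  obtain S D where S: "finite S" "S \<subseteq> {0..s}" and D: "D \<in> sets (\<Pi>\<^sub>M r\<in>S. borel)"
    and C_eq: "C = (\<lambda>\<omega>. \<lambda>r\<in>S. W r \<omega>) -` D \<inter> space M"
    using C unfolding cylinders_def by blast
  \<comment> \<open>The time 0 is added so that the partial sums start from \<open>W 0 = 0\<close>,
    the time \<open>s\<close> so that the last listed increment ends exactly at
    \<open>s\<close>.\<close>
  define A where "A = insert 0 (insert s S)"
  define l where "l = sorted_list_of_set A"
  have A: "finite A" "A \<subseteq> {0..s}" "0 \<in> A" "s \<in> A" using S s by (auto simp: A_def)
  have l: "set l = A" "sorted l" "distinct l" "l \<noteq> []" using A by (auto simp: l_def)
  define n where "n = length l - 1"
  have n: "length l = Suc n" using l by (cases l) (auto simp: n_def)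
  \<comment> \<open>Beyond the list the time is \<open>t\<close>; the increment with index
    \<open>n\<close> is therefore \<open>W t - W s\<close>.\<close>
  define \<tau> where "\<tau> i = (if i \<le> n then l ! i else t)" for i
  have in_A: "l ! i \<in> A" if "i \<le> n" for i using that n l by (metis le_imp_less_Suc nth_mem)
  have mono: "l ! i \<le> l ! j" if "i \<le> j" "j \<le> n" for i j using that n l by (intro sorted_nth_mono) auto
  have idx: "\<exists>i\<le>n. l ! i = r" if "r \<in> A" for r using that l n by (metis in_set_conv_nth less_Suc_eq_le)
  have \<tau>0: "\<tau> 0 = 0"
  proof -
    obtain i where "i \<le> n" "l ! i = 0" using idx A by blast
    then have "l ! 0 \<le> 0" using mono[of 0 i] by simp
    then show ?thesis using in_A[of 0] A by (auto simp: \<tau>_def)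
  qed
  have \<tau>n: "\<tau> n = s"
  proof -
    obtain i where "i \<le> n" "l ! i = s" using idx A by blast
    then have "s \<le> l ! n" using mono[of i n] by simp
    then show ?thesis using in_A[of n] A by (auto simp: \<tau>_def)
  qed
  define X where "X i \<omega> = W (\<tau> (Suc i)) \<omega> - W (\<tau> i) \<omega>" for i \<omega>
  have ind: "indep_vars (\<lambda>_. borel) X {..<Suc n}"
  proof -
    have "(\<forall>i\<le>Suc n. \<tau> i \<in> {0..T}) \<and> (\<forall>i<Suc n. \<tau> i \<le> \<tau> (Suc i))"
    proof (intro conjI allI impI)
      fix i show "\<tau> i \<in> {0..T}" using in_A[of i] A s by (auto simp: \<tau>_def)
      assume "i < Suc n"
      then show "\<tau> i \<le> \<tau> (Suc i)" using mono[of i "Suc i"] in_A[of i] A s by (auto simp: \<tau>_def)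
    qed
    then show ?thesis using brownian unfolding brownian_motion_def X_def by blast
  qed
  have iv: "indep_var (PiM {..<n} (\<lambda>_. borel)) (\<lambda>\<omega>. restrict (\<lambda>i. X i \<omega>) {..<n})
      (PiM {n} (\<lambda>_. borel)) (\<lambda>\<omega>. restrict (\<lambda>i. X i \<omega>) {n})"
    by (rule indep_var_restrict[OF ind]) auto
  have tele: "W (\<tau> k) \<omega> = (\<Sum>i<k. X i \<omega>)" if "\<omega> \<in> space M" for k \<omega>
    unfolding X_def by (subst sum_lessThan_telescope) (simp add: \<tau>0 W_0 that)
  obtain k where k: "\<And>r. r \<in> S \<Longrightarrow> k r \<le> n \<and> l ! (k r) = r"
    using idx by (metis A_def insertCI)
  \<comment> \<open>The map that recovers the values of \<open>W\<close> on \<open>S\<close> from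
    the increments.\<close>
  define f :: "(nat \<Rightarrow> real) \<Rightarrow> real \<Rightarrow> real" where "f y = (\<lambda>r\<in>S. \<Sum>i<k r. y i)" for y
  have f: "f \<in> PiM {..<n} (\<lambda>_. borel) \<rightarrow>\<^sub>M PiM S (\<lambda>_. borel)"
    unfolding f_def
  proof (rule measurable_restrict)
    fix r assume "r \<in> S"
    show "(\<lambda>y. \<Sum>i<k r. y i) \<in> borel_measurable (PiM {..<n} (\<lambda>_. borel :: real measure))"
    proof -
      have "(\<lambda>y. \<Sum>i\<in>{..<k r}. (\<lambda>i y. y i) i y) \<in> borel_measurable (PiM {..<n} (\<lambda>_. borel :: real measure))"
      proof (rule borel_measurable_sum)
        fix i assume "i \<in> {..<k r}"
        then have "i \<in> {..<n}" using k[OF \<open>r \<in> S\<close>] by auto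
        then show "(\<lambda>y. y i) \<in> borel_measurable (PiM {..<n} (\<lambda>_. borel :: real measure))"
          by (rule measurable_component_singleton)
      qed
      then show ?thesis by simp
    qed
  qed
  have fX: "f (restrict (\<lambda>i. X i \<omega>) {..<n}) = (\<lambda>r\<in>S. W r \<omega>)" if "\<omega> \<in> space M" for \<omega>
  proof
    fix r
    show "f (restrict (\<lambda>i. X i \<omega>) {..<n}) r = (\<lambda>r\<in>S. W r \<omega>) r"
    proof (cases "r \<in> S")
      case True
      then have "W r \<omega> = (\<Sum>i<k r. X i \<omega>)" using k[OF True] tele[OF that, of "k r"] by (simp add: \<tau>_def)
      then show ?thesis using True k[OF True] by (simp add: f_def)
    qed (simp add: f_def)
  qed
  let ?D = "f -` D \<inter> space (PiM {..<n} (\<lambda>_. borel))"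
  let ?B = "(\<lambda>y. y n) -` B \<inter> space (PiM {n} (\<lambda>_. borel :: real measure))"
  have C1: "C = (\<lambda>\<omega>. restrict (\<lambda>i. X i \<omega>) {..<n}) -` ?D \<inter> space M"
    using fX by (auto simp: C_eq space_PiM)
  have Xn: "X n \<omega> = W t \<omega> - W s \<omega>" for \<omega> by (simp add: X_def \<tau>n) (simp add: \<tau>_def)
  have B1: "{\<omega>\<in>space M. W t \<omega> - W s \<omega> \<in> B} = (\<lambda>\<omega>. restrict (\<lambda>i. X i \<omega>) {n}) -` ?B \<inter> space M"
    by (auto simp: Xn space_PiM)
  have "?D \<in> sets (PiM {..<n} (\<lambda>_. borel))" using f D by (rule measurable_sets)
  moreover have "?B \<in> sets (PiM {n} (\<lambda>_. borel))" using B
    by (intro measurable_sets[OF measurable_component_singleton]) auto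
  ultimately have "prob ((\<lambda>\<omega>. (\<lambda>i\<in>{..<n}. X i \<omega>, \<lambda>i\<in>{n}. X i \<omega>)) -` (?D \<times> ?B) \<inter> space M) =
      prob C * prob {\<omega>\<in>space M. W t \<omega> - W s \<omega> \<in> B}"
    unfolding B1 C1 by (rule indep_varD[OF iv])
  moreover have "(\<lambda>\<omega>. (\<lambda>i\<in>{..<n}. X i \<omega>, \<lambda>i\<in>{n}. X i \<omega>)) -` (?D \<times> ?B) \<inter> space M =
      C \<inter> {\<omega>\<in>space M. W t \<omega> - W s \<omega> \<in> B}"
    unfolding B1 C1 by blast
  ultimately show ?thesis by simp
qed

text \<open>The events that agree almost surely with a cylinder are intersection-stable, contain the
  generators of \<open>F s\<close> and all null sets, and inherit the product formula from
  cylinders. Independence then extends to the generated sigma-algebra.\<close>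

lemma prob_F_increment:
  assumes A: "A \<in> sets (F s)" and s: "0 \<le> s" "s < t" "t \<le> T" and B: "B \<in> sets borel"
  shows "prob (A \<inter> {\<omega>\<in>space M. W t \<omega> - W s \<omega> \<in> B}) = prob A * prob {\<omega>\<in>space M. W t \<omega> - W s \<omega> \<in> B}"
proof -
  let ?E = "{\<omega>\<in>space M. W t \<omega> - W s \<omega> \<in> B}"
  define G where "G = {A \<in> events. \<exists>C\<in>cylinders s. AE \<omega> in M. \<omega> \<in> A \<longleftrightarrow> \<omega> \<in> C}"
  have [measurable]: "W s \<in> borel_measurable M" "W t \<in> borel_measurable M" using s by auto
  note [measurable] = B
  have cyl: "C \<in> events" if "C \<in> cylinders s" for C
  proof -
    obtain S D where S: "finite S" "S \<subseteq> {0..s}" and D: "D \<in> sets (\<Pi>\<^sub>M r\<in>S. borel)"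
      and C_eq: "C = (\<lambda>\<omega>. \<lambda>r\<in>S. W r \<omega>) -` D \<inter> space M"
      using \<open>C \<in> cylinders s\<close> unfolding cylinders_def by blast
    have "(\<lambda>\<omega>. \<lambda>r\<in>S. W r \<omega>) \<in> M \<rightarrow>\<^sub>M (\<Pi>\<^sub>M r\<in>S. borel)"
      using S s by (intro measurable_restrict measurable_W) auto
    then show ?thesis unfolding C_eq using D by (rule measurable_sets)
  qed
  have G: "prob (A \<inter> ?E) = prob A * prob ?E" if "A \<in> G" for A
  proof -
    obtain C where C: "C \<in> cylinders s" "AE \<omega> in M. \<omega> \<in> A \<longleftrightarrow> \<omega> \<in> C" and [measurable]: "A \<in> events"
      using \<open>A \<in> G\<close> unfolding G_def by blast
    note [measurable] = cyl[OF C(1)]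
    have "prob (A \<inter> ?E) = prob (C \<inter> ?E)" "prob A = prob C"
      using C(2) by (auto intro!: finite_measure_eq_AE)
    then show ?thesis using prob_cylinder_increment[OF C(1) s B] by simp
  qed
  have "indep_set G {?E}"
    by (rule indep_setI) (auto simp: G_def intro: G[unfolded G_def])
  moreover have "Int_stable G"
  proof (rule Int_stableI)
    fix A1 A2 assume "A1 \<in> G" "A2 \<in> G"
    then obtain C1 C2 where *: "A1 \<in> events" "A2 \<in> events" "C1 \<in> cylinders s" "C2 \<in> cylinders s"
      "AE \<omega> in M. \<omega> \<in> A1 \<longleftrightarrow> \<omega> \<in> C1" "AE \<omega> in M. \<omega> \<in> A2 \<longleftrightarrow> \<omega> \<in> C2" by (auto simp: G_def)
    then show "A1 \<inter> A2 \<in> G" unfolding G_def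
      by (intro CollectI conjI bexI[OF _ Int_cylinders[OF *(3,4)]]) auto
  qed
  moreover have "Int_stable {?E}" by (auto simp: Int_stable_def)
  ultimately have ind: "indep_set (sigma_sets (space M) G) (sigma_sets (space M) {?E})"
    by (rule indep_set_sigma_sets)
  have "{W r -` B \<inter> space M | r B. 0 \<le> r \<and> r \<le> s \<and> r \<le> T \<and> B \<in> sets borel} \<union> null_sets M \<subseteq> G"
  proof (intro Un_least subsetI)
    fix A assume "A \<in> {W r -` B \<inter> space M | r B. 0 \<le> r \<and> r \<le> s \<and> r \<le> T \<and> B \<in> sets borel}"
    then obtain r B' where A: "A = W r -` B' \<inter> space M" and r: "0 \<le> r" "r \<le> s" "r \<le> T" and B': "B' \<in> sets borel"
      by blast
    have "A \<in> cylinders s" unfolding cylinders_def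
    proof (intro CollectI exI conjI)
      show "(\<lambda>f. f r) -` B' \<inter> space (\<Pi>\<^sub>M r\<in>{r}. (borel :: real measure)) \<in> sets (\<Pi>\<^sub>M r\<in>{r}. borel)"
        using B' by (intro measurable_sets[OF measurable_component_singleton]) auto
    qed (use r in \<open>auto simp: A space_PiM\<close>)
    then show "A \<in> G" unfolding G_def using cyl by auto
  next
    fix A assume A: "A \<in> null_sets M"
    have "{} \<in> cylinders s" unfolding cylinders_def
      by (auto intro!: exI[of _ "{}"])
    then show "A \<in> G" unfolding G_def using A AE_not_in[OF A] by auto
  qed
  then have "A \<in> sigma_sets (space M) G"
    using A sigma_sets_mono' unfolding sets_F by blast
  then show ?thesis using indep_setD[OF ind, of A ?E] by auto
qed

text \<open>The freezing principle: on \<open>F s\<close> times the Borel sets, the joint law of the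
  sample point and the increment is a product measure, as \<open>prob_F_increment\<close> shows on
  rectangles. It does the work of conditional expectations given \<open>F s\<close> in the estimates
  below.\<close>

lemma nn_integral_increment:
  assumes s: "0 \<le> s" "s < t" "t \<le> T" and f: "f \<in> borel_measurable (F s \<Otimes>\<^sub>M borel)"
  shows "(\<integral>\<^sup>+\<omega>. f (\<omega>, W t \<omega> - W s \<omega>) \<partial>M) =
    (\<integral>\<^sup>+\<omega>. \<integral>\<^sup>+y. f (\<omega>, y) * ennreal (normal_density 0 (sqrt (t - s)) y) \<partial>lborel \<partial>M)"
proof -
  \<comment> \<open>Restricting \<open>M\<close> to \<open>F s\<close> makes the sample point itself
    a random element whose law can be the first factor of the product.\<close>
  define R where "R = restr_to_subalg M (F s)"
  define N where "N = density lborel (normal_density 0 (sqrt (t - s)))"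
  interpret R: prob_space R unfolding R_def using prob_space_restr_to_subalg[OF subalgebra_F prob_space_axioms] .
  interpret N: prob_space N unfolding N_def using s by (intro prob_space_normal_density) simp
  have sR: "sets R = sets (F s)" "space R = space M"
    by (auto simp: R_def sets_restr_to_subalg[OF subalgebra_F] space_restr_to_subalg)
  have sN: "sets N = sets borel" "space N = UNIV" by (auto simp: N_def)
  have [measurable]: "W s \<in> borel_measurable M" "W t \<in> borel_measurable M" using s by auto
  have id: "(\<lambda>\<omega>. \<omega>) \<in> measurable M R"
    using sets_F_subset by (auto simp: measurable_def sR dest: sets.sets_into_space)
  have m: "(\<lambda>\<omega>. (\<omega>, W t \<omega> - W s \<omega>)) \<in> measurable M (R \<Otimes>\<^sub>M N)"
    using id by (intro measurable_Pair) (auto simp: measurable_cong_sets[OF refl sN(1)])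
  have eq: "R \<Otimes>\<^sub>M N = distr M (R \<Otimes>\<^sub>M N) (\<lambda>\<omega>. (\<omega>, W t \<omega> - W s \<omega>))"
  proof (rule pair_measure_eqI)
    fix A B assume A: "A \<in> sets R" and B: "B \<in> sets N"
    have "emeasure (distr M (R \<Otimes>\<^sub>M N) (\<lambda>\<omega>. (\<omega>, W t \<omega> - W s \<omega>))) (A \<times> B)
       = emeasure M (A \<inter> {\<omega>\<in>space M. W t \<omega> - W s \<omega> \<in> B})"
      using A B sets.sets_into_space[OF A]
      by (subst emeasure_distr[OF m]) (auto intro!: arg_cong[where f = "emeasure M"] simp: sR)
    also have "\<dots> = emeasure M A * emeasure M {\<omega>\<in>space M. W t \<omega> - W s \<omega> \<in> B}"
      using prob_F_increment[OF _ s, of A B] A B sR sN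
      by (simp add: emeasure_eq_measure ennreal_mult)
    also have "emeasure M {\<omega>\<in>space M. W t \<omega> - W s \<omega> \<in> B} = emeasure (distr M lborel (\<lambda>\<omega>. W t \<omega> - W s \<omega>)) B"
      using B sN by (subst emeasure_distr) (auto intro!: arg_cong[where f = "emeasure M"])
    also have "\<dots> = emeasure N B"
      using distributed_distr_eq_density[OF distributed_increment[OF s]] by (simp add: N_def)
    also have "emeasure M A = emeasure R A"
      using A unfolding R_def sR(1)[unfolded R_def] by (simp add: emeasure_restr_to_subalg[OF subalgebra_F])
    finally show "emeasure R A * emeasure N B = emeasure (distr M (R \<Otimes>\<^sub>M N) (\<lambda>\<omega>. (\<omega>, W t \<omega> - W s \<omega>))) (A \<times> B)" ..
  qed (auto intro: R.sigma_finite_measure_axioms N.sigma_finite_measure_axioms)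
  have f': "f \<in> borel_measurable (R \<Otimes>\<^sub>M N)"
    using f by (subst measurable_cong_sets[OF sets_pair_measure_cong[OF sR(1) sN(1)] refl])
  have f'': "(\<lambda>y. f (\<omega>, y)) \<in> borel_measurable borel" if "\<omega> \<in> space M" for \<omega>
    using measurable_Pair2[OF f] that by (simp add: space_F)
  have "(\<integral>\<^sup>+\<omega>. f (\<omega>, W t \<omega> - W s \<omega>) \<partial>M) = (\<integral>\<^sup>+z. f z \<partial>(distr M (R \<Otimes>\<^sub>M N) (\<lambda>\<omega>. (\<omega>, W t \<omega> - W s \<omega>))))"
    by (rule nn_integral_distr[OF m, symmetric]) (use f' in simp)
  also have "\<dots> = (\<integral>\<^sup>+z. f z \<partial>(R \<Otimes>\<^sub>M N))" using eq by simp
  also have "\<dots> = (\<integral>\<^sup>+\<omega>. \<integral>\<^sup>+y. f (\<omega>, y) \<partial>N \<partial>R)" by (rule N.nn_integral_fst[OF f', symmetric])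
  also have "\<dots> = (\<integral>\<^sup>+\<omega>. \<integral>\<^sup>+y. f (\<omega>, y) \<partial>N \<partial>M)"
    unfolding R_def using N.borel_measurable_nn_integral_fst[OF f']
    by (intro nn_integral_subalgebra2[OF subalgebra_F]) (simp add: measurable_cong_sets[OF sR(1) refl])
  also have "\<dots> = (\<integral>\<^sup>+\<omega>. \<integral>\<^sup>+y. f (\<omega>, y) * ennreal (normal_density 0 (sqrt (t - s)) y) \<partial>lborel \<partial>M)"
    unfolding N_def using f'' by (intro nn_integral_cong) (simp add: nn_integral_density mult.commute)
  finally show ?thesis .
qed

end

section \<open>The K-functional\<close>

lemma abs_le_Cb0_norm: "f \<in> Cb0 \<Longrightarrow> \<bar>f x\<bar> \<le> Cb0_norm f"
  unfolding Cb0_norm_def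
  by (rule cSUP_upper) (auto simp: Cb0_def bounded_iff bdd_above_def)

lemma Cb0_norm_nonneg: "f \<in> Cb0 \<Longrightarrow> 0 \<le> Cb0_norm f"
  using abs_le_Cb0_norm[of f 0] by simp

lemma abs_diff_le_Lip0_norm:
  assumes f: "f \<in> Lip0"
  shows "\<bar>f x - f y\<bar> \<le> Lip0_norm f * \<bar>x - y\<bar>"
proof (cases "x = y")
  case False
  obtain L where L: "L-lipschitz_on UNIV f" using f by (auto simp: Lip0_def)
  have "\<bar>f x - f y\<bar> / \<bar>x - y\<bar> \<le> Lip0_norm f"
    unfolding Lip0_norm_def
  proof (rule cSUP_upper2[where x = "(x, y)"])
    show "bdd_above ((\<lambda>(x, y). \<bar>f x - f y\<bar> / \<bar>x - y\<bar>) ` {(x, y). x \<noteq> y})"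
    proof (rule bdd_aboveI2[where M = L], clarsimp)
      fix a b :: real assume "a \<noteq> b"
      then show "\<bar>f a - f b\<bar> / \<bar>a - b\<bar> \<le> L"
        using lipschitz_onD[OF L, of a b] by (simp add: dist_real_def divide_le_eq)
    qed
  qed (use False in auto)
  then show ?thesis using False by (simp add: divide_le_eq)
qed simp

lemma Lip0_norm_nonneg:
  assumes "f \<in> Lip0" shows "0 \<le> Lip0_norm f"
  using abs_diff_le_Lip0_norm[OF assms, of 1 0] by simp

text \<open>Membership in the sum space. It makes the set behind the K-functional nonempty, so that
  its infimum is meaningful.\<close>

definition decomposable :: "(real \<Rightarrow> real) \<Rightarrow> bool" where
  "decomposable g \<longleftrightarrow> (\<exists>f0\<in>Cb0. \<exists>f1\<in>Lip0. g = (\<lambda>x. f0 x + f1 x))"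

lemma K_functional_greatest:
  assumes "decomposable g"
    and "\<And>f0 f1. f0 \<in> Cb0 \<Longrightarrow> f1 \<in> Lip0 \<Longrightarrow> g = (\<lambda>x. f0 x + f1 x) \<Longrightarrow> c \<le> Cb0_norm f0 + v * Lip0_norm f1"
  shows "c \<le> K_functional v g"
  unfolding K_functional_def using assms unfolding decomposable_def by (intro cInf_greatest) blast+

lemma K_functional_le:
  assumes "0 \<le> v" "f0 \<in> Cb0" "f1 \<in> Lip0" "g = (\<lambda>x. f0 x + f1 x)"
  shows "K_functional v g \<le> Cb0_norm f0 + v * Lip0_norm f1"
  unfolding K_functional_def
proof (rule cInf_lower)
  show "bdd_below {Cb0_norm f0 + v * Lip0_norm f1 |f0 f1. f0 \<in> Cb0 \<and> f1 \<in> Lip0 \<and> g = (\<lambda>x. f0 x + f1 x)}"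
    using assms(1) by (intro bdd_belowI[of _ 0]) (auto intro!: add_nonneg_nonneg mult_nonneg_nonneg Cb0_norm_nonneg Lip0_norm_nonneg)
qed (use assms in blast)

text \<open>For \<open>v < 0\<close> the infimum in the definition of the K-functional may be unbounded below; with the
  cut-off the function is monotone on the whole line.\<close>

definition Kpos :: "(real \<Rightarrow> real) \<Rightarrow> real \<Rightarrow> real" where
  "Kpos g v = (if 0 < v then K_functional v g else 0)"

lemma Kpos_nonneg: "decomposable g \<Longrightarrow> 0 \<le> Kpos g v"
  by (auto simp: Kpos_def intro!: K_functional_greatest add_nonneg_nonneg mult_nonneg_nonneg Cb0_norm_nonneg Lip0_norm_nonneg)

lemma Kpos_mono: "decomposable g \<Longrightarrow> mono (Kpos g)"
proof (rule monoI)
  fix v w :: real assume g: "decomposable g" and "v \<le> w"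
  then show "Kpos g v \<le> Kpos g w"
  proof (cases "0 < v")
    case True
    have "K_functional v g \<le> K_functional w g"
    proof (rule K_functional_greatest[OF g])
      fix f0 f1 assume f: "f0 \<in> Cb0" "f1 \<in> Lip0" "g = (\<lambda>x. f0 x + f1 x)"
      have "K_functional v g \<le> Cb0_norm f0 + v * Lip0_norm f1"
        using True by (intro K_functional_le f) auto
      also have "\<dots> \<le> Cb0_norm f0 + w * Lip0_norm f1"
        using \<open>v \<le> w\<close> by (intro add_left_mono mult_right_mono Lip0_norm_nonneg f)
      finally show "K_functional v g \<le> Cb0_norm f0 + w * Lip0_norm f1" .
    qed
    then show ?thesis using True \<open>v \<le> w\<close> by (simp add: Kpos_def)
  next
    case False
    then show ?thesis using Kpos_nonneg[OF g, of w] by (simp add: Kpos_def)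
  qed
qed

text \<open>Passing from \<open>v\<close> to \<open>c * v\<close> multiplies only the Lipschitz term
  of a splitting by \<open>c\<close>, hence its total cost by at most \<open>c\<close>.\<close>

lemma Kpos_scale:
  assumes g: "decomposable g" and c: "1 \<le> c"
  shows "Kpos g (c * v) \<le> c * Kpos g v"
proof (cases "0 < v")
  case True
  have "K_functional (c * v) g / c \<le> K_functional v g"
  proof (rule K_functional_greatest[OF g])
    fix f0 f1 assume f: "f0 \<in> Cb0" "f1 \<in> Lip0" "g = (\<lambda>x. f0 x + f1 x)"
    have "K_functional (c * v) g \<le> Cb0_norm f0 + c * v * Lip0_norm f1"
      using True c by (intro K_functional_le f) auto
    also have "\<dots> \<le> c * Cb0_norm f0 + c * v * Lip0_norm f1"
      using c Cb0_norm_nonneg[OF f(1)] mult_right_mono[of 1 c "Cb0_norm f0"] by simp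
    finally show "K_functional (c * v) g / c \<le> Cb0_norm f0 + v * Lip0_norm f1"
      using c by (simp add: divide_le_eq algebra_simps)
  qed
  then show ?thesis using True c by (simp add: Kpos_def divide_le_eq mult.commute)
qed (use c in \<open>auto simp: Kpos_def zero_less_mult_iff\<close>)

text \<open>Monotonicity and scaling combined, for either sign of \<open>b\<close>. This is the
  comparison of two positions that later replaces the current value of Brownian motion by an earlier
  one.\<close>

lemma Kpos_exp_shift:
  assumes g: "decomposable g" and v: "0 \<le> v"
  shows "Kpos g (v * exp (y + b)) \<le> exp \<bar>b\<bar> * Kpos g (v * exp y)"
proof -
  have "v * exp (y + b) \<le> exp \<bar>b\<bar> * (v * exp y)"
    using v by (simp add: exp_add mult_left_mono mult_right_mono mult.left_commute[of _ v] mult.commute)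
  then have "Kpos g (v * exp (y + b)) \<le> Kpos g (exp \<bar>b\<bar> * (v * exp y))"
    using Kpos_mono[OF g] by (rule monoD[rotated])
  also have "\<dots> \<le> exp \<bar>b\<bar> * Kpos g (v * exp y)" by (rule Kpos_scale[OF g]) simp
  finally show ?thesis .
qed

lemma decomposable_exp_growth:
  assumes g: "decomposable g" and T: "0 < T"
  obtains C where "\<And>s. \<bar>g (exp (s - T / 2))\<bar> \<le> C * exp \<bar>s\<bar>"
proof -
  obtain f0 f1 where f: "f0 \<in> Cb0" "f1 \<in> Lip0" "g = (\<lambda>x. f0 x + f1 x)" using g by (auto simp: decomposable_def)
  have "\<bar>g (exp (s - T / 2))\<bar> \<le> (Cb0_norm f0 + Lip0_norm f1) * exp \<bar>s\<bar>" for s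
  proof -
    have "\<bar>f0 (exp (s - T / 2))\<bar> \<le> Cb0_norm f0 * exp \<bar>s\<bar>"
      using abs_le_Cb0_norm[OF f(1), of "exp (s - T / 2)"] Cb0_norm_nonneg[OF f(1)]
        mult_left_mono[of 1 "exp \<bar>s\<bar>" "Cb0_norm f0"] by simp
    moreover have "\<bar>f1 (exp (s - T / 2))\<bar> \<le> Lip0_norm f1 * exp (s - T / 2)"
      using abs_diff_le_Lip0_norm[OF f(2), of "exp (s - T / 2)" 0] f(2) by (simp add: Lip0_def)
    moreover have "Lip0_norm f1 * exp (s - T / 2) \<le> Lip0_norm f1 * exp \<bar>s\<bar>"
      using T by (intro mult_left_mono Lip0_norm_nonneg f) auto
    ultimately show ?thesis by (simp add: f(3) algebra_simps)
  qed
  then show ?thesis by (rule that)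
qed

lemma decomposable_continuous:
  assumes "decomposable g" shows "continuous_on UNIV (\<lambda>s. g (exp (s - T / 2)))"
proof -
  obtain f0 f1 where f: "f0 \<in> Cb0" "f1 \<in> Lip0" "g = (\<lambda>x. f0 x + f1 x)" using assms by (auto simp: decomposable_def)
  have "continuous_on UNIV f0" "continuous_on UNIV f1"
    using f by (auto simp: Cb0_def Lip0_def intro: lipschitz_on_continuous_on)
  then have "continuous_on UNIV g" unfolding f(3) by (intro continuous_intros)
  then show ?thesis by (rule continuous_on_compose2) (auto intro!: continuous_intros)
qed

lemma decomposable_gauss_tame:
  assumes "decomposable g" "0 < T"
  shows "gauss_tame (\<lambda>s. g (exp (s - T / 2)))"
proof -
  obtain C where "\<And>s. \<bar>g (exp (s - T / 2))\<bar> \<le> C * exp \<bar>s\<bar>"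
    using decomposable_exp_growth[OF assms] by blast
  then show ?thesis
    using borel_measurable_continuous_onI[OF decomposable_continuous[OF assms(1)]]
    by (intro gauss_tameI_exp_bound[of _ C 1]) auto
qed

section \<open>Modulus of the gradient flow in terms of the K-functional\<close>

lemma dheat_add:
  assumes "gauss_tame h" "gauss_tame k" "0 < \<tau>"
  shows "dheat \<tau> (\<lambda>s. h s + k s) x = dheat \<tau> h x + dheat \<tau> k x"
  unfolding dheat_def distrib_right
  using assms by (intro Bochner_Integration.integral_add integrable_dheat)

text \<open>Each splitting of \<open>g\<close> gives a bound: the bounded part through two smoothing
  halves, the Lipschitz part through translation. Both have the common factor
  \<open>\<bar>r\<bar> * exp \<bar>r\<bar> / \<tau>\<close>, and what remains is the cost of the
  splitting at \<open>v = sqrt \<tau> * exp x\<close>, over which the infimum is taken.\<close>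

lemma dheat_modulus:
  assumes g: "decomposable g" and t: "0 < \<tau>" "\<tau> \<le> T"
  shows "\<bar>dheat \<tau> (\<lambda>s. g (exp (s - T / 2))) (x + r) - dheat \<tau> (\<lambda>s. g (exp (s - T / 2))) x\<bar>
    \<le> (2 + normal_exp_moment 1 (sqrt T)) * (\<bar>r\<bar> * exp \<bar>r\<bar>) / \<tau> * Kpos g (sqrt \<tau> * exp x)"
proof -
  define m where "m = normal_exp_moment 1 (sqrt T)"
  have m: "0 \<le> m" by (simp add: m_def normal_exp_moment_nonneg)
  have T: "0 < T" using t by simp
  define V where "V = \<bar>dheat \<tau> (\<lambda>s. g (exp (s - T / 2))) (x + r) - dheat \<tau> (\<lambda>s. g (exp (s - T / 2))) x\<bar>"
  define E where "E = \<bar>r\<bar> * exp \<bar>r\<bar>"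
  have E: "0 \<le> E" "\<bar>r\<bar> \<le> E" using mult_left_mono[of 1 "exp \<bar>r\<bar>" "\<bar>r\<bar>"] by (auto simp: E_def)
  have "V \<le> (2 + m) * E / \<tau> * (Cb0_norm f0 + (sqrt \<tau> * exp x) * Lip0_norm f1)"
    if f: "f0 \<in> Cb0" "f1 \<in> Lip0" "g = (\<lambda>x. f0 x + f1 x)" for f0 f1
  proof -
    note n = Cb0_norm_nonneg[OF f(1)] Lip0_norm_nonneg[OF f(2)]
    \<comment> \<open>Together with the zero function, \<open>f1\<close> is a splitting of itself;
      this makes the Lipschitz part tame.\<close>
    have d1: "decomposable f1"
      unfolding decomposable_def using f(2)
      by (intro bexI[of _ "\<lambda>_. 0"] bexI[of _ f1]) (auto simp: Cb0_def)
    let ?h0 = "\<lambda>s. f0 (exp (s - T / 2))" and ?h1 = "\<lambda>s. f1 (exp (s - T / 2))"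
    have c0: "continuous_on UNIV f0" using f(1) by (auto simp: Cb0_def)
    then have [measurable]: "f0 \<in> borel_measurable borel" by (rule borel_measurable_continuous_onI)
    have h0: "\<bar>?h0 s\<bar> \<le> Cb0_norm f0" for s by (rule abs_le_Cb0_norm[OF f(1)])
    have t0: "gauss_tame ?h0" by (rule gauss_tameI_bounded[OF _ h0]) measurable
    note t1 = decomposable_gauss_tame[OF d1 T]
    have eq: "dheat \<tau> (\<lambda>s. g (exp (s - T / 2))) y = dheat \<tau> ?h0 y + dheat \<tau> ?h1 y" for y
      unfolding f(3) by (rule dheat_add[OF t0 t1 t(1)])
    have 0: "\<bar>dheat \<tau> ?h0 (x + r) - dheat \<tau> ?h0 x\<bar> \<le> 2 * Cb0_norm f0 / \<tau> * \<bar>r\<bar>"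
      by (rule dheat_lipschitz_bounded[OF _ h0 t(1)]) measurable
    have 1: "\<bar>dheat \<tau> ?h1 (x + r) - dheat \<tau> ?h1 x\<bar> \<le> (Lip0_norm f1 * E) * exp x * m / sqrt \<tau>"
      unfolding m_def
    proof (rule dheat_exp_lipschitz[OF t1 _ t])
      fix y
      have "exp (y + r - T / 2) - exp (y - T / 2) = exp (y - T / 2) * (exp r - 1)"
        by (simp add: right_diff_distrib exp_add[symmetric] add_diff_eq add.commute)
      then have "\<bar>exp (y + r - T / 2) - exp (y - T / 2)\<bar> = exp (y - T / 2) * \<bar>exp r - 1\<bar>"
        by (simp add: abs_mult)
      also have "\<dots> \<le> exp y * E"
        using abs_exp_diff_le[of r] T E by (intro mult_mono) (auto simp: E_def)
      finally have "Lip0_norm f1 * \<bar>exp (y + r - T / 2) - exp (y - T / 2)\<bar> \<le> Lip0_norm f1 * (exp y * E)"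
        using n by (intro mult_left_mono)
      then show "\<bar>?h1 (y + r) - ?h1 y\<bar> \<le> (Lip0_norm f1 * E) * exp y"
        using abs_diff_le_Lip0_norm[OF f(2), of "exp (y + r - T / 2)" "exp (y - T / 2)"] by (simp add: mult_ac)
    qed
    have "V \<le> 2 * Cb0_norm f0 / \<tau> * \<bar>r\<bar> + (Lip0_norm f1 * E) * exp x * m / sqrt \<tau>"
      using 0 1 unfolding V_def eq by linarith
    also have "\<dots> \<le> 2 * Cb0_norm f0 / \<tau> * E + (Lip0_norm f1 * E) * exp x * m / sqrt \<tau>"
      using E n t by (intro add_mono mult_left_mono) auto
    also have "\<dots> = E / \<tau> * (2 * Cb0_norm f0 + m * (sqrt \<tau> * exp x * Lip0_norm f1))"
    proof -
      \<comment> \<open>Written in this way the Lipschitz part acquires the prefactor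
        \<open>1 / \<tau>\<close> of the bounded part, at the price of the weight
        \<open>sqrt \<tau>\<close> that belongs to the K-functional.\<close>
      have "1 / sqrt \<tau> = sqrt \<tau> / \<tau>" using t by (simp add: field_simps)
      then have "(Lip0_norm f1 * E) * exp x * m / sqrt \<tau> = (Lip0_norm f1 * E) * exp x * m * (sqrt \<tau> / \<tau>)"
        by (metis mult.right_neutral times_divide_eq_right)
      then show ?thesis by (simp add: algebra_simps)
    qed
    also have "\<dots> \<le> E / \<tau> * ((2 + m) * (Cb0_norm f0 + sqrt \<tau> * exp x * Lip0_norm f1))"
      using E n t m by (intro mult_left_mono) (auto simp: algebra_simps intro!: add_nonneg_nonneg)
    finally show ?thesis by (simp add: mult_ac)
  qed
  note V = this
  show ?thesis
  \<comment> \<open>The passage to the infimum divides by this factor, which vanishes for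
    \<open>r = 0\<close>.\<close>
  proof (cases "(2 + m) * E / \<tau> = 0")
    case True
    obtain f0 f1 where "f0 \<in> Cb0" "f1 \<in> Lip0" "g = (\<lambda>x. f0 x + f1 x)" using g by (auto simp: decomposable_def)
    from V[OF this] have "V \<le> 0" unfolding True by simp
    moreover have "(2 + m) * E / \<tau> * Kpos g (sqrt \<tau> * exp x) = 0" unfolding True by simp
    ultimately show ?thesis unfolding V_def E_def m_def by linarith
  next
    case False
    moreover have "0 \<le> (2 + m) * E / \<tau>" using E m t by simp
    ultimately have pos: "0 < (2 + m) * E / \<tau>" by linarith
    have "V / ((2 + m) * E / \<tau>) \<le> K_functional (sqrt \<tau> * exp x) g"
      by (rule K_functional_greatest[OF g]) (use V pos in \<open>simp only: pos_divide_le_eq mult.commute\<close>)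
    then have "V \<le> (2 + m) * E / \<tau> * K_functional (sqrt \<tau> * exp x) g"
      using pos by (simp only: pos_divide_le_eq mult.commute)
    then show ?thesis unfolding V_def E_def m_def Kpos_def using t by simp
  qed
qed

section \<open>Hoelder membership as a weighted integral of the K-functional\<close>

lemma Hoelder_decomposable: "g \<in> Hoelder \<theta> q \<Longrightarrow> decomposable g"
  by (auto simp: Hoelder_def decomposable_def)

lemma borel_measurable_Kpos [measurable]: "decomposable g \<Longrightarrow> Kpos g \<in> borel_measurable borel"
  by (intro borel_measurable_mono Kpos_mono)

text \<open>Finiteness of the norm for the exponent 2 means finiteness of the integral under the
  root; squaring \<open>v powr (- \<theta>)\<close> and multiplying by the density
  \<open>1 / v\<close> produces the exponent \<open>- 2 * \<theta> - 1\<close>.\<close>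

lemma Hoelder_nn_integral_Kpos:
  assumes g: "g \<in> Hoelder \<theta> 2"
  shows "(\<integral>\<^sup>+v. ennreal (v powr (- 2 * \<theta> - 1) * (Kpos g v)\<^sup>2) * indicator {0<..} v \<partial>lborel) < \<infinity>"
proof -
  note d = Hoelder_decomposable[OF g]
  note [measurable] = borel_measurable_Kpos[OF d]
  let ?R = "restrict_space lborel {0<..} :: real measure"
  have m: "(\<lambda>v. K_functional v g) \<in> borel_measurable ?R"
  proof -
    have "Kpos g \<in> borel_measurable ?R" by (rule measurable_restrict_space1) measurable
    then show ?thesis
      by (rule measurable_cong[THEN iffD1, rotated]) (auto simp: Kpos_def space_restrict_space)
  qed
  have [measurable]: "(\<lambda>v. v) \<in> borel_measurable ?R" by (rule measurable_restrict_space1) measurable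
  note [measurable] = m
  have "(\<integral>\<^sup>+v. ennreal (v powr (- 2 * \<theta> - 1) * (Kpos g v)\<^sup>2) * indicator {0<..} v \<partial>lborel)
    = (\<integral>\<^sup>+v. ennreal (1 / v) * ennreal (\<bar>v powr (- \<theta>) * K_functional v g\<bar> powr 2) \<partial>?R)"
  proof (subst nn_integral_restrict_space, simp, intro nn_integral_cong)
    fix v :: real
    show "ennreal (v powr (- 2 * \<theta> - 1) * (Kpos g v)\<^sup>2) * indicator {0<..} v =
      ennreal (1 / v) * ennreal (\<bar>v powr (- \<theta>) * K_functional v g\<bar> powr 2) * indicator {0<..} v"
    proof (cases "0 < v")
      case True
      have "\<bar>v powr (- \<theta>) * K_functional v g\<bar> powr 2 = (v powr (- \<theta>) * K_functional v g)\<^sup>2"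
        by (subst powr_numeral) auto
      also have "\<dots> = v powr (- 2 * \<theta>) * (K_functional v g)\<^sup>2"
        using True by (simp add: power_mult_distrib power2_eq_square powr_add[symmetric])
      finally have "1 / v * \<bar>v powr (- \<theta>) * K_functional v g\<bar> powr 2 = v powr (- 2 * \<theta> - 1) * (K_functional v g)\<^sup>2"
        using True by (simp add: powr_diff)
      then show ?thesis using True by (simp add: Kpos_def ennreal_mult'[symmetric])
    qed simp
  qed
  also have "\<dots> = (\<integral>\<^sup>+v. ennreal (\<bar>v powr (- \<theta>) * K_functional v g\<bar> powr 2) \<partial>density ?R (\<lambda>v. ennreal (1 / v)))"
    by (subst nn_integral_density) measurable
  also have "\<dots> < \<infinity>"
    using g unfolding Hoelder_def Lp_norm_def by (auto simp: Let_def less_top split: if_splits)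
  finally show ?thesis .
qed

text \<open>Substituting \<open>v = sqrt (T - u) * exp y\<close> turns \<open>dv/v\<close> into \<open>du / (2 * (T - u))\<close>.\<close>

lemma Hoelder_weighted_integral:
  assumes g: "g \<in> Hoelder \<theta> 2" and T: "0 < T"
  obtains C where "0 \<le> C"
    "\<And>y. (\<integral>\<^sup>+u. ennreal ((T - u) powr (- 1 - \<theta>) * (Kpos g (sqrt (T - u) * exp y))\<^sup>2) * indicator {0..T} u \<partial>lborel)
      \<le> ennreal (C * exp (2 * \<theta> * y))"
proof -
  note d = Hoelder_decomposable[OF g]
  note [measurable] = borel_measurable_Kpos[OF d]
  define I where "I = (\<integral>\<^sup>+v. ennreal (v powr (- 2 * \<theta> - 1) * (Kpos g v)\<^sup>2) * indicator {0<..} v \<partial>lborel)"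
  have I: "I < \<infinity>" unfolding I_def by (rule Hoelder_nn_integral_Kpos[OF g])
  have "(\<integral>\<^sup>+u. ennreal ((T - u) powr (- 1 - \<theta>) * (Kpos g (sqrt (T - u) * exp y))\<^sup>2) * indicator {0..T} u \<partial>lborel)
      \<le> ennreal ((2 * enn2real I) * exp (2 * \<theta> * y))" for y
  proof -
    define f where "f \<tau> = \<tau> powr (- 1 - \<theta>) * (Kpos g (sqrt \<tau> * exp y))\<^sup>2" for \<tau>
    have [measurable]: "f \<in> borel_measurable borel" unfolding f_def by measurable
    define b where "b = sqrt T * exp y"
    \<comment> \<open>The inverse substitution, expressing the remaining time \<open>\<tau>\<close>
      through \<open>v\<close>. Since d\<tau> / \<tau> = 2 dv / v, it produces the factor 2; the
      powers of \<open>exp y\<close> combine to \<open>exp (2 * \<theta> * y)\<close>.\<close>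
    define q where "q v = v\<^sup>2 * exp (- 2 * y)" for v
    have b: "0 \<le> b" using T by (simp add: b_def)
    have qb: "q b = T" using T by (simp add: q_def b_def power_mult_distrib exp_double[symmetric] exp_minus field_simps power2_eq_square exp_add[symmetric])
    have q0: "q 0 = 0" by (simp add: q_def)
    have "(\<integral>\<^sup>+u. ennreal ((T - u) powr (- 1 - \<theta>) * (Kpos g (sqrt (T - u) * exp y))\<^sup>2) * indicator {0..T} u \<partial>lborel)
       = (\<integral>\<^sup>+u. ennreal (f (T - u)) * indicator {0..T} (T - u) \<partial>lborel)"
      by (intro nn_integral_cong) (auto simp: f_def indicator_def)
    also have "\<dots> = (\<integral>\<^sup>+\<tau>. ennreal (f \<tau>) * indicator {0..T} \<tau> \<partial>lborel)"
      by (subst (2) nn_integral_real_affine[where t = T and c = "-1"]) (auto simp: minus_mult_left)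
    also have "\<dots> = (\<integral>\<^sup>+\<tau>. ennreal (f \<tau> * indicator {q 0..q b} \<tau>) \<partial>lborel)"
      unfolding q0 qb by (intro nn_integral_cong) (auto simp: indicator_def)
    also have "\<dots> = (\<integral>\<^sup>+v. ennreal (f (q v) * (2 * v * exp (- 2 * y)) * indicator {0..b} v) \<partial>lborel)"
      by (rule nn_integral_substitution[OF _ _ _ _ b])
        (auto simp: q_def set_borel_measurable_def intro!: derivative_eq_intros continuous_intros)
    also have "\<dots> \<le> (\<integral>\<^sup>+v. ennreal (2 * exp (2 * \<theta> * y)) * (ennreal (v powr (- 2 * \<theta> - 1) * (Kpos g v)\<^sup>2) * indicator {0<..} v) \<partial>lborel)"
    proof (intro nn_integral_mono)
      fix v :: real
      show "ennreal (f (q v) * (2 * v * exp (- 2 * y)) * indicator {0..b} v)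
        \<le> ennreal (2 * exp (2 * \<theta> * y)) * (ennreal (v powr (- 2 * \<theta> - 1) * (Kpos g v)\<^sup>2) * indicator {0<..} v)"
      proof (cases "0 < v")
        case True
        have s: "sqrt (q v) * exp y = v"
        proof -
          have "q v = (v * exp (- y))\<^sup>2" by (simp add: q_def power_mult_distrib exp_double[symmetric])
          then show ?thesis using True by (simp add: exp_minus)
        qed
        have "q v powr (- 1 - \<theta>) = v powr (- 2 - 2 * \<theta>) * exp (2 * y + 2 * \<theta> * y)"
        proof -
          have "q v = v powr 2 * exp (- 2 * y)" using True by (simp add: q_def)
          then have "q v powr (- 1 - \<theta>) = (v powr 2) powr (- 1 - \<theta>) * exp (- 2 * y) powr (- 1 - \<theta>)"
            using True by (simp add: powr_mult)
          also have "(v powr 2) powr (- 1 - \<theta>) = v powr (- 2 - 2 * \<theta>)"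
            unfolding powr_powr by (simp add: algebra_simps)
          also have "exp (- 2 * y) powr (- 1 - \<theta>) = exp (2 * y + 2 * \<theta> * y)"
            by (simp add: powr_def algebra_simps)
          finally show ?thesis .
        qed
        then have "f (q v) * (2 * v * exp (- 2 * y)) =
            2 * (exp (2 * y + 2 * \<theta> * y) * exp (- 2 * y)) * ((v powr (- 2 - 2 * \<theta>) * v) * (Kpos g v)\<^sup>2)"
          unfolding f_def s by (simp add: mult_ac)
        also have "exp (2 * y + 2 * \<theta> * y) * exp (- 2 * y) = exp (2 * \<theta> * y)" by (simp flip: exp_add)
        also have "v powr (- 2 - 2 * \<theta>) * v = v powr (- 2 * \<theta> - 1)"
        proof -
          have "v powr (- 2 * \<theta> - 1) = v powr ((- 2 - 2 * \<theta>) + 1)" by (rule arg_cong[where f = "(powr) v"]) simp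
          also have "\<dots> = v powr (- 2 - 2 * \<theta>) * v" using True by (simp only: powr_add powr_one)
          finally show ?thesis ..
        qed
        finally have "f (q v) * (2 * v * exp (- 2 * y)) =
          2 * exp (2 * \<theta> * y) * (v powr (- 2 * \<theta> - 1) * (Kpos g v)\<^sup>2)" .
        then show ?thesis using True by (auto simp: ennreal_mult[symmetric] indicator_def)
      next
        case False
        then have "v = 0 \<or> v \<notin> {0..b}" by auto
        then show ?thesis by auto
      qed
    qed
    also have "\<dots> = ennreal (2 * exp (2 * \<theta> * y)) * I"
      unfolding I_def by (rule nn_integral_cmult) measurable
    also have "\<dots> = ennreal ((2 * enn2real I) * exp (2 * \<theta> * y))"
      using I by (cases I) (auto simp: ennreal_mult'[symmetric] mult_ac)
    finally show ?thesis .
  qed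
  then show ?thesis by (rule that[rotated]) simp
qed

section \<open>The fractional integral\<close>

definition grid :: "real \<Rightarrow> real \<Rightarrow> nat \<Rightarrow> nat \<Rightarrow> real" where
  "grid s t n j = s + real j * (t - s) / real n"

locale frac_kernel =
  fixes T \<alpha> :: real
  assumes T_pos: "0 < T" and \<alpha>_pos: "0 < \<alpha>"
begin

text \<open>A probability density on \<open>{0..T}\<close>: the fractional integral is the average
  under it of the path stopped at \<open>t\<close>.\<close>

definition k :: "real \<Rightarrow> real" where
  "k u = \<alpha> / T powr \<alpha> * (T - u) powr (\<alpha> - 1) * indicator {0..T} u"

definition w :: "real \<Rightarrow> real" where
  "w c = ((T - c) / T) powr \<alpha>"

lemma borel_measurable_k [measurable]: "k \<in> borel_measurable borel"
  unfolding k_def[abs_def] by measurable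

lemma k_nonneg: "0 \<le> k u"
  using T_pos \<alpha>_pos by (auto simp: k_def)

text \<open>Reflecting \<open>u\<close> to \<open>T - u\<close> leaves a power integral from 0 with
  exponent \<open>\<alpha> - 1\<close>, which converges at its singularity because
  \<open>\<alpha>\<close> is positive.\<close>

lemma nn_integral_k_tail:
  assumes c: "0 \<le> c" "c \<le> T"
  shows "(\<integral>\<^sup>+u. ennreal (k u * indicator {c..} u) \<partial>lborel) = ennreal (w c)"
proof -
  have "((\<lambda>\<tau>. \<tau> powr (\<alpha> - 1)) has_integral ((T - c) powr (\<alpha> - 1 + 1) / (\<alpha> - 1 + 1))) {0..T - c}"
    using c \<alpha>_pos by (intro has_integral_powr_from_0) auto
  then have "((\<lambda>\<tau>. \<alpha> / T powr \<alpha> * \<tau> powr (\<alpha> - 1)) has_integral (\<alpha> / T powr \<alpha> * ((T - c) powr \<alpha> / \<alpha>))) {0..T - c}"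
    by (intro has_integral_mult_right) simp
  also have "\<alpha> / T powr \<alpha> * ((T - c) powr \<alpha> / \<alpha>) = w c"
    using \<alpha>_pos T_pos c by (simp add: w_def powr_divide)
  finally have h: "((\<lambda>\<tau>. if \<tau> \<in> {0..T - c} then \<alpha> / T powr \<alpha> * \<tau> powr (\<alpha> - 1) else 0) has_integral w c) UNIV"
    unfolding has_integral_restrict_UNIV .
  have "(\<integral>\<^sup>+u. ennreal (k u * indicator {c..} u) \<partial>lborel)
      = (\<integral>\<^sup>+u. ennreal (if T - u \<in> {0..T - c} then \<alpha> / T powr \<alpha> * (T - u) powr (\<alpha> - 1) else 0) \<partial>lborel)"
    using c by (intro nn_integral_cong) (auto simp: k_def indicator_def)
  also have "\<dots> = (\<integral>\<^sup>+\<tau>. ennreal (if \<tau> \<in> {0..T - c} then \<alpha> / T powr \<alpha> * \<tau> powr (\<alpha> - 1) else 0) \<partial>lborel)"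
    by (subst (2) nn_integral_real_affine[where t = T and c = "-1"]) (simp_all del: atLeastAtMost_iff cong: if_cong)
  also have "\<dots> = ennreal (w c)"
    using h \<alpha>_pos T_pos by (intro nn_integral_has_integral_lborel) auto
  finally show ?thesis .
qed

lemma w_nonneg: "0 \<le> w c" by (simp add: w_def)

lemma integrable_k_tail:
  assumes "0 \<le> c" "c \<le> T" shows "integrable lborel (\<lambda>u. k u * indicator {c..} u)"
  using nn_integral_k_tail[OF assms] k_nonneg by (intro integrableI_nonneg) (auto simp: indicator_def)

lemma integral_k_tail:
  assumes "0 \<le> c" "c \<le> T" shows "(LINT u|lborel. k u * indicator {c..} u) = w c"
  using nn_integral_k_tail[OF assms] k_nonneg w_nonneg
  by (intro integral_eq_nn_integral[THEN trans]) (auto simp: indicator_def)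

lemma k_eq: "k u * indicator {0..} u = k u" by (auto simp: k_def indicator_def)

lemma integrable_k: "integrable lborel k" and integral_k: "(LINT u|lborel. k u) = 1"
  using integrable_k_tail[of 0] integral_k_tail[of 0] T_pos unfolding k_eq by (auto simp: w_def)

lemma frac_int_eq: "frac_int T \<alpha> x t = (LINT u|lborel. k u * x (min u t))"
  unfolding frac_int_def set_lebesgue_integral_def integral_mult_right_zero[symmetric]
  by (intro Bochner_Integration.integral_cong) (auto simp: k_def indicator_def)

lemma k_zero: "u \<notin> {0..T} \<Longrightarrow> k u = 0" by (simp add: k_def)

context
  fixes x :: "real \<Rightarrow> real"
  assumes x: "continuous_on {0..<T} x"
begin

text \<open>One constant serves all cut-offs up to \<open>c < T\<close>, although the path itself
  may be unbounded near \<open>T\<close>. It supplies the majorants for dominated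
  convergence.\<close>

lemma stopped_path_bounded:
  assumes "0 \<le> c" "c < T"
  obtains X where "0 \<le> X" "\<And>u t. 0 \<le> u \<Longrightarrow> 0 \<le> t \<Longrightarrow> t \<le> c \<Longrightarrow> \<bar>x (min u t)\<bar> \<le> X"
proof -
  have "compact (x ` {0..c})"
    using assms by (intro compact_continuous_image continuous_on_subset[OF x]) auto
  then obtain X where X: "\<And>y. y \<in> x ` {0..c} \<Longrightarrow> norm y \<le> X"
    using compact_imp_bounded bounded_iff by metis
  have "\<bar>x (min u t)\<bar> \<le> max X 0" if "0 \<le> u" "0 \<le> t" "t \<le> c" for u t
    using X[of "x (min u t)"] that by fastforce
  then show ?thesis by (intro that[of "max X 0"]) auto
qed

lemma borel_measurable_k_stopped:
  assumes t: "0 \<le> t" "t < T"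
  shows "(\<lambda>u. k u * x (min u t)) \<in> borel_measurable borel"
proof -
  have "continuous_on {0..T} (\<lambda>u. x (min u t))"
    using t by (intro continuous_on_compose2[OF x] continuous_intros) auto
  then have "(\<lambda>u. indicator {0..T} u *\<^sub>R x (min u t)) \<in> borel_measurable borel"
    by (intro borel_measurable_continuous_on_indicator) auto
  then have "(\<lambda>u. k u * (indicator {0..T} u *\<^sub>R x (min u t))) \<in> borel_measurable borel" by measurable
  also have "(\<lambda>u. k u * (indicator {0..T} u *\<^sub>R x (min u t))) = (\<lambda>u. k u * x (min u t))"
    by (auto simp: k_def indicator_def fun_eq_iff)
  finally show ?thesis .
qed

lemma abs_k_mult_le:
  assumes "\<And>u. 0 \<le> u \<Longrightarrow> \<bar>y u\<bar> \<le> X"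
  shows "norm (k u * y u) \<le> X * k u"
proof (cases "0 \<le> u")
  case True
  then have "k u * \<bar>y u\<bar> \<le> k u * X" using assms k_nonneg by (intro mult_left_mono) auto
  then show ?thesis using k_nonneg[of u] by (simp add: abs_mult mult.commute)
qed (simp add: k_def)

lemma integrable_k_stopped:
  assumes t: "0 \<le> t" "t < T"
  shows "integrable lborel (\<lambda>u. k u * x (min u t))"
proof -
  obtain X where X: "0 \<le> X" "\<And>u. 0 \<le> u \<Longrightarrow> \<bar>x (min u t)\<bar> \<le> X"
    using stopped_path_bounded[OF t] t by (metis order_refl)
  show ?thesis
  proof (rule Bochner_Integration.integrable_bound)
    show "integrable lborel (\<lambda>u. X * k u)" by (intro integrable_mult_right integrable_k)
    show "AE u in lborel. norm (k u * x (min u t)) \<le> norm (X * k u)"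
      using abs_k_mult_le[OF X(2)] X(1) k_nonneg by (intro AE_I2) simp
  qed (use borel_measurable_k_stopped[OF t] in simp)
qed

lemma frac_int_0: "frac_int T \<alpha> x 0 = x 0"
proof -
  have "frac_int T \<alpha> x 0 = (LINT u|lborel. k u * x 0)"
    unfolding frac_int_eq
    by (intro Bochner_Integration.integral_cong) (auto simp: k_def indicator_def min_def)
  then show ?thesis by (simp add: integral_k)
qed

lemma continuous_on_frac_int: "continuous_on {0..<T} (frac_int T \<alpha> x)"
  unfolding continuous_on_sequentially
proof (intro allI ballI impI, elim conjE)
  fix v t assume t: "t \<in> {0..<T}" and v: "\<forall>n. v n \<in> {0..<T}" "v \<longlonglongrightarrow> t"
  \<comment> \<open>A convergent sequence together with its limit is compact, so its largest time
    \<open>c\<close> is still below \<open>T\<close> and a single majorant works for the whole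
    sequence.\<close>
  have "compact (insert t (range v))" using v(2) by (rule compact_sequence_with_limit)
  then obtain c where c: "c \<in> insert t (range v)" "\<And>y. y \<in> insert t (range v) \<Longrightarrow> y \<le> c"
    using compact_attains_sup by (metis insert_not_empty)
  have c': "0 \<le> c" "c < T" using c(1) t v(1) by auto
  obtain X where X: "0 \<le> X" "\<And>u t. 0 \<le> u \<Longrightarrow> 0 \<le> t \<Longrightarrow> t \<le> c \<Longrightarrow> \<bar>x (min u t)\<bar> \<le> X"
    using stopped_path_bounded[OF c'] by metis
  show "(frac_int T \<alpha> x \<circ> v) \<longlonglongrightarrow> frac_int T \<alpha> x t"
    unfolding frac_int_eq[abs_def] o_def
  proof (rule integral_dominated_convergence[where w = "\<lambda>u. X * k u"])
    show "integrable lborel (\<lambda>u. X * k u)" by (intro integrable_mult_right integrable_k)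
    show "AE u in lborel. norm (k u * x (min u (v n))) \<le> X * k u" for n
      using v(1) c(2) by (intro AE_I2 abs_k_mult_le X(2)) auto
    show "AE u in lborel. (\<lambda>n. k u * x (min u (v n))) \<longlonglongrightarrow> k u * x (min u t)"
    proof (rule AE_I2)
      fix u
      show "(\<lambda>n. k u * x (min u (v n))) \<longlonglongrightarrow> k u * x (min u t)"
      proof (cases "0 \<le> u")
        case True
        have "(\<lambda>n. x (min u (v n))) \<longlonglongrightarrow> x (min u t)"
        proof (rule continuous_on_tendsto_compose[OF x])
          show "(\<lambda>n. min u (v n)) \<longlonglongrightarrow> min u t" by (intro tendsto_intros v)
          show "min u t \<in> {0..<T}" using True t by auto
          show "\<forall>\<^sub>F n in sequentially. min u (v n) \<in> {0..<T}" using True v(1) by (simp add: min_less_iff_disj)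
        qed
        then show ?thesis by (intro tendsto_intros)
      qed (simp add: k_def)
    qed
  qed (use borel_measurable_k_stopped t v(1) in simp_all)
qed

definition weighted_sum :: "real \<Rightarrow> real \<Rightarrow> nat \<Rightarrow> real" where
  "weighted_sum s t n = (\<Sum>j<n. w (grid s t n (Suc j)) * (x (grid s t n (Suc j)) - x (grid s t n j)))"

text \<open>Since \<open>w c\<close> is the mass of \<open>[c, T]\<close> under the kernel, the weighted sum is the integral of the
  increments of \<open>x\<close> along the grid up to time \<open>u\<close>.\<close>

lemma weighted_sum_tendsto:
  assumes s: "0 \<le> s" "s < t" "t < T"
  shows "weighted_sum s t \<longlonglongrightarrow> frac_int T \<alpha> x t - frac_int T \<alpha> x s"
proof -
  \<comment> \<open>The number of cells completed by time \<open>u\<close>, capped at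
    \<open>n\<close>. For \<open>u < s\<close> the floor is not positive and \<open>nat\<close>
    yields 0.\<close>
  define m where "m n u = min n (nat \<lfloor>(u - s) * n / (t - s)\<rfloor>)" for n :: nat and u
  define p where "p n u = x (grid s t n (m n u)) - x s" for n u
  obtain X where X: "0 \<le> X" "\<And>u r. 0 \<le> u \<Longrightarrow> 0 \<le> r \<Longrightarrow> r \<le> t \<Longrightarrow> \<bar>x (min u r)\<bar> \<le> X"
    using stopped_path_bounded[of t] s by (metis less_eq_real_def order_trans)
  have grid: "s \<le> grid s t n j" "grid s t n j \<le> t" if "j \<le> n" for n j
  proof -
    show "s \<le> grid s t n j" using s by (simp add: grid_def)
    have "real j / real n \<le> 1" using that by (auto simp: divide_le_eq)
    then have "real j / real n * (t - s) \<le> 1 * (t - s)" using s by (intro mult_right_mono) auto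
    then show "grid s t n j \<le> t" by (simp add: grid_def)
  qed
  have xX: "\<bar>x r\<bar> \<le> X" if "s \<le> r" "r \<le> t" for r using X(2)[of r r] that s by simp
  have pX: "\<bar>p n u\<bar> \<le> 2 * X" for n u
    using xX[OF grid, of "m n u" n] xX[of s] s by (auto simp: p_def m_def intro!: order_trans[OF abs_triangle_ineq4])
  \<comment> \<open>The weight sits at the right endpoint, so a cell is counted at time
    \<open>u\<close> exactly when it has been completed by then. The counted increments therefore
    telescope to \<open>p n u\<close>.\<close>
  have le_iff: "grid s t n (Suc j) \<le> u \<longleftrightarrow> j < m n u" if j: "j < n" for n j u
  proof -
    have n: "0 < real n" using j by simp
    have "grid s t n (Suc j) \<le> u \<longleftrightarrow> real (Suc j) * (t - s) / real n \<le> u - s" by (auto simp: grid_def)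
    also have "\<dots> \<longleftrightarrow> real (Suc j) \<le> (u - s) * n / (t - s)" using n s by (simp add: field_simps)
    also have "\<dots> \<longleftrightarrow> Suc j \<le> nat \<lfloor>(u - s) * n / (t - s)\<rfloor>" by linarith
    also have "\<dots> \<longleftrightarrow> j < m n u" using j by (auto simp: m_def)
    finally show ?thesis .
  qed
  have sum_eq: "weighted_sum s t n = (LINT u|lborel. k u * p n u)" for n
  proof -
    have c: "0 \<le> grid s t n (Suc j)" "grid s t n (Suc j) \<le> T" if "j < n" for j
      using grid[of "Suc j" n] that s by auto
    have "weighted_sum s t n = (\<Sum>j<n. (LINT u|lborel. (k u * indicator {grid s t n (Suc j)..} u) * (x (grid s t n (Suc j)) - x (grid s t n j))))"
      unfolding weighted_sum_def by (intro sum.cong) (auto simp: integral_k_tail c)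
    also have "\<dots> = (LINT u|lborel. (\<Sum>j<n. (k u * indicator {grid s t n (Suc j)..} u) * (x (grid s t n (Suc j)) - x (grid s t n j))))"
      by (subst Bochner_Integration.integral_sum) (auto intro!: integrable_mult_left integrable_k_tail c)
    also have "\<dots> = (LINT u|lborel. k u * p n u)"
    proof (intro Bochner_Integration.integral_cong refl)
      fix u
      have "(\<Sum>j<n. (k u * indicator {grid s t n (Suc j)..} u) * (x (grid s t n (Suc j)) - x (grid s t n j)))
         = (\<Sum>j<n. if j < m n u then k u * (x (grid s t n (Suc j)) - x (grid s t n j)) else 0)"
        by (intro sum.cong) (auto simp: le_iff indicator_def)
      also have "\<dots> = (\<Sum>j<m n u. k u * (x (grid s t n (Suc j)) - x (grid s t n j)))"
        by (rule sum.mono_neutral_cong_right) (auto simp: m_def)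
      also have "\<dots> = k u * p n u"
        unfolding sum_distrib_left[symmetric] p_def
        by (subst sum_lessThan_telescope) (simp add: grid_def)
      finally show "(\<Sum>j<n. (k u * indicator {grid s t n (Suc j)..} u) * (x (grid s t n (Suc j)) - x (grid s t n j))) = k u * p n u" .
    qed
    finally show ?thesis .
  qed
  have "(\<lambda>n. LINT u|lborel. k u * p n u) \<longlonglongrightarrow> (LINT u|lborel. k u * x (min u t) - k u * x (min u s))"
  proof (rule integral_dominated_convergence[where w = "\<lambda>u. (2 * X) * k u"])
    show "integrable lborel (\<lambda>u. (2 * X) * k u)" by (intro integrable_mult_right integrable_k)
    show "(\<lambda>u. k u * x (min u t) - k u * x (min u s)) \<in> borel_measurable lborel"
      using s by (auto intro!: borel_measurable_diff borel_measurable_k_stopped)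
    show "(\<lambda>u. k u * p n u) \<in> borel_measurable lborel" for n
    proof -
      have [measurable]: "(\<lambda>u. m n u) \<in> measurable borel (count_space UNIV)" unfolding m_def by measurable
      show ?thesis unfolding p_def by measurable
    qed
    show "AE u in lborel. norm (k u * p n u) \<le> 2 * X * k u" for n
      by (intro AE_I2 abs_k_mult_le pX)
    show "AE u in lborel. (\<lambda>n. k u * p n u) \<longlonglongrightarrow> k u * x (min u t) - k u * x (min u s)"
    proof (rule AE_I2)
      fix u
      consider "u < 0" | "0 \<le> u" "u < s" | "s \<le> u" by linarith
      then show "(\<lambda>n. k u * p n u) \<longlonglongrightarrow> k u * x (min u t) - k u * x (min u s)"
      proof cases
        case 1 then show ?thesis by (simp add: k_def)
      next
        case 2
        have "m n u = 0" for n
        proof -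
          have "(u - s) * n / (t - s) \<le> 0" using 2 s by (simp add: divide_le_0_iff mult_le_0_iff)
          then have "\<lfloor>(u - s) * n / (t - s)\<rfloor> \<le> 0" by linarith
          then show ?thesis by (simp add: m_def)
        qed
        then show ?thesis using 2 s by (simp add: p_def grid_def min_def)
      next
        case 3
        have "(\<lambda>n. grid s t n (m n u)) \<longlonglongrightarrow> min u t"
        proof (rule LIMSEQ_I)
          fix e :: real assume e: "0 < e"
          obtain N where N: "(t - s) / e < real N" using reals_Archimedean2 by blast
          have "norm (grid s t n (m n u) - min u t) < e" if n: "Suc N \<le> n" for n
          proof -
            have n0: "0 < real n" using n by simp
            define q where "q = (u - s) * n / (t - s)"
            have q0: "0 \<le> q" using 3 s by (simp add: q_def)
            have d: "(t - s) / n < e"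
            proof -
              have "(t - s) / e < real n" using N n by linarith
              then show ?thesis using e n0 by (simp add: field_simps)
            qed
            show ?thesis
            proof (cases "t \<le> u")
              case True
              have "real n \<le> q" using True s n0 by (simp add: q_def field_simps mult_right_mono)
              then have "n \<le> nat \<lfloor>q\<rfloor>" by (simp add: le_nat_floor)
              then have "m n u = n" by (simp add: m_def q_def)
              then show ?thesis using True n0 e by (simp add: grid_def)
            next
              case False
              have "q < real n" using False s n0 by (simp add: q_def field_simps mult_strict_right_mono)
              then have "nat \<lfloor>q\<rfloor> \<le> n" using q0 by linarith
              then have m: "m n u = nat \<lfloor>q\<rfloor>" by (simp add: m_def q_def)
              have "grid s t n (m n u) - u = (real (nat \<lfloor>q\<rfloor>) - q) * ((t - s) / n)"
                unfolding m grid_def using s n0 by (simp add: q_def field_simps)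
              also have "\<bar>\<dots>\<bar> \<le> 1 * ((t - s) / n)"
                unfolding abs_mult using q0 s by (intro mult_mono) (auto simp: abs_le_iff, linarith+)
              finally show ?thesis using d False by simp
            qed
          qed
          then show "\<exists>no. \<forall>n\<ge>no. norm (grid s t n (m n u) - min u t) < e" by blast
        qed
        then have "(\<lambda>n. x (grid s t n (m n u))) \<longlonglongrightarrow> x (min u t)"
        proof (rule continuous_on_tendsto_compose[OF x])
          show "min u t \<in> {0..<T}" using 3 s by auto
          have "grid s t n (m n u) \<in> {0..<T}" for n
            using grid[of "m n u" n] s by (auto simp: m_def)
          then show "\<forall>\<^sub>F n in sequentially. grid s t n (m n u) \<in> {0..<T}" by simp
        qed
        then have "(\<lambda>n. k u * p n u) \<longlonglongrightarrow> k u * (x (min u t) - x s)"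
          unfolding p_def by (intro tendsto_intros)
        moreover have "min u s = s" using 3 by simp
        ultimately show ?thesis by (simp add: right_diff_distrib)
      qed
    qed
  qed
  also have "(LINT u|lborel. k u * x (min u t) - k u * x (min u s)) = frac_int T \<alpha> x t - frac_int T \<alpha> x s"
    unfolding frac_int_eq using s by (intro Bochner_Integration.integral_diff integrable_k_stopped) auto
  finally show ?thesis unfolding sum_eq .
qed

end

end

lemma cadlag_continuous:
  assumes "continuous_on {0..<T} x" shows "cadlag T x"
proof -
  have at: "(x \<longlongrightarrow> x t) (at t within {0..<T})" if "t \<in> {0..<T}" for t
    using assms that by (auto simp: continuous_on_def)
  have 1: "(x \<longlongrightarrow> x t) (at_right t)" if t: "t \<in> {0..<T}" for t
  proof -
    have "(x \<longlongrightarrow> x t) (at t within {t<..<T})" using at[OF t] by (rule tendsto_within_subset) (use t in auto)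
    moreover have "at t within {t<..<T} = at_right t"
      by (rule at_within_nhd[of t "{..<T}"]) (use t in auto)
    ultimately show ?thesis by simp
  qed
  have 2: "(x \<longlongrightarrow> x t) (at_left t)" if t: "t \<in> {0<..<T}" for t
  proof -
    have "(x \<longlongrightarrow> x t) (at t within {0<..<t})" using at[of t] by (rule tendsto_within_subset) (use t in auto)
    moreover have "at t within {0<..<t} = at_left t"
      by (rule at_within_nhd[of t "{0<..}"]) (use t in auto)
    ultimately show ?thesis by simp
  qed
  show ?thesis unfolding cadlag_def using 1 2 by blast
qed

text \<open>Replaces the left limit at the stopping time in the definition of \<open>BMO\<close> by
  the value at the stopping time.\<close>

lemma left_lim_continuous:
  assumes "continuous_on {0..<T} x" "0 \<le> t" "t < T" shows "left_lim x t = x t"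
proof (cases "t = 0")
  case False
  have "(x \<longlongrightarrow> x t) (at t within {0..<T})"
    using assms by (auto simp: continuous_on_def)
  then have "(x \<longlongrightarrow> x t) (at t within {0<..<t})" by (rule tendsto_within_subset) (use assms in auto)
  moreover have "at t within {0<..<t} = at_left t"
    by (rule at_within_nhd[of t "{0<..}"]) (use False assms in auto)
  ultimately have "(x \<longlongrightarrow> x t) (at_left t)" by simp
  then show ?thesis using False by (simp add: left_lim_def tendsto_Lim)
qed (simp add: left_lim_def)

section \<open>Moments of weighted increments\<close>

text \<open>The identity y exp (w - (T - t) / 2) = exp ((ln y + t / 2 + w) - T / 2) turns
  \<open>value_fun\<close> into a heat flow at the point \<open>ln y + t / 2\<close>. For
  \<open>y = gbm W t \<omega>\<close> this point is \<open>W t \<omega>\<close>, and the chain rule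
  contributes \<open>1 / y\<close>.\<close>

lemma value_fun_has_derivative:
  assumes bm: "brownian M T W" and h: "gauss_tame (\<lambda>s. g (exp (s - T / 2)))"
    and t: "0 \<le> t" "t < T" and y: "0 < y"
  shows "(value_fun M T W g t has_real_derivative dheat (T - t) (\<lambda>s. g (exp (s - T / 2))) (ln y + t / 2) / y) (at y)"
proof -
  interpret brownian M T W by fact
  let ?h = "\<lambda>s. g (exp (s - T / 2))"
  note [measurable] = gauss_tame_measurable[OF h]
  have \<tau>: "0 < T - t" "T - t \<le> T" using t by auto
  have eq: "value_fun M T W g t z = heat (T - t) ?h (ln z + t / 2)" if z: "0 < z" for z
  proof -
    have [measurable]: "(\<lambda>u. g (z * exp (u - (T - t) / 2))) \<in> borel_measurable borel"
    proof -
      have "z * exp (u - (T - t) / 2) = exp ((ln z + t / 2 + u) - T / 2)" for u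
      proof -
        have "(ln z + t / 2 + u) - T / 2 = ln z + (u - (T - t) / 2)" by (simp add: field_simps)
        then show ?thesis using z by (simp only: exp_add exp_ln)
      qed
      then show ?thesis using measurable_compose[of "\<lambda>u. ln z + t / 2 + u" borel borel ?h borel] by simp
    qed
    have "value_fun M T W g t z = (\<integral>\<omega>. g (z * exp ((W (T - t) \<omega> - W 0 \<omega>) - (T - t) / 2)) \<partial>M)"
      unfolding value_fun_def gbm_def by (intro Bochner_Integration.integral_cong) (simp_all add: W_0)
    also have "\<dots> = (LINT u|lborel. normal_density 0 (sqrt (T - t)) u * g (z * exp (u - (T - t) / 2)))"
      using distributed_integral[OF distributed_increment[of 0 "T - t"],
          of "\<lambda>u. g (z * exp (u - (T - t) / 2))"] \<tau> by simp
    also have "\<dots> = (LINT s|lborel. ?h s * normal_density (ln z + t / 2) (sqrt (T - t)) s)"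
    proof -
      have "exp (ln z + t / 2 + u - T / 2) = z * exp (u - (T - t) / 2)" for u
      proof -
        have "(ln z + t / 2 + u) - T / 2 = ln z + (u - (T - t) / 2)" by (simp add: field_simps)
        then show ?thesis using z by (simp only: exp_add exp_ln)
      qed
      then have "(LINT u|lborel. normal_density 0 (sqrt (T - t)) u * g (z * exp (u - (T - t) / 2)))
          = (LINT u|lborel. ?h (ln z + t / 2 + 1 * u) * normal_density (ln z + t / 2) (sqrt (T - t)) (ln z + t / 2 + 1 * u))"
        by (intro Bochner_Integration.integral_cong) (simp_all add: normal_density_def)
      also have "\<dots> = (LINT s|lborel. ?h s * normal_density (ln z + t / 2) (sqrt (T - t)) s)"
        using lborel_integral_real_affine[of 1 "\<lambda>s. ?h s * normal_density (ln z + t / 2) (sqrt (T - t)) s" "ln z + t / 2"]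
        by simp
      finally show ?thesis .
    qed
    finally show ?thesis by (simp add: heat_def)
  qed
  have "((\<lambda>z. heat (T - t) ?h (ln z + t / 2)) has_real_derivative dheat (T - t) ?h (ln y + t / 2) * (1 / y)) (at y)"
  proof (rule DERIV_chain2[where f = "heat (T - t) ?h" and g = "\<lambda>z. ln z + t / 2"])
    show "(heat (T - t) ?h has_real_derivative dheat (T - t) ?h (ln y + t / 2)) (at (ln y + t / 2))"
      by (rule heat_has_derivative[OF h \<tau>(1)])
    show "((\<lambda>z. ln z + t / 2) has_real_derivative 1 / y) (at y)"
      using y by (auto intro!: derivative_eq_intros)
  qed
  then show ?thesis
    using y by (subst (asm) DERIV_cong_ev[OF refl _ refl, where g = "value_fun M T W g t"])
      (auto simp: eq eventually_nhds intro!: exI[of _ "{0<..}"])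
qed

lemma grad_process_eq:
  assumes "brownian M T W" "gauss_tame (\<lambda>s. g (exp (s - T / 2)))" "0 \<le> t" "t < T"
  shows "grad_process M T W g t \<omega> = dheat (T - t) (\<lambda>s. g (exp (s - T / 2))) (W t \<omega>) / gbm W t \<omega>"
  using DERIV_imp_deriv[OF value_fun_has_derivative[OF assms, of "gbm W t \<omega>"]]
  by (simp add: grad_process_def gbm_def)

lemma Z_process_eq:
  assumes "brownian M T W" "gauss_tame (\<lambda>s. g (exp (s - T / 2)))" "0 \<le> t" "t < T"
  shows "Z_process M T W g t \<omega> = dheat (T - t) (\<lambda>s. g (exp (s - T / 2))) (W t \<omega>)"
  using grad_process_eq[OF assms, of \<omega>] by (simp add: grad_process_def Z_process_def gbm_def)

lemma heat_shift:
  "heat \<sigma> f x = (LINT y|lborel. f (x + y) * normal_density 0 (sqrt \<sigma>) y)"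
  unfolding heat_def by (subst lborel_integral_real_affine[of 1 _ x]) (auto simp: normal_density_def)

text \<open>The linear term is kept exact, as it will vanish against a centred \<open>d\<close>.
  Each term of order at least 2 is at most one of the two displayed extremes, according to which of
  |N| and |d| is larger, and the binomial coefficients sum to
  \<open>2 ^ (2 * k) = 4 ^ k\<close>.\<close>

lemma binomial_remainder_even:
  fixes N d :: real assumes k: "1 \<le> k"
  shows "(N + d) ^ (2 * k) \<le> N ^ (2 * k) + real (2 * k) * N ^ (2 * k - 1) * d
    + 4 ^ k * (N ^ (2 * k - 2) * d\<^sup>2 + d ^ (2 * k))"
proof -
  define R where "R = N ^ (2 * k - 2) * d\<^sup>2 + d ^ (2 * k)"
  have ev: "even (2 * k - 2)" using k by auto
  have R0: "0 \<le> R" using ev by (auto simp: R_def intro!: add_nonneg_nonneg mult_nonneg_nonneg zero_le_even_power)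
  have tm: "N ^ (2 * k - i) * d ^ i \<le> R" if i: "2 \<le> i" "i \<le> 2 * k" for i
  proof -
    have "N ^ (2 * k - i) * d ^ i \<le> \<bar>N\<bar> ^ (2 * k - i) * \<bar>d\<bar> ^ i"
      using abs_ge_self[of "N ^ (2 * k - i) * d ^ i"] by (simp add: abs_mult power_abs)
    also have "\<dots> \<le> R"
    proof (cases "\<bar>d\<bar> \<le> \<bar>N\<bar>")
      case True
      have "\<bar>N\<bar> ^ (2 * k - i) * \<bar>d\<bar> ^ i = \<bar>N\<bar> ^ (2 * k - i) * \<bar>d\<bar> ^ (i - 2) * d\<^sup>2"
      proof -
        have "\<bar>d\<bar> ^ i = \<bar>d\<bar> ^ ((i - 2) + 2)" using i by (simp only: le_add_diff_inverse2)
        then show ?thesis unfolding power_add by simp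
      qed
      also have "\<dots> \<le> \<bar>N\<bar> ^ (2 * k - i) * \<bar>N\<bar> ^ (i - 2) * d\<^sup>2"
        using True by (intro mult_right_mono mult_left_mono power_mono) auto
      also have "\<dots> = N ^ (2 * k - 2) * d\<^sup>2"
        using i ev by (simp add: power_add[symmetric] power_even_abs)
      also have "\<dots> \<le> R" by (simp add: R_def)
      finally show ?thesis .
    next
      case False
      have "\<bar>N\<bar> ^ (2 * k - i) * \<bar>d\<bar> ^ i \<le> \<bar>d\<bar> ^ (2 * k - i) * \<bar>d\<bar> ^ i"
        using False by (intro mult_right_mono power_mono) auto
      also have "\<dots> = d ^ (2 * k)" using i by (simp add: power_add[symmetric] power_even_abs)
      also have "\<dots> \<le> R" using ev by (auto simp: R_def intro!: mult_nonneg_nonneg zero_le_even_power)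
      finally show ?thesis .
    qed
    finally show ?thesis .
  qed
  have split: "{..2 * k} = {0, 1} \<union> {2..2 * k}" using k by auto
  have "(N + d) ^ (2 * k) = (\<Sum>i\<le>2 * k. (2 * k choose i) * (N ^ (2 * k - i) * d ^ i))"
    unfolding add.commute[of N d] by (subst binomial_ring) (simp add: mult_ac)
  also have "\<dots> = (\<Sum>i\<in>{0, 1}. (2 * k choose i) * (N ^ (2 * k - i) * d ^ i))
      + (\<Sum>i\<in>{2..2 * k}. (2 * k choose i) * (N ^ (2 * k - i) * d ^ i))"
    unfolding split by (intro sum.union_disjoint) auto
  also have "(\<Sum>i\<in>{0, 1}. (2 * k choose i) * (N ^ (2 * k - i) * d ^ i)) = N ^ (2 * k) + real (2 * k) * N ^ (2 * k - 1) * d"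
    by simp
  also have "(\<Sum>i\<in>{2..2 * k}. (2 * k choose i) * (N ^ (2 * k - i) * d ^ i)) \<le> (\<Sum>i\<in>{2..2 * k}. real (2 * k choose i) * R)"
    by (intro sum_mono mult_left_mono tm) auto
  also have "\<dots> \<le> (\<Sum>i\<le>2 * k. real (2 * k choose i) * R)"
    using R0 by (intro sum_mono2) auto
  also have "\<dots> = real (\<Sum>i\<le>2 * k. 2 * k choose i) * R" by (simp add: sum_distrib_right)
  also have "\<dots> = 4 ^ k * R" unfolding choose_row_sum by (simp add: power_mult)
  finally show ?thesis by (simp add: R_def)
qed

text \<open>If \<open>b \<le> \<epsilon> * a\<close>, the first term suffices; otherwise
  \<open>a\<close> is below \<open>b / \<epsilon>\<close> and the second does.\<close>

lemma power_weighted_young: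
  fixes a b \<epsilon> :: real
  assumes "0 \<le> a" "0 \<le> b" "0 < \<epsilon>"
  shows "a ^ m * b \<le> \<epsilon> * a ^ Suc m + (1 / \<epsilon>) ^ m * b ^ Suc m"
proof (cases "b \<le> \<epsilon> * a")
  case True
  then have "a ^ m * b \<le> a ^ m * (\<epsilon> * a)" using assms by (intro mult_left_mono) auto
  moreover have "0 \<le> (1 / \<epsilon>) ^ m * b ^ Suc m" using assms by simp
  ultimately show ?thesis by (simp add: mult_ac)
next
  case False
  then have "a \<le> 1 / \<epsilon> * b" using assms by (simp add: field_simps)
  then have "a ^ m \<le> (1 / \<epsilon> * b) ^ m" using assms by (intro power_mono) auto
  then have "a ^ m * b \<le> (1 / \<epsilon> * b) ^ m * b" using assms by (intro mult_right_mono) auto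
  also have "\<dots> = (1 / \<epsilon>) ^ m * b ^ Suc m" by (simp only: power_mult_distrib power_Suc mult_ac)
  finally show ?thesis using assms by (simp add: add_increasing)
qed

lemma power_add_le_2:
  fixes a b :: real assumes "0 \<le> a" "0 \<le> b" shows "(a + b) ^ p \<le> 2 ^ p * (a ^ p + b ^ p)"
proof -
  have "(a + b) ^ p \<le> (2 * max a b) ^ p" using assms by (intro power_mono) auto
  also have "\<dots> = 2 ^ p * max a b ^ p" by (simp add: power_mult_distrib)
  also have "\<dots> \<le> 2 ^ p * (a ^ p + b ^ p)" using assms by (intro mult_left_mono) (auto simp: max_def)
  finally show ?thesis .
qed

section \<open>Moments of the increment of the gradient over one cell\<close>

locale hoelder_brownian = brownian M T W for M :: "'a measure" and T W +
  fixes g :: "real \<Rightarrow> real" and \<theta> :: real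
  assumes \<theta>: "0 < \<theta>" "\<theta> < 1" and g: "g \<in> Hoelder \<theta> 2"
begin

sublocale fk: frac_kernel T "(1 - \<theta>) / 2"
  using T_pos \<theta> by unfold_locales auto

definition h :: "real \<Rightarrow> real" where "h s = g (exp (s - T / 2))"

definition v :: "real \<Rightarrow> real \<Rightarrow> real" where "v \<tau> = dheat \<tau> h"

definition Z :: "real \<Rightarrow> 'a \<Rightarrow> real" where "Z t \<omega> = v (T - t) (W t \<omega>)"

text \<open>Up to a constant, \<open>m1 \<tau>\<close> is the local Lipschitz constant of \<open>v \<tau>\<close>.\<close>

definition m1 :: "real \<Rightarrow> real \<Rightarrow> real" where "m1 \<tau> x = Kpos g (sqrt \<tau> * exp x) / \<tau>"

definition Cd :: real where "Cd = 2 + normal_exp_moment 1 (sqrt T)"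

text \<open>The moment constant for one cell. The factor \<open>2 ^ p\<close> separates two errors:
  the first moment term stems from the fluctuation of \<open>v \<tau>\<close> around its value at
  the left position, the second from replacing that value by the mean.\<close>

definition Cp :: "nat \<Rightarrow> real" where
  "Cp p = (2 * Cd) ^ p * (normal_exp_moment p (p * sqrt T) + normal_exp_moment 1 (sqrt T) ^ p)"

lemma decomposable_g: "decomposable g" using g by (rule Hoelder_decomposable)

lemma h_eq: "h = (\<lambda>s. g (exp (s - T / 2)))" by (simp add: h_def[abs_def])

lemma tame_h: "gauss_tame h" unfolding h_eq by (rule decomposable_gauss_tame[OF decomposable_g T_pos])

lemma brownian_M: "brownian M T W" by unfold_locales

lemma Z_process_Z: "0 \<le> t \<Longrightarrow> t < T \<Longrightarrow> Z_process M T W g t \<omega> = Z t \<omega>"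
  using Z_process_eq[OF brownian_M tame_h[unfolded h_eq]] by (simp add: Z_def v_def h_eq)

lemma borel_measurable_v [measurable]: "v \<tau> \<in> borel_measurable borel"
  unfolding v_def using gauss_tame_measurable[OF tame_h] by measurable

lemma Cd_nonneg: "0 \<le> Cd" unfolding Cd_def using normal_exp_moment_nonneg[of 1 "sqrt T"] by simp

lemma Cp_nonneg: "0 \<le> Cp p" unfolding Cp_def
  using Cd_nonneg normal_exp_moment_nonneg by (auto intro!: mult_nonneg_nonneg add_nonneg_nonneg)

lemma m1_nonneg: "0 \<le> \<tau> \<Longrightarrow> 0 \<le> m1 \<tau> x" unfolding m1_def using Kpos_nonneg[OF decomposable_g] by simp

lemma borel_measurable_m1 [measurable]: "m1 \<tau> \<in> borel_measurable borel"
  unfolding m1_def[abs_def] using borel_measurable_Kpos[OF decomposable_g] by measurable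

lemma m1_shift: "0 < \<tau> \<Longrightarrow> m1 \<tau> (x + b) \<le> exp \<bar>b\<bar> * m1 \<tau> x"
  unfolding m1_def using Kpos_exp_shift[OF decomposable_g, of "sqrt \<tau>" x b] by (simp add: divide_right_mono)

lemma v_modulus:
  assumes "0 < \<tau>" "\<tau> \<le> T"
  shows "\<bar>v \<tau> (x + r) - v \<tau> x\<bar> \<le> Cd * m1 \<tau> x * (\<bar>r\<bar> * exp \<bar>r\<bar>)"
  using dheat_modulus[OF decomposable_g assms, of x r] unfolding v_def h_eq Cd_def m1_def by (simp add: mult_ac)

lemma normal_nn_moment:
  assumes d: "0 < \<delta>" "\<delta> \<le> T" and c: "0 \<le> c"
  shows "integrable lborel (\<lambda>y. \<bar>y\<bar> ^ p * exp (c * \<bar>y\<bar>) * normal_density 0 (sqrt \<delta>) y)"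
    and "(LINT y|lborel. \<bar>y\<bar> ^ p * exp (c * \<bar>y\<bar>) * normal_density 0 (sqrt \<delta>) y) \<le> sqrt \<delta> ^ p * normal_exp_moment p (c * sqrt T)"
proof -
  note le = nn_integral_normal_exp_moment[OF c d, of p]
  show i: "integrable lborel (\<lambda>y. \<bar>y\<bar> ^ p * exp (c * \<bar>y\<bar>) * normal_density 0 (sqrt \<delta>) y)"
    using le by (intro integrableI_nonneg) (auto intro: le_less_trans)
  show "(LINT y|lborel. \<bar>y\<bar> ^ p * exp (c * \<bar>y\<bar>) * normal_density 0 (sqrt \<delta>) y) \<le> sqrt \<delta> ^ p * normal_exp_moment p (c * sqrt T)"
    using le d normal_exp_moment_nonneg[of p "c * sqrt T"]
    by (subst (asm) nn_integral_eq_integral[OF i]) (auto simp: ennreal_le_iff)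
qed

context
  fixes \<tau> \<delta> x :: real
  assumes \<tau>: "0 < \<tau>" and \<delta>: "0 < \<delta>" and \<tau>\<delta>: "\<tau> + \<delta> \<le> T"
begin

abbreviation (input) "nd \<equiv> normal_density 0 (sqrt \<delta>)"

text \<open>The increment of the martingale \<open>Z\<close> over a cell of length
  \<open>\<delta>\<close> that ends when time \<open>\<tau>\<close> remains, as a function of the
  Brownian increment \<open>y\<close> from the position \<open>x\<close>.\<close>

definition D :: "real \<Rightarrow> real" where "D y = v \<tau> (x + y) - v (\<tau> + \<delta>) x"

lemma borel_measurable_D [measurable]: "D \<in> borel_measurable borel"
  unfolding D_def[abs_def] by measurable

lemma integrable_v_nd: "integrable lborel (\<lambda>y. v \<tau> (x + y) * nd y)"
  and integral_v_nd: "(LINT y|lborel. v \<tau> (x + y) * nd y) = v (\<tau> + \<delta>) x"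
proof -
  have "integrable lborel (\<lambda>y. v \<tau> y * normal_density x (sqrt \<delta>) y)"
    unfolding v_def by (rule dheat_semigroup(1)[OF tame_h \<delta> \<tau>])
  then show "integrable lborel (\<lambda>y. v \<tau> (x + y) * nd y)"
    by (subst (asm) lborel_integrable_real_affine_iff[symmetric, of 1 _ x]) (simp_all add: normal_density_def)
  show "(LINT y|lborel. v \<tau> (x + y) * nd y) = v (\<tau> + \<delta>) x"
    unfolding heat_shift[symmetric] v_def using dheat_semigroup(2)[OF tame_h \<delta> \<tau>] by (simp add: add.commute)
qed

lemma integral_nd: "(LINT y|lborel. nd y) = 1" "integrable lborel nd"
  using \<delta> by auto

text \<open>By the semigroup property \<open>v (\<tau> + \<delta>) x\<close> is the Gaussian mean of
  \<open>v \<tau> (x + y)\<close>, so \<open>D\<close> is centred.\<close>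

lemma integrable_D: "integrable lborel (\<lambda>y. D y * nd y)"
  and integral_D: "(LINT y|lborel. D y * nd y) = 0"
  using integrable_v_nd integral_v_nd integral_nd unfolding D_def left_diff_distrib by simp_all

text \<open>Both \<open>v \<tau> (x + y)\<close> and the mean \<open>v (\<tau> + \<delta>) x\<close>
  are compared with \<open>v \<tau> x\<close>; the second difference is the Gaussian average of the
  modulus and has order \<open>sqrt \<delta>\<close>.\<close>

lemma abs_D_le:
  "\<bar>D y\<bar> \<le> Cd * m1 \<tau> x * (\<bar>y\<bar> * exp \<bar>y\<bar> + sqrt \<delta> * normal_exp_moment 1 (sqrt T))"
proof -
  have tT: "\<tau> \<le> T" "\<delta> \<le> T" using \<tau> \<delta> \<tau>\<delta> by auto
  have C0: "0 \<le> Cd * m1 \<tau> x" using Cd_nonneg m1_nonneg[of \<tau>] \<tau> by simp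
  note mom = normal_nn_moment[OF \<delta> tT(2) zero_le_one, of 1]
  have eq: "v \<tau> x - v (\<tau> + \<delta>) x = (LINT y|lborel. (v \<tau> x - v \<tau> (x + y)) * nd y)"
    unfolding left_diff_distrib using integrable_v_nd integral_v_nd integral_nd by simp
  have "\<bar>v \<tau> x - v (\<tau> + \<delta>) x\<bar> \<le> (LINT y|lborel. Cd * m1 \<tau> x * (\<bar>y\<bar> ^ 1 * exp (1 * \<bar>y\<bar>) * nd y))"
    unfolding eq
  proof (rule integral_abs_bound_integral)
    show "integrable lborel (\<lambda>y. (v \<tau> x - v \<tau> (x + y)) * nd y)"
      unfolding left_diff_distrib using integrable_v_nd integral_nd by simp
    show "integrable lborel (\<lambda>y. Cd * m1 \<tau> x * (\<bar>y\<bar> ^ 1 * exp (1 * \<bar>y\<bar>) * nd y))"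
      using mom(1) by (intro integrable_mult_right) simp
    fix y
    have "\<bar>v \<tau> x - v \<tau> (x + y)\<bar> * nd y \<le> Cd * m1 \<tau> x * (\<bar>y\<bar> * exp \<bar>y\<bar>) * nd y"
      by (rule mult_right_mono) (use v_modulus[OF \<tau> tT(1), of x y] in linarith, simp)
    then show "\<bar>(v \<tau> x - v \<tau> (x + y)) * nd y\<bar> \<le> Cd * m1 \<tau> x * (\<bar>y\<bar> ^ 1 * exp (1 * \<bar>y\<bar>) * nd y)"
      by (simp only: abs_mult abs_of_nonneg normal_density_nonneg power_one_right mult_1 mult.assoc)
  qed
  also have "\<dots> \<le> Cd * m1 \<tau> x * (sqrt \<delta> * normal_exp_moment 1 (sqrt T))"
    unfolding integral_mult_right_zero
    by (rule mult_left_mono[OF _ C0]) (use mom(2) in \<open>simp only: power_one_right mult_1\<close>)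
  finally have "\<bar>v \<tau> x - v (\<tau> + \<delta>) x\<bar> \<le> Cd * m1 \<tau> x * (sqrt \<delta> * normal_exp_moment 1 (sqrt T))" .
  moreover have "\<bar>D y\<bar> \<le> \<bar>v \<tau> (x + y) - v \<tau> x\<bar> + \<bar>v \<tau> x - v (\<tau> + \<delta>) x\<bar>"
    unfolding D_def by linarith
  ultimately show ?thesis
    using v_modulus[OF \<tau> tT(1), of x y] unfolding distrib_left[of "Cd * m1 \<tau> x"] by linarith
qed

lemma D_moment:
  "integrable lborel (\<lambda>y. \<bar>D y\<bar> ^ p * nd y)"
  "(LINT y|lborel. \<bar>D y\<bar> ^ p * nd y) \<le> Cp p * (sqrt \<delta> * m1 \<tau> x) ^ p"
proof -
  have tT: "\<tau> \<le> T" "\<delta> \<le> T" using \<tau> \<delta> \<tau>\<delta> by auto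
  define A where "A = Cd * m1 \<tau> x"
  define m where "m = normal_exp_moment 1 (sqrt T)"
  have A0: "0 \<le> A" unfolding A_def using Cd_nonneg m1_nonneg[of \<tau>] \<tau> by simp
  have m0: "0 \<le> m" by (simp add: m_def normal_exp_moment_nonneg)
  note mom = normal_nn_moment[OF \<delta> tT(2), of p p]
  define B where "B y = (2 * A) ^ p * (\<bar>y\<bar> ^ p * exp (p * \<bar>y\<bar>) * nd y + (sqrt \<delta> * m) ^ p * nd y)" for y :: real
  have B: "integrable lborel B" unfolding B_def using mom(1) integral_nd
    by (intro integrable_mult_right Bochner_Integration.integrable_add) auto
  have le: "\<bar>D y\<bar> ^ p * nd y \<le> B y" for y
  proof -
    have "\<bar>D y\<bar> ^ p \<le> (A * (\<bar>y\<bar> * exp \<bar>y\<bar> + sqrt \<delta> * m)) ^ p"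
      using abs_D_le[of y] unfolding A_def m_def by (intro power_mono) auto
    also have "\<dots> = A ^ p * (\<bar>y\<bar> * exp \<bar>y\<bar> + sqrt \<delta> * m) ^ p" by (rule power_mult_distrib)
    also have "\<dots> \<le> A ^ p * (2 ^ p * ((\<bar>y\<bar> * exp \<bar>y\<bar>) ^ p + (sqrt \<delta> * m) ^ p))"
      using A0 m0 \<delta> by (intro mult_left_mono power_add_le_2) auto
    also have "\<dots> = (2 * A) ^ p * (\<bar>y\<bar> ^ p * exp (p * \<bar>y\<bar>) + (sqrt \<delta> * m) ^ p)"
      unfolding exp_of_nat_mult by (simp only: power_mult_distrib mult_ac)
    finally have "\<bar>D y\<bar> ^ p * nd y \<le> (2 * A) ^ p * (\<bar>y\<bar> ^ p * exp (p * \<bar>y\<bar>) + (sqrt \<delta> * m) ^ p) * nd y"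
      by (rule mult_right_mono) simp
    then show ?thesis by (simp only: B_def distrib_left distrib_right mult_ac)
  qed
  show i: "integrable lborel (\<lambda>y. \<bar>D y\<bar> ^ p * nd y)"
  proof (rule Bochner_Integration.integrable_bound[OF B])
    show "AE y in lborel. norm (\<bar>D y\<bar> ^ p * nd y) \<le> norm (B y)"
    proof (rule AE_I2)
      fix y
      have "0 \<le> \<bar>D y\<bar> ^ p * nd y" by simp
      then have "norm (\<bar>D y\<bar> ^ p * nd y) = \<bar>D y\<bar> ^ p * nd y" by simp
      also have "\<dots> \<le> norm (B y)" using le[of y] by simp
      finally show "norm (\<bar>D y\<bar> ^ p * nd y) \<le> norm (B y)" .
    qed
  qed measurable
  have "(LINT y|lborel. \<bar>D y\<bar> ^ p * nd y) \<le> (LINT y|lborel. B y)"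
    by (rule integral_mono[OF i B le])
  also have "\<dots> = (2 * A) ^ p * ((LINT y|lborel. \<bar>y\<bar> ^ p * exp (p * \<bar>y\<bar>) * nd y) + (sqrt \<delta> * m) ^ p)"
    unfolding B_def using mom(1) integral_nd by simp
  also have "\<dots> \<le> (2 * A) ^ p * (sqrt \<delta> ^ p * normal_exp_moment p (p * sqrt T) + (sqrt \<delta> * m) ^ p)"
    using mom(2) A0 by (intro mult_left_mono add_right_mono) auto
  also have "\<dots> = Cp p * (sqrt \<delta> * m1 \<tau> x) ^ p"
    unfolding Cp_def A_def m_def by (simp only: power_mult_distrib distrib_left distrib_right mult_ac)
  finally show "(LINT y|lborel. \<bar>D y\<bar> ^ p * nd y) \<le> Cp p * (sqrt \<delta> * m1 \<tau> x) ^ p" .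
qed

text \<open>The linear term of the expansion integrates to zero because \<open>D\<close> is centred.
  The leading remainder is proportional to \<open>q\<close>, hence to the cell length
  \<open>\<delta>\<close> rather than its root, which lets the contributions of many cells add up to
  an integral.\<close>

lemma perturbed_moment_le:
  assumes k: "1 \<le> k" and c: "0 \<le> c"
  defines "q \<equiv> c\<^sup>2 * \<delta> * (m1 \<tau> x)\<^sup>2"
  shows "(\<integral>\<^sup>+y. ennreal ((N + c * D y) ^ (2 * k) * nd y) \<partial>lborel)
    \<le> ennreal (N ^ (2 * k) + 4 ^ k * (Cp 2 + Cp (2 * k)) * (N ^ (2 * k - 2) * q + q ^ k))"
proof -
  have ev: "even (2 * k - 2)" using k by auto
  have Ne: "0 \<le> N ^ (2 * k - 2)" using ev by (rule zero_le_even_power)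
  let ?R = "\<lambda>y. N ^ (2 * k) * nd y + real (2 * k) * N ^ (2 * k - 1) * c * (D y * nd y)
     + 4 ^ k * (N ^ (2 * k - 2) * c\<^sup>2 * (\<bar>D y\<bar> ^ 2 * nd y) + c ^ (2 * k) * (\<bar>D y\<bar> ^ (2 * k) * nd y))"
  have iR: "integrable lborel ?R"
    using integral_nd integrable_D D_moment(1)[of 2] D_moment(1)[of "2 * k"]
    by (intro Bochner_Integration.integrable_add integrable_mult_right) auto
  have le: "(N + c * D y) ^ (2 * k) * nd y \<le> ?R y" for y
  proof -
    have "(N + c * D y) ^ (2 * k) * nd y \<le> (N ^ (2 * k) + real (2 * k) * N ^ (2 * k - 1) * (c * D y)
      + 4 ^ k * (N ^ (2 * k - 2) * (c * D y)\<^sup>2 + (c * D y) ^ (2 * k))) * nd y"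
      by (rule mult_right_mono[OF binomial_remainder_even[OF k]]) simp
    also have "\<dots> = ?R y"
      by (simp add: power_mult_distrib power_even_abs algebra_simps)
    finally show ?thesis .
  qed
  have pos: "0 \<le> (N + c * D y) ^ (2 * k) * nd y" for y
    by (intro mult_nonneg_nonneg zero_le_even_power) auto
  have "(\<integral>\<^sup>+y. ennreal ((N + c * D y) ^ (2 * k) * nd y) \<partial>lborel) \<le> (\<integral>\<^sup>+y. ennreal (?R y) \<partial>lborel)"
    by (intro nn_integral_mono ennreal_leI le)
  also have "\<dots> = ennreal (LINT y|lborel. ?R y)"
    using iR order_trans[OF pos le] by (intro nn_integral_eq_integral) auto
  also have "(LINT y|lborel. ?R y) = N ^ (2 * k) + 4 ^ k * (N ^ (2 * k - 2) * c\<^sup>2 * (LINT y|lborel. \<bar>D y\<bar> ^ 2 * nd y)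
      + c ^ (2 * k) * (LINT y|lborel. \<bar>D y\<bar> ^ (2 * k) * nd y))"
    using integral_nd integrable_D D_moment(1)[of 2] D_moment(1)[of "2 * k"] integral_D
    by (simp add: Bochner_Integration.integral_add del: power2_abs)
  also have "\<dots> \<le> N ^ (2 * k) + 4 ^ k * (N ^ (2 * k - 2) * c\<^sup>2 * (Cp 2 * (sqrt \<delta> * m1 \<tau> x) ^ 2)
      + c ^ (2 * k) * (Cp (2 * k) * (sqrt \<delta> * m1 \<tau> x) ^ (2 * k)))"
    using Ne by (intro add_left_mono mult_left_mono add_mono D_moment(2)) auto
  also have "\<dots> = N ^ (2 * k) + 4 ^ k * (Cp 2 * (N ^ (2 * k - 2) * q) + Cp (2 * k) * q ^ k)"
  proof -
    have "(sqrt \<delta> * m1 \<tau> x) ^ 2 = \<delta> * (m1 \<tau> x)\<^sup>2" using \<delta> by (simp add: power_mult_distrib)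
    moreover have "c ^ (2 * k) * (sqrt \<delta> * m1 \<tau> x) ^ (2 * k) = q ^ k"
      using \<delta> by (simp add: q_def power_mult power_mult_distrib)
    ultimately show ?thesis by (simp add: q_def mult_ac)
  qed
  also have "\<dots> \<le> N ^ (2 * k) + 4 ^ k * (Cp 2 + Cp (2 * k)) * (N ^ (2 * k - 2) * q + q ^ k)"
  proof -
    have q: "0 \<le> q" using \<delta> by (simp add: q_def)
    have "Cp 2 * (N ^ (2 * k - 2) * q) + Cp (2 * k) * q ^ k \<le> (Cp 2 + Cp (2 * k)) * (N ^ (2 * k - 2) * q + q ^ k)"
      using q Ne Cp_nonneg[of 2] Cp_nonneg[of "2 * k"] by (simp add: algebra_simps)
    then have "4 ^ k * (Cp 2 * (N ^ (2 * k - 2) * q) + Cp (2 * k) * q ^ k) \<le> 4 ^ k * ((Cp 2 + Cp (2 * k)) * (N ^ (2 * k - 2) * q + q ^ k))"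
      by (intro mult_left_mono) auto
    then show ?thesis by (simp add: mult.assoc)
  qed
  finally show ?thesis by (simp add: ennreal_leI)
qed

end

end

context brownian begin

text \<open>\<open>H\<close> and the increment are independent, so the exponential factors out at
  the cost of its moment. The summand 1 in the constant covers \<open>a = t\<close>, where the
  increment has no density.\<close>

lemma nn_integral_exp_increment:
  assumes a: "0 \<le> a" "a \<le> t" "t \<le> T" and H: "H \<in> borel_measurable (F a)" and c: "0 \<le> c"
  shows "(\<integral>\<^sup>+\<omega>. H \<omega> * ennreal (exp (c * \<bar>W t \<omega> - W a \<omega>\<bar>)) \<partial>M)
    \<le> ennreal (1 + normal_exp_moment 0 (c * sqrt T)) * (\<integral>\<^sup>+\<omega>. H \<omega> \<partial>M)"
proof -
  note [measurable] = H measurable_F_M[OF H]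
  have C1: "1 \<le> ennreal (1 + normal_exp_moment 0 (c * sqrt T))"
    using normal_exp_moment_nonneg[of 0 "c * sqrt T"] by simp
  show ?thesis
  proof (cases "a = t")
    case True
    then have "(\<integral>\<^sup>+\<omega>. H \<omega> * ennreal (exp (c * \<bar>W t \<omega> - W a \<omega>\<bar>)) \<partial>M) = 1 * (\<integral>\<^sup>+\<omega>. H \<omega> \<partial>M)" by simp
    also have "\<dots> \<le> ennreal (1 + normal_exp_moment 0 (c * sqrt T)) * (\<integral>\<^sup>+\<omega>. H \<omega> \<partial>M)"
      using C1 by (rule mult_right_mono) simp
    finally show ?thesis .
  next
    case False
    then have a': "0 \<le> a" "a < t" "t \<le> T" using a by auto
    have [measurable]: "(\<lambda>z. H (fst z) * ennreal (exp (c * \<bar>snd z\<bar>))) \<in> borel_measurable (F a \<Otimes>\<^sub>M borel)"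
      by measurable
    have "(\<integral>\<^sup>+\<omega>. H \<omega> * ennreal (exp (c * \<bar>W t \<omega> - W a \<omega>\<bar>)) \<partial>M)
       = (\<integral>\<^sup>+\<omega>. \<integral>\<^sup>+y. H \<omega> * ennreal (exp (c * \<bar>y\<bar>)) * ennreal (normal_density 0 (sqrt (t - a)) y) \<partial>lborel \<partial>M)"
      using nn_integral_increment[OF a', of "\<lambda>z. H (fst z) * ennreal (exp (c * \<bar>snd z\<bar>))"] by simp
    also have "\<dots> = (\<integral>\<^sup>+\<omega>. H \<omega> * (\<integral>\<^sup>+y. ennreal (\<bar>y\<bar> ^ 0 * exp (c * \<bar>y\<bar>) * normal_density 0 (sqrt (t - a)) y) \<partial>lborel) \<partial>M)"
      by (intro nn_integral_cong) (simp add: nn_integral_cmult[symmetric] ennreal_mult mult.assoc)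
    also have "\<dots> \<le> (\<integral>\<^sup>+\<omega>. H \<omega> * ennreal (1 + normal_exp_moment 0 (c * sqrt T)) \<partial>M)"
    proof (intro nn_integral_mono mult_left_mono)
      have "(\<integral>\<^sup>+y. ennreal (\<bar>y\<bar> ^ 0 * exp (c * \<bar>y\<bar>) * normal_density 0 (sqrt (t - a)) y) \<partial>lborel)
         \<le> ennreal (sqrt (t - a) ^ 0 * normal_exp_moment 0 (c * sqrt T))"
        using a' by (intro nn_integral_normal_exp_moment c) auto
      also have "\<dots> \<le> ennreal (1 + normal_exp_moment 0 (c * sqrt T))" by (intro ennreal_leI) simp
      finally show "(\<integral>\<^sup>+y. ennreal (\<bar>y\<bar> ^ 0 * exp (c * \<bar>y\<bar>) * normal_density 0 (sqrt (t - a)) y) \<partial>lborel)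
         \<le> ennreal (1 + normal_exp_moment 0 (c * sqrt T))" .
    qed simp
    also have "\<dots> = ennreal (1 + normal_exp_moment 0 (c * sqrt T)) * (\<integral>\<^sup>+\<omega>. H \<omega> \<partial>M)"
      by (subst nn_integral_multc) (auto simp: mult.commute)
    finally show ?thesis .
  qed
qed

end

text \<open>If the denominator is 0, then \<open>q\<close> is 0 as well and the convention
  \<open>x / 0 = 0\<close> gives the right value, so the Young parameter causes no exceptional
  case.\<close>

lemma ratio_mult_sum:
  fixes q S :: real assumes "0 \<le> q" "0 \<le> S" shows "q / (S + q) * (S + q) = q"
proof (cases "S + q = 0")
  case True
  then have "q = 0" using assms by linarith
  then show ?thesis by simp
next
  case False then show ?thesis by simp
qed

text \<open>The Young parameter \<open>r = q / (S + q)\<close> makes the bound \<open>N\<^sup>2\<^sup>k \<lesssim> S\<^sup>k\<close> stable under the step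
  \<open>S \<mapsto> S + q\<close>.\<close>

lemma young_step:
  fixes N q E S A :: real
  assumes k: "1 \<le> k" and q: "0 \<le> q" and E: "0 \<le> E" and S: "0 \<le> S" and A: "1 \<le> A"
  defines "r \<equiv> q / (S + q)"
  shows "A * (N ^ (2 * k - 2) * (q * E) + (q * E) ^ k)
    \<le> r / 2 * N ^ (2 * k) + A * ((2 * A) ^ (k - 1) + 1) * r * (S + q) ^ k * E ^ k"
proof -
  have r: "0 \<le> r" "r \<le> 1" using q S by (auto simp: r_def divide_le_eq)
  have qr: "r * (S + q) = q" unfolding r_def by (rule ratio_mult_sum[OF q S])
  define b where "b = (S + q) * E"
  have b: "0 \<le> b" using q S E by (simp add: b_def)
  have qE: "q * E = r * b" unfolding b_def mult.assoc[symmetric] qr ..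
  have kk: "Suc (k - 1) = k" "N ^ (2 * k - 2) = (N\<^sup>2) ^ (k - 1)" "N ^ (2 * k) = (N\<^sup>2) ^ k"
    using k by (auto simp: power_mult[symmetric] right_diff_distrib')
  \<comment> \<open>With the Young parameter \<open>1 / (2 * A)\<close>, the outer factor
    \<open>A * r\<close> turns the coefficient of \<open>N ^ (2 * k)\<close> into
    \<open>r / 2\<close>.\<close>
  have "(N\<^sup>2) ^ (k - 1) * b \<le> (1 / (2 * A)) * (N\<^sup>2) ^ Suc (k - 1) + (1 / (1 / (2 * A))) ^ (k - 1) * b ^ Suc (k - 1)"
    using A b by (intro power_weighted_young) auto
  then have y: "(N\<^sup>2) ^ (k - 1) * b \<le> (1 / (2 * A)) * (N\<^sup>2) ^ k + (2 * A) ^ (k - 1) * b ^ k"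
    unfolding kk(1) by simp
  have rk: "r ^ k \<le> r" using power_decreasing[of 1 k r] k r by simp
  have "A * (N ^ (2 * k - 2) * (q * E) + (q * E) ^ k) = A * (r * ((N\<^sup>2) ^ (k - 1) * b) + r ^ k * b ^ k)"
    unfolding qE kk(2) by (simp add: power_mult_distrib)
  also have "\<dots> \<le> A * (r * ((1 / (2 * A)) * (N\<^sup>2) ^ k + (2 * A) ^ (k - 1) * b ^ k) + r * b ^ k)"
    using A r y b rk by (intro mult_left_mono add_mono mult_right_mono) auto
  also have "\<dots> = r / 2 * (N\<^sup>2) ^ k + A * ((2 * A) ^ (k - 1) + 1) * r * b ^ k"
    using A by (simp add: field_simps)
  also have "b ^ k = (S + q) ^ k * E ^ k" by (simp add: b_def power_mult_distrib)
  finally show ?thesis unfolding kk(3) by (simp add: mult.assoc)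
qed

lemma power_form_mono:
  fixes p P a b x :: real
  assumes p: "0 \<le> p" "p \<le> P" and a: "0 \<le> a" "a \<le> b" and m: "even m"
  shows "a * (x ^ m * p + p ^ k) \<le> b * (x ^ m * P + P ^ k)"
proof (rule mult_mono)
  have x: "0 \<le> x ^ m" using m by (rule zero_le_even_power)
  show "x ^ m * p + p ^ k \<le> x ^ m * P + P ^ k"
    by (intro add_mono mult_left_mono[OF p(2) x] power_mono p)
  show "0 \<le> x ^ m * p + p ^ k" by (intro add_nonneg_nonneg mult_nonneg_nonneg[OF x p(1)] zero_le_power p)
qed (use a in auto)

text \<open>Since \<open>S = (1 - r) * (S + q)\<close> and \<open>k \<ge> 1\<close>, replacing
  \<open>S ^ k\<close> by the larger \<open>(S + q) ^ k\<close> gains the factor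
  \<open>1 - r\<close>. This beats the growth \<open>1 + r / 2\<close> by \<open>r / 2\<close>, and
  \<open>2 * c \<le> C\<close> lets this gain absorb the added term. The constant therefore does not
  deteriorate with the number of cells.\<close>

lemma young_step_sum:
  fixes q S c C :: real
  assumes k: "1 \<le> k" and q: "0 \<le> q" and S: "0 \<le> S" and c: "0 \<le> c" "2 * c \<le> C"
  defines "r \<equiv> q / (S + q)"
  shows "(1 + r / 2) * (C * S ^ k) + c * r * (S + q) ^ k \<le> C * (S + q) ^ k"
proof -
  have r: "0 \<le> r" "r \<le> 1" using q S by (auto simp: r_def divide_le_eq)
  have "r * (S + q) = q" unfolding r_def by (rule ratio_mult_sum[OF q S])
  then have Sr: "S = (1 - r) * (S + q)" unfolding left_diff_distrib by simp
  have C: "0 \<le> C" using c by simp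
  have p: "0 \<le> (S + q) ^ k" using q S by simp
  have "(1 - r) ^ k \<le> 1 - r" using power_decreasing[of 1 k "1 - r"] k r by simp
  then have "(1 + r / 2) * (1 - r) ^ k \<le> (1 + r / 2) * (1 - r)" using r by (intro mult_left_mono) auto
  also have "\<dots> \<le> 1 - r / 2" using r by (simp add: algebra_simps)
  finally have 1: "(1 + r / 2) * (1 - r) ^ k \<le> 1 - r / 2" .
  have "S ^ k = (1 - r) ^ k * (S + q) ^ k" using Sr by (metis power_mult_distrib)
  then have "(1 + r / 2) * (C * S ^ k) + c * r * (S + q) ^ k
      = (C * ((1 + r / 2) * (1 - r) ^ k) + c * r) * (S + q) ^ k" by (simp add: algebra_simps)
  also have "\<dots> \<le> (C * (1 - r / 2) + c * r) * (S + q) ^ k"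
    using 1 C p by (intro mult_right_mono add_right_mono mult_left_mono) auto
  also have "\<dots> \<le> C * (S + q) ^ k"
  proof (rule mult_right_mono[OF _ p])
    have "c * r \<le> (C / 2) * r" using c r by (intro mult_right_mono) auto
    then show "C * (1 - r / 2) + c * r \<le> C" by (simp add: algebra_simps)
  qed
  finally show ?thesis .
qed

section \<open>Recursion of the moments over the cells of a grid\<close>

context hoelder_brownian begin

lemma measurable_Z: "0 \<le> t \<Longrightarrow> t < T \<Longrightarrow> Z t \<in> borel_measurable (F t)"
  unfolding Z_def[abs_def] using measurable_W_F[of t t] by simp

lemma continuous_Z: "\<omega> \<in> space M \<Longrightarrow> continuous_on {0..<T} (\<lambda>t. Z t \<omega>)"
proof -
  assume \<omega>: "\<omega> \<in> space M"
  obtain C where C: "\<And>s. \<bar>h s\<bar> \<le> C * exp \<bar>s\<bar>"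
    using decomposable_exp_growth[OF decomposable_g T_pos] unfolding h_eq by blast
  show ?thesis unfolding Z_def v_def
  proof (rule continuous_on_dheat[OF _ C])
    show "continuous_on UNIV h" unfolding h_eq by (rule decomposable_continuous[OF decomposable_g])
    show "continuous_on {0..<T} (\<lambda>t. W t \<omega>)"
      by (rule continuous_on_subset[OF continuous_W[OF \<omega>]]) auto
  qed (auto intro!: continuous_intros)
qed

text \<open>\<open>q c \<delta> y\<close> bounds the second moment of a weighted increment of \<open>Z\<close> over \<open>[c - \<delta>, c]\<close> started
  from \<open>W = y\<close>.\<close>

definition q :: "real \<Rightarrow> real \<Rightarrow> real \<Rightarrow> real" where
  "q c \<delta> y = (fk.w c)\<^sup>2 * \<delta> * (m1 (T - c) y)\<^sup>2"

lemma borel_measurable_q [measurable]: "q c \<delta> \<in> borel_measurable borel"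
  unfolding q_def[abs_def] by measurable

lemma q_nonneg: "0 \<le> \<delta> \<Longrightarrow> 0 \<le> q c \<delta> y" by (simp add: q_def)

lemma q_shift:
  assumes "c < T" "0 \<le> \<delta>"
  shows "q c \<delta> (y + b) \<le> q c \<delta> y * exp (2 * \<bar>b\<bar>)"
proof -
  have "(m1 (T - c) (y + b))\<^sup>2 \<le> (exp \<bar>b\<bar> * m1 (T - c) y)\<^sup>2"
    using assms by (intro power_mono m1_shift m1_nonneg) auto
  also have "\<dots> = (m1 (T - c) y)\<^sup>2 * exp (2 * \<bar>b\<bar>)"
    unfolding power_mult_distrib exp_double[symmetric] by (simp only: mult.commute)
  finally have "(fk.w c)\<^sup>2 * \<delta> * (m1 (T - c) (y + b))\<^sup>2 \<le> (fk.w c)\<^sup>2 * \<delta> * ((m1 (T - c) y)\<^sup>2 * exp (2 * \<bar>b\<bar>))"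
    using assms by (intro mult_left_mono) auto
  then show ?thesis by (simp add: q_def mult.assoc)
qed

definition A :: "nat \<Rightarrow> real" where "A k = 1 + 4 ^ k * (Cp 2 + Cp (2 * k))"

text \<open>The constant of \<open>young_step\<close> times the exponential moment that pays for
  evaluating the local variance at \<open>W a\<close> instead of the current position.\<close>

definition cA :: "nat \<Rightarrow> real" where
  "cA k = A k * ((2 * A k) ^ (k - 1) + 1) * (1 + normal_exp_moment 0 ((2 * k) * sqrt T))"

lemma A_ge: "1 \<le> A k" unfolding A_def using Cp_nonneg[of 2] Cp_nonneg[of "2 * k"] by simp

lemma cA_nonneg: "0 \<le> cA k"
  unfolding cA_def using A_ge[of k] normal_exp_moment_nonneg[of 0] by (auto intro!: mult_nonneg_nonneg add_nonneg_nonneg)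

text \<open>The cell starts at \<open>u\<close>, but \<open>S\<close> and \<open>q\<close> are
  evaluated at \<open>W a\<close>, which keeps \<open>r\<close> measurable for \<open>F a\<close>.
  The shift bound costs \<open>exp (2 * \<bar>W u - W a\<bar>)\<close> in the variance, its
  \<open>k\<close>-th power in the moment, and this is integrated out because the increment from
  \<open>a\<close> to \<open>u\<close> is independent of \<open>F a\<close>.\<close>

lemma increment_moment_step:
  assumes a: "0 \<le> a" "a \<le> u" "u < c" "c < T"
    and N: "N \<in> borel_measurable (F u)" and H: "H \<in> borel_measurable (F a)" "\<And>\<omega>. 0 \<le> H \<omega>"
    and S: "S \<in> borel_measurable borel" "\<And>y. 0 \<le> S y" and k: "1 \<le> k"
  defines "r \<equiv> \<lambda>\<omega>. q c (c - u) (W a \<omega>) / (S (W a \<omega>) + q c (c - u) (W a \<omega>))"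
  shows "(\<integral>\<^sup>+\<omega>. ennreal (H \<omega> * (N \<omega> + fk.w c * (Z c \<omega> - Z u \<omega>)) ^ (2 * k)) \<partial>M)
    \<le> (\<integral>\<^sup>+\<omega>. ennreal (H \<omega> * (1 + r \<omega> / 2) * N \<omega> ^ (2 * k)) \<partial>M)
      + (\<integral>\<^sup>+\<omega>. ennreal (H \<omega> * (cA k * r \<omega> * (S (W a \<omega>) + q c (c - u) (W a \<omega>)) ^ k)) \<partial>M)"
proof -
  define \<delta> where "\<delta> = c - u"
  define \<tau> where "\<tau> = T - c"
  have d: "0 < \<delta>" "0 < \<tau>" "\<tau> + \<delta> \<le> T" "\<tau> + \<delta> = T - u" "c - u = \<delta>" using a by (auto simp: \<delta>_def \<tau>_def)
  have u: "0 \<le> u" "u < c" "c \<le> T" "u \<le> T" "a \<le> T" using a by auto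
  have Wa_a: "W a \<in> borel_measurable (F a)" using u a by (intro measurable_W_F) auto
  note [measurable] = N H(1) S(1) Wa_a
  have [measurable]: "W u \<in> borel_measurable (F u)" using u by (intro measurable_W_F) auto
  have [measurable]: "H \<in> borel_measurable (F u)" by (rule measurable_F_mono[OF a(2) H(1)])
  have [measurable]: "H \<in> borel_measurable M" "N \<in> borel_measurable M" "W a \<in> borel_measurable M"
      "W u \<in> borel_measurable M" "W c \<in> borel_measurable M"
    using measurable_F_M[OF H(1)] measurable_F_M[OF N] a u by auto
  define Q where "Q \<omega> = q c \<delta> (W a \<omega>)" for \<omega>
  define E where "E \<omega> = exp (2 * \<bar>W u \<omega> - W a \<omega>\<bar>)" for \<omega>
  define cc where "cc = A k * ((2 * A k) ^ (k - 1) + 1)"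
  define H' where "H' \<omega> = H \<omega> * (cc * r \<omega> * (S (W a \<omega>) + Q \<omega>) ^ k)" for \<omega>
  have Q0: "0 \<le> Q \<omega>" for \<omega> using d by (simp add: Q_def q_nonneg)
  have r0: "0 \<le> r \<omega>" for \<omega> using Q0 S(2) by (simp add: r_def Q_def d)
  have cc0: "0 \<le> cc" unfolding cc_def using A_ge[of k] by (intro mult_nonneg_nonneg add_nonneg_nonneg) auto
  have mF [measurable]: "r \<in> borel_measurable (F a)" "Q \<in> borel_measurable (F a)" "H' \<in> borel_measurable (F a)"
    unfolding r_def H'_def Q_def by measurable
  note [measurable] = mF[THEN measurable_F_M]
  have H'0: "0 \<le> H' \<omega>" for \<omega> unfolding H'_def using H(2) cc0 r0 Q0 S(2) by (intro mult_nonneg_nonneg zero_le_power add_nonneg_nonneg)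
  let ?f = "\<lambda>z. ennreal (H (fst z) * (N (fst z) + fk.w c * (v \<tau> (W u (fst z) + snd z) - v (\<tau> + \<delta>) (W u (fst z)))) ^ (2 * k))"
  have [measurable]: "?f \<in> borel_measurable (F u \<Otimes>\<^sub>M borel)" by measurable
  have "(\<integral>\<^sup>+\<omega>. ennreal (H \<omega> * (N \<omega> + fk.w c * (Z c \<omega> - Z u \<omega>)) ^ (2 * k)) \<partial>M)
      = (\<integral>\<^sup>+\<omega>. ?f (\<omega>, W c \<omega> - W u \<omega>) \<partial>M)"
    unfolding Z_def d(4)[symmetric] \<tau>_def[symmetric] by simp
  also have "\<dots> = (\<integral>\<^sup>+\<omega>. \<integral>\<^sup>+y. ?f (\<omega>, y) * ennreal (normal_density 0 (sqrt (c - u)) y) \<partial>lborel \<partial>M)"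
    by (rule nn_integral_increment[OF u(1-3)]) measurable
  \<comment> \<open>The second summand is brought into the form of an \<open>F a\<close>-measurable
    factor \<open>H'\<close> times an exponential of the increment from \<open>a\<close> to
    \<open>u\<close>, as \<open>nn_integral_exp_increment\<close> requires.\<close>
  also have "\<dots> \<le> (\<integral>\<^sup>+\<omega>. ennreal (H \<omega> * (1 + r \<omega> / 2) * N \<omega> ^ (2 * k)) + ennreal (H' \<omega>) * ennreal (exp ((2 * k) * \<bar>W u \<omega> - W a \<omega>\<bar>)) \<partial>M)"
  proof (rule nn_integral_mono)
    fix \<omega>
    define x where "x = W u \<omega>"
    have "(\<integral>\<^sup>+y. ?f (\<omega>, y) * ennreal (normal_density 0 (sqrt (c - u)) y) \<partial>lborel)
        = (\<integral>\<^sup>+y. ennreal (H \<omega>) * ennreal ((N \<omega> + fk.w c * D \<tau> \<delta> x y) ^ (2 * k) * normal_density 0 (sqrt \<delta>) y) \<partial>lborel)"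
    proof (rule nn_integral_cong)
      fix y
      define P where "P = (N \<omega> + fk.w c * D \<tau> \<delta> x y) ^ (2 * k)"
      have P0: "0 \<le> P" unfolding P_def by (rule zero_le_even_power) simp
      have fP: "?f (\<omega>, y) = ennreal (H \<omega> * P)"
        unfolding P_def D_def[OF d(2,1,3)] x_def by simp
      show "?f (\<omega>, y) * ennreal (normal_density 0 (sqrt (c - u)) y) = ennreal (H \<omega>) * ennreal (P * normal_density 0 (sqrt \<delta>) y)"
        unfolding fP d(5) using H(2)[of \<omega>] P0 by (simp only: ennreal_mult normal_density_nonneg mult.assoc)
    qed
    also have "\<dots> = ennreal (H \<omega>) * (\<integral>\<^sup>+y. ennreal ((N \<omega> + fk.w c * D \<tau> \<delta> x y) ^ (2 * k) * normal_density 0 (sqrt \<delta>) y) \<partial>lborel)"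
      using d(1-3) by (intro nn_integral_cmult) (measurable; auto)
    also have "\<dots> \<le> ennreal (H \<omega>) * ennreal (N \<omega> ^ (2 * k) + 4 ^ k * (Cp 2 + Cp (2 * k)) *
        (N \<omega> ^ (2 * k - 2) * ((fk.w c)\<^sup>2 * \<delta> * (m1 \<tau> x)\<^sup>2) + ((fk.w c)\<^sup>2 * \<delta> * (m1 \<tau> x)\<^sup>2) ^ k))"
      by (intro mult_left_mono perturbed_moment_le[OF d(2,1,3) k fk.w_nonneg]) simp
    also have "\<dots> \<le> ennreal (H \<omega>) * ennreal (N \<omega> ^ (2 * k) + (r \<omega> / 2 * N \<omega> ^ (2 * k) +
        cc * r \<omega> * (S (W a \<omega>) + Q \<omega>) ^ k * E \<omega> ^ k))"
    proof (intro mult_left_mono ennreal_leI add_left_mono)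
      have ev: "even (2 * k - 2)" using k by auto
      have qx: "(fk.w c)\<^sup>2 * \<delta> * (m1 \<tau> x)\<^sup>2 \<le> Q \<omega> * E \<omega>" "0 \<le> (fk.w c)\<^sup>2 * \<delta> * (m1 \<tau> x)\<^sup>2"
        using q_shift[OF a(4), of \<delta> "W a \<omega>" "W u \<omega> - W a \<omega>"] d
        by (auto simp: q_def Q_def E_def \<tau>_def x_def)
      have "4 ^ k * (Cp 2 + Cp (2 * k)) * (N \<omega> ^ (2 * k - 2) * ((fk.w c)\<^sup>2 * \<delta> * (m1 \<tau> x)\<^sup>2) + ((fk.w c)\<^sup>2 * \<delta> * (m1 \<tau> x)\<^sup>2) ^ k)
        \<le> A k * (N \<omega> ^ (2 * k - 2) * (Q \<omega> * E \<omega>) + (Q \<omega> * E \<omega>) ^ k)"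
        using qx ev Cp_nonneg[of 2] Cp_nonneg[of "2 * k"] by (intro power_form_mono) (auto simp: A_def)
      also have "\<dots> \<le> r \<omega> / 2 * N \<omega> ^ (2 * k) + cc * r \<omega> * (S (W a \<omega>) + Q \<omega>) ^ k * E \<omega> ^ k"
        unfolding r_def d(5) cc_def Q_def[symmetric]
        by (rule young_step[OF k Q0 _ S(2) A_ge]) (simp add: E_def)
      finally show "4 ^ k * (Cp 2 + Cp (2 * k)) * (N \<omega> ^ (2 * k - 2) * ((fk.w c)\<^sup>2 * \<delta> * (m1 \<tau> x)\<^sup>2) + ((fk.w c)\<^sup>2 * \<delta> * (m1 \<tau> x)\<^sup>2) ^ k)
        \<le> r \<omega> / 2 * N \<omega> ^ (2 * k) + cc * r \<omega> * (S (W a \<omega>) + Q \<omega>) ^ k * E \<omega> ^ k" .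
    qed simp
    also have "\<dots> = ennreal (H \<omega> * (1 + r \<omega> / 2) * N \<omega> ^ (2 * k) + H' \<omega> * E \<omega> ^ k)"
      using H(2)[of \<omega>] by (subst ennreal_mult'[symmetric]) (auto simp: H'_def algebra_simps)
    also have "\<dots> = ennreal (H \<omega> * (1 + r \<omega> / 2) * N \<omega> ^ (2 * k)) + ennreal (H' \<omega>) * ennreal (exp ((2 * k) * \<bar>W u \<omega> - W a \<omega>\<bar>))"
    proof -
      have "E \<omega> ^ k = exp ((2 * k) * \<bar>W u \<omega> - W a \<omega>\<bar>)" by (simp add: E_def exp_of_nat_mult[symmetric] mult_ac)
      moreover have "0 \<le> H \<omega> * (1 + r \<omega> / 2) * N \<omega> ^ (2 * k)" using H(2) r0 by (simp add: zero_le_even_power)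
      ultimately show ?thesis using H'0 by (simp add: ennreal_plus ennreal_mult)
    qed
    finally show "(\<integral>\<^sup>+y. ?f (\<omega>, y) * ennreal (normal_density 0 (sqrt (c - u)) y) \<partial>lborel) \<le> \<dots>" .
  qed
  also have "\<dots> = (\<integral>\<^sup>+\<omega>. ennreal (H \<omega> * (1 + r \<omega> / 2) * N \<omega> ^ (2 * k)) \<partial>M) + (\<integral>\<^sup>+\<omega>. ennreal (H' \<omega>) * ennreal (exp ((2 * k) * \<bar>W u \<omega> - W a \<omega>\<bar>)) \<partial>M)"
    by (rule nn_integral_add) measurable
  also have "\<dots> \<le> (\<integral>\<^sup>+\<omega>. ennreal (H \<omega> * (1 + r \<omega> / 2) * N \<omega> ^ (2 * k)) \<partial>M) + ennreal (1 + normal_exp_moment 0 ((2 * k) * sqrt T)) * (\<integral>\<^sup>+\<omega>. ennreal (H' \<omega>) \<partial>M)"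
    using a u by (intro add_left_mono nn_integral_exp_increment) auto
  also have "ennreal (1 + normal_exp_moment 0 ((2 * k) * sqrt T)) * (\<integral>\<^sup>+\<omega>. ennreal (H' \<omega>) \<partial>M)
     = (\<integral>\<^sup>+\<omega>. ennreal (H \<omega> * (cA k * r \<omega> * (S (W a \<omega>) + q c (c - u) (W a \<omega>)) ^ k)) \<partial>M)"
  proof -
    define n where "n = 1 + normal_exp_moment 0 ((2 * k) * sqrt T)"
    have n: "0 \<le> n" using normal_exp_moment_nonneg[of 0 "(2 * k) * sqrt T"] by (simp add: n_def)
    have "ennreal n * (\<integral>\<^sup>+\<omega>. ennreal (H' \<omega>) \<partial>M) = (\<integral>\<^sup>+\<omega>. ennreal n * ennreal (H' \<omega>) \<partial>M)"
      by (rule nn_integral_cmult[symmetric]) measurable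
    also have "\<dots> = (\<integral>\<^sup>+\<omega>. ennreal (H \<omega> * (cA k * r \<omega> * (S (W a \<omega>) + q c (c - u) (W a \<omega>)) ^ k)) \<partial>M)"
    proof (rule nn_integral_cong)
      fix \<omega>
      have "n * H' \<omega> = H \<omega> * (cA k * r \<omega> * (S (W a \<omega>) + q c (c - u) (W a \<omega>)) ^ k)"
        unfolding H'_def Q_def cA_def cc_def d(5) n_def by (simp add: mult_ac)
      then show "ennreal n * ennreal (H' \<omega>) = ennreal (H \<omega> * (cA k * r \<omega> * (S (W a \<omega>) + q c (c - u) (W a \<omega>)) ^ k))"
        using n H'0[of \<omega>] by (simp only: ennreal_mult[symmetric])
    qed
    finally show ?thesis unfolding n_def .
  qed
  finally show ?thesis .
qed

lemma grid_Suc: "grid s t n (Suc j) = grid s t n j + (t - s) / n"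
  by (simp add: grid_def distrib_right add_divide_distrib)

lemma grid_n: "0 < n \<Longrightarrow> grid s t n n = t" by (simp add: grid_def)

lemma grid_bounds:
  assumes "s \<le> t" "j \<le> n"
  shows "s \<le> grid s t n j" "grid s t n j \<le> t"
proof -
  show "s \<le> grid s t n j" using assms by (simp add: grid_def)
  have "real j / real n \<le> 1" using assms by (auto simp: divide_le_eq)
  then have "real j / real n * (t - s) \<le> 1 * (t - s)" using assms by (intro mult_right_mono) auto
  then show "grid s t n j \<le> t" by (simp add: grid_def)
qed

definition N :: "real \<Rightarrow> real \<Rightarrow> nat \<Rightarrow> nat \<Rightarrow> 'a \<Rightarrow> real" where
  "N s t n j \<omega> = (\<Sum>i<j. fk.w (grid s t n (Suc i)) * (Z (grid s t n (Suc i)) \<omega> - Z (grid s t n i) \<omega>))"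

definition S :: "real \<Rightarrow> real \<Rightarrow> nat \<Rightarrow> nat \<Rightarrow> real \<Rightarrow> real" where
  "S s t n j y = (\<Sum>i<j. q (grid s t n (Suc i)) ((t - s) / n) y)"

lemma borel_measurable_S [measurable]: "S s t n j \<in> borel_measurable borel"
  unfolding S_def[abs_def] by measurable

lemma S_nonneg: "s \<le> t \<Longrightarrow> 0 \<le> S s t n j y" unfolding S_def by (intro sum_nonneg q_nonneg) simp

lemma measurable_N:
  assumes s: "0 \<le> s" "s < t" "t < T" and j: "j \<le> n"
  shows "N s t n j \<in> borel_measurable (F (grid s t n j))"
  unfolding N_def[abs_def]
proof (intro borel_measurable_sum borel_measurable_times borel_measurable_diff borel_measurable_const)
  fix i assume "i \<in> {..<j}"
  then have i: "Suc i \<le> j" "Suc i \<le> n" "i \<le> n" using j by auto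
  have mono: "grid s t n i \<le> grid s t n j" if "i \<le> j" for i
    using s that by (auto simp: grid_def intro!: divide_right_mono mult_right_mono)
  note b = grid_bounds[of s t _ n, OF less_imp_le[OF s(2)]]
  show "Z (grid s t n (Suc i)) \<in> borel_measurable (F (grid s t n j))"
    using b[OF i(2)] s i by (intro measurable_F_mono[OF mono measurable_Z]) auto
  show "Z (grid s t n i) \<in> borel_measurable (F (grid s t n j))"
    using b[OF i(3)] s i by (intro measurable_F_mono[OF mono measurable_Z]) auto
qed

text \<open>Induction on the number of cells, one application of
  \<open>increment_moment_step\<close> per cell. The choice of \<open>r\<close> through
  \<open>young_step_sum\<close> keeps the factor \<open>2 * cA k\<close> fixed. The bound is frozen
  at \<open>W a\<close> even when \<open>a\<close> is earlier than the start \<open>s\<close> of the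
  grid, which is used with \<open>a = 0\<close> for the tail estimates.\<close>

lemma N_moment:
  assumes a: "0 \<le> a" "a \<le> s" "s < t" "t < T" and k: "1 \<le> k" and j: "j \<le> n"
    and H: "H \<in> borel_measurable (F a)" "\<And>\<omega>. 0 \<le> H \<omega>"
  shows "(\<integral>\<^sup>+\<omega>. ennreal (H \<omega> * N s t n j \<omega> ^ (2 * k)) \<partial>M)
    \<le> (\<integral>\<^sup>+\<omega>. ennreal (H \<omega> * (2 * cA k * S s t n j (W a \<omega>) ^ k)) \<partial>M)"
  using j H
proof (induction j arbitrary: H)
  case 0
  then show ?case using k by (simp add: N_def S_def power_0_left)
next
  case (Suc j)
  define u where "u = grid s t n j"
  define c where "c = grid s t n (Suc j)"
  define Q where "Q \<omega> = q c (c - u) (W a \<omega>)" for \<omega>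
  define SS where "SS \<omega> = S s t n j (W a \<omega>)" for \<omega>
  define r where "r \<omega> = Q \<omega> / (SS \<omega> + Q \<omega>)" for \<omega>
  have n: "0 < real n" using Suc.prems(1) by simp
  have cu: "c - u = (t - s) / n" by (simp add: c_def u_def grid_Suc)
  then have cu0: "u < c" using a n by (smt (verit) divide_pos_pos)
  have b: "s \<le> u" "u \<le> t" "s \<le> c" "c \<le> t"
    using grid_bounds[of s t _ n] a Suc.prems(1) by (auto simp: u_def c_def)
  have Wa: "W a \<in> borel_measurable (F a)" using a by (intro measurable_W_F) auto
  note [measurable] = Wa Suc.prems(2) measurable_F_M[OF Wa] measurable_F_M[OF Suc.prems(2)]
  have [measurable]: "r \<in> borel_measurable (F a)" "r \<in> borel_measurable M" "Q \<in> borel_measurable M" "SS \<in> borel_measurable M"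
    unfolding r_def Q_def SS_def by measurable
  have Q0: "0 \<le> Q \<omega>" and S0: "0 \<le> SS \<omega>" for \<omega>
    using cu0 a by (auto simp: Q_def SS_def q_nonneg S_nonneg)
  have r0: "0 \<le> r \<omega>" for \<omega> using Q0 S0 by (simp add: r_def)
  have NS: "N s t n (Suc j) \<omega> = N s t n j \<omega> + fk.w c * (Z c \<omega> - Z u \<omega>)" for \<omega>
    by (simp add: N_def c_def u_def)
  have SQ: "S s t n (Suc j) (W a \<omega>) = SS \<omega> + Q \<omega>" for \<omega>
    by (simp add: S_def SS_def Q_def c_def[symmetric] cu)
  have "(\<integral>\<^sup>+\<omega>. ennreal (H \<omega> * N s t n (Suc j) \<omega> ^ (2 * k)) \<partial>M)
    \<le> (\<integral>\<^sup>+\<omega>. ennreal (H \<omega> * (1 + r \<omega> / 2) * N s t n j \<omega> ^ (2 * k)) \<partial>M)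
      + (\<integral>\<^sup>+\<omega>. ennreal (H \<omega> * (cA k * r \<omega> * (SS \<omega> + Q \<omega>) ^ k)) \<partial>M)"
    unfolding NS r_def Q_def SS_def
  proof (rule increment_moment_step)
    show "N s t n j \<in> borel_measurable (F u)" unfolding u_def
      using measurable_N[of s t j n] a Suc.prems(1) by simp
  qed (use a b cu0 Suc.prems k S_nonneg in auto)
  \<comment> \<open>The induction hypothesis is applied to the test function
    \<open>H * (1 + r / 2)\<close>, again nonnegative and measurable at time \<open>a\<close>; for
    this reason \<open>H\<close> varies in the induction.\<close>
  also have "(\<integral>\<^sup>+\<omega>. ennreal (H \<omega> * (1 + r \<omega> / 2) * N s t n j \<omega> ^ (2 * k)) \<partial>M)
      \<le> (\<integral>\<^sup>+\<omega>. ennreal (H \<omega> * (1 + r \<omega> / 2) * (2 * cA k * SS \<omega> ^ k)) \<partial>M)"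
    unfolding SS_def using Suc.prems r0 by (intro Suc.IH) auto
  also have "(\<integral>\<^sup>+\<omega>. ennreal (H \<omega> * (1 + r \<omega> / 2) * (2 * cA k * SS \<omega> ^ k)) \<partial>M) +
      (\<integral>\<^sup>+\<omega>. ennreal (H \<omega> * (cA k * r \<omega> * (SS \<omega> + Q \<omega>) ^ k)) \<partial>M)
     = (\<integral>\<^sup>+\<omega>. ennreal (H \<omega> * (1 + r \<omega> / 2) * (2 * cA k * SS \<omega> ^ k)) + ennreal (H \<omega> * (cA k * r \<omega> * (SS \<omega> + Q \<omega>) ^ k)) \<partial>M)"
    by (rule nn_integral_add[symmetric]) measurable
  also have "\<dots> \<le> (\<integral>\<^sup>+\<omega>. ennreal (H \<omega> * (2 * cA k * S s t n (Suc j) (W a \<omega>) ^ k)) \<partial>M)"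
  proof (rule nn_integral_mono)
    fix \<omega>
    have "ennreal (H \<omega> * (1 + r \<omega> / 2) * (2 * cA k * SS \<omega> ^ k)) + ennreal (H \<omega> * (cA k * r \<omega> * (SS \<omega> + Q \<omega>) ^ k))
      = ennreal (H \<omega> * ((1 + r \<omega> / 2) * (2 * cA k * SS \<omega> ^ k) + cA k * r \<omega> * (SS \<omega> + Q \<omega>) ^ k))"
      using Suc.prems(3)[of \<omega>] r0[of \<omega>] S0[of \<omega>] Q0[of \<omega>] cA_nonneg[of k]
      by (subst ennreal_plus[symmetric]) (auto simp: distrib_left mult.assoc)
    also have "\<dots> \<le> ennreal (H \<omega> * (2 * cA k * (SS \<omega> + Q \<omega>) ^ k))"
      using Suc.prems(3)[of \<omega>] unfolding r_def
      by (intro ennreal_leI mult_left_mono young_step_sum[OF k Q0 S0 cA_nonneg]) auto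
    finally show "ennreal (H \<omega> * (1 + r \<omega> / 2) * (2 * cA k * SS \<omega> ^ k)) + ennreal (H \<omega> * (cA k * r \<omega> * (SS \<omega> + Q \<omega>) ^ k))
      \<le> ennreal (H \<omega> * (2 * cA k * S s t n (Suc j) (W a \<omega>) ^ k))" unfolding SQ .
  qed
  finally show ?case by (simp add: add_right_mono)
qed

end

context hoelder_brownian begin

text \<open>The K-functional enters the moment bounds through the tail integral \<open>Q s y\<close> of \<open>kdens y\<close>, of
  which the sums of the \<open>q\<close> are Riemann sums up to a constant factor.\<close>

definition kdens :: "real \<Rightarrow> real \<Rightarrow> real" where
  "kdens y u = (T - u) powr (- 1 - \<theta>) * (Kpos g (sqrt (T - u) * exp y))\<^sup>2"

definition Q :: "real \<Rightarrow> real \<Rightarrow> ennreal" where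
  "Q s y = (\<integral>\<^sup>+u. ennreal (kdens y u) * indicator {s..T} u \<partial>lborel)"

definition I :: "real \<Rightarrow> 'a \<Rightarrow> real" where
  "I t \<omega> = frac_int T ((1 - \<theta>) / 2) (\<lambda>u. Z u \<omega>) t"

lemma borel_measurable_kdens [measurable]: "kdens y \<in> borel_measurable borel"
  unfolding kdens_def[abs_def] using borel_measurable_Kpos[OF decomposable_g] by measurable

lemma kdens_nonneg: "0 \<le> kdens y u" by (simp add: kdens_def)

lemma q_eq_kdens:
  assumes "c < T"
  shows "q c \<delta> y = T powr (\<theta> - 1) * (\<delta> * kdens y c)"
proof -
  define \<tau> where "\<tau> = T - c"
  have \<tau>: "0 < \<tau>" using assms by (simp add: \<tau>_def)
  have "(fk.w c)\<^sup>2 = (\<tau> / T) powr (1 - \<theta>)"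
    unfolding fk.w_def \<tau>_def[symmetric] power2_eq_square powr_add[symmetric] by (simp only: field_sum_of_halves)
  also have "\<dots> = \<tau> powr (1 - \<theta>) * T powr (\<theta> - 1)"
    using \<tau> T_pos by (simp add: powr_divide powr_diff)
  finally have w: "(fk.w c)\<^sup>2 = \<tau> powr (1 - \<theta>) * T powr (\<theta> - 1)" .
  have "\<tau> powr (1 - \<theta>) / \<tau>\<^sup>2 = \<tau> powr (- 1 - \<theta>)"
  proof -
    have "\<tau> powr (- 1 - \<theta>) = \<tau> powr ((1 - \<theta>) - 2)" by (rule arg_cong[where f = "(powr) \<tau>"]) simp
    also have "\<dots> = \<tau> powr (1 - \<theta>) / \<tau>\<^sup>2" unfolding powr_diff[of \<tau> "1 - \<theta>" 2] using \<tau> by simp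
    finally show ?thesis ..
  qed
  then have "\<tau> powr (1 - \<theta>) * (Kpos g (sqrt \<tau> * exp y) / \<tau>)\<^sup>2 = kdens y c"
    unfolding kdens_def \<tau>_def[symmetric] power_divide by (metis times_divide_eq_left times_divide_eq_right)
  then show ?thesis unfolding q_def w m1_def \<tau>_def[symmetric] by (simp add: mult_ac)
qed

text \<open>The condition says that \<open>T - u\<close> is at most twice \<open>T - c\<close>, so
  the singular power grows by at most \<open>2 powr (1 + \<theta>) \<le> 4\<close>, while
  \<open>Kpos\<close> only decreases as the remaining time shrinks.\<close>

lemma kdens_le_4:
  assumes u: "u \<le> c" "c < T" "c - u \<le> T - c"
  shows "kdens y c \<le> 4 * kdens y u"
proof -
  have p: "0 < T - c" "0 < T - u" using u by auto
  have K: "Kpos g (sqrt (T - c) * exp y) \<le> Kpos g (sqrt (T - u) * exp y)"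
    using u by (intro monoD[OF Kpos_mono[OF decomposable_g]] mult_right_mono) auto
  have "(T - c) powr (- 1 - \<theta>) \<le> ((T - u) / 2) powr (- 1 - \<theta>)"
    using u p \<theta> by (intro powr_mono2') auto
  also have "\<dots> = (T - u) powr (- 1 - \<theta>) * 2 powr (1 + \<theta>)"
  proof -
    have "(2::real) powr (- 1 - \<theta>) = 1 / 2 powr (1 + \<theta>)"
      using powr_minus_divide[of "2::real" "1 + \<theta>"] by simp
    then show ?thesis using p by (simp add: powr_divide)
  qed
  also have "\<dots> \<le> (T - u) powr (- 1 - \<theta>) * 4"
  proof (rule mult_left_mono)
    have "(2::real) powr (1 + \<theta>) \<le> 2 powr 2" using \<theta> by (intro powr_mono) auto
    then show "(2::real) powr (1 + \<theta>) \<le> 4" by simp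
  qed simp
  finally have "(T - c) powr (- 1 - \<theta>) \<le> (T - u) powr (- 1 - \<theta>) * 4" .
  then have "kdens y c \<le> ((T - u) powr (- 1 - \<theta>) * 4) * (Kpos g (sqrt (T - u) * exp y))\<^sup>2"
    unfolding kdens_def using K Kpos_nonneg[OF decomposable_g] by (intro mult_mono power_mono) auto
  then show ?thesis by (simp add: kdens_def mult_ac)
qed

text \<open>The Riemann sum evaluates the singular density at right endpoints, where it may exceed
  its values inside the cell. A mesh of at most \<open>T - t\<close> keeps every cell shorter than
  the time remaining after it, and \<open>kdens_le_4\<close> then compares cell by cell.\<close>

lemma S_le_Q:
  assumes s: "0 \<le> s" "s < t" "t < T" and n: "(t - s) / n \<le> T - t" "0 < n"
  shows "ennreal (S s t n n y) \<le> ennreal (4 * T powr (\<theta> - 1)) * Q s y"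
proof -
  define G where "G i = grid s t n i" for i
  have b: "s \<le> G i" "G i \<le> t" if "i \<le> n" for i
    using grid_bounds[of s t i n] that s by (auto simp: G_def)
  have GS: "G (Suc i) = G i + (t - s) / n" for i by (simp add: G_def grid_Suc)
  have d0: "0 < (t - s) / n" using s n by simp
  have part: "ennreal (S s t n j y) \<le> ennreal (4 * T powr (\<theta> - 1)) * (\<integral>\<^sup>+u. ennreal (kdens y u) * indicator {s..<G j} u \<partial>lborel)"
    if "j \<le> n" for j using that
  proof (induction j)
    case 0
    then show ?case by (simp add: S_def)
  next
    case (Suc j)
    have j: "j < n" using Suc.prems by simp
    let ?J = "\<lambda>A. (\<integral>\<^sup>+u. ennreal (kdens y u) * indicator A u \<partial>lborel)"
    have c: "G (Suc j) < T" "G (Suc j) \<le> t" "G j < G (Suc j)" using b[of "Suc j"] Suc.prems s d0 GS[of j] by auto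
    have "ennreal ((t - s) / n * kdens y (G (Suc j))) = (\<integral>\<^sup>+u. ennreal (kdens y (G (Suc j))) * indicator {G j..<G (Suc j)} u \<partial>lborel)"
    proof -
      have "emeasure lborel {G j..<G (Suc j)} = ennreal ((t - s) / n)" using GS[of j] d0 by simp
      then show ?thesis
        using d0 by (subst nn_integral_cmult_indicator) (simp_all add: ennreal_mult[symmetric] kdens_nonneg less_imp_le mult.commute del: times_divide_eq_left times_divide_eq_right)
    qed
    also have "\<dots> \<le> (\<integral>\<^sup>+u. ennreal 4 * (ennreal (kdens y u) * indicator {G j..<G (Suc j)} u) \<partial>lborel)"
    proof (rule nn_integral_mono)
      fix u
      show "ennreal (kdens y (G (Suc j))) * indicator {G j..<G (Suc j)} u \<le> ennreal 4 * (ennreal (kdens y u) * indicator {G j..<G (Suc j)} u)"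
      proof (cases "u \<in> {G j..<G (Suc j)}")
        case True
        have "kdens y (G (Suc j)) \<le> 4 * kdens y u"
        proof (rule kdens_le_4)
          have "G (Suc j) - u \<le> (t - s) / n" using True GS[of j] by auto
          also have "\<dots> \<le> T - G (Suc j)" using n(1) c(2) by linarith
          finally show "G (Suc j) - u \<le> T - G (Suc j)" .
        qed (use True c in auto)
        then show ?thesis using True kdens_nonneg[of y u] by (simp add: ennreal_mult[symmetric] ennreal_leI del: ennreal_numeral)
      qed simp
    qed
    also have "\<dots> = ennreal 4 * ?J {G j..<G (Suc j)}" by (rule nn_integral_cmult) measurable
    finally have st: "ennreal ((t - s) / n * kdens y (G (Suc j))) \<le> ennreal 4 * ?J {G j..<G (Suc j)}" .
    have "S s t n (Suc j) y = S s t n j y + T powr (\<theta> - 1) * ((t - s) / n * kdens y (G (Suc j)))"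
      unfolding S_def using q_eq_kdens[OF c(1)] by (simp add: G_def)
    then have "ennreal (S s t n (Suc j) y) = ennreal (S s t n j y) + ennreal (T powr (\<theta> - 1)) * ennreal ((t - s) / n * kdens y (G (Suc j)))"
      using S_nonneg[of s t n j y] s d0 kdens_nonneg
      by (simp only:) (subst ennreal_plus; simp add: ennreal_mult' less_imp_le del: times_divide_eq_left)
    also have "\<dots> \<le> ennreal (4 * T powr (\<theta> - 1)) * ?J {s..<G j} + ennreal (T powr (\<theta> - 1)) * (ennreal 4 * ?J {G j..<G (Suc j)})"
      using Suc j by (intro add_mono mult_left_mono st) auto
    also have "ennreal (T powr (\<theta> - 1)) * (ennreal 4 * ?J {G j..<G (Suc j)}) = ennreal (4 * T powr (\<theta> - 1)) * ?J {G j..<G (Suc j)}"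
      by (subst ennreal_mult) (auto simp: mult_ac)
    also have "ennreal (4 * T powr (\<theta> - 1)) * ?J {s..<G j} + \<dots> = ennreal (4 * T powr (\<theta> - 1)) * (?J {s..<G j} + ?J {G j..<G (Suc j)})"
      by (simp add: distrib_left)
    also have "?J {s..<G j} + ?J {G j..<G (Suc j)} = ?J {s..<G (Suc j)}"
      using c(3) b(1)[of j] j
      by (subst nn_integral_add[symmetric]) (auto intro!: nn_integral_cong simp: indicator_def)
    finally show ?case .
  qed
  have "(\<integral>\<^sup>+u. ennreal (kdens y u) * indicator {s..<G n} u \<partial>lborel) \<le> Q s y"
    unfolding Q_def using b(2)[of n] s by (intro nn_integral_mono) (auto simp: indicator_def)
  then show ?thesis using part[of n] by (meson mult_left_mono order_refl order_trans zero_le)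
qed

lemma N_tendsto:
  assumes "0 \<le> s" "s < t" "t < T" "\<omega> \<in> space M"
  shows "(\<lambda>n. N s t n n \<omega>) \<longlonglongrightarrow> I t \<omega> - I s \<omega>"
  using fk.weighted_sum_tendsto[OF continuous_Z[OF assms(4)] assms(1-3)]
  unfolding N_def I_def fk.weighted_sum_def[OF continuous_Z[OF assms(4)]] by simp

lemma I_0: "\<omega> \<in> space M \<Longrightarrow> I 0 \<omega> = Z 0 \<omega>"
  unfolding I_def by (rule fk.frac_int_0[OF continuous_Z])

lemma continuous_I: "\<omega> \<in> space M \<Longrightarrow> continuous_on {0..<T} (\<lambda>t. I t \<omega>)"
  unfolding I_def by (rule fk.continuous_on_frac_int[OF continuous_Z])

text \<open>Adaptedness is obtained from the convergence of the weighted sums, whose terms use only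
  values of \<open>Z\<close> up to \<open>t\<close>.\<close>

lemma measurable_I:
  assumes t: "0 \<le> t" "t < T" shows "I t \<in> borel_measurable (F t)"
proof (cases "t = 0")
  case True
  have "Z 0 \<in> borel_measurable (F 0)" using T_pos by (intro measurable_Z) auto
  then show ?thesis unfolding True
    by (rule measurable_cong[THEN iffD2, rotated]) (simp add: space_F I_0)
next
  case False
  have "(\<lambda>\<omega>. I t \<omega> - I 0 \<omega> + Z 0 \<omega>) \<in> borel_measurable (F t)"
  proof (intro borel_measurable_add)
    show "Z 0 \<in> borel_measurable (F t)" using t by (intro measurable_F_mono[OF _ measurable_Z]) auto
    show "(\<lambda>\<omega>. I t \<omega> - I 0 \<omega>) \<in> borel_measurable (F t)"
    proof (rule borel_measurable_LIMSEQ_real)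
      \<comment> \<open>Indices start at 1 because the last point of an empty grid is not
        \<open>t\<close>.\<close>
      show "(\<lambda>n. N 0 t (Suc n) (Suc n) \<omega>) \<longlonglongrightarrow> I t \<omega> - I 0 \<omega>" if "\<omega> \<in> space (F t)" for \<omega>
        using N_tendsto[of 0 t \<omega>] t False that LIMSEQ_Suc by (simp add: space_F)
      show "N 0 t (Suc n) (Suc n) \<in> borel_measurable (F t)" for n
        using measurable_N[of 0 t "Suc n" "Suc n"] t False by (simp add: grid_n)
    qed
  qed
  then show ?thesis
    by (rule measurable_cong[THEN iffD2, rotated]) (simp add: space_F I_0)
qed

lemma measurable_I_M [measurable]: "0 \<le> t \<Longrightarrow> t < T \<Longrightarrow> I t \<in> borel_measurable M"
  using measurable_F_M[OF measurable_I] .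

text \<open>Fatou's lemma carries the bound from the weighted sums to their limit, since the
  right-hand side no longer depends on the grid.\<close>

lemma I_moment:
  assumes a: "0 \<le> a" "a \<le> s" "s \<le> t" "t < T" and k: "1 \<le> k"
    and H: "H \<in> borel_measurable (F a)" "\<And>\<omega>. 0 \<le> H \<omega>"
  shows "(\<integral>\<^sup>+\<omega>. ennreal (H \<omega> * (I t \<omega> - I s \<omega>) ^ (2 * k)) \<partial>M)
    \<le> (\<integral>\<^sup>+\<omega>. ennreal (H \<omega>) * (ennreal (2 * cA k) * (ennreal (4 * T powr (\<theta> - 1)) * Q s (W a \<omega>)) ^ k) \<partial>M)"
proof (cases "s = t")
  case True
  then show ?thesis using k by (simp add: power_0_left)
next
  case False
  then have st: "0 \<le> s" "s < t" "t < T" using a by auto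
  let ?R = "(\<integral>\<^sup>+\<omega>. ennreal (H \<omega>) * (ennreal (2 * cA k) * (ennreal (4 * T powr (\<theta> - 1)) * Q s (W a \<omega>)) ^ k) \<partial>M)"
  have [measurable]: "H \<in> borel_measurable M" using measurable_F_M[OF H(1)] .
  have meas: "(\<lambda>\<omega>. ennreal (H \<omega> * N s t n n \<omega> ^ (2 * k))) \<in> borel_measurable M" for n
    using measurable_F_M[OF measurable_N[OF st order_refl, of n]] by measurable
  \<comment> \<open>From \<open>n0\<close> on the mesh is below \<open>T - t\<close>, as needed for
    \<open>S_le_Q\<close>.\<close>
  obtain n0 :: nat where n0: "(t - s) / (T - t) < n0" using reals_Archimedean2 by blast
  have le: "(\<integral>\<^sup>+\<omega>. ennreal (H \<omega> * N s t n n \<omega> ^ (2 * k)) \<partial>M) \<le> ?R" if n: "n0 \<le> n" for n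
  proof -
    have "(t - s) / (T - t) < n" using n0 n by linarith
    moreover have "0 < (t - s) / (T - t)" using st by simp
    ultimately have "0 < real n" by linarith
    moreover have "t - s < n * (T - t)" using \<open>(t - s) / (T - t) < n\<close> st by (simp add: pos_divide_less_eq)
    ultimately have n': "(t - s) / n \<le> T - t" "0 < n" by (auto simp: pos_divide_le_eq mult.commute)
    have "(\<integral>\<^sup>+\<omega>. ennreal (H \<omega> * N s t n n \<omega> ^ (2 * k)) \<partial>M) \<le> (\<integral>\<^sup>+\<omega>. ennreal (H \<omega> * (2 * cA k * S s t n n (W a \<omega>) ^ k)) \<partial>M)"
      by (rule N_moment[OF a(1,2) st(2,3) k order_refl H])
    also have "\<dots> \<le> ?R"
    proof (rule nn_integral_mono)
      fix \<omega>
      have S0: "0 \<le> S s t n n (W a \<omega>)" using st by (intro S_nonneg) simp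
      have "ennreal (H \<omega> * (2 * cA k * S s t n n (W a \<omega>) ^ k)) = ennreal (H \<omega>) * (ennreal (2 * cA k) * ennreal (S s t n n (W a \<omega>)) ^ k)"
        using H(2)[of \<omega>] S0 cA_nonneg[of k] by (simp add: ennreal_mult ennreal_power)
      also have "\<dots> \<le> ennreal (H \<omega>) * (ennreal (2 * cA k) * (ennreal (4 * T powr (\<theta> - 1)) * Q s (W a \<omega>)) ^ k)"
        by (intro mult_left_mono power_mono S_le_Q[OF st n']) auto
      finally show "ennreal (H \<omega> * (2 * cA k * S s t n n (W a \<omega>) ^ k)) \<le> ennreal (H \<omega>) * (ennreal (2 * cA k) * (ennreal (4 * T powr (\<theta> - 1)) * Q s (W a \<omega>)) ^ k)" .
    qed
    finally show ?thesis .
  qed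
  have "(\<integral>\<^sup>+\<omega>. ennreal (H \<omega> * (I t \<omega> - I s \<omega>) ^ (2 * k)) \<partial>M)
     = (\<integral>\<^sup>+\<omega>. liminf (\<lambda>n. ennreal (H \<omega> * N s t n n \<omega> ^ (2 * k))) \<partial>M)"
  proof (rule nn_integral_cong)
    fix \<omega> assume "\<omega> \<in> space M"
    then have "(\<lambda>n. ennreal (H \<omega> * N s t n n \<omega> ^ (2 * k))) \<longlonglongrightarrow> ennreal (H \<omega> * (I t \<omega> - I s \<omega>) ^ (2 * k))"
      by (intro tendsto_intros tendsto_ennrealI N_tendsto st)
    then show "ennreal (H \<omega> * (I t \<omega> - I s \<omega>) ^ (2 * k)) = liminf (\<lambda>n. ennreal (H \<omega> * N s t n n \<omega> ^ (2 * k)))"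
      by (intro lim_imp_Liminf[symmetric]) auto
  qed
  also have "\<dots> \<le> liminf (\<lambda>n. (\<integral>\<^sup>+\<omega>. ennreal (H \<omega> * N s t n n \<omega> ^ (2 * k)) \<partial>M))"
    by (rule nn_integral_liminf[OF meas])
  also have "\<dots> \<le> ?R"
  proof -
    have "\<forall>\<^sub>F n in sequentially. (\<integral>\<^sup>+\<omega>. ennreal (H \<omega> * N s t n n \<omega> ^ (2 * k)) \<partial>M) \<le> ?R"
      using le by (auto simp: eventually_sequentially)
    then have "liminf (\<lambda>n. (\<integral>\<^sup>+\<omega>. ennreal (H \<omega> * N s t n n \<omega> ^ (2 * k)) \<partial>M)) \<le> liminf (\<lambda>n. ?R)"
      by (rule Liminf_mono)
    then show ?thesis by (simp add: Liminf_const)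
  qed
  finally show ?thesis .
qed

lemma Q_bound: obtains C where "0 \<le> C" "\<And>s y. 0 \<le> s \<Longrightarrow> Q s y \<le> ennreal (C * exp (2 * \<theta> * y))"
proof -
  obtain C where C: "0 \<le> C"
    "\<And>y. (\<integral>\<^sup>+u. ennreal ((T - u) powr (- 1 - \<theta>) * (Kpos g (sqrt (T - u) * exp y))\<^sup>2) * indicator {0..T} u \<partial>lborel)
      \<le> ennreal (C * exp (2 * \<theta> * y))"
    using Hoelder_weighted_integral[OF g T_pos] by blast
  have "Q s y \<le> ennreal (C * exp (2 * \<theta> * y))" if "0 \<le> s" for s y
  proof -
    have "Q s y \<le> (\<integral>\<^sup>+u. ennreal (kdens y u) * indicator {0..T} u \<partial>lborel)"
      unfolding Q_def using that by (intro nn_integral_mono) (auto simp: indicator_def)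
    also have "\<dots> \<le> ennreal (C * exp (2 * \<theta> * y))" using C(2) by (simp add: kdens_def)
    finally show ?thesis .
  qed
  then show ?thesis using C(1) that by blast
qed

text \<open>The tail of a convergent integral: dominated convergence along times increasing to
  \<open>T\<close>, for fixed \<open>y\<close>.\<close>

lemma Q_tail:
  assumes e: "0 < e"
  obtains s where "0 \<le> s" "s < T" "\<And>r. s \<le> r \<Longrightarrow> Q r y < e"
proof -
  obtain C where C: "0 \<le> C" "\<And>s y. 0 \<le> s \<Longrightarrow> Q s y \<le> ennreal (C * exp (2 * \<theta> * y))" using Q_bound by blast
  define z where "z n = T - T / real (Suc n)" for n
  have z: "0 \<le> z n" "z n < T" for n using T_pos by (auto simp: z_def divide_le_eq)
  have zl: "z \<longlonglongrightarrow> T - 0" unfolding z_def by (intro tendsto_intros LIMSEQ_Suc lim_const_over_n)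
  have "(\<lambda>n. Q (z n) y) \<longlonglongrightarrow> (\<integral>\<^sup>+u. 0 \<partial>(lborel :: real measure))"
    unfolding Q_def
  proof (rule nn_integral_dominated_convergence[where w = "\<lambda>u. ennreal (kdens y u) * indicator {0..T} u"
        and u = "\<lambda>n u. ennreal (kdens y u) * indicator {z n..T} u" and u' = "\<lambda>_. 0"])
    show "(\<integral>\<^sup>+u. ennreal (kdens y u) * indicator {0..T} u \<partial>lborel) < \<infinity>"
      using C(2)[of 0 y] by (auto simp: Q_def intro: le_less_trans)
    show "AE u in lborel. ennreal (kdens y u) * indicator {z n..T} u \<le> ennreal (kdens y u) * indicator {0..T} u" for n
      using z[of n] by (intro AE_I2) (auto simp: indicator_def)
    show "AE u in lborel. (\<lambda>n. ennreal (kdens y u) * indicator {z n..T} u) \<longlonglongrightarrow> 0"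
    proof (rule AE_I2)
      fix u
      show "(\<lambda>n. ennreal (kdens y u) * indicator {z n..T} u) \<longlonglongrightarrow> 0"
      proof (cases "u < T")
        case True
        then have "\<forall>\<^sub>F n in sequentially. u < z n" using zl by (intro order_tendstoD(1)) auto
        then have "\<forall>\<^sub>F n in sequentially. ennreal (kdens y u) * indicator {z n..T} u = 0"
          by (rule eventually_mono) simp
        then show ?thesis by (rule tendsto_eventually)
      next
        case False
        \<comment> \<open>At \<open>u = T\<close> all indicators equal 1; the limit is still 0
          because the power of 0 is 0 by convention.\<close>
        have "kdens y T = 0" by (simp add: kdens_def)
        then show ?thesis using False by (cases "u = T") (auto simp: indicator_def)
      qed
    qed
  qed measurable
  then have "\<forall>\<^sub>F n in sequentially. Q (z n) y < e" using e by (intro order_tendstoD(2)) auto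
  then obtain n where n: "Q (z n) y < e" by (auto simp: eventually_sequentially)
  have "Q r y < e" if "z n \<le> r" for r
  proof -
    have "Q r y \<le> Q (z n) y" unfolding Q_def using that by (intro nn_integral_mono) (auto simp: indicator_def)
    then show ?thesis using n by simp
  qed
  then show ?thesis using z that by blast
qed

text \<open>Reduces an arbitrary exponent to an even one by comparing |x| with a level
  \<open>y\<close>. If \<open>y\<close> has the size of \<open>x\<close>, both terms scale like
  \<open>y powr p\<close>, so no homogeneity is lost when \<open>y\<close> is chosen as the
  weight.\<close>

lemma powr_le_add_even:
  fixes x y p :: real
  assumes y: "0 < y" and p: "0 < p" "p \<le> real (2 * k)"
  shows "\<bar>x\<bar> powr p \<le> y powr p + y powr (p - real (2 * k)) * x ^ (2 * k)"
proof (cases "\<bar>x\<bar> \<le> y")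
  case True
  then have "\<bar>x\<bar> powr p \<le> y powr p" using p by (intro powr_mono2) auto
  then show ?thesis by (simp add: add_increasing2 zero_le_even_power)
next
  case False
  have "\<bar>x\<bar> powr p = \<bar>x\<bar> powr (p - real (2 * k)) * \<bar>x\<bar> powr (2 * k)" unfolding powr_add[symmetric] by simp
  also have "\<bar>x\<bar> powr (2 * k) = x ^ (2 * k)" using False y powr_realpow[of "\<bar>x\<bar>" "2 * k"] by (simp add: power_even_abs)
  also have "\<bar>x\<bar> powr (p - real (2 * k)) * x ^ (2 * k) \<le> y powr (p - real (2 * k)) * x ^ (2 * k)"
    using False y p by (intro mult_right_mono powr_mono2') (auto simp: zero_le_even_power)
  finally show ?thesis by (simp add: add_increasing)
qed

lemma gbm_pos: "0 < gbm W t \<omega>" by (simp add: gbm_def)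

lemma measurable_gbm: "0 \<le> t \<Longrightarrow> t \<le> T \<Longrightarrow> gbm W t \<in> borel_measurable (F t)"
  unfolding gbm_def[abs_def] using measurable_W_F[of t t] by measurable

text \<open>The conditional estimate, written over sets of \<open>F s\<close>. With the weight
  \<open>y = \<Phi>\<close> at time \<open>s\<close>, the test function
  \<open>indicator A * y powr (p - 2 * k)\<close> makes the bound \<open>y powr (2 * k)\<close> of
  the even moment collapse to \<open>y powr p\<close>.\<close>

lemma I_conditional_bound:
  assumes p: "0 < p"
  obtains C where "0 \<le> C"
    "\<And>s t A. 0 \<le> s \<Longrightarrow> s \<le> t \<Longrightarrow> t < T \<Longrightarrow> A \<in> sets (F s) \<Longrightarrow>
      (\<integral>\<^sup>+\<omega>. ennreal (\<bar>I t \<omega> - I s \<omega>\<bar> powr p) * indicator A \<omega> \<partial>M)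
        \<le> ennreal C * (\<integral>\<^sup>+\<omega>. ennreal ((gbm W s \<omega> powr \<theta>) powr p) * indicator A \<omega> \<partial>M)"
proof -
  obtain C where C: "0 \<le> C" "\<And>s y. 0 \<le> s \<Longrightarrow> Q s y \<le> ennreal (C * exp (2 * \<theta> * y))" using Q_bound by blast
  obtain k :: nat where "p / 2 \<le> k" using real_arch_simple by blast
  then have k: "p \<le> real (2 * k)" "1 \<le> k" using p by (cases k; auto)+
  \<comment> \<open>The factors come from \<open>I_moment\<close>, from \<open>Q_bound\<close>, and
    from rewriting \<open>exp (2 * \<theta> * W s)\<close> through the weight: since W_s = ln Y_s +
    s / 2, its \<open>k\<close>-th power picks up at most
    \<open>exp (k * \<theta> * T)\<close>.\<close>
  define B where "B = 2 * cA k * (4 * T powr (\<theta> - 1) * C) ^ k * exp (k * \<theta> * T)"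
  have B0: "0 \<le> B" unfolding B_def using C(1) cA_nonneg[of k] by simp
  have "(\<integral>\<^sup>+\<omega>. ennreal (\<bar>I t \<omega> - I s \<omega>\<bar> powr p) * indicator A \<omega> \<partial>M)
        \<le> ennreal (1 + B) * (\<integral>\<^sup>+\<omega>. ennreal ((gbm W s \<omega> powr \<theta>) powr p) * indicator A \<omega> \<partial>M)"
    if s: "0 \<le> s" "s \<le> t" "t < T" and A: "A \<in> sets (F s)" for s t A
  proof -
    define y where "y \<omega> = gbm W s \<omega> powr \<theta>" for \<omega>
    have y0: "0 < y \<omega>" for \<omega> using gbm_pos[of s \<omega>] by (simp add: y_def)
    define H where "H \<omega> = indicator A \<omega> * y \<omega> powr (p - real (2 * k))" for \<omega>
    have [measurable]: "gbm W s \<in> borel_measurable (F s)" "A \<in> sets (F s)" using s A by (auto intro: measurable_gbm)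
    have HF: "H \<in> borel_measurable (F s)" "y \<in> borel_measurable (F s)" unfolding H_def[abs_def] y_def[abs_def] by measurable
    note [measurable] = HF[THEN measurable_F_M]
    have [measurable]: "I t \<in> borel_measurable M" "I s \<in> borel_measurable M" "A \<in> sets M"
      using s A sets_F_subset[of s] by auto
    have H0: "0 \<le> H \<omega>" for \<omega> by (simp add: H_def)
    let ?Y = "(\<integral>\<^sup>+\<omega>. ennreal (y \<omega> powr p) * indicator A \<omega> \<partial>M)"
    have "(\<integral>\<^sup>+\<omega>. ennreal (\<bar>I t \<omega> - I s \<omega>\<bar> powr p) * indicator A \<omega> \<partial>M)
      \<le> (\<integral>\<^sup>+\<omega>. ennreal (y \<omega> powr p) * indicator A \<omega> + ennreal (H \<omega> * (I t \<omega> - I s \<omega>) ^ (2 * k)) \<partial>M)"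
    proof (rule nn_integral_mono)
      fix \<omega>
      show "ennreal (\<bar>I t \<omega> - I s \<omega>\<bar> powr p) * indicator A \<omega> \<le> ennreal (y \<omega> powr p) * indicator A \<omega> + ennreal (H \<omega> * (I t \<omega> - I s \<omega>) ^ (2 * k))"
      proof (cases "\<omega> \<in> A")
        case True
        have "ennreal (\<bar>I t \<omega> - I s \<omega>\<bar> powr p) \<le> ennreal (y \<omega> powr p + H \<omega> * (I t \<omega> - I s \<omega>) ^ (2 * k))"
          using powr_le_add_even[OF y0 p(1) k(1), of "I t \<omega> - I s \<omega>" \<omega>] True by (intro ennreal_leI) (simp add: H_def)
        also have "\<dots> = ennreal (y \<omega> powr p) + ennreal (H \<omega> * (I t \<omega> - I s \<omega>) ^ (2 * k))"
          using H0[of \<omega>] by (intro ennreal_plus) (auto simp: zero_le_even_power)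
        finally show ?thesis using True by simp
      qed simp
    qed
    also have "\<dots> = ?Y + (\<integral>\<^sup>+\<omega>. ennreal (H \<omega> * (I t \<omega> - I s \<omega>) ^ (2 * k)) \<partial>M)"
      by (rule nn_integral_add) measurable
    also have "(\<integral>\<^sup>+\<omega>. ennreal (H \<omega> * (I t \<omega> - I s \<omega>) ^ (2 * k)) \<partial>M)
      \<le> (\<integral>\<^sup>+\<omega>. ennreal (H \<omega>) * (ennreal (2 * cA k) * (ennreal (4 * T powr (\<theta> - 1)) * Q s (W s \<omega>)) ^ k) \<partial>M)"
      by (rule I_moment[OF s(1) order_refl s(2,3) k(2) HF(1) H0])
    also have "\<dots> \<le> (\<integral>\<^sup>+\<omega>. ennreal B * (ennreal (y \<omega> powr p) * indicator A \<omega>) \<partial>M)"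
    proof (rule nn_integral_mono)
      fix \<omega>
      define X where "X = exp (2 * \<theta> * W s \<omega>)"
      have X: "X ^ k \<le> exp (k * \<theta> * T) * y \<omega> powr (2 * k)"
      proof -
        have "X ^ k = exp (k * (2 * \<theta> * W s \<omega>))" unfolding X_def by (rule exp_of_nat_mult[symmetric])
        also have "\<dots> = exp (k * \<theta> * s + 2 * k * (\<theta> * (W s \<omega> - s / 2)))" by (simp add: algebra_simps)
        also have "\<dots> = exp (k * \<theta> * s) * y \<omega> powr (2 * k)"
          unfolding exp_add y_def gbm_def by (simp add: powr_def)
        also have "\<dots> \<le> exp (k * \<theta> * T) * y \<omega> powr (2 * k)"
          using s \<theta> by (intro mult_right_mono) (auto intro!: mult_left_mono)
        finally show ?thesis .
      qed
      have "ennreal (H \<omega>) * (ennreal (2 * cA k) * (ennreal (4 * T powr (\<theta> - 1)) * Q s (W s \<omega>)) ^ k)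
         \<le> ennreal (H \<omega>) * (ennreal (2 * cA k) * (ennreal (4 * T powr (\<theta> - 1)) * ennreal (C * X)) ^ k)"
        unfolding X_def by (intro mult_left_mono power_mono C(2) s) auto
      also have "\<dots> = ennreal (H \<omega> * (2 * cA k * (4 * T powr (\<theta> - 1) * (C * X)) ^ k))"
      proof -
        have "0 \<le> C * X" using C(1) by (simp add: X_def)
        then have e: "ennreal (4 * T powr (\<theta> - 1)) * ennreal (C * X) = ennreal (4 * T powr (\<theta> - 1) * (C * X))"
          by (intro ennreal_mult[symmetric]) auto
        have nn: "0 \<le> 4 * T powr (\<theta> - 1) * (C * X)" using \<open>0 \<le> C * X\<close> by simp
        show ?thesis unfolding e ennreal_power[OF nn] using H0[of \<omega>] cA_nonneg[of k] nn
          by (simp only: ennreal_mult[symmetric] mult_nonneg_nonneg zero_le_power zero_le_numeral)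
      qed
      also have "\<dots> \<le> ennreal (B * (y \<omega> powr p * indicator A \<omega>))"
      proof (rule ennreal_leI)
        have "H \<omega> * (2 * cA k * (4 * T powr (\<theta> - 1) * (C * X)) ^ k) = H \<omega> * (2 * cA k * (4 * T powr (\<theta> - 1) * C) ^ k) * X ^ k"
          by (simp add: power_mult_distrib mult_ac)
        also have "\<dots> \<le> H \<omega> * (2 * cA k * (4 * T powr (\<theta> - 1) * C) ^ k) * (exp (k * \<theta> * T) * y \<omega> powr (2 * k))"
          using H0[of \<omega>] cA_nonneg[of k] C(1) by (intro mult_left_mono[OF X] mult_nonneg_nonneg) auto
        also have "\<dots> = B * (indicator A \<omega> * (y \<omega> powr (p - real (2 * k)) * y \<omega> powr (2 * k)))"
          unfolding B_def H_def by (simp only: mult_ac)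
        also have "y \<omega> powr (p - real (2 * k)) * y \<omega> powr (2 * k) = y \<omega> powr p" unfolding powr_add[symmetric] by simp
        finally show "H \<omega> * (2 * cA k * (4 * T powr (\<theta> - 1) * (C * X)) ^ k) \<le> B * (y \<omega> powr p * indicator A \<omega>)"
          by (simp add: mult.commute)
      qed
      also have "\<dots> = ennreal B * (ennreal (y \<omega> powr p) * indicator A \<omega>)"
        using B0 by (auto simp: ennreal_mult indicator_def)
      finally show "ennreal (H \<omega>) * (ennreal (2 * cA k) * (ennreal (4 * T powr (\<theta> - 1)) * Q s (W s \<omega>)) ^ k)
        \<le> ennreal B * (ennreal (y \<omega> powr p) * indicator A \<omega>)" .
    qed
    also have "\<dots> = ennreal B * ?Y" by (rule nn_integral_cmult) measurable
    also have "?Y + ennreal B * ?Y = ennreal (1 + B) * ?Y"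
      using B0 by (simp add: distrib_right)
    finally show ?thesis unfolding y_def by (simp add: add_left_mono)
  qed
  then show ?thesis using B0 by (intro that[of "1 + B"]) auto
qed

end

section \<open>Stopping times\<close>

text \<open>If the bound failed on a set of positive measure, it would fail on such a set with
  \<open>b \<le> n\<close> for some \<open>n\<close>. There the integral of \<open>b\<close> is
  finite, so the integrals may be subtracted and contradict the hypothesis on sets.\<close>

lemma (in prob_space) nn_cond_exp_le:
  assumes sub: "subalgebra M G" and f[measurable]: "f \<in> borel_measurable M"
    and b[measurable]: "b \<in> borel_measurable G"
    and le: "\<And>A. A \<in> sets G \<Longrightarrow> (\<integral>\<^sup>+x. f x * indicator A x \<partial>M) \<le> (\<integral>\<^sup>+x. ennreal (b x) * indicator A x \<partial>M)"
  shows "AE x in M. nn_cond_exp M G f x \<le> ennreal (b x)"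
proof -
  interpret finite_measure_subalgebra M G using sub by unfold_locales
  define e where "e = nn_cond_exp M G f"
  have e[measurable]: "e \<in> borel_measurable G" by (simp add: e_def)
  have eM[measurable]: "e \<in> borel_measurable M" "b \<in> borel_measurable M"
    using measurable_from_subalg[OF sub e] measurable_from_subalg[OF sub b] by auto
  have "AE x in M. \<not> (ennreal (b x) < e x \<and> b x \<le> real n)" for n
  proof -
    define B where "B = {x \<in> space G. ennreal (b x) < e x \<and> b x \<le> real n}"
    have B[measurable]: "B \<in> sets G" unfolding B_def by measurable
    then have BM[measurable]: "B \<in> sets M" using sub by (auto simp: subalgebra_def)
    have "(\<integral>\<^sup>+x. e x * indicator B x \<partial>M) = (\<integral>\<^sup>+x. f x * indicator B x \<partial>M)"
      using nn_cond_exp_intg[of "indicator B" f] by (simp add: e_def mult.commute)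
    also have "\<dots> \<le> (\<integral>\<^sup>+x. ennreal (b x) * indicator B x \<partial>M)" by (rule le[OF B])
    finally have 1: "(\<integral>\<^sup>+x. e x * indicator B x \<partial>M) \<le> (\<integral>\<^sup>+x. ennreal (b x) * indicator B x \<partial>M)" .
    have "(\<integral>\<^sup>+x. ennreal (b x) * indicator B x \<partial>M) \<le> (\<integral>\<^sup>+x. ennreal (real n) \<partial>M)"
      by (intro nn_integral_mono) (auto simp: B_def indicator_def intro: ennreal_leI)
    also have "\<dots> < \<infinity>" by (simp add: emeasure_space_1)
    finally have fin: "(\<integral>\<^sup>+x. ennreal (b x) * indicator B x \<partial>M) \<noteq> \<infinity>" by simp
    have "(\<integral>\<^sup>+x. e x * indicator B x - ennreal (b x) * indicator B x \<partial>M) =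
       (\<integral>\<^sup>+x. e x * indicator B x \<partial>M) - (\<integral>\<^sup>+x. ennreal (b x) * indicator B x \<partial>M)"
    proof (rule nn_integral_diff)
      show "AE x in M. ennreal (b x) * indicator B x \<le> e x * indicator B x"
        by (intro AE_I2) (auto simp: B_def indicator_def intro: less_imp_le)
    qed (use fin in measurable)
    also have "\<dots> = 0"
      using 1 le_less_trans[OF 1] fin by (intro diff_eq_0_ennreal) (auto simp: less_top)
    finally have "AE x in M. e x * indicator B x - ennreal (b x) * indicator B x = 0"
      by (subst (asm) nn_integral_0_iff_AE) measurable
    then show ?thesis using AE_space
    proof eventually_elim
      case (elim x)
      show ?case
      proof
        assume x: "ennreal (b x) < e x \<and> b x \<le> real n"
        then have "x \<in> B" using elim(2) sub by (simp add: B_def subalgebra_def)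
        then have "e x \<le> ennreal (b x)" using elim(1) by (simp add: ennreal_minus_eq_0)
        then show False using x by (auto dest: leD)
      qed
    qed
  qed
  then have "AE x in M. \<forall>n. \<not> (ennreal (b x) < e x \<and> b x \<le> real n)" unfolding AE_all_countable by blast
  then show ?thesis
  proof eventually_elim
    case (elim x)
    obtain n :: nat where "b x \<le> real n" using real_arch_simple by blast
    then show ?case using elim by (auto simp: e_def not_less)
  qed
qed

text \<open>The converse direction of Fatou's lemma under uniform integrability: by
  \<open>V \<le> min V L + V\<^sup>2 / L\<close> the mass above a level \<open>L\<close> is
  uniformly small, and the truncated functions converge by domination.\<close>

lemma nn_integral_limit_L2_bounded:
  fixes V :: "nat \<Rightarrow> 'b \<Rightarrow> real"
  assumes [measurable]: "\<And>n. V n \<in> borel_measurable N" "A \<in> sets N"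
    and fin: "finite_measure N"
    and V0: "\<And>n x. x \<in> space N \<Longrightarrow> 0 \<le> V n x"
    and lim: "\<And>x. x \<in> space N \<Longrightarrow> (\<lambda>n. V n x) \<longlonglongrightarrow> U x"
    and K: "\<And>n. (\<integral>\<^sup>+x. ennreal ((V n x)\<^sup>2) * indicator A x \<partial>N) \<le> ennreal K" "0 \<le> K"
  shows "liminf (\<lambda>n. \<integral>\<^sup>+x. ennreal (V n x) * indicator A x \<partial>N) \<le> (\<integral>\<^sup>+x. ennreal (U x) * indicator A x \<partial>N)"
proof (rule ennreal_le_epsilon)
  interpret finite_measure N by fact
  have [measurable]: "U \<in> borel_measurable N" by (rule borel_measurable_LIMSEQ_real[OF lim]) measurable
  fix \<epsilon> :: real assume \<epsilon>: "0 < \<epsilon>"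
  \<comment> \<open>Chosen so that \<open>K / L \<le> \<epsilon>\<close>; the added 1 keeps
    \<open>L\<close> positive when \<open>K = 0\<close>.\<close>
  define L where "L = K / \<epsilon> + 1"
  have L: "0 < L" using K(2) \<epsilon> by (simp add: L_def add_nonneg_pos)
  have KL: "K / L \<le> \<epsilon>" using \<epsilon> L K(2) by (simp add: L_def divide_le_eq field_simps)
  have le: "(\<integral>\<^sup>+x. ennreal (V n x) * indicator A x \<partial>N) \<le> (\<integral>\<^sup>+x. ennreal (min (V n x) L) * indicator A x \<partial>N) + ennreal \<epsilon>" for n
  proof -
    have "(\<integral>\<^sup>+x. ennreal (V n x) * indicator A x \<partial>N)
       \<le> (\<integral>\<^sup>+x. ennreal (min (V n x) L) * indicator A x + ennreal (1 / L) * (ennreal ((V n x)\<^sup>2) * indicator A x) \<partial>N)"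
    proof (rule nn_integral_mono)
      fix x assume x: "x \<in> space N"
      have "V n x \<le> min (V n x) L + 1 / L * (V n x)\<^sup>2"
      proof (cases "V n x \<le> L")
        case False
        then have "V n x * L \<le> V n x * V n x" using L by (intro mult_left_mono) auto
        then have "V n x \<le> 1 / L * (V n x)\<^sup>2" using L by (simp add: field_simps power2_eq_square)
        then show ?thesis using L False by (simp add: min_def)
      qed (use L in simp)
      then have "ennreal (V n x) \<le> ennreal (min (V n x) L) + ennreal (1 / L) * ennreal ((V n x)\<^sup>2)"
        using V0[OF x, of n] L by (simp add: ennreal_mult[symmetric] ennreal_plus[symmetric] ennreal_leI del: ennreal_plus)
      then show "ennreal (V n x) * indicator A x \<le> ennreal (min (V n x) L) * indicator A x + ennreal (1 / L) * (ennreal ((V n x)\<^sup>2) * indicator A x)"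
        by (auto simp: indicator_def)
    qed
    also have "\<dots> = (\<integral>\<^sup>+x. ennreal (min (V n x) L) * indicator A x \<partial>N) + ennreal (1 / L) * (\<integral>\<^sup>+x. ennreal ((V n x)\<^sup>2) * indicator A x \<partial>N)"
      by (subst nn_integral_add) (auto simp: nn_integral_cmult)
    also have "\<dots> \<le> (\<integral>\<^sup>+x. ennreal (min (V n x) L) * indicator A x \<partial>N) + ennreal (1 / L) * ennreal K"
      by (intro add_left_mono mult_left_mono K) simp
    also have "ennreal (1 / L) * ennreal K \<le> ennreal \<epsilon>"
      using L KL K(2) by (simp add: ennreal_mult[symmetric] ennreal_leI del: times_divide_eq_left) (simp add: ennreal_leI)
    finally show ?thesis by (simp add: add_left_mono)
  qed
  have "(\<lambda>n. \<integral>\<^sup>+x. ennreal (min (V n x) L) * indicator A x \<partial>N) \<longlonglongrightarrow> (\<integral>\<^sup>+x. ennreal (min (U x) L) * indicator A x \<partial>N)"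
  proof (rule nn_integral_dominated_convergence[where w = "\<lambda>_. ennreal L"])
    show "(\<integral>\<^sup>+x. ennreal L \<partial>N) < \<infinity>" by (simp add: emeasure_eq_measure ennreal_mult_less_top)
    show "AE x in N. ennreal (min (V n x) L) * indicator A x \<le> ennreal L" for n
      by (intro AE_I2) (auto simp: indicator_def intro: ennreal_leI)
    show "AE x in N. (\<lambda>n. ennreal (min (V n x) L) * indicator A x) \<longlonglongrightarrow> ennreal (min (U x) L) * indicator A x"
    proof (rule AE_I2)
      fix x assume "x \<in> space N"
      then have "(\<lambda>n. ennreal (min (V n x) L)) \<longlonglongrightarrow> ennreal (min (U x) L)"
        by (intro tendsto_ennrealI tendsto_min lim tendsto_const)
      then show "(\<lambda>n. ennreal (min (V n x) L) * indicator A x) \<longlonglongrightarrow> ennreal (min (U x) L) * indicator A x"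
        by (auto simp: indicator_def)
    qed
  qed measurable
  then have "(\<lambda>n. (\<integral>\<^sup>+x. ennreal (min (V n x) L) * indicator A x \<partial>N) + ennreal \<epsilon>) \<longlonglongrightarrow> (\<integral>\<^sup>+x. ennreal (min (U x) L) * indicator A x \<partial>N) + ennreal \<epsilon>"
    by (intro tendsto_add tendsto_const)
  then have "liminf (\<lambda>n. (\<integral>\<^sup>+x. ennreal (min (V n x) L) * indicator A x \<partial>N) + ennreal \<epsilon>) = (\<integral>\<^sup>+x. ennreal (min (U x) L) * indicator A x \<partial>N) + ennreal \<epsilon>"
    by (intro lim_imp_Liminf) auto
  moreover have "liminf (\<lambda>n. \<integral>\<^sup>+x. ennreal (V n x) * indicator A x \<partial>N) \<le> liminf (\<lambda>n. (\<integral>\<^sup>+x. ennreal (min (V n x) L) * indicator A x \<partial>N) + ennreal \<epsilon>)"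
    using le by (intro Liminf_mono always_eventually) auto
  moreover have "(\<integral>\<^sup>+x. ennreal (min (U x) L) * indicator A x \<partial>N) \<le> (\<integral>\<^sup>+x. ennreal (U x) * indicator A x \<partial>N)"
    by (intro nn_integral_mono mult_right_mono ennreal_leI) auto
  ultimately show "liminf (\<lambda>n. \<integral>\<^sup>+x. ennreal (V n x) * indicator A x \<partial>N) \<le> (\<integral>\<^sup>+x. ennreal (U x) * indicator A x \<partial>N) + ennreal \<epsilon>"
    using add_right_mono[of "\<integral>\<^sup>+x. ennreal (min (U x) L) * indicator A x \<partial>N" "\<integral>\<^sup>+x. ennreal (U x) * indicator A x \<partial>N" "ennreal \<epsilon>"]
    by (metis (no_types, lifting) order_trans)
qed

section \<open>Stopping times approximated by grid times\<close>

context brownian begin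

text \<open>An independent centred increment satisfies E exp (c y) >= 1, from exp x >= 1 + x. This
  moves exponential bounds from grid times to the fixed time \<open>t\<close>.\<close>

lemma exp_submartingale:
  assumes s: "0 \<le> s" "s \<le> t" "t \<le> T" and B: "B \<in> sets (F s)"
  shows "(\<integral>\<^sup>+\<omega>. ennreal (exp (c * W s \<omega>)) * indicator B \<omega> \<partial>M) \<le> (\<integral>\<^sup>+\<omega>. ennreal (exp (c * W t \<omega>)) * indicator B \<omega> \<partial>M)"
proof (cases "s = t")
  case False
  then have st: "0 \<le> s" "s < t" "t \<le> T" using s by auto
  have [measurable]: "W s \<in> borel_measurable (F s)" "B \<in> sets (F s)" using measurable_W_F[of s s] st B by auto
  define \<sigma> where "\<sigma> = sqrt (t - s)"
  have \<sigma>: "0 < \<sigma>" using st by (simp add: \<sigma>_def)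
  have one: "1 \<le> (\<integral>\<^sup>+y. ennreal (exp (c * y)) * ennreal (normal_density 0 \<sigma> y) \<partial>lborel)"
  proof (cases "(\<integral>\<^sup>+y. ennreal (exp (c * y) * normal_density 0 \<sigma> y) \<partial>lborel) = \<infinity>")
    case True then show ?thesis by (simp add: ennreal_mult)
  next
    case False
    then have i: "integrable lborel (\<lambda>y. exp (c * y) * normal_density 0 \<sigma> y)"
      by (intro integrableI_nonneg) (auto simp: less_top)
    have "1 = (LINT y|lborel. normal_density 0 \<sigma> y + c * (normal_density 0 \<sigma> y * y))"
      using integrable_normal_density[OF \<sigma>] integrable_normal_moment_nz_1[OF \<sigma>] integral_normal_moment_nz_1[OF \<sigma>, of 0] integral_normal_density[OF \<sigma>]
      by (simp add: Bochner_Integration.integral_add)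
    also have "\<dots> \<le> (LINT y|lborel. exp (c * y) * normal_density 0 \<sigma> y)"
    proof (rule integral_mono[OF _ i])
      show "integrable lborel (\<lambda>y. normal_density 0 \<sigma> y + c * (normal_density 0 \<sigma> y * y))"
        using integrable_normal_density[OF \<sigma>] integrable_normal_moment_nz_1[OF \<sigma>] by auto
      fix y
      have "(1 + c * y) * normal_density 0 \<sigma> y \<le> exp (c * y) * normal_density 0 \<sigma> y"
        by (intro mult_right_mono) auto
      then show "normal_density 0 \<sigma> y + c * (normal_density 0 \<sigma> y * y) \<le> exp (c * y) * normal_density 0 \<sigma> y"
        by (simp add: algebra_simps)
    qed
    finally have "1 \<le> ennreal (LINT y|lborel. exp (c * y) * normal_density 0 \<sigma> y)" by simp
    then show ?thesis using nn_integral_eq_integral[OF i] by (simp add: ennreal_mult)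
  qed
  let ?f = "\<lambda>z. ennreal (exp (c * W s (fst z))) * ennreal (exp (c * snd z)) * indicator B (fst z)"
  have [measurable]: "?f \<in> borel_measurable (F s \<Otimes>\<^sub>M borel)" by measurable
  have "(\<integral>\<^sup>+\<omega>. ennreal (exp (c * W s \<omega>)) * indicator B \<omega> \<partial>M)
     \<le> (\<integral>\<^sup>+\<omega>. \<integral>\<^sup>+y. ?f (\<omega>, y) * ennreal (normal_density 0 \<sigma> y) \<partial>lborel \<partial>M)"
  proof (rule nn_integral_mono)
    fix \<omega>
    have "ennreal (exp (c * W s \<omega>)) * indicator B \<omega> * 1 \<le> ennreal (exp (c * W s \<omega>)) * indicator B \<omega> * (\<integral>\<^sup>+y. ennreal (exp (c * y)) * ennreal (normal_density 0 \<sigma> y) \<partial>lborel)"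
      by (intro mult_left_mono one) simp
    also have "\<dots> = (\<integral>\<^sup>+y. ?f (\<omega>, y) * ennreal (normal_density 0 \<sigma> y) \<partial>lborel)"
      by (subst nn_integral_cmult[symmetric]) (auto intro!: nn_integral_cong simp: mult_ac)
    finally show "ennreal (exp (c * W s \<omega>)) * indicator B \<omega> \<le> (\<integral>\<^sup>+y. ?f (\<omega>, y) * ennreal (normal_density 0 \<sigma> y) \<partial>lborel)" by simp
  qed
  also have "\<dots> = (\<integral>\<^sup>+\<omega>. ?f (\<omega>, W t \<omega> - W s \<omega>) \<partial>M)"
    unfolding \<sigma>_def by (rule nn_integral_increment[OF st, symmetric]) measurable
  also have "\<dots> = (\<integral>\<^sup>+\<omega>. ennreal (exp (c * W t \<omega>)) * indicator B \<omega> \<partial>M)"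
    by (intro nn_integral_cong) (simp add: ennreal_mult[symmetric] exp_add[symmetric] algebra_simps flip: mult.assoc)
  finally show ?thesis .
qed simp

abbreviation Fst :: "('a \<Rightarrow> real) \<Rightarrow> 'a measure" where
  "Fst \<rho> \<equiv> filtration.pre_sigma (space M) F \<rho>"

context
  fixes \<rho> :: "'a \<Rightarrow> real" and t :: real
  assumes stop: "stopping_time F \<rho>" and \<rho>: "\<And>\<omega>. \<omega> \<in> space M \<Longrightarrow> 0 \<le> \<rho> \<omega>" "\<And>\<omega>. \<omega> \<in> space M \<Longrightarrow> \<rho> \<omega> \<le> t"
    and t: "0 \<le> t" "t < T"
begin

lemma sets_Fst: "A \<in> sets (Fst \<rho>) \<longleftrightarrow> (\<forall>r. {\<omega>\<in>A. \<rho> \<omega> \<le> r} \<in> sets (F r))"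
  using filtration.sets_pre_sigma[OF filtration_F stop] by auto

lemma space_Fst: "space (Fst \<rho>) = space M"
  by (rule filtration.space_pre_sigma[OF filtration_F])

lemma Fst_subset_space: "A \<in> sets (Fst \<rho>) \<Longrightarrow> A \<subseteq> space M"
  using sets.sets_into_space[of A "Fst \<rho>"] by (simp add: space_Fst)

text \<open>Because \<open>\<rho> \<le> t\<close>, levels beyond \<open>t\<close> may be replaced by
  \<open>t\<close>. The approximating times can thus be capped at \<open>t < T\<close> without
  losing measurability.\<close>

lemma Fst_before:
  assumes "A \<in> sets (Fst \<rho>)" shows "{\<omega>\<in>A. \<rho> \<omega> \<le> r} \<in> sets (F (min r t))"
proof -
  have "{\<omega>\<in>A. \<rho> \<omega> \<le> r} = {\<omega>\<in>A. \<rho> \<omega> \<le> min r t}" using \<rho> Fst_subset_space[OF assms] by auto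
  moreover have "{\<omega>\<in>A. \<rho> \<omega> \<le> min r t} \<in> sets (F (min r t))" using assms unfolding sets_Fst by blast
  ultimately show ?thesis by simp
qed

lemma subalgebra_Fst: "subalgebra M (Fst \<rho>)"
  unfolding subalgebra_def
proof (intro conjI subsetI)
  fix A assume A: "A \<in> sets (Fst \<rho>)"
  have "A = {\<omega>\<in>A. \<rho> \<omega> \<le> t}" using \<rho> Fst_subset_space[OF A] by auto
  then show "A \<in> sets M" using Fst_before[OF A, of t] sets_F_subset by auto
qed (rule space_Fst)

text \<open>On \<open>\<rho> \<le> r\<close> the process is evaluated at
  \<open>min \<rho> r\<close>, and by continuity this is the limit of evaluations at countably many
  times. The approximation runs from below, so that only information up to \<open>r\<close> is
  used.\<close>

lemma measurable_stopped_process: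
  fixes X :: "real \<Rightarrow> 'a \<Rightarrow> real"
  assumes X: "\<And>s. 0 \<le> s \<Longrightarrow> s < T \<Longrightarrow> X s \<in> borel_measurable (F s)"
    and cont: "\<And>\<omega>. \<omega> \<in> space M \<Longrightarrow> continuous_on {0..<T} (\<lambda>s. X s \<omega>)"
  shows "(\<lambda>\<omega>. X (\<rho> \<omega>) \<omega>) \<in> borel_measurable (Fst \<rho>)"
proof (rule borel_measurableI_le)
  fix c :: real
  have "{\<omega> \<in> {\<omega> \<in> space M. X (\<rho> \<omega>) \<omega> \<le> c}. \<rho> \<omega> \<le> r} \<in> sets (F r)" for r
  proof (cases "0 \<le> r")
    case False
    then have "{\<omega> \<in> {\<omega> \<in> space M. X (\<rho> \<omega>) \<omega> \<le> c}. \<rho> \<omega> \<le> r} = {}" using \<rho>(1) by force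
    then show ?thesis by (simp only:) simp
  next
    case True
    define r' where "r' = min r t"
    have r': "0 \<le> r'" "r' < T" "r' \<le> r" using True t by (auto simp: r'_def)
    define \<sigma> where "\<sigma> \<omega> = min (\<rho> \<omega>) r'" for \<omega>
    have \<rho>_le: "{\<omega> \<in> space M. \<rho> \<omega> \<le> s} \<in> sets (F s)" for s
      using stopping_timeD[OF stop, of s] by (simp add: pred_def space_F)
    have \<sigma>m[measurable]: "\<sigma> \<in> borel_measurable (F r')"
    proof (rule borel_measurableI_le)
      fix s
      show "{\<omega> \<in> space (F r'). \<sigma> \<omega> \<le> s} \<in> sets (F r')"
      proof (cases "r' \<le> s")
        case True
        then have "{\<omega> \<in> space (F r'). \<sigma> \<omega> \<le> s} = space (F r')" by (auto simp: \<sigma>_def)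
        then show ?thesis by simp
      next
        case False
        then have "{\<omega> \<in> space (F r'). \<sigma> \<omega> \<le> s} = {\<omega> \<in> space M. \<rho> \<omega> \<le> s}" by (auto simp: \<sigma>_def space_F)
        then show ?thesis using \<rho>_le[of s] sets_F_mono[of s r'] False by auto
      qed
    qed
    have \<sigma>0: "0 \<le> \<sigma> \<omega>" "\<sigma> \<omega> \<le> r'" if "\<omega> \<in> space M" for \<omega> using \<rho>(1)[OF that] r' by (auto simp: \<sigma>_def)
    \<comment> \<open>The grid index just below \<open>\<sigma>\<close>. In what follows the cap at
      \<open>r'\<close> matters for indices not attained: it keeps every member of the countable
      family measurable for \<open>F r'\<close>.\<close>
    define fl where "fl n \<omega> = nat \<lfloor>\<sigma> \<omega> * real (Suc n)\<rfloor>" for n \<omega>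
    have "(\<lambda>\<omega>. X (\<sigma> \<omega>) \<omega>) \<in> borel_measurable (F r')"
    proof (rule borel_measurable_LIMSEQ_real)
      show "(\<lambda>\<omega>. X (min r' (real (fl n \<omega>) / real (Suc n))) \<omega>) \<in> borel_measurable (F r')" for n
      proof (rule measurable_compose_countable[where f = "\<lambda>i. X (min r' (real i / real (Suc n)))"])
        show "X (min r' (real i / real (Suc n))) \<in> borel_measurable (F r')" for i
          using r' by (intro measurable_F_mono[OF _ X]) auto
        show "fl n \<in> measurable (F r') (count_space UNIV)" unfolding fl_def by measurable
      qed
      fix \<omega> assume "\<omega> \<in> space (F r')"
      then have \<omega>: "\<omega> \<in> space M" by (simp add: space_F)
      have low: "\<sigma> \<omega> - 1 / real (Suc n) \<le> min r' (real (fl n \<omega>) / real (Suc n))"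
        and up: "min r' (real (fl n \<omega>) / real (Suc n)) \<le> \<sigma> \<omega>" for n
      proof -
        have nn: "0 \<le> \<sigma> \<omega> * real (Suc n)" using \<sigma>0[OF \<omega>] by simp
        then have "real (fl n \<omega>) \<le> \<sigma> \<omega> * real (Suc n)" "\<sigma> \<omega> * real (Suc n) - 1 \<le> real (fl n \<omega>)"
          unfolding fl_def by linarith+
        then have "real (fl n \<omega>) / real (Suc n) \<le> \<sigma> \<omega>"
            "(\<sigma> \<omega> * real (Suc n) - 1) / real (Suc n) \<le> real (fl n \<omega>) / real (Suc n)"
          by (simp only: pos_divide_le_eq of_nat_0_less_iff zero_less_Suc, intro divide_right_mono) auto
        then have "real (fl n \<omega>) / real (Suc n) \<le> \<sigma> \<omega>" "\<sigma> \<omega> - 1 / real (Suc n) \<le> real (fl n \<omega>) / real (Suc n)"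
          unfolding diff_divide_distrib by auto
        moreover have "0 \<le> 1 / real (Suc n)" by simp
        ultimately show "\<sigma> \<omega> - 1 / real (Suc n) \<le> min r' (real (fl n \<omega>) / real (Suc n))"
          "min r' (real (fl n \<omega>) / real (Suc n)) \<le> \<sigma> \<omega>"
          unfolding min.bounded_iff min_le_iff_disj using \<sigma>0[OF \<omega>] by linarith+
      qed
      have l: "(\<lambda>n. min r' (real (fl n \<omega>) / real (Suc n))) \<longlonglongrightarrow> \<sigma> \<omega>"
      proof (rule tendsto_sandwich[where f = "\<lambda>n. \<sigma> \<omega> - 1 / real (Suc n)" and h = "\<lambda>_. \<sigma> \<omega>"])
        have "(\<lambda>n. \<sigma> \<omega> - 1 / real (Suc n)) \<longlonglongrightarrow> \<sigma> \<omega> - 0"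
          by (intro tendsto_intros LIMSEQ_Suc lim_const_over_n)
        then show "(\<lambda>n. \<sigma> \<omega> - 1 / real (Suc n)) \<longlonglongrightarrow> \<sigma> \<omega>" by simp
        show "\<forall>\<^sub>F n in sequentially. \<sigma> \<omega> - 1 / real (Suc n) \<le> min r' (real (fl n \<omega>) / real (Suc n))"
          by (intro always_eventually allI low)
        show "\<forall>\<^sub>F n in sequentially. min r' (real (fl n \<omega>) / real (Suc n)) \<le> \<sigma> \<omega>"
          by (intro always_eventually allI up)
      qed simp
      show "(\<lambda>n. X (min r' (real (fl n \<omega>) / real (Suc n))) \<omega>) \<longlonglongrightarrow> X (\<sigma> \<omega>) \<omega>"
      proof (rule continuous_on_tendsto_compose[OF cont[OF \<omega>] l])
        show "\<sigma> \<omega> \<in> {0..<T}" using \<sigma>0[OF \<omega>] r' by auto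
        have "min r' (real (fl n \<omega>) / real (Suc n)) \<in> {0..<T}" for n using r' by (auto simp: min_less_iff_disj)
        then show "\<forall>\<^sub>F n in sequentially. min r' (real (fl n \<omega>) / real (Suc n)) \<in> {0..<T}" by (intro always_eventually allI)
      qed
    qed
    then have "{\<omega> \<in> space (F r'). X (\<sigma> \<omega>) \<omega> \<le> c} \<in> sets (F r')" by measurable
    then have "{\<omega> \<in> space M. X (\<sigma> \<omega>) \<omega> \<le> c} \<inter> {\<omega> \<in> space M. \<rho> \<omega> \<le> r'} \<in> sets (F r')"
      using \<rho>_le[of r'] by (auto simp: space_F)
    moreover have "{\<omega> \<in> space M. X (\<sigma> \<omega>) \<omega> \<le> c} \<inter> {\<omega> \<in> space M. \<rho> \<omega> \<le> r'} = {\<omega> \<in> {\<omega> \<in> space M. X (\<rho> \<omega>) \<omega> \<le> c}. \<rho> \<omega> \<le> r}"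
    proof -
      have "\<rho> \<omega> \<le> r \<longleftrightarrow> \<rho> \<omega> \<le> r'" if "\<omega> \<in> space M" for \<omega>
        using \<rho>(2)[OF that] by (auto simp: r'_def)
      then show ?thesis by (auto simp: \<sigma>_def)
    qed
    ultimately show ?thesis using sets_F_mono[OF r'(3)] by auto
  qed
  then show "{\<omega> \<in> space (Fst \<rho>). X (\<rho> \<omega>) \<omega> \<le> c} \<in> sets (Fst \<rho>)"
    unfolding sets_Fst space_Fst by blast
qed

text \<open>\<open>lev n (up n \<omega>)\<close> approximates \<open>\<rho> \<omega>\<close> from above on the grid of mesh \<open>1 / Suc n\<close>, capped at \<open>t\<close>, and
  \<open>piece n A j\<close> is the part of \<open>A\<close> on which \<open>up n\<close> equals \<open>j\<close>.\<close>

definition up :: "nat \<Rightarrow> 'a \<Rightarrow> nat" where "up n \<omega> = nat \<lceil>\<rho> \<omega> * real (Suc n)\<rceil>"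

definition lev :: "nat \<Rightarrow> nat \<Rightarrow> real" where "lev n j = min (real j / real (Suc n)) t"

definition piece :: "nat \<Rightarrow> 'a set \<Rightarrow> nat \<Rightarrow> 'a set" where
  "piece n A j = {\<omega>\<in>A. \<rho> \<omega> \<le> real j / real (Suc n)} - {\<omega>\<in>A. \<rho> \<omega> \<le> (real j - 1) / real (Suc n)}"

lemma lev: "0 \<le> lev n j" "lev n j \<le> t" "lev n j < T" using t by (auto simp: lev_def)

lemma piece_sets: "A \<in> sets (Fst \<rho>) \<Longrightarrow> piece n A j \<in> sets (F (lev n j))"
proof -
  assume A: "A \<in> sets (Fst \<rho>)"
  have "min ((real j - 1) / real (Suc n)) t \<le> lev n j"
    unfolding lev_def by (intro min.mono divide_right_mono) auto
  then show ?thesis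
    using Fst_before[OF A, of "real j / real (Suc n)"] Fst_before[OF A, of "(real j - 1) / real (Suc n)"] sets_F_mono
    unfolding piece_def lev_def by blast
qed

lemma piece_iff:
  assumes A: "A \<in> sets (Fst \<rho>)"
  shows "\<omega> \<in> piece n A j \<longleftrightarrow> \<omega> \<in> A \<and> up n \<omega> = j"
proof (cases "\<omega> \<in> A")
  case True
  then have "0 \<le> \<rho> \<omega> * real (Suc n)" using \<rho>(1) Fst_subset_space[OF A] by auto
  then have "up n \<omega> = j \<longleftrightarrow> \<rho> \<omega> * real (Suc n) \<le> real j \<and> \<not> \<rho> \<omega> * real (Suc n) \<le> real j - 1"
    unfolding up_def by linarith
  also have "\<rho> \<omega> * real (Suc n) \<le> real j \<longleftrightarrow> \<rho> \<omega> \<le> real j / real (Suc n)" by (simp only: pos_le_divide_eq of_nat_0_less_iff zero_less_Suc)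
  also have "\<rho> \<omega> * real (Suc n) \<le> real j - 1 \<longleftrightarrow> \<rho> \<omega> \<le> (real j - 1) / real (Suc n)" by (simp only: pos_le_divide_eq of_nat_0_less_iff zero_less_Suc)
  finally show ?thesis using True by (auto simp: piece_def)
qed (auto simp: piece_def)

lemma up_le: "\<omega> \<in> space M \<Longrightarrow> up n \<omega> \<le> nat \<lceil>t * real (Suc n)\<rceil>"
  unfolding up_def using \<rho>(2)[of \<omega>] by (intro nat_mono ceiling_mono mult_right_mono) auto

lemma lev_up_tendsto:
  assumes \<omega>: "\<omega> \<in> space M" shows "(\<lambda>n. lev n (up n \<omega>)) \<longlonglongrightarrow> \<rho> \<omega>"
proof (rule tendsto_sandwich[where f = "\<lambda>_. \<rho> \<omega>" and h = "\<lambda>n. \<rho> \<omega> + 1 / real (Suc n)", OF always_eventually always_eventually])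
  have "(\<lambda>n. \<rho> \<omega> + 1 / real (Suc n)) \<longlonglongrightarrow> \<rho> \<omega> + 0"
    by (intro tendsto_intros LIMSEQ_Suc lim_const_over_n)
  then show "(\<lambda>n. \<rho> \<omega> + 1 / real (Suc n)) \<longlonglongrightarrow> \<rho> \<omega>" by simp
  have *: "\<rho> \<omega> \<le> real (up n \<omega>) / real (Suc n)" "real (up n \<omega>) / real (Suc n) \<le> \<rho> \<omega> + 1 / real (Suc n)" for n
  proof -
    have "0 \<le> \<rho> \<omega> * real (Suc n)" using \<rho>(1)[OF \<omega>] by simp
    then have "\<rho> \<omega> * real (Suc n) \<le> real (up n \<omega>)" "real (up n \<omega>) \<le> \<rho> \<omega> * real (Suc n) + 1"
      unfolding up_def by linarith+
    then have "\<rho> \<omega> \<le> real (up n \<omega>) / real (Suc n)"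
        "real (up n \<omega>) / real (Suc n) \<le> (\<rho> \<omega> * real (Suc n) + 1) / real (Suc n)"
      by (simp only: pos_le_divide_eq of_nat_0_less_iff zero_less_Suc, intro divide_right_mono) auto
    then show "\<rho> \<omega> \<le> real (up n \<omega>) / real (Suc n)" "real (up n \<omega>) / real (Suc n) \<le> \<rho> \<omega> + 1 / real (Suc n)"
      unfolding add_divide_distrib by auto
  qed
  show "\<forall>n. \<rho> \<omega> \<le> lev n (up n \<omega>)" using * \<rho>(2)[OF \<omega>] by (auto simp: lev_def)
  show "\<forall>n. lev n (up n \<omega>) \<le> \<rho> \<omega> + 1 / real (Suc n)" using *(2) by (auto simp: lev_def min_le_iff_disj)
qed simp

lemma discretized_sum:
  fixes f :: "real \<Rightarrow> 'a \<Rightarrow> ennreal"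
  assumes A: "A \<in> sets (Fst \<rho>)" and \<omega>: "\<omega> \<in> space M"
  shows "f (lev n (up n \<omega>)) \<omega> * indicator A \<omega> =
    (\<Sum>j\<le>nat \<lceil>t * real (Suc n)\<rceil>. f (lev n j) \<omega> * indicator (piece n A j) \<omega>)"
proof -
  have "(\<Sum>j\<le>nat \<lceil>t * real (Suc n)\<rceil>. f (lev n j) \<omega> * indicator (piece n A j) \<omega>)
      = (\<Sum>j\<le>nat \<lceil>t * real (Suc n)\<rceil>. if j = up n \<omega> then f (lev n (up n \<omega>)) \<omega> * indicator A \<omega> else 0)"
    by (intro sum.cong refl) (auto simp: indicator_def piece_iff[OF A])
  also have "\<dots> = f (lev n (up n \<omega>)) \<omega> * indicator A \<omega>"
    using up_le[OF \<omega>, of n] by (subst sum.delta) auto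
  finally show ?thesis ..
qed

lemma
  fixes f :: "real \<Rightarrow> 'a \<Rightarrow> ennreal"
  assumes A: "A \<in> sets (Fst \<rho>)" and f: "\<And>s. 0 \<le> s \<Longrightarrow> s \<le> t \<Longrightarrow> f s \<in> borel_measurable M"
  shows measurable_discretized: "(\<lambda>\<omega>. f (lev n (up n \<omega>)) \<omega> * indicator A \<omega>) \<in> borel_measurable M"
    and nn_integral_discretized: "(\<integral>\<^sup>+\<omega>. f (lev n (up n \<omega>)) \<omega> * indicator A \<omega> \<partial>M) =
      (\<Sum>j\<le>nat \<lceil>t * real (Suc n)\<rceil>. (\<integral>\<^sup>+\<omega>. f (lev n j) \<omega> * indicator (piece n A j) \<omega> \<partial>M))"
proof -
  have m: "(\<lambda>\<omega>. f (lev n j) \<omega> * indicator (piece n A j) \<omega>) \<in> borel_measurable M" for j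
  proof -
    have [measurable]: "piece n A j \<in> sets M" "f (lev n j) \<in> borel_measurable M"
      using piece_sets[OF A, of n j] sets_F_subset f[OF lev(1,2)] by auto
    show ?thesis by measurable
  qed
  show "(\<lambda>\<omega>. f (lev n (up n \<omega>)) \<omega> * indicator A \<omega>) \<in> borel_measurable M"
  proof (rule measurable_cong[THEN iffD2])
    show "(\<lambda>\<omega>. (\<Sum>j\<le>nat \<lceil>t * real (Suc n)\<rceil>. f (lev n j) \<omega> * indicator (piece n A j) \<omega>)) \<in> borel_measurable M"
      using m by (rule borel_measurable_sum)
  qed (rule discretized_sum[OF A])
  have "(\<integral>\<^sup>+\<omega>. f (lev n (up n \<omega>)) \<omega> * indicator A \<omega> \<partial>M) = (\<integral>\<^sup>+\<omega>. (\<Sum>j\<le>nat \<lceil>t * real (Suc n)\<rceil>. f (lev n j) \<omega> * indicator (piece n A j) \<omega>) \<partial>M)"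
    by (intro nn_integral_cong discretized_sum[OF A])
  also have "\<dots> = (\<Sum>j\<le>nat \<lceil>t * real (Suc n)\<rceil>. (\<integral>\<^sup>+\<omega>. f (lev n j) \<omega> * indicator (piece n A j) \<omega> \<partial>M))"
    by (rule nn_integral_sum) (rule m)
  finally show "(\<integral>\<^sup>+\<omega>. f (lev n (up n \<omega>)) \<omega> * indicator A \<omega> \<partial>M) =
      (\<Sum>j\<le>nat \<lceil>t * real (Suc n)\<rceil>. (\<integral>\<^sup>+\<omega>. f (lev n j) \<omega> * indicator (piece n A j) \<omega> \<partial>M))" .
qed

text \<open>On each piece the discretized time is a constant and the piece is known at that time, so
  the fixed-time inequality applies; summing the pieces gives the inequality at the random
  time.\<close>

lemma discretized_le:
  fixes f f' :: "real \<Rightarrow> 'a \<Rightarrow> ennreal"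
  assumes A: "A \<in> sets (Fst \<rho>)"
    and f: "\<And>s. 0 \<le> s \<Longrightarrow> s \<le> t \<Longrightarrow> f s \<in> borel_measurable M" "\<And>s. 0 \<le> s \<Longrightarrow> s \<le> t \<Longrightarrow> f' s \<in> borel_measurable M"
    and le: "\<And>s B. 0 \<le> s \<Longrightarrow> s \<le> t \<Longrightarrow> B \<in> sets (F s) \<Longrightarrow>
      (\<integral>\<^sup>+\<omega>. f s \<omega> * indicator B \<omega> \<partial>M) \<le> C * (\<integral>\<^sup>+\<omega>. f' s \<omega> * indicator B \<omega> \<partial>M)"
  shows "(\<integral>\<^sup>+\<omega>. f (lev n (up n \<omega>)) \<omega> * indicator A \<omega> \<partial>M) \<le> C * (\<integral>\<^sup>+\<omega>. f' (lev n (up n \<omega>)) \<omega> * indicator A \<omega> \<partial>M)"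
proof -
  have "(\<integral>\<^sup>+\<omega>. f (lev n (up n \<omega>)) \<omega> * indicator A \<omega> \<partial>M)
      = (\<Sum>j\<le>nat \<lceil>t * real (Suc n)\<rceil>. (\<integral>\<^sup>+\<omega>. f (lev n j) \<omega> * indicator (piece n A j) \<omega> \<partial>M))"
    using A f(1) by (rule nn_integral_discretized)
  also have "\<dots> \<le> (\<Sum>j\<le>nat \<lceil>t * real (Suc n)\<rceil>. C * (\<integral>\<^sup>+\<omega>. f' (lev n j) \<omega> * indicator (piece n A j) \<omega> \<partial>M))"
    by (intro sum_mono le lev piece_sets A)
  also have "\<dots> = C * (\<integral>\<^sup>+\<omega>. f' (lev n (up n \<omega>)) \<omega> * indicator A \<omega> \<partial>M)"
    unfolding sum_distrib_left[symmetric]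
    by (rule arg_cong[where f = "(*) C"], rule nn_integral_discretized[symmetric]) (use A f(2) in auto)
  finally show ?thesis .
qed

lemma measurable_discretized_process:
  fixes V :: "real \<Rightarrow> 'a \<Rightarrow> real"
  assumes "\<And>s. 0 \<le> s \<Longrightarrow> s \<le> t \<Longrightarrow> V s \<in> borel_measurable M"
  shows "(\<lambda>\<omega>. V (lev n (up n \<omega>)) \<omega>) \<in> borel_measurable M"
proof (rule measurable_compose_countable[where f = "\<lambda>j. V (lev n j)"])
  have [measurable]: "\<rho> \<in> borel_measurable M"
    by (rule measurable_stopping_time[OF stop sets_F_subset space_F])
  show "up n \<in> measurable M (count_space UNIV)" unfolding up_def by measurable
qed (use assms lev in auto)

text \<open>Transfers a fixed-time estimate to a stopping time. For \<open>J\<close> Fatou's lemma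
  is enough; on the right the limit must be taken in the opposite direction, for which the growth
  bound on \<open>V\<close> provides boundedness in L2.\<close>

lemma stopped_le:
  fixes J V :: "real \<Rightarrow> 'a \<Rightarrow> real"
  assumes A: "A \<in> sets (Fst \<rho>)"
    and J: "\<And>s. 0 \<le> s \<Longrightarrow> s \<le> t \<Longrightarrow> J s \<in> borel_measurable M" "\<And>\<omega>. \<omega> \<in> space M \<Longrightarrow> continuous_on {0..<T} (\<lambda>s. J s \<omega>)"
    and V: "\<And>s. 0 \<le> s \<Longrightarrow> s \<le> t \<Longrightarrow> V s \<in> borel_measurable M" "\<And>\<omega>. \<omega> \<in> space M \<Longrightarrow> continuous_on {0..<T} (\<lambda>s. V s \<omega>)"
    and V0: "\<And>s \<omega>. 0 \<le> V s \<omega>"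
    and V2: "\<And>s \<omega>. 0 \<le> s \<Longrightarrow> (V s \<omega>)\<^sup>2 \<le> exp (c * W s \<omega>)" and c: "0 \<le> c"
    and le: "\<And>s B. 0 \<le> s \<Longrightarrow> s \<le> t \<Longrightarrow> B \<in> sets (F s) \<Longrightarrow>
      (\<integral>\<^sup>+\<omega>. ennreal (J s \<omega>) * indicator B \<omega> \<partial>M) \<le> ennreal C * (\<integral>\<^sup>+\<omega>. ennreal (V s \<omega>) * indicator B \<omega> \<partial>M)"
  shows "(\<integral>\<^sup>+\<omega>. ennreal (J (\<rho> \<omega>) \<omega>) * indicator A \<omega> \<partial>M) \<le> ennreal C * (\<integral>\<^sup>+\<omega>. ennreal (V (\<rho> \<omega>) \<omega>) * indicator A \<omega> \<partial>M)"
proof -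
  have AM[measurable]: "A \<in> sets M" using A subalgebra_Fst by (auto simp: subalgebra_def)
  have \<rho>T: "\<rho> \<omega> \<in> {0..<T}" if "\<omega> \<in> space M" for \<omega> using \<rho>(1)[OF that] \<rho>(2)[OF that] t by auto
  have limJ: "(\<lambda>n. J (lev n (up n \<omega>)) \<omega>) \<longlonglongrightarrow> J (\<rho> \<omega>) \<omega>" if \<omega>: "\<omega> \<in> space M" for \<omega>
    by (rule continuous_on_tendsto_compose[OF J(2)[OF \<omega>] lev_up_tendsto[OF \<omega>] \<rho>T[OF \<omega>]]) (simp add: lev)
  have limV: "(\<lambda>n. V (lev n (up n \<omega>)) \<omega>) \<longlonglongrightarrow> V (\<rho> \<omega>) \<omega>" if \<omega>: "\<omega> \<in> space M" for \<omega>
    by (rule continuous_on_tendsto_compose[OF V(2)[OF \<omega>] lev_up_tendsto[OF \<omega>] \<rho>T[OF \<omega>]]) (simp add: lev)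
  define K where "K = 1 + normal_exp_moment 0 (c * sqrt T)"
  have K0: "0 \<le> K" using normal_exp_moment_nonneg[of 0 "c * sqrt T"] by (simp add: K_def)
  have Wt[measurable]: "W t \<in> borel_measurable M" using t by simp
  \<comment> \<open>Piece by piece the bound \<open>exp (c * W s)\<close> at the grid time is pushed
    forward to the common time \<open>t\<close>, so it does not depend on \<open>n\<close>.\<close>
  have L2: "(\<integral>\<^sup>+\<omega>. ennreal ((V (lev n (up n \<omega>)) \<omega>)\<^sup>2) * indicator A \<omega> \<partial>M) \<le> ennreal K" for n
  proof -
    have "(\<integral>\<^sup>+\<omega>. ennreal ((V (lev n (up n \<omega>)) \<omega>)\<^sup>2) * indicator A \<omega> \<partial>M)
        \<le> 1 * (\<integral>\<^sup>+\<omega>. ennreal (exp (c * W t \<omega>)) * indicator A \<omega> \<partial>M)"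
    proof (rule discretized_le[where f = "\<lambda>s \<omega>. ennreal ((V s \<omega>)\<^sup>2)" and f' = "\<lambda>s \<omega>. ennreal (exp (c * W t \<omega>))", OF A])
      show "(\<lambda>\<omega>. ennreal ((V s \<omega>)\<^sup>2)) \<in> borel_measurable M" if "0 \<le> s" "s \<le> t" for s
        using V(1)[OF that] by measurable
      fix s B assume s: "0 \<le> s" "s \<le> t" and B: "B \<in> sets (F s)"
      have "(\<integral>\<^sup>+\<omega>. ennreal ((V s \<omega>)\<^sup>2) * indicator B \<omega> \<partial>M) \<le> (\<integral>\<^sup>+\<omega>. ennreal (exp (c * W s \<omega>)) * indicator B \<omega> \<partial>M)"
        by (intro nn_integral_mono mult_right_mono ennreal_leI V2 s) simp
      also have "\<dots> \<le> (\<integral>\<^sup>+\<omega>. ennreal (exp (c * W t \<omega>)) * indicator B \<omega> \<partial>M)"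
        using t by (intro exp_submartingale s B) simp
      finally show "(\<integral>\<^sup>+\<omega>. ennreal ((V s \<omega>)\<^sup>2) * indicator B \<omega> \<partial>M) \<le> 1 * (\<integral>\<^sup>+\<omega>. ennreal (exp (c * W t \<omega>)) * indicator B \<omega> \<partial>M)"
        by simp
    qed measurable
    also have "\<dots> \<le> (\<integral>\<^sup>+\<omega>. 1 * ennreal (exp (c * \<bar>W t \<omega> - W 0 \<omega>\<bar>)) \<partial>M)"
    proof (simp only: mult_1, rule nn_integral_mono)
      fix \<omega> assume "\<omega> \<in> space M"
      then have "exp (c * W t \<omega>) \<le> exp (c * \<bar>W t \<omega> - W 0 \<omega>\<bar>)" using c by (simp add: W_0 mult_left_mono)
      then show "ennreal (exp (c * W t \<omega>)) * indicator A \<omega> \<le> ennreal (exp (c * \<bar>W t \<omega> - W 0 \<omega>\<bar>))"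
        by (auto simp: indicator_def intro: ennreal_leI)
    qed
    also have "\<dots> \<le> ennreal K * (\<integral>\<^sup>+\<omega>. 1 \<partial>M)"
      unfolding K_def using t c by (intro nn_integral_exp_increment) auto
    finally show ?thesis by (simp add: emeasure_space_1)
  qed
  have "(\<integral>\<^sup>+\<omega>. ennreal (J (\<rho> \<omega>) \<omega>) * indicator A \<omega> \<partial>M)
      = (\<integral>\<^sup>+\<omega>. liminf (\<lambda>n. ennreal (J (lev n (up n \<omega>)) \<omega>) * indicator A \<omega>) \<partial>M)"
  proof (rule nn_integral_cong)
    fix \<omega> assume \<omega>: "\<omega> \<in> space M"
    have "(\<lambda>n. ennreal (J (lev n (up n \<omega>)) \<omega>) * indicator A \<omega>) \<longlonglongrightarrow> ennreal (J (\<rho> \<omega>) \<omega>) * indicator A \<omega>"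
      using tendsto_ennrealI[OF limJ[OF \<omega>]] by (cases "\<omega> \<in> A") auto
    then show "ennreal (J (\<rho> \<omega>) \<omega>) * indicator A \<omega> = liminf (\<lambda>n. ennreal (J (lev n (up n \<omega>)) \<omega>) * indicator A \<omega>)"
      by (intro lim_imp_Liminf[symmetric]) auto
  qed
  also have "\<dots> \<le> liminf (\<lambda>n. \<integral>\<^sup>+\<omega>. ennreal (J (lev n (up n \<omega>)) \<omega>) * indicator A \<omega> \<partial>M)"
  proof (rule nn_integral_liminf)
    fix n
    have [measurable]: "(\<lambda>\<omega>. J (lev n (up n \<omega>)) \<omega>) \<in> borel_measurable M"
      by (rule measurable_discretized_process) (rule J(1))
    show "(\<lambda>\<omega>. ennreal (J (lev n (up n \<omega>)) \<omega>) * indicator A \<omega>) \<in> borel_measurable M" by measurable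
  qed
  also have "\<dots> \<le> liminf (\<lambda>n. ennreal C * (\<integral>\<^sup>+\<omega>. ennreal (V (lev n (up n \<omega>)) \<omega>) * indicator A \<omega> \<partial>M))"
  proof (intro Liminf_mono always_eventually allI)
    fix n
    show "(\<integral>\<^sup>+\<omega>. ennreal (J (lev n (up n \<omega>)) \<omega>) * indicator A \<omega> \<partial>M) \<le> ennreal C * (\<integral>\<^sup>+\<omega>. ennreal (V (lev n (up n \<omega>)) \<omega>) * indicator A \<omega> \<partial>M)"
    proof (rule discretized_le[where f = "\<lambda>s \<omega>. ennreal (J s \<omega>)" and f' = "\<lambda>s \<omega>. ennreal (V s \<omega>)", OF A])
      show "(\<lambda>\<omega>. ennreal (J s \<omega>)) \<in> borel_measurable M" "(\<lambda>\<omega>. ennreal (V s \<omega>)) \<in> borel_measurable M"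
        if "0 \<le> s" "s \<le> t" for s using J(1)[OF that] V(1)[OF that] by measurable
    qed (rule le)
  qed
  also have "\<dots> = ennreal C * liminf (\<lambda>n. \<integral>\<^sup>+\<omega>. ennreal (V (lev n (up n \<omega>)) \<omega>) * indicator A \<omega> \<partial>M)"
    by (rule Liminf_compose_continuous_mono[where f = "\<lambda>x. ennreal C * x"])
      (auto intro!: ennreal_continuous_on_cmult continuous_intros monoI mult_left_mono)
  also have "\<dots> \<le> ennreal C * (\<integral>\<^sup>+\<omega>. ennreal (V (\<rho> \<omega>) \<omega>) * indicator A \<omega> \<partial>M)"
  proof (rule mult_left_mono)
    show "liminf (\<lambda>n. \<integral>\<^sup>+\<omega>. ennreal (V (lev n (up n \<omega>)) \<omega>) * indicator A \<omega> \<partial>M) \<le> (\<integral>\<^sup>+\<omega>. ennreal (V (\<rho> \<omega>) \<omega>) * indicator A \<omega> \<partial>M)"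
    proof (rule nn_integral_limit_L2_bounded[where V = "\<lambda>n \<omega>. V (lev n (up n \<omega>)) \<omega>" and K = K])
      show "(\<lambda>\<omega>. V (lev n (up n \<omega>)) \<omega>) \<in> borel_measurable M" for n
        by (rule measurable_discretized_process) (rule V(1))
      show "finite_measure M" by unfold_locales
      show "(\<lambda>n. V (lev n (up n \<omega>)) \<omega>) \<longlonglongrightarrow> V (\<rho> \<omega>) \<omega>" if "\<omega> \<in> space M" for \<omega>
        by (rule limV[OF that])
    qed (use V0 L2 K0 in auto)
  qed simp
  finally show ?thesis .
qed

end

end

section \<open>Bounded mean oscillation\<close>

lemma nn_integral_pos_eq_neg:
  fixes f :: "'b \<Rightarrow> real"
  assumes f: "integrable N f" and "(LINT x|N. f x) = 0"
  shows "(\<integral>\<^sup>+x. ennreal (f x) \<partial>N) = (\<integral>\<^sup>+x. ennreal (- f x) \<partial>N)"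
proof -
  define a where "a = (\<integral>\<^sup>+x. ennreal (f x) \<partial>N)"
  define b where "b = (\<integral>\<^sup>+x. ennreal (- f x) \<partial>N)"
  have "a \<noteq> \<infinity>" "b \<noteq> \<infinity>" using f unfolding real_integrable_def a_def b_def by auto
  moreover have "enn2real a = enn2real b"
    using real_lebesgue_integral_def[OF f] assms(2) by (simp add: a_def b_def)
  ultimately have "a = b" by (cases a; cases b) auto
  then show ?thesis by (simp add: a_def b_def)
qed

context hoelder_brownian begin

lemma frac_int_process_eq: "0 \<le> t \<Longrightarrow> t < T \<Longrightarrow> frac_int_process T ((1 - \<theta>) / 2) (Z_process M T W g) t \<omega> = I t \<omega>"
  unfolding frac_int_process_def I_def fk.frac_int_eq
proof (intro Bochner_Integration.integral_cong refl)
  fix u assume t: "0 \<le> t" "t < T"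
  show "fk.k u * Z_process M T W g (min u t) \<omega> = fk.k u * Z (min u t) \<omega>"
  proof (cases "u \<in> {0..T}")
    case True
    then show ?thesis using t by (subst Z_process_Z) auto
  qed (simp add: fk.k_zero)
qed

text \<open>Continuity of the paths removes the left limit, \<open>stopped_le\<close> carries
  \<open>I_conditional_bound\<close> from fixed times to \<open>\<rho>\<close>, and
  \<open>nn_cond_exp_le\<close> turns the resulting bound over sets of the stopped sigma-algebra
  into the almost sure one.\<close>

lemma BMO_I:
  assumes p: "0 < p"
  shows "(\<lambda>t \<omega>. frac_int_process T ((1 - \<theta>) / 2) (Z_process M T W g) t \<omega> - Z_process M T W g 0 \<omega>)
    \<in> BMO M F T p (\<lambda>t \<omega>. gbm W t \<omega> powr \<theta>)"
proof -
  define X where "X = (\<lambda>t \<omega>. frac_int_process T ((1 - \<theta>) / 2) (Z_process M T W g) t \<omega> - Z_process M T W g 0 \<omega>)"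
  have Xeq: "X t \<omega> = I t \<omega> - Z 0 \<omega>" if "0 \<le> t" "t < T" for t \<omega>
    using that T_pos by (simp add: X_def frac_int_process_eq Z_process_Z)
  have Xcont: "continuous_on {0..<T} (\<lambda>t. X t \<omega>)" if "\<omega> \<in> space M" for \<omega>
  proof -
    have "continuous_on {0..<T} (\<lambda>t. I t \<omega> - Z 0 \<omega>)" by (intro continuous_intros continuous_I[OF that])
    then show ?thesis by (rule continuous_on_cong[THEN iffD1, rotated 2]) (auto simp: Xeq)
  qed
  have Xad: "adapted_cadlag M F T X"
    unfolding adapted_cadlag_def adapted_def
  proof (intro conjI ballI cadlag_continuous Xcont)
    fix t assume t: "t \<in> {0..<T}"
    have "Z 0 \<in> borel_measurable (F t)" using t by (intro measurable_F_mono[OF _ measurable_Z]) auto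
    then have "(\<lambda>\<omega>. I t \<omega> - Z 0 \<omega>) \<in> borel_measurable (F t)" using measurable_I[of t] t by simp
    moreover have "X t = (\<lambda>\<omega>. I t \<omega> - Z 0 \<omega>)" using Xeq[of t] t by (intro ext) auto
    ultimately show "X t \<in> borel_measurable (F t)" by simp
  qed
  have gcont: "continuous_on {0..<T} (\<lambda>t. gbm W t \<omega> powr \<theta>)" if "\<omega> \<in> space M" for \<omega>
  proof -
    have "continuous_on {0..<T} (\<lambda>t. W t \<omega>)" by (rule continuous_on_subset[OF continuous_W[OF that]]) auto
    then show ?thesis unfolding gbm_def by (intro continuous_intros) auto
  qed
  have gm: "(\<lambda>\<omega>. gbm W s \<omega> powr \<theta>) \<in> borel_measurable (F s)" if "0 \<le> s" "s < T" for s
    using measurable_gbm[of s] that by simp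
  have gad: "adapted_cadlag M F T (\<lambda>t \<omega>. gbm W t \<omega> powr \<theta>)"
    unfolding adapted_cadlag_def adapted_def by (intro conjI ballI cadlag_continuous gcont gm) auto
  have X0: "X 0 \<omega> = 0" if "\<omega> \<in> space M" for \<omega> using that T_pos by (simp add: Xeq I_0)
  obtain C where C: "0 \<le> C"
    "\<And>s t A. 0 \<le> s \<Longrightarrow> s \<le> t \<Longrightarrow> t < T \<Longrightarrow> A \<in> sets (F s) \<Longrightarrow>
      (\<integral>\<^sup>+\<omega>. ennreal (\<bar>I t \<omega> - I s \<omega>\<bar> powr p) * indicator A \<omega> \<partial>M)
        \<le> ennreal C * (\<integral>\<^sup>+\<omega>. ennreal ((gbm W s \<omega> powr \<theta>) powr p) * indicator A \<omega> \<partial>M)"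
    using I_conditional_bound[OF p] by blast
  define c where "c = C powr (1 / p)"
  have cp: "c powr p = C" using C(1) p by (simp add: c_def powr_powr)
  have main: "AE \<omega> in M. nn_cond_exp M (Fst \<rho>) (\<lambda>\<omega>'. ennreal (\<bar>X t \<omega>' - left_lim (\<lambda>s. X s \<omega>') (\<rho> \<omega>')\<bar> powr p)) \<omega>
      \<le> ennreal (c powr p * (gbm W (\<rho> \<omega>) \<omega> powr \<theta>) powr p)"
    if t: "t \<in> {0..<T}" and \<rho>: "stopping_time F \<rho> \<and> (\<forall>\<omega>\<in>space M. 0 \<le> \<rho> \<omega> \<and> \<rho> \<omega> \<le> t)" for t \<rho>
  proof -
    have st: "stopping_time F \<rho>" "\<And>\<omega>. \<omega> \<in> space M \<Longrightarrow> 0 \<le> \<rho> \<omega>" "\<And>\<omega>. \<omega> \<in> space M \<Longrightarrow> \<rho> \<omega> \<le> t" "0 \<le> t" "t < T"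
      using t \<rho> by auto
    have sub: "subalgebra M (Fst \<rho>)" by (rule subalgebra_Fst[OF st(1) _ _ st(4,5)]) (use st in auto)
    have Ist: "(\<lambda>\<omega>. I (\<rho> \<omega>) \<omega>) \<in> borel_measurable (Fst \<rho>)"
      by (rule measurable_stopped_process[OF st(1) _ _ st(4,5)]) (use st measurable_I continuous_I in auto)
    note [measurable] = measurable_from_subalg[OF sub Ist]
    have [measurable]: "I t \<in> borel_measurable M" using st by simp
    have gst: "(\<lambda>\<omega>. gbm W (\<rho> \<omega>) \<omega> powr \<theta>) \<in> borel_measurable (Fst \<rho>)"
      by (rule measurable_stopped_process[OF st(1) _ _ st(4,5), where X = "\<lambda>s \<omega>. gbm W s \<omega> powr \<theta>"])
        (use st gm gcont in auto)
    have gstp: "(\<lambda>\<omega>. (gbm W (\<rho> \<omega>) \<omega> powr \<theta>) powr p) \<in> borel_measurable (Fst \<rho>)"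
      by (rule measurable_compose[OF gst, of "\<lambda>x. x powr p"]) measurable
    have eq: "ennreal (\<bar>X t \<omega> - left_lim (\<lambda>s. X s \<omega>) (\<rho> \<omega>)\<bar> powr p) = ennreal (\<bar>I t \<omega> - I (\<rho> \<omega>) \<omega>\<bar> powr p)"
      if \<omega>: "\<omega> \<in> space M" for \<omega>
    proof -
      have r: "0 \<le> \<rho> \<omega>" "\<rho> \<omega> < T" using st(2,3)[OF \<omega>] st(5) by auto
      show ?thesis unfolding left_lim_continuous[OF Xcont[OF \<omega>] r] Xeq[OF r] Xeq[OF st(4,5)] by simp
    qed
    show ?thesis
    proof (rule nn_cond_exp_le[OF sub])
      show "(\<lambda>\<omega>'. ennreal (\<bar>X t \<omega>' - left_lim (\<lambda>s. X s \<omega>') (\<rho> \<omega>')\<bar> powr p)) \<in> borel_measurable M"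
        by (rule measurable_cong[THEN iffD2, OF eq]) measurable
      show "(\<lambda>\<omega>. c powr p * (gbm W (\<rho> \<omega>) \<omega> powr \<theta>) powr p) \<in> borel_measurable (Fst \<rho>)"
        by (intro borel_measurable_times borel_measurable_const gstp)
      fix A assume A: "A \<in> sets (Fst \<rho>)"
      have AM: "A \<in> sets M" using A sub by (auto simp: subalgebra_def)
      have "(\<integral>\<^sup>+\<omega>. ennreal (\<bar>X t \<omega> - left_lim (\<lambda>s. X s \<omega>) (\<rho> \<omega>)\<bar> powr p) * indicator A \<omega> \<partial>M)
          = (\<integral>\<^sup>+\<omega>. ennreal (\<bar>I t \<omega> - I (\<rho> \<omega>) \<omega>\<bar> powr p) * indicator A \<omega> \<partial>M)"
        by (intro nn_integral_cong) (simp only: eq)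
      also have "\<dots> \<le> ennreal C * (\<integral>\<^sup>+\<omega>. ennreal ((gbm W (\<rho> \<omega>) \<omega> powr \<theta>) powr p) * indicator A \<omega> \<partial>M)"
      proof (rule stopped_le[OF st(1) _ _ st(4,5) A, where J = "\<lambda>s \<omega>. \<bar>I t \<omega> - I s \<omega>\<bar> powr p" and V = "\<lambda>s \<omega>. (gbm W s \<omega> powr \<theta>) powr p" and c = "2 * \<theta> * p"])
        show "(\<lambda>\<omega>. \<bar>I t \<omega> - I s \<omega>\<bar> powr p) \<in> borel_measurable M" if "0 \<le> s" "s \<le> t" for s
        proof -
          have [measurable]: "I s \<in> borel_measurable M" using that st(5) by simp
          show ?thesis by measurable
        qed
        show "(\<lambda>\<omega>. (gbm W s \<omega> powr \<theta>) powr p) \<in> borel_measurable M" if "0 \<le> s" "s \<le> t" for s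
        proof -
          have [measurable]: "gbm W s \<in> borel_measurable M" using that st(5) by (intro measurable_F_M[OF measurable_gbm]) auto
          show ?thesis by measurable
        qed
        show "continuous_on {0..<T} (\<lambda>s. \<bar>I t \<omega> - I s \<omega>\<bar> powr p)" if "\<omega> \<in> space M" for \<omega>
          using p by (intro continuous_on_powr' continuous_intros continuous_I[OF that]) auto
        show "continuous_on {0..<T} (\<lambda>s. (gbm W s \<omega> powr \<theta>) powr p)" if "\<omega> \<in> space M" for \<omega>
          by (rule continuous_on_powr[OF gcont[OF that] continuous_on_const]) (auto simp: gbm_def)
        show "((gbm W s \<omega> powr \<theta>) powr p)\<^sup>2 \<le> exp (2 * \<theta> * p * W s \<omega>)" if "0 \<le> s" for s \<omega>
        proof -
          have "((gbm W s \<omega> powr \<theta>) powr p)\<^sup>2 = exp (2 * \<theta> * p * (W s \<omega> - s / 2))"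
            by (simp add: gbm_def powr_def exp_double[symmetric] algebra_simps)
          also have "\<dots> \<le> exp (2 * \<theta> * p * W s \<omega>)" using that p \<theta> by (intro exp_le_cancel_iff[THEN iffD2] mult_left_mono) auto
          finally show ?thesis .
        qed
        show "0 \<le> 2 * \<theta> * p" using \<theta> p by simp
      qed (use C(2) st in auto)
      also have "\<dots> = (\<integral>\<^sup>+\<omega>. ennreal C * (ennreal ((gbm W (\<rho> \<omega>) \<omega> powr \<theta>) powr p) * indicator A \<omega>) \<partial>M)"
      proof (rule nn_integral_cmult[symmetric])
        have [measurable]: "(\<lambda>\<omega>. (gbm W (\<rho> \<omega>) \<omega> powr \<theta>) powr p) \<in> borel_measurable M"
          by (rule measurable_from_subalg[OF sub gstp])
        note [measurable] = AM
        show "(\<lambda>\<omega>. ennreal ((gbm W (\<rho> \<omega>) \<omega> powr \<theta>) powr p) * indicator A \<omega>) \<in> borel_measurable M" by measurable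
      qed
      also have "\<dots> = (\<integral>\<^sup>+\<omega>. ennreal (c powr p * (gbm W (\<rho> \<omega>) \<omega> powr \<theta>) powr p) * indicator A \<omega> \<partial>M)"
        unfolding cp using C(1) by (intro nn_integral_cong) (simp add: ennreal_mult mult.assoc)
      finally show "(\<integral>\<^sup>+\<omega>. ennreal (\<bar>X t \<omega> - left_lim (\<lambda>s. X s \<omega>) (\<rho> \<omega>)\<bar> powr p) * indicator A \<omega> \<partial>M)
        \<le> (\<integral>\<^sup>+\<omega>. ennreal (c powr p * (gbm W (\<rho> \<omega>) \<omega> powr \<theta>) powr p) * indicator A \<omega> \<partial>M)" .
    qed
  qed
  have "X \<in> BMO M F T p (\<lambda>t \<omega>. gbm W t \<omega> powr \<theta>)"
    unfolding BMO_def
    by (intro CollectI conjI Xad gad ballI exI[of _ c] allI impI main X0) (auto simp: c_def)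
  then show ?thesis by (simp add: X_def)
qed

text \<open>Freezing the bound at time 0, where \<open>W\<close> vanishes, leaves the deterministic
  tail \<open>Q s 0\<close>, which tends to 0.\<close>

lemma I_even_moment_small:
  assumes k: "1 \<le> k" and e: "0 < e"
  obtains s0 where "0 \<le> s0" "s0 < T"
    "\<And>s t. s0 \<le> s \<Longrightarrow> s \<le> t \<Longrightarrow> t < T \<Longrightarrow> (\<integral>\<^sup>+\<omega>. ennreal ((I t \<omega> - I s \<omega>) ^ (2 * k)) \<partial>M) \<le> ennreal e"
proof -
  define c4 where "c4 = 4 * T powr (\<theta> - 1)"
  have c4: "0 < c4" using T_pos by (simp add: c4_def)
  \<comment> \<open>The cap at 1 gives \<open>x ^ k \<le> x\<close>; the second entry makes
    \<open>2 * cA k * x\<close> at most \<open>e\<close>.\<close>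
  define x where "x = min 1 (e / (2 * cA k + 1))"
  have x: "0 < x" "x \<le> 1" using e cA_nonneg[of k] by (auto simp: x_def)
  have "2 * cA k * x \<le> e"
  proof -
    have "2 * cA k * x \<le> (2 * cA k + 1) * (e / (2 * cA k + 1))"
      using cA_nonneg[of k] x by (intro mult_mono) (auto simp: x_def)
    then show ?thesis using cA_nonneg[of k] by simp
  qed
  moreover have "x ^ k \<le> x" using power_decreasing[of 1 k x] x k by simp
  ultimately have xe: "2 * cA k * x ^ k \<le> e" using cA_nonneg[of k] by (meson mult_left_mono order_trans mult_nonneg_nonneg zero_le_numeral)
  obtain s0 where s0: "0 \<le> s0" "s0 < T" "\<And>r. s0 \<le> r \<Longrightarrow> Q r 0 < ennreal (x / c4)"
    using Q_tail[of "ennreal (x / c4)" 0] x c4 by auto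
  have "(\<integral>\<^sup>+\<omega>. ennreal ((I t \<omega> - I s \<omega>) ^ (2 * k)) \<partial>M) \<le> ennreal e" if st: "s0 \<le> s" "s \<le> t" "t < T" for s t
  proof -
    have "(\<integral>\<^sup>+\<omega>. ennreal (1 * (I t \<omega> - I s \<omega>) ^ (2 * k)) \<partial>M)
      \<le> (\<integral>\<^sup>+\<omega>. ennreal 1 * (ennreal (2 * cA k) * (ennreal (4 * T powr (\<theta> - 1)) * Q s (W 0 \<omega>)) ^ k) \<partial>M)"
      using st s0 by (intro I_moment k) auto
    also have "\<dots> \<le> (\<integral>\<^sup>+\<omega>. ennreal e \<partial>M)"
    proof (rule nn_integral_mono)
      fix \<omega> assume "\<omega> \<in> space M"
      then have "ennreal (2 * cA k) * (ennreal c4 * Q s (W 0 \<omega>)) ^ k \<le> ennreal (2 * cA k) * (ennreal c4 * ennreal (x / c4)) ^ k"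
        using s0(3)[OF st(1)] by (intro mult_left_mono power_mono) (auto simp: W_0)
      also have "ennreal c4 * ennreal (x / c4) = ennreal x" using c4 x by (simp add: ennreal_mult[symmetric] less_imp_le)
      also have "ennreal (2 * cA k) * ennreal x ^ k = ennreal (2 * cA k * x ^ k)"
        using x cA_nonneg[of k] by (simp only: ennreal_power less_imp_le ennreal_mult mult_nonneg_nonneg zero_le_numeral zero_le_power)
      also have "\<dots> \<le> ennreal e" using xe by (rule ennreal_leI)
      finally show "ennreal 1 * (ennreal (2 * cA k) * (ennreal (4 * T powr (\<theta> - 1)) * Q s (W 0 \<omega>)) ^ k) \<le> ennreal e"
        by (simp add: c4_def)
    qed
    also have "\<dots> = ennreal e" by (simp add: emeasure_space_1)
    finally show ?thesis by simp
  qed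
  then show ?thesis using s0 that by blast
qed

lemma I_moment_small:
  assumes p: "0 < p" and e: "0 < e"
  obtains s0 where "0 \<le> s0" "s0 < T"
    "\<And>s t. s0 \<le> s \<Longrightarrow> s \<le> t \<Longrightarrow> t < T \<Longrightarrow> (\<integral>\<^sup>+\<omega>. ennreal (\<bar>I t \<omega> - I s \<omega>\<bar> powr p) \<partial>M) \<le> ennreal e"
proof -
  obtain k :: nat where "p / 2 \<le> k" using real_arch_simple by blast
  then have k: "p \<le> real (2 * k)" "1 \<le> k" using p by (cases k; auto)+
  \<comment> \<open>The level \<open>y\<close> spends half of \<open>e\<close> in
    \<open>powr_le_add_even\<close>, and \<open>d\<close> below is the size of the even moment that
    spends the other half.\<close>
  define y where "y = (e / 2) powr (1 / p)"
  have y: "0 < y" "y powr p = e / 2" using e p by (auto simp: y_def powr_powr)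
  define d where "d = e / 2 / y powr (p - real (2 * k))"
  have d: "0 < d" "y powr (p - real (2 * k)) * d = e / 2" using e y by (auto simp: d_def)
  obtain s0 where s0: "0 \<le> s0" "s0 < T"
    "\<And>s t. s0 \<le> s \<Longrightarrow> s \<le> t \<Longrightarrow> t < T \<Longrightarrow> (\<integral>\<^sup>+\<omega>. ennreal ((I t \<omega> - I s \<omega>) ^ (2 * k)) \<partial>M) \<le> ennreal d"
    using I_even_moment_small[OF k(2) d(1)] by blast
  have "(\<integral>\<^sup>+\<omega>. ennreal (\<bar>I t \<omega> - I s \<omega>\<bar> powr p) \<partial>M) \<le> ennreal e" if st: "s0 \<le> s" "s \<le> t" "t < T" for s t
  proof -
    have [measurable]: "I t \<in> borel_measurable M" "I s \<in> borel_measurable M" using st s0 by auto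
    have "(\<integral>\<^sup>+\<omega>. ennreal (\<bar>I t \<omega> - I s \<omega>\<bar> powr p) \<partial>M)
      \<le> (\<integral>\<^sup>+\<omega>. ennreal (e / 2) + ennreal (y powr (p - real (2 * k))) * ennreal ((I t \<omega> - I s \<omega>) ^ (2 * k)) \<partial>M)"
    proof (rule nn_integral_mono)
      fix \<omega>
      have "ennreal (\<bar>I t \<omega> - I s \<omega>\<bar> powr p) \<le> ennreal (e / 2 + y powr (p - real (2 * k)) * (I t \<omega> - I s \<omega>) ^ (2 * k))"
        using powr_le_add_even[OF y(1) p k(1), of "I t \<omega> - I s \<omega>"] y(2) by (intro ennreal_leI) simp
      also have "\<dots> = ennreal (e / 2) + ennreal (y powr (p - real (2 * k)) * (I t \<omega> - I s \<omega>) ^ (2 * k))"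
        using e by (intro ennreal_plus) (auto simp: zero_le_even_power)
      also have "ennreal (y powr (p - real (2 * k)) * (I t \<omega> - I s \<omega>) ^ (2 * k)) = ennreal (y powr (p - real (2 * k))) * ennreal ((I t \<omega> - I s \<omega>) ^ (2 * k))"
        by (intro ennreal_mult) (auto simp: zero_le_even_power)
      finally show "ennreal (\<bar>I t \<omega> - I s \<omega>\<bar> powr p) \<le> ennreal (e / 2) + ennreal (y powr (p - real (2 * k))) * ennreal ((I t \<omega> - I s \<omega>) ^ (2 * k))" .
    qed
    also have "\<dots> = ennreal (e / 2) + ennreal (y powr (p - real (2 * k))) * (\<integral>\<^sup>+\<omega>. ennreal ((I t \<omega> - I s \<omega>) ^ (2 * k)) \<partial>M)"
      by (subst nn_integral_add) (auto simp: nn_integral_cmult emeasure_space_1)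
    also have "\<dots> \<le> ennreal (e / 2) + ennreal (y powr (p - real (2 * k))) * ennreal d"
      by (intro add_left_mono mult_left_mono s0(3) st) auto
    also have "\<dots> = ennreal (e / 2) + ennreal (e / 2)"
      using d(1) by (simp only: ennreal_mult[symmetric] powr_ge_zero less_imp_le d(2))
    also have "\<dots> = ennreal e" using e by (subst ennreal_plus[symmetric]) auto
    finally show ?thesis .
  qed
  then show ?thesis using s0 that by blast
qed

text \<open>Freezing at time \<open>u\<close> expresses the integrals of the positive and the
  negative part through \<open>D\<close>; they agree because \<open>D\<close> is centred, and the
  moment bound of \<open>D\<close> with the shift of \<open>m1\<close> makes them finite.\<close>

lemma Z_increment_martingale:
  assumes u: "0 \<le> u" "u < c" "c < T" and E: "E \<in> sets (F u)"
  shows "integrable M (\<lambda>\<omega>. Z c \<omega> - Z u \<omega>)" and "(LINT \<omega>|M. (Z c \<omega> - Z u \<omega>) * indicator E \<omega>) = 0"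
proof -
  define \<delta> where "\<delta> = c - u"
  define \<tau> where "\<tau> = T - c"
  have d: "0 < \<tau>" "0 < \<delta>" "\<tau> + \<delta> \<le> T" using u by (auto simp: \<delta>_def \<tau>_def)
  have u': "0 \<le> u" "u < c" "c \<le> T" using u by auto
  let ?nd = "normal_density 0 (sqrt \<delta>)"
  define D' where "D' x y = v \<tau> (x + y) - v (\<tau> + \<delta>) x" for x y
  have D': "D' x y = D \<tau> \<delta> x y" for x y unfolding D'_def D_def[OF d] ..
  have Zd: "Z c \<omega> - Z u \<omega> = D' (W u \<omega>) (W c \<omega> - W u \<omega>)" for \<omega>
  proof -
    have "T - u = \<tau> + \<delta>" by (simp add: \<tau>_def \<delta>_def)
    then show ?thesis unfolding D'_def Z_def \<tau>_def[symmetric] by simp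
  qed
  have [measurable]: "W u \<in> borel_measurable (F u)" "E \<in> sets (F u)" using measurable_W_F[of u u] u E by auto
  have [measurable]: "W u \<in> borel_measurable M" "E \<in> sets M" "Z c \<in> borel_measurable M" "Z u \<in> borel_measurable M"
    using u E sets_F_subset[of u] measurable_F_M[OF measurable_Z[of c]] measurable_F_M[OF measurable_Z[of u]] by auto
  have step: "(\<integral>\<^sup>+\<omega>. f (Z c \<omega> - Z u \<omega>) * indicator B \<omega> \<partial>M)
      = (\<integral>\<^sup>+\<omega>. indicator B \<omega> * (\<integral>\<^sup>+y. f (D' (W u \<omega>) y) * ennreal (?nd y) \<partial>lborel) \<partial>M)"
    if f[measurable]: "f \<in> borel_measurable borel" and B[measurable]: "B \<in> sets (F u)" for f :: "real \<Rightarrow> ennreal" and B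
  proof -
    have [measurable]: "(\<lambda>z. f (D' (W u (fst z)) (snd z)) * indicator B (fst z)) \<in> borel_measurable (F u \<Otimes>\<^sub>M borel)"
      unfolding D'_def by measurable
    have "(\<integral>\<^sup>+\<omega>. f (Z c \<omega> - Z u \<omega>) * indicator B \<omega> \<partial>M) = (\<integral>\<^sup>+\<omega>. (\<lambda>z. f (D' (W u (fst z)) (snd z)) * indicator B (fst z)) (\<omega>, W c \<omega> - W u \<omega>) \<partial>M)"
      unfolding Zd by simp
    also have "\<dots> = (\<integral>\<^sup>+\<omega>. \<integral>\<^sup>+y. (\<lambda>z. f (D' (W u (fst z)) (snd z)) * indicator B (fst z)) (\<omega>, y) * ennreal (normal_density 0 (sqrt (c - u)) y) \<partial>lborel \<partial>M)"
      by (rule nn_integral_increment[OF u']) measurable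
    also have "\<dots> = (\<integral>\<^sup>+\<omega>. indicator B \<omega> * (\<integral>\<^sup>+y. f (D' (W u \<omega>) y) * ennreal (?nd y) \<partial>lborel) \<partial>M)"
    proof (rule nn_integral_cong)
      fix \<omega>
      have [measurable]: "(\<lambda>y. f (D' (W u \<omega>) y)) \<in> borel_measurable borel" unfolding D'_def by measurable
      show "(\<integral>\<^sup>+y. (\<lambda>z. f (D' (W u (fst z)) (snd z)) * indicator B (fst z)) (\<omega>, y) * ennreal (normal_density 0 (sqrt (c - u)) y) \<partial>lborel)
        = indicator B \<omega> * (\<integral>\<^sup>+y. f (D' (W u \<omega>) y) * ennreal (?nd y) \<partial>lborel)"
        by (subst nn_integral_cmult[symmetric]) (auto intro!: nn_integral_cong simp: \<delta>_def mult_ac)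
    qed
    finally show ?thesis .
  qed
  have fin: "(\<integral>\<^sup>+\<omega>. ennreal \<bar>Z c \<omega> - Z u \<omega>\<bar> * indicator (space M) \<omega> \<partial>M) < \<infinity>"
  proof -
    have "(\<integral>\<^sup>+\<omega>. ennreal \<bar>Z c \<omega> - Z u \<omega>\<bar> * indicator (space M) \<omega> \<partial>M)
       = (\<integral>\<^sup>+\<omega>. indicator (space M) \<omega> * (\<integral>\<^sup>+y. ennreal \<bar>D' (W u \<omega>) y\<bar> * ennreal (?nd y) \<partial>lborel) \<partial>M)"
      by (rule step) (use sets.top[of "F u"] in \<open>auto simp: space_F\<close>)
    also have "\<dots> \<le> (\<integral>\<^sup>+\<omega>. ennreal (Cp 1 * sqrt \<delta> * m1 \<tau> 0) * ennreal (exp (1 * \<bar>W u \<omega> - W 0 \<omega>\<bar>)) \<partial>M)"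
    proof (rule nn_integral_mono)
      fix \<omega> assume \<omega>: "\<omega> \<in> space M"
      have "(\<integral>\<^sup>+y. ennreal \<bar>D' (W u \<omega>) y\<bar> * ennreal (?nd y) \<partial>lborel) = ennreal (LINT y|lborel. \<bar>D \<tau> \<delta> (W u \<omega>) y\<bar> ^ 1 * ?nd y)"
        using D_moment(1)[OF d, of "W u \<omega>" 1]
        by (subst nn_integral_eq_integral[symmetric]) (auto simp: D' ennreal_mult)
      also have "\<dots> \<le> ennreal (Cp 1 * (sqrt \<delta> * m1 \<tau> (W u \<omega>)) ^ 1)"
        by (intro ennreal_leI D_moment(2)[OF d])
      also have "\<dots> \<le> ennreal (Cp 1 * (sqrt \<delta> * (exp \<bar>W u \<omega>\<bar> * m1 \<tau> 0)) ^ 1)"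
        using m1_shift[OF d(1), of 0 "W u \<omega>"] d Cp_nonneg[of 1] m1_nonneg[of \<tau>]
        by (intro ennreal_leI mult_left_mono power_mono) auto
      also have "\<dots> = ennreal (Cp 1 * sqrt \<delta> * m1 \<tau> 0) * ennreal (exp (1 * \<bar>W u \<omega> - W 0 \<omega>\<bar>))"
        using \<omega> d Cp_nonneg[of 1] m1_nonneg[of \<tau>] by (subst ennreal_mult[symmetric]) (auto simp: W_0 mult_ac)
      finally show "indicator (space M) \<omega> * (\<integral>\<^sup>+y. ennreal \<bar>D' (W u \<omega>) y\<bar> * ennreal (?nd y) \<partial>lborel) \<le> ennreal (Cp 1 * sqrt \<delta> * m1 \<tau> 0) * ennreal (exp (1 * \<bar>W u \<omega> - W 0 \<omega>\<bar>))"
        using \<omega> by simp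
    qed
    also have "\<dots> \<le> ennreal (1 + normal_exp_moment 0 (1 * sqrt T)) * (\<integral>\<^sup>+\<omega>. ennreal (Cp 1 * sqrt \<delta> * m1 \<tau> 0) \<partial>M)"
      using u by (intro nn_integral_exp_increment) auto
    also have "\<dots> < \<infinity>" by (simp add: emeasure_space_1 ennreal_mult_less_top)
    finally show ?thesis .
  qed
  show i: "integrable M (\<lambda>\<omega>. Z c \<omega> - Z u \<omega>)"
  proof (rule integrableI_bounded)
    have "(\<integral>\<^sup>+\<omega>. ennreal (norm (Z c \<omega> - Z u \<omega>)) \<partial>M) = (\<integral>\<^sup>+\<omega>. ennreal \<bar>Z c \<omega> - Z u \<omega>\<bar> * indicator (space M) \<omega> \<partial>M)"
      by (intro nn_integral_cong) simp
    then show "(\<integral>\<^sup>+\<omega>. ennreal (norm (Z c \<omega> - Z u \<omega>)) \<partial>M) < \<infinity>" using fin by simp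
  qed measurable
  have inner: "(\<integral>\<^sup>+y. ennreal (D' x y) * ennreal (?nd y) \<partial>lborel) = (\<integral>\<^sup>+y. ennreal (- D' x y) * ennreal (?nd y) \<partial>lborel)" for x
  proof -
    note iD = integrable_D[OF d, of x]
    have "(\<integral>\<^sup>+y. ennreal (D \<tau> \<delta> x y * ?nd y) \<partial>lborel) = (\<integral>\<^sup>+y. ennreal (- (D \<tau> \<delta> x y * ?nd y)) \<partial>lborel)"
      by (rule nn_integral_pos_eq_neg[OF iD integral_D[OF d]])
    moreover have "ennreal (D' x y) * ennreal (?nd y) = ennreal (D \<tau> \<delta> x y * ?nd y)"
      "ennreal (- D' x y) * ennreal (?nd y) = ennreal (- (D \<tau> \<delta> x y * ?nd y))" for y
      using ennreal_mult''[of "?nd y" "D \<tau> \<delta> x y"] ennreal_mult''[of "?nd y" "- D \<tau> \<delta> x y"]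
      by (simp_all only: D' normal_density_nonneg mult_minus_left)
    ultimately show ?thesis by simp
  qed
  have "(\<integral>\<^sup>+\<omega>. ennreal (Z c \<omega> - Z u \<omega>) * indicator E \<omega> \<partial>M) = (\<integral>\<^sup>+\<omega>. ennreal (- (Z c \<omega> - Z u \<omega>)) * indicator E \<omega> \<partial>M)"
    using step[of ennreal E] step[of "\<lambda>x. ennreal (- x)" E] inner by simp
  moreover have iA: "integrable M (\<lambda>\<omega>. (Z c \<omega> - Z u \<omega>) * indicator E \<omega>)" by (rule integrable_real_mult_indicator[OF _ i]) simp
  moreover have "(\<integral>\<^sup>+\<omega>. ennreal ((Z c \<omega> - Z u \<omega>) * indicator E \<omega>) \<partial>M) = (\<integral>\<^sup>+\<omega>. ennreal (Z c \<omega> - Z u \<omega>) * indicator E \<omega> \<partial>M)"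
    "(\<integral>\<^sup>+\<omega>. ennreal (- ((Z c \<omega> - Z u \<omega>) * indicator E \<omega>)) \<partial>M) = (\<integral>\<^sup>+\<omega>. ennreal (- (Z c \<omega> - Z u \<omega>)) * indicator E \<omega> \<partial>M)"
    by (auto intro!: nn_integral_cong simp: indicator_def)
  ultimately show "(LINT \<omega>|M. (Z c \<omega> - Z u \<omega>) * indicator E \<omega>) = 0"
    using real_lebesgue_integral_def[OF iA] by simp
qed

end

section \<open>Maximal oscillation of the gradient\<close>

text \<open>The scale \<open>t = 1 / sqrt a\<close> turns the weight
  \<open>exp (- a * s\<^sup>2)\<close> into \<open>exp (- y\<^sup>2)\<close>, and evaluation at
  \<open>x = - c\<close> yields a weighted square integral. From |x| <= x^2 + 1 the weighted
  integral of \<open>g\<close> itself is finite.\<close>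

lemma C_Y_gauss_tame:
  assumes g: "g \<in> C_Y"
  shows "gauss_tame (\<lambda>s. g (exp (s - c)))"
proof -
  have gm: "g \<in> borel_measurable (restrict_space borel {0<..})" using g by (simp add: C_Y_def)
  have "(\<lambda>s. exp (s - c)) \<in> measurable borel (restrict_space borel {0<..})"
    by (rule measurable_restrict_space2) auto
  then have [measurable]: "(\<lambda>s. g (exp (s - c))) \<in> borel_measurable borel"
    using gm by (rule measurable_compose)
  have "integrable lborel (\<lambda>s. g (exp (s - c)) * exp (- a * s\<^sup>2))" if a: "0 < a" for a
  proof -
    obtain m where m: "0 < m" "\<And>t. 0 < t \<Longrightarrow> (SUP x::real. ennreal (exp (- m * \<bar>x\<bar>)) *
          (\<integral>\<^sup>+ y. ennreal (\<bar>g (exp (x + t * y))\<bar>\<^sup>2 * exp (- y\<^sup>2)) \<partial>lborel)) < \<infinity>"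
      using g unfolding C_Y_def by blast
    define t where "t = 1 / sqrt a"
    have t: "0 < t" "t\<^sup>2 * a = 1" using a by (auto simp: t_def power_divide)
    have "ennreal (exp (- m * \<bar>- c\<bar>)) * (\<integral>\<^sup>+ y. ennreal (\<bar>g (exp (- c + t * y))\<bar>\<^sup>2 * exp (- y\<^sup>2)) \<partial>lborel) < \<infinity>"
      by (rule le_less_trans[OF SUP_upper m(2)[OF t(1)]]) simp
    then have fin: "(\<integral>\<^sup>+ y. ennreal (\<bar>g (exp (- c + t * y))\<bar>\<^sup>2 * exp (- y\<^sup>2)) \<partial>lborel) < \<infinity>"
      by (auto simp: ennreal_mult_less_top)
    have e: "exp (- a * (t * y)\<^sup>2) = exp (- y\<^sup>2)" for y
      using t by (simp add: power_mult_distrib mult.assoc[symmetric] mult.commute[of a])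
    have meas: "(\<lambda>s. ennreal ((g (exp (s - c)))\<^sup>2 * exp (- a * s\<^sup>2))) \<in> borel_measurable borel" by measurable
    have "(\<integral>\<^sup>+s. ennreal ((g (exp (s - c)))\<^sup>2 * exp (- a * s\<^sup>2)) \<partial>lborel)
        = ennreal \<bar>t\<bar> * (\<integral>\<^sup>+y. ennreal ((g (exp (0 + t * y - c)))\<^sup>2 * exp (- a * (0 + t * y)\<^sup>2)) \<partial>lborel)"
      using t by (intro nn_integral_real_affine[OF meas]) simp
    also have "(\<lambda>y. ennreal ((g (exp (0 + t * y - c)))\<^sup>2 * exp (- a * (0 + t * y)\<^sup>2)))
       = (\<lambda>y. ennreal (\<bar>g (exp (- c + t * y))\<bar>\<^sup>2 * exp (- y\<^sup>2)))"
      by (simp only: add_0 e power2_abs) (simp add: add.commute)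
    also have "ennreal \<bar>t\<bar> * (\<integral>\<^sup>+y. ennreal (\<bar>g (exp (- c + t * y))\<bar>\<^sup>2 * exp (- y\<^sup>2)) \<partial>lborel) < \<infinity>"
      using fin by (simp add: ennreal_mult_less_top)
    finally have i2: "integrable lborel (\<lambda>s. (g (exp (s - c)))\<^sup>2 * exp (- a * s\<^sup>2))"
      by (intro integrableI_nonneg) auto
    have i: "integrable lborel (\<lambda>s. (g (exp (s - c)))\<^sup>2 * exp (- a * s\<^sup>2) + exp (- a * s\<^sup>2))"
      by (intro Bochner_Integration.integrable_add i2 integrable_exp_minus_square a)
    show ?thesis
    proof (rule Bochner_Integration.integrable_bound[OF i])
      show "AE s in lborel. norm (g (exp (s - c)) * exp (- a * s\<^sup>2)) \<le> norm ((g (exp (s - c)))\<^sup>2 * exp (- a * s\<^sup>2) + exp (- a * s\<^sup>2))"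
      proof (rule AE_I2)
        fix s
        define x where "x = g (exp (s - c))"
        have "\<bar>x\<bar> \<le> x\<^sup>2 + 1"
        proof -
          have "0 \<le> (\<bar>x\<bar> - 1)\<^sup>2 + \<bar>x\<bar>" by simp
          then show ?thesis by (simp add: power2_eq_square algebra_simps)
        qed
        then have "\<bar>x\<bar> * exp (- a * s\<^sup>2) \<le> (x\<^sup>2 + 1) * exp (- a * s\<^sup>2)" by (rule mult_right_mono) simp
        then show "norm (g (exp (s - c)) * exp (- a * s\<^sup>2)) \<le> norm ((g (exp (s - c)))\<^sup>2 * exp (- a * s\<^sup>2) + exp (- a * s\<^sup>2))"
          unfolding x_def[symmetric] real_norm_def by (simp add: abs_mult distrib_right)
      qed
    qed measurable
  qed
  then show ?thesis by (simp add: gauss_tame_def)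
qed

context brownian begin

text \<open>The exceptional set has measure zero under the product law, hence Gaussian measure zero
  in almost every section. As the normal density is strictly positive, these sections are Lebesgue
  null.\<close>

lemma AE_increment:
  assumes s: "0 \<le> s" "s < t" "t \<le> T" and P: "{z \<in> space (F s \<Otimes>\<^sub>M borel). \<not> P z} \<in> sets (F s \<Otimes>\<^sub>M borel)"
    and AE: "AE \<omega> in M. P (\<omega>, W t \<omega> - W s \<omega>)"
  shows "AE \<omega> in M. AE y in lborel. P (\<omega>, y)"
proof -
  define B where "B = {z \<in> space (F s \<Otimes>\<^sub>M borel). \<not> P z}"
  let ?n = "normal_density 0 (sqrt (t - s))"
  have [measurable]: "B \<in> sets (F s \<Otimes>\<^sub>M borel)" using P by (simp add: B_def)
  have "(\<integral>\<^sup>+\<omega>. indicator B (\<omega>, W t \<omega> - W s \<omega>) \<partial>M) = (\<integral>\<^sup>+\<omega>. 0 \<partial>M)"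
    using AE by (intro nn_integral_cong_AE) (auto simp: B_def indicator_def)
  then have "(\<integral>\<^sup>+\<omega>. \<integral>\<^sup>+y. indicator B (\<omega>, y) * ennreal (?n y) \<partial>lborel \<partial>M) = 0"
    using nn_integral_increment[OF s, of "indicator B"] by simp
  moreover have m: "(\<lambda>\<omega>. \<integral>\<^sup>+y. indicator B (\<omega>, y) * ennreal (?n y) \<partial>lborel) \<in> borel_measurable M"
  proof (rule measurable_F_M[of _ s])
    have "(\<lambda>z. indicator B z * ennreal (?n (snd z))) \<in> borel_measurable (F s \<Otimes>\<^sub>M lborel)" by measurable
    then show "(\<lambda>\<omega>. \<integral>\<^sup>+y. indicator B (\<omega>, y) * ennreal (?n y) \<partial>lborel) \<in> borel_measurable (F s)"
      using lborel.borel_measurable_nn_integral_fst[of "\<lambda>z. indicator B z * ennreal (?n (snd z))" "F s"] by simp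
  qed
  ultimately have "AE \<omega> in M. (\<integral>\<^sup>+y. indicator B (\<omega>, y) * ennreal (?n y) \<partial>lborel) = 0"
    by (subst (asm) nn_integral_0_iff_AE) auto
  then show ?thesis using AE_space
  proof eventually_elim
    case (elim \<omega>)
    have \<omega>: "\<omega> \<in> space (F s)" using elim(2) by (simp add: space_F)
    have [measurable]: "(\<lambda>y. indicator B (\<omega>, y) :: ennreal) \<in> borel_measurable borel"
      by (rule measurable_Pair2[OF _ \<omega>]) measurable
    have "AE y in lborel. indicator B (\<omega>, y) * ennreal (?n y) = 0"
      using elim(1) by (subst (asm) nn_integral_0_iff_AE) auto
    then show ?case
    proof eventually_elim
      case (elim y)
      have "0 < ?n y" using s by (intro normal_density_pos) simp
      then have "ennreal (?n y) \<noteq> 0" by simp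
      then have "(\<omega>, y) \<notin> B" using elim by (auto simp: indicator_def split: if_splits)
      then show ?case using \<omega> by (auto simp: B_def space_pair_measure)
    qed
  qed
qed

lemma maximal_oscillation_grad:
  assumes g: "g \<in> C_Y" shows "maximal_oscillation M T (grad_process M T W g)"
proof -
  define h where "h = (\<lambda>s. g (exp (s - T / 2)))"
  have h: "gauss_tame h" unfolding h_def by (rule C_Y_gauss_tame[OF g])
  have bm: "brownian M T W" by unfold_locales
  define \<psi> where "\<psi> t x = dheat (T - t) h x / exp (x - t / 2)" for t x
  have \<psi>: "grad_process M T W g t \<omega> = \<psi> t (W t \<omega>)" if "0 \<le> t" "t < T" for t \<omega>
    using grad_process_eq[OF bm h[unfolded h_def] that] by (simp add: \<psi>_def h_def gbm_def)
  have [measurable]: "\<psi> t \<in> borel_measurable borel" for t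
    unfolding \<psi>_def[abs_def] using borel_measurable_dheat[OF gauss_tame_measurable[OF h]] by measurable
  have W_T: "W t \<in> borel_measurable M" if "0 \<le> t" "t < T" for t using that by simp
  have meas: "(\<lambda>\<omega>. grad_process M T W g t \<omega> - grad_process M T W g s \<omega>) \<in> borel_measurable M"
    if "0 \<le> t" "t < T" "0 \<le> s" "s < T" for s t
  proof -
    note [measurable] = W_T[OF that(1,2)] W_T[OF that(3,4)]
    show ?thesis unfolding \<psi>[OF that(1,2)] \<psi>[OF that(3,4)] by measurable
  qed
  have key: "Lp_norm \<infinity> M (\<lambda>\<omega>. grad_process M T W g t \<omega> - grad_process M T W g 0 \<omega>)
      \<le> 2 * Lp_norm \<infinity> M (\<lambda>\<omega>. grad_process M T W g t \<omega> - grad_process M T W g s \<omega>)"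
    if t: "0 < t" "t < T" and s: "0 \<le> s" "s < t" for s t
  proof (cases "Lp_norm \<infinity> M (\<lambda>\<omega>. grad_process M T W g t \<omega> - grad_process M T W g s \<omega>)")
    case top
    then show ?thesis by (simp add: ennreal_mult_eq_top_iff)
  next
    case (real C)
    have tt: "0 \<le> t" "t < T" "0 \<le> s" "s < T" "t \<le> T" using t s by auto
    note [measurable] = W_T[OF tt(1,2)] W_T[OF tt(3,4)]
    have "AE \<omega> in M. ennreal \<bar>grad_process M T W g t \<omega> - grad_process M T W g s \<omega>\<bar> \<le> ennreal C"
      using esssup_AE[of "\<lambda>\<omega>. ennreal \<bar>grad_process M T W g t \<omega> - grad_process M T W g s \<omega>\<bar>" M] real
      by (simp add: Lp_norm_def)
    then have 1: "AE \<omega> in M. (\<lambda>z. \<bar>\<psi> t (W s (fst z) + snd z) - \<psi> s (W s (fst z))\<bar> \<le> C) (\<omega>, W t \<omega> - W s \<omega>)"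
      unfolding \<psi>[OF tt(1,2)] \<psi>[OF tt(3,4)] using real by simp
    have [measurable]: "W s \<in> borel_measurable (F s)" using measurable_W_F[of s s] tt by simp
    have "AE \<omega> in M. AE y in lborel. (\<lambda>z. \<bar>\<psi> t (W s (fst z) + snd z) - \<psi> s (W s (fst z))\<bar> \<le> C) (\<omega>, y)"
      by (rule AE_increment[OF s(1,2) tt(5) _ 1]) measurable
    then have 2: "AE \<omega> in M. AE y in lborel. \<bar>\<psi> t (W s \<omega> + y) - \<psi> s (W s \<omega>)\<bar> \<le> C" by simp
    \<comment> \<open>One sample point is enough: an almost sure property of a probability space has
      a witness.\<close>
    obtain \<omega> where \<omega>: "AE y in lborel. \<bar>\<psi> t (W s \<omega> + y) - \<psi> s (W s \<omega>)\<bar> \<le> C"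
    proof (rule ccontr)
      assume "\<not> thesis"
      then have "\<not> (AE y in lborel. \<bar>\<psi> t (W s \<omega> + y) - \<psi> s (W s \<omega>)\<bar> \<le> C)" for \<omega> using that by blast
      then have "AE \<omega> in M. False" using 2 by simp
      then show False by simp
    qed
    define c0 where "c0 = \<psi> s (W s \<omega>)"
    \<comment> \<open>With the sample point fixed, \<open>W s \<omega>\<close> is a constant shift,
      and Lebesgue null sets are translation invariant. The bound thus holds for almost every
      position \<open>x\<close>.\<close>
    have ae: "AE x in lborel. \<bar>\<psi> t x - c0\<bar> \<le> C"
    proof -
      have "AE y in lborel. \<bar>\<psi> t (W s \<omega> + y) - c0\<bar> \<le> C" using \<omega> by (simp add: c0_def)
      then have "AE y in lborel. \<bar>\<psi> t (W s \<omega> + (- W s \<omega> + 1 * y)) - c0\<bar> \<le> C"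
        by (rule AE_borel_affine[rotated 2]) auto
      then show ?thesis by simp
    qed
    have dW: "distributed M lborel (\<lambda>\<omega>. W t \<omega> - W 0 \<omega>) (normal_density 0 (sqrt t))"
      using distributed_increment[of 0 t] t by simp
    have aeW: "AE \<omega> in M. \<bar>\<psi> t (W t \<omega>) - c0\<bar> \<le> C"
    proof -
      have "AE x in density lborel (normal_density 0 (sqrt t)). \<bar>\<psi> t x - c0\<bar> \<le> C"
        using ae by (subst AE_density) auto
      then have "AE x in distr M lborel (\<lambda>\<omega>. W t \<omega> - W 0 \<omega>). \<bar>\<psi> t x - c0\<bar> \<le> C"
        unfolding distributed_distr_eq_density[OF dW] .
      then have "AE \<omega> in M. \<bar>\<psi> t (W t \<omega> - W 0 \<omega>) - c0\<bar> \<le> C"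
        using t by (subst (asm) AE_distr_iff) auto
      then show ?thesis using AE_space by eventually_elim (simp add: W_0)
    qed
    define n where "n = normal_density 0 (sqrt t)"
    have st: "0 < sqrt t" using t by simp
    have Tt: "0 < T - t" using t by simp
    text \<open>\<open>exp (x - t / 2)\<close> times the centred normal density is the density shifted by \<open>t\<close>, and the
      gradient is a martingale under this change of measure.\<close>
    have shift: "exp (x - t / 2) * n x = normal_density t (sqrt t) x" for x
    proof -
      have "x - t / 2 + - x\<^sup>2 / (2 * t) = - (x - t)\<^sup>2 / (2 * t)" using t by (simp add: field_simps power2_eq_square)
      then have "exp (x - t / 2) * exp (- x\<^sup>2 / (2 * t)) = exp (- (x - t)\<^sup>2 / (2 * t))" by (simp flip: exp_add)
      then show ?thesis using t by (simp add: n_def normal_density_def)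
    qed
    have "\<psi> 0 0 = dheat (t + (T - t)) h 0" by (simp add: \<psi>_def)
    also have "\<dots> = (LINT y|lborel. dheat (T - t) h y * n y)"
      using dheat_semigroup(2)[OF h t(1) Tt, of 0] by (simp add: heat_def n_def)
    also have "(\<lambda>y. dheat (T - t) h y * n y) = (\<lambda>y. \<psi> t y * normal_density t (sqrt t) y)"
      unfolding shift[symmetric] by (auto simp: \<psi>_def)
    finally have \<psi>0: "\<psi> 0 0 = (LINT y|lborel. \<psi> t y * normal_density t (sqrt t) y)" .
    have i: "integrable lborel (\<lambda>y. \<psi> t y * normal_density t (sqrt t) y)"
    proof -
      have "integrable lborel (\<lambda>y. dheat (T - t) h y * n y)"
        unfolding n_def by (rule dheat_semigroup(1)[OF h t(1) Tt])
      also have "(\<lambda>y. dheat (T - t) h y * n y) = (\<lambda>y. \<psi> t y * normal_density t (sqrt t) y)"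
        unfolding shift[symmetric] by (auto simp: \<psi>_def)
      finally show ?thesis .
    qed
    have "\<psi> 0 0 - c0 = (LINT y|lborel. (\<psi> t y - c0) * normal_density t (sqrt t) y)"
      unfolding left_diff_distrib \<psi>0 using i st by (subst Bochner_Integration.integral_diff) auto
    then have "\<bar>\<psi> 0 0 - c0\<bar> \<le> (LINT y|lborel. \<bar>(\<psi> t y - c0) * normal_density t (sqrt t) y\<bar>)"
      by (simp only: integral_abs_bound)
    also have "\<dots> \<le> (LINT y|lborel. C * normal_density t (sqrt t) y)"
    proof (rule integral_mono_AE)
      show "integrable lborel (\<lambda>y. \<bar>(\<psi> t y - c0) * normal_density t (sqrt t) y\<bar>)"
        unfolding left_diff_distrib using i st by (intro integrable_abs Bochner_Integration.integrable_diff) auto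
      show "AE y in lborel. \<bar>(\<psi> t y - c0) * normal_density t (sqrt t) y\<bar> \<le> C * normal_density t (sqrt t) y"
        using ae by eventually_elim (simp only: abs_mult abs_of_nonneg normal_density_nonneg mult_right_mono)
    qed (use st in auto)
    also have "\<dots> = C" using st by simp
    finally have c0: "\<bar>\<psi> 0 0 - c0\<bar> \<le> C" .
    have "AE \<omega> in M. ennreal \<bar>grad_process M T W g t \<omega> - grad_process M T W g 0 \<omega>\<bar> \<le> ennreal (2 * C)"
      using aeW AE_space
    proof eventually_elim
      case (elim \<omega>)
      then have "\<bar>\<psi> t (W t \<omega>) - \<psi> 0 (W 0 \<omega>)\<bar> \<le> 2 * C" using c0 by (simp add: W_0)
      then show ?case using \<psi>[OF tt(1,2)] \<psi>[of 0] T_pos by (simp add: ennreal_leI)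
    qed
    then have "Lp_norm \<infinity> M (\<lambda>\<omega>. grad_process M T W g t \<omega> - grad_process M T W g 0 \<omega>) \<le> ennreal (2 * C)"
      unfolding Lp_norm_def using meas[OF tt(1,2), of 0] T_pos by (auto intro!: esssup_I)
    also have "\<dots> = 2 * ennreal C" using real by (simp add: ennreal_mult)
    finally show ?thesis using real by simp
  qed
  show ?thesis unfolding maximal_oscillation_def
  proof (intro exI[of _ 2] conjI ballI)
    fix t assume t: "t \<in> {0<..<T}"
    show "ennreal (1 / 2) * Lp_norm \<infinity> M (\<lambda>\<omega>. grad_process M T W g t \<omega> - grad_process M T W g 0 \<omega>) \<le> lower_osc M (grad_process M T W g) t"
      unfolding lower_osc_def
    proof (rule INF_greatest)
      fix s assume s: "s \<in> {0..<t}"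
      have "ennreal (1 / 2) * Lp_norm \<infinity> M (\<lambda>\<omega>. grad_process M T W g t \<omega> - grad_process M T W g 0 \<omega>)
        \<le> ennreal (1 / 2) * (2 * Lp_norm \<infinity> M (\<lambda>\<omega>. grad_process M T W g t \<omega> - grad_process M T W g s \<omega>))"
        using key[of t s] t s by (intro mult_left_mono) auto
      also have "\<dots> = (ennreal (1 / 2) * ennreal 2) * Lp_norm \<infinity> M (\<lambda>\<omega>. grad_process M T W g t \<omega> - grad_process M T W g s \<omega>)"
        by (simp add: mult.assoc)
      also have "ennreal (1 / 2) * ennreal 2 = 1" by (subst ennreal_mult[symmetric]) auto
      finally show "ennreal (1 / 2) * Lp_norm \<infinity> M (\<lambda>\<omega>. grad_process M T W g t \<omega> - grad_process M T W g 0 \<omega>)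
        \<le> Lp_norm \<infinity> M (\<lambda>\<omega>. grad_process M T W g t \<omega> - grad_process M T W g s \<omega>)" by simp
    qed
  qed simp
qed

end

section \<open>Convergence at the terminal time\<close>

context hoelder_brownian begin

lemma I_even_moment_finite:
  assumes k: "1 \<le> k"
  obtains B where "0 \<le> B" "\<And>s t. 0 \<le> s \<Longrightarrow> s \<le> t \<Longrightarrow> t < T \<Longrightarrow> (\<integral>\<^sup>+\<omega>. ennreal ((I t \<omega> - I s \<omega>) ^ (2 * k)) \<partial>M) \<le> ennreal B"
proof -
  obtain C where C: "0 \<le> C" "\<And>s y. 0 \<le> s \<Longrightarrow> Q s y \<le> ennreal (C * exp (2 * \<theta> * y))" using Q_bound by blast
  define x where "x = 4 * T powr (\<theta> - 1) * C"
  have x: "0 \<le> x" using C(1) by (simp add: x_def)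
  have "(\<integral>\<^sup>+\<omega>. ennreal ((I t \<omega> - I s \<omega>) ^ (2 * k)) \<partial>M) \<le> ennreal (2 * cA k * x ^ k)" if st: "0 \<le> s" "s \<le> t" "t < T" for s t
  proof -
    have "(\<integral>\<^sup>+\<omega>. ennreal (1 * (I t \<omega> - I s \<omega>) ^ (2 * k)) \<partial>M)
      \<le> (\<integral>\<^sup>+\<omega>. ennreal 1 * (ennreal (2 * cA k) * (ennreal (4 * T powr (\<theta> - 1)) * Q s (W 0 \<omega>)) ^ k) \<partial>M)"
      using st by (intro I_moment k) auto
    also have "\<dots> \<le> (\<integral>\<^sup>+\<omega>. ennreal (2 * cA k * x ^ k) \<partial>M)"
    proof (rule nn_integral_mono)
      fix \<omega> assume "\<omega> \<in> space M"
      then have "ennreal (2 * cA k) * (ennreal (4 * T powr (\<theta> - 1)) * Q s (W 0 \<omega>)) ^ k \<le> ennreal (2 * cA k) * (ennreal (4 * T powr (\<theta> - 1)) * ennreal C) ^ k"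
        using C(2)[OF st(1), of 0] by (intro mult_left_mono power_mono) (auto simp: W_0)
      also have "ennreal (4 * T powr (\<theta> - 1)) * ennreal C = ennreal x" unfolding x_def using C(1) by (intro ennreal_mult[symmetric]) auto
      also have "ennreal (2 * cA k) * ennreal x ^ k = ennreal (2 * cA k * x ^ k)"
        using x cA_nonneg[of k] by (simp only: ennreal_power ennreal_mult mult_nonneg_nonneg zero_le_numeral zero_le_power)
      finally show "ennreal 1 * (ennreal (2 * cA k) * (ennreal (4 * T powr (\<theta> - 1)) * Q s (W 0 \<omega>)) ^ k) \<le> ennreal (2 * cA k * x ^ k)"
        by simp
    qed
    also have "\<dots> = ennreal (2 * cA k * x ^ k)" by (simp add: emeasure_space_1)
    finally show ?thesis by simp
  qed
  then show ?thesis using x cA_nonneg[of k] by (intro that[of "2 * cA k * x ^ k"]) auto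
qed

lemma I_powr_moment_finite:
  assumes p: "0 < p"
  obtains B where "0 \<le> B" "\<And>s t. 0 \<le> s \<Longrightarrow> s \<le> t \<Longrightarrow> t < T \<Longrightarrow> (\<integral>\<^sup>+\<omega>. ennreal (\<bar>I t \<omega> - I s \<omega>\<bar> powr p) \<partial>M) \<le> ennreal B"
proof -
  obtain k :: nat where "p / 2 \<le> k" using real_arch_simple by blast
  then have k: "p \<le> real (2 * k)" "1 \<le> k" using p by (cases k; auto)+
  obtain B where B: "0 \<le> B" "\<And>s t. 0 \<le> s \<Longrightarrow> s \<le> t \<Longrightarrow> t < T \<Longrightarrow> (\<integral>\<^sup>+\<omega>. ennreal ((I t \<omega> - I s \<omega>) ^ (2 * k)) \<partial>M) \<le> ennreal B"
    using I_even_moment_finite[OF k(2)] by blast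
  have "(\<integral>\<^sup>+\<omega>. ennreal (\<bar>I t \<omega> - I s \<omega>\<bar> powr p) \<partial>M) \<le> ennreal (1 + B)" if st: "0 \<le> s" "s \<le> t" "t < T" for s t
  proof -
    have [measurable]: "I t \<in> borel_measurable M" "I s \<in> borel_measurable M" using st by auto
    have "(\<integral>\<^sup>+\<omega>. ennreal (\<bar>I t \<omega> - I s \<omega>\<bar> powr p) \<partial>M) \<le> (\<integral>\<^sup>+\<omega>. 1 + ennreal ((I t \<omega> - I s \<omega>) ^ (2 * k)) \<partial>M)"
    proof (rule nn_integral_mono)
      fix \<omega>
      have "ennreal (\<bar>I t \<omega> - I s \<omega>\<bar> powr p) \<le> ennreal (1 + (I t \<omega> - I s \<omega>) ^ (2 * k))"
        using powr_le_add_even[of 1, OF _ p k(1), of "I t \<omega> - I s \<omega>"] by (intro ennreal_leI) simp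
      also have "\<dots> = 1 + ennreal ((I t \<omega> - I s \<omega>) ^ (2 * k))" by (subst ennreal_plus) (auto simp: zero_le_even_power)
      finally show "ennreal (\<bar>I t \<omega> - I s \<omega>\<bar> powr p) \<le> 1 + ennreal ((I t \<omega> - I s \<omega>) ^ (2 * k))" .
    qed
    also have "\<dots> = 1 + (\<integral>\<^sup>+\<omega>. ennreal ((I t \<omega> - I s \<omega>) ^ (2 * k)) \<partial>M)"
      by (subst nn_integral_add) (auto simp: emeasure_space_1)
    also have "\<dots> \<le> 1 + ennreal B" by (intro add_left_mono B(2) st)
    also have "\<dots> = ennreal (1 + B)" using B(1) by simp
    finally show ?thesis .
  qed
  then show ?thesis using B(1) by (intro that[of "1 + B"]) auto
qed

section \<open>Martingale property of the fractional integral and Doob's inequality\<close>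

lemma integrable_I_diff:
  assumes st: "0 \<le> s" "s \<le> t" "t < T" shows "integrable M (\<lambda>\<omega>. I t \<omega> - I s \<omega>)"
proof (rule I_powr_moment_finite[OF zero_less_one])
  fix B assume B: "\<And>s t. 0 \<le> s \<Longrightarrow> s \<le> t \<Longrightarrow> t < T \<Longrightarrow> (\<integral>\<^sup>+\<omega>. ennreal (\<bar>I t \<omega> - I s \<omega>\<bar> powr 1) \<partial>M) \<le> ennreal B"
  have [measurable]: "I t \<in> borel_measurable M" "I s \<in> borel_measurable M" using st by auto
  show ?thesis
  proof (rule integrableI_bounded)
    have "(\<integral>\<^sup>+\<omega>. ennreal (norm (I t \<omega> - I s \<omega>)) \<partial>M) \<le> ennreal B" using B[OF st] by simp
    then show "(\<integral>\<^sup>+\<omega>. ennreal (norm (I t \<omega> - I s \<omega>)) \<partial>M) < \<infinity>" by (rule le_less_trans) simp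
  qed measurable
qed

lemma N_martingale:
  assumes s: "0 \<le> s" "s < t" "t < T" and E: "E \<in> sets (F s)"
  shows "integrable M (\<lambda>\<omega>. N s t n n \<omega> * indicator E \<omega>)" "(LINT \<omega>|M. N s t n n \<omega> * indicator E \<omega>) = 0"
proof -
  have EM: "E \<in> sets M" using E sets_F_subset by auto
  have st: "integrable M (\<lambda>\<omega>. fk.w (grid s t n (Suc i)) * ((Z (grid s t n (Suc i)) \<omega> - Z (grid s t n i) \<omega>) * indicator E \<omega>))
      \<and> (LINT \<omega>|M. fk.w (grid s t n (Suc i)) * ((Z (grid s t n (Suc i)) \<omega> - Z (grid s t n i) \<omega>) * indicator E \<omega>)) = 0"
    if i: "i < n" for i
  proof -
    have b: "0 \<le> grid s t n i" "grid s t n i < grid s t n (Suc i)" "grid s t n (Suc i) < T" "s \<le> grid s t n i"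
    proof -
      have "0 < (t - s) / n" using s i by simp
      then show "grid s t n i < grid s t n (Suc i)" by (simp add: grid_Suc)
    qed (use grid_bounds[of s t i n] grid_bounds[of s t "Suc i" n] s i in auto)
    have "E \<in> sets (F (grid s t n i))" using E sets_F_mono[OF b(4)] by auto
    note m = Z_increment_martingale[OF b(1-3) this]
    have "integrable M (\<lambda>\<omega>. (Z (grid s t n (Suc i)) \<omega> - Z (grid s t n i) \<omega>) * indicator E \<omega>)"
      by (rule integrable_real_mult_indicator[OF EM m(1)])
    then show ?thesis using m(2) by (simp only: integral_mult_right_zero integrable_mult_right mult_zero_right simp_thms)
  qed
  have eq: "(\<lambda>\<omega>. N s t n n \<omega> * indicator E \<omega>) = (\<lambda>\<omega>. \<Sum>i<n. fk.w (grid s t n (Suc i)) * ((Z (grid s t n (Suc i)) \<omega> - Z (grid s t n i) \<omega>) * indicator E \<omega>))"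
    by (simp add: N_def sum_distrib_right mult.assoc)
  show "integrable M (\<lambda>\<omega>. N s t n n \<omega> * indicator E \<omega>)" unfolding eq by (intro Bochner_Integration.integrable_sum) (use st in blast)
  show "(LINT \<omega>|M. N s t n n \<omega> * indicator E \<omega>) = 0"
  proof -
    have "(LINT \<omega>|M. (\<Sum>i<n. fk.w (grid s t n (Suc i)) * ((Z (grid s t n (Suc i)) \<omega> - Z (grid s t n i) \<omega>) * indicator E \<omega>)))
        = (\<Sum>i<n. LINT \<omega>|M. fk.w (grid s t n (Suc i)) * ((Z (grid s t n (Suc i)) \<omega> - Z (grid s t n i) \<omega>) * indicator E \<omega>))"
      by (rule Bochner_Integration.integral_sum) (use st in blast)
    also have "\<dots> = 0" by (rule sum.neutral) (use st in blast)
    finally show ?thesis unfolding eq .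
  qed
qed

text \<open>Boundedness in L2 is the uniform integrability that lets the martingale identity pass
  from the sums to the limit; the index \<open>n0\<close> ensures a mesh below
  \<open>T - t\<close>.\<close>

lemma N_L2_bounded:
  assumes s: "0 \<le> s" "s < t" "t < T"
  obtains B n0 where "0 \<le> B" "\<And>n. n0 \<le> n \<Longrightarrow> (\<integral>\<^sup>+\<omega>. ennreal ((N s t n n \<omega>)\<^sup>2) \<partial>M) \<le> ennreal B"
proof -
  obtain C where C: "0 \<le> C" "\<And>s y. 0 \<le> s \<Longrightarrow> Q s y \<le> ennreal (C * exp (2 * \<theta> * y))" using Q_bound by blast
  define x where "x = 4 * T powr (\<theta> - 1) * C"
  have x: "0 \<le> x" using C(1) by (simp add: x_def)
  obtain n0 :: nat where n0: "(t - s) / (T - t) < n0" using reals_Archimedean2 by blast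
  have "(\<integral>\<^sup>+\<omega>. ennreal ((N s t n n \<omega>)\<^sup>2) \<partial>M) \<le> ennreal (2 * cA 1 * x)" if n: "n0 \<le> n" for n
  proof -
    have "(t - s) / (T - t) < n" using n0 n by linarith
    moreover have "0 < (t - s) / (T - t)" using s by simp
    ultimately have "0 < real n" by linarith
    moreover have "t - s < n * (T - t)" using \<open>(t - s) / (T - t) < n\<close> s by (simp add: pos_divide_less_eq)
    ultimately have n': "(t - s) / n \<le> T - t" "0 < n" by (auto simp: pos_divide_le_eq mult.commute)
    have S: "S s t n n 0 \<le> x"
    proof -
      have "ennreal (S s t n n 0) \<le> ennreal (4 * T powr (\<theta> - 1)) * ennreal C"
      proof -
        have "Q s 0 \<le> ennreal C" using C(2)[OF s(1), of 0] by simp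
        then show ?thesis using S_le_Q[OF s n', of 0] by (meson order_trans mult_left_mono zero_le)
      qed
      also have "\<dots> = ennreal x" unfolding x_def using C(1) by (intro ennreal_mult[symmetric]) auto
      finally show ?thesis using x by (simp add: ennreal_le_iff)
    qed
    have "(\<integral>\<^sup>+\<omega>. ennreal (1 * N s t n n \<omega> ^ (2 * 1)) \<partial>M) \<le> (\<integral>\<^sup>+\<omega>. ennreal (1 * (2 * cA 1 * S s t n n (W 0 \<omega>) ^ 1)) \<partial>M)"
      using s by (intro N_moment) auto
    also have "\<dots> \<le> (\<integral>\<^sup>+\<omega>. ennreal (2 * cA 1 * x) \<partial>M)"
      using S cA_nonneg[of 1] by (intro nn_integral_mono ennreal_leI) (auto simp: W_0 intro!: mult_left_mono)
    also have "\<dots> = ennreal (2 * cA 1 * x)" by (simp add: emeasure_space_1)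
    finally show ?thesis by simp
  qed
  then show ?thesis using x cA_nonneg[of 1] by (intro that[of "2 * cA 1 * x" n0]) auto
qed

text \<open>Positive and negative parts of the weighted sums have equal integrals over
  \<open>E\<close>. Each of the two integrals passes to the limit separately, so the limits agree as
  well.\<close>

lemma I_martingale:
  assumes s: "0 \<le> s" "s \<le> t" "t < T" and E: "E \<in> sets (F s)"
  shows "(LINT \<omega>|M. (I t \<omega> - I s \<omega>) * indicator E \<omega>) = 0"
proof (cases "s = t")
  case False
  then have st: "0 \<le> s" "s < t" "t < T" using s by auto
  have EM[measurable]: "E \<in> sets M" using E sets_F_subset by auto
  define X where "X \<omega> = I t \<omega> - I s \<omega>" for \<omega>
  obtain B n0 where B: "0 \<le> B" "\<And>n. n0 \<le> n \<Longrightarrow> (\<integral>\<^sup>+\<omega>. ennreal ((N s t n n \<omega>)\<^sup>2) \<partial>M) \<le> ennreal B"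
    using N_L2_bounded[OF st] by blast
  define Y where "Y n \<omega> = N s t (n + n0) (n + n0) \<omega>" for n \<omega>
  have Ym[measurable]: "Y n \<in> borel_measurable M" for n
    unfolding Y_def using measurable_F_M[OF measurable_N[OF st order_refl, of "n + n0"]] by simp
  have Yl: "(\<lambda>n. Y n \<omega>) \<longlonglongrightarrow> X \<omega>" if "\<omega> \<in> space M" for \<omega>
    unfolding Y_def X_def by (rule LIMSEQ_ignore_initial_segment[OF N_tendsto[OF st that]])
  \<comment> \<open>The values 1 and -1 of \<open>c\<close> select the positive and the negative
    part, since \<open>ennreal\<close> cuts off at 0. Fatou's lemma gives one inequality,
    boundedness in L2 the other.\<close>
  have lim: "liminf (\<lambda>n. \<integral>\<^sup>+\<omega>. ennreal (c * Y n \<omega>) * indicator E \<omega> \<partial>M) = (\<integral>\<^sup>+\<omega>. ennreal (c * X \<omega>) * indicator E \<omega> \<partial>M)"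
    if c: "\<bar>c\<bar> = 1" for c :: real
  proof (rule antisym)
    have *: "ennreal (max 0 x) = ennreal x" for x by (simp add: max_def ennreal_neg)
    have "liminf (\<lambda>n. \<integral>\<^sup>+\<omega>. ennreal (max 0 (c * Y n \<omega>)) * indicator E \<omega> \<partial>M) \<le> (\<integral>\<^sup>+\<omega>. ennreal (max 0 (c * X \<omega>)) * indicator E \<omega> \<partial>M)"
    proof (rule nn_integral_limit_L2_bounded[where K = B])
      show "(\<lambda>n. max 0 (c * Y n \<omega>)) \<longlonglongrightarrow> max 0 (c * X \<omega>)" if "\<omega> \<in> space M" for \<omega>
        by (intro tendsto_intros Yl that)
      show "(\<integral>\<^sup>+\<omega>. ennreal ((max 0 (c * Y n \<omega>))\<^sup>2) * indicator E \<omega> \<partial>M) \<le> ennreal B" for n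
      proof -
        have c2: "c\<^sup>2 = 1" using c by (metis power2_abs power_one)
        have "(\<integral>\<^sup>+\<omega>. ennreal ((max 0 (c * Y n \<omega>))\<^sup>2) * indicator E \<omega> \<partial>M) \<le> (\<integral>\<^sup>+\<omega>. ennreal ((Y n \<omega>)\<^sup>2) \<partial>M)"
        proof (rule nn_integral_mono)
          fix \<omega>
          have "(max 0 (c * Y n \<omega>))\<^sup>2 \<le> (Y n \<omega>)\<^sup>2" using c2 by (simp add: max_def power_mult_distrib)
          then show "ennreal ((max 0 (c * Y n \<omega>))\<^sup>2) * indicator E \<omega> \<le> ennreal ((Y n \<omega>)\<^sup>2)"
            by (auto simp: indicator_def intro: ennreal_leI)
        qed
        also have "\<dots> \<le> ennreal B" unfolding Y_def by (rule B(2)) simp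
        finally show ?thesis .
      qed
      show "finite_measure M" by unfold_locales
    qed (use B(1) in auto)
    then show "liminf (\<lambda>n. \<integral>\<^sup>+\<omega>. ennreal (c * Y n \<omega>) * indicator E \<omega> \<partial>M) \<le> (\<integral>\<^sup>+\<omega>. ennreal (c * X \<omega>) * indicator E \<omega> \<partial>M)"
      unfolding * .
    have "(\<integral>\<^sup>+\<omega>. ennreal (c * X \<omega>) * indicator E \<omega> \<partial>M) = (\<integral>\<^sup>+\<omega>. liminf (\<lambda>n. ennreal (c * Y n \<omega>) * indicator E \<omega>) \<partial>M)"
    proof (rule nn_integral_cong)
      fix \<omega> assume \<omega>: "\<omega> \<in> space M"
      have "(\<lambda>n. ennreal (c * Y n \<omega>)) \<longlonglongrightarrow> ennreal (c * X \<omega>)" by (intro tendsto_ennrealI tendsto_intros Yl \<omega>)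
      then have "(\<lambda>n. ennreal (c * Y n \<omega>) * indicator E \<omega>) \<longlonglongrightarrow> ennreal (c * X \<omega>) * indicator E \<omega>"
        by (cases "\<omega> \<in> E") auto
      then show "ennreal (c * X \<omega>) * indicator E \<omega> = liminf (\<lambda>n. ennreal (c * Y n \<omega>) * indicator E \<omega>)"
        by (intro lim_imp_Liminf[symmetric]) auto
    qed
    also have "\<dots> \<le> liminf (\<lambda>n. \<integral>\<^sup>+\<omega>. ennreal (c * Y n \<omega>) * indicator E \<omega> \<partial>M)"
      by (rule nn_integral_liminf) measurable
    finally show "(\<integral>\<^sup>+\<omega>. ennreal (c * X \<omega>) * indicator E \<omega> \<partial>M) \<le> liminf (\<lambda>n. \<integral>\<^sup>+\<omega>. ennreal (c * Y n \<omega>) * indicator E \<omega> \<partial>M)" .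
  qed
  have ind: "ennreal (x * indicator E \<omega>) = ennreal x * indicator E \<omega>" for x \<omega> by (simp add: indicator_def)
  have "(\<integral>\<^sup>+\<omega>. ennreal (1 * Y n \<omega>) * indicator E \<omega> \<partial>M) = (\<integral>\<^sup>+\<omega>. ennreal (- 1 * Y n \<omega>) * indicator E \<omega> \<partial>M)" for n
    using nn_integral_pos_eq_neg[OF N_martingale[OF st E, of "n + n0"]]
    unfolding Y_def[symmetric] minus_mult_left ind by simp
  then have eq: "(\<integral>\<^sup>+\<omega>. ennreal (1 * X \<omega>) * indicator E \<omega> \<partial>M) = (\<integral>\<^sup>+\<omega>. ennreal (- 1 * X \<omega>) * indicator E \<omega> \<partial>M)"
    using lim[of 1] lim[of "- 1"] by simp
  have i: "integrable M (\<lambda>\<omega>. X \<omega> * indicator E \<omega>)"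
    unfolding X_def by (rule integrable_real_mult_indicator[OF EM integrable_I_diff[OF s]])
  show ?thesis
    using real_lebesgue_integral_def[OF i] eq unfolding minus_mult_left ind X_def by simp
qed simp

text \<open>The event is partitioned by the first time \<open>s\<close> of \<open>R\<close> at which
  the level is exceeded. That piece is known at time \<open>s\<close>, so the martingale property
  replaces the value at \<open>s\<close> by the value at \<open>t\<close>.\<close>

lemma doob_maximal_finite:
  assumes R: "finite R" "R \<subseteq> {r..t}" and r: "0 \<le> r" "r \<le> t" "t < T" and l: "0 < l"
  shows "l * prob {\<omega>\<in>space M. \<exists>s\<in>R. l < \<bar>I s \<omega> - I r \<omega>\<bar>} \<le> (LINT \<omega>|M. \<bar>I t \<omega> - I r \<omega>\<bar>)"
proof -
  define X where "X s \<omega> = I s \<omega> - I r \<omega>" for s \<omega>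
  have Rb: "0 \<le> s" "r \<le> s" "s \<le> t" "s < T" if "s \<in> R" for s using R(2) that r by auto
  have XF: "X s \<in> borel_measurable (F u)" if "r \<le> s" "s \<le> u" "s < T" for s u
  proof -
    have "I s \<in> borel_measurable (F u)" "I r \<in> borel_measurable (F u)"
      using that r by (auto intro: measurable_F_mono[OF _ measurable_I])
    then show ?thesis unfolding X_def by measurable
  qed
  define E where "E s = {\<omega>\<in>space M. l < \<bar>X s \<omega>\<bar> \<and> (\<forall>u\<in>{u\<in>R. u < s}. \<bar>X u \<omega>\<bar> \<le> l)}" for s
  have EF: "E s \<in> sets (F s)" if "s \<in> R" for s
  proof -
    have [measurable]: "X s \<in> borel_measurable (F s)" using Rb[OF that] by (intro XF) auto
    have a: "{\<omega>\<in>space (F s). l < \<bar>X s \<omega>\<bar>} \<in> sets (F s)" by measurable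
    have b: "{\<omega>\<in>space (F s). \<forall>u\<in>{u\<in>R. u < s}. \<bar>X u \<omega>\<bar> \<le> l} \<in> sets (F s)"
    proof (rule sets.sets_Collect_finite_All)
      fix u assume u: "u \<in> {u\<in>R. u < s}"
      then have [measurable]: "X u \<in> borel_measurable (F s)" using Rb[of u] by (intro XF) auto
      show "{\<omega>\<in>space (F s). \<bar>X u \<omega>\<bar> \<le> l} \<in> sets (F s)" by measurable
    qed (use R in auto)
    have "E s = {\<omega>\<in>space (F s). l < \<bar>X s \<omega>\<bar>} \<inter> {\<omega>\<in>space (F s). \<forall>u\<in>{u\<in>R. u < s}. \<bar>X u \<omega>\<bar> \<le> l}"
      by (auto simp: E_def space_F)
    then show ?thesis using a b by simp
  qed
  have EM: "E s \<in> events" if "s \<in> R" for s using EF[OF that] sets_F_subset by auto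
  have iX: "integrable M (X s)" if "r \<le> s" "s < T" for s
    unfolding X_def using that r by (intro integrable_I_diff) auto
  have le: "l * prob (E s) \<le> (LINT \<omega>|M. \<bar>X t \<omega>\<bar> * indicator (E s) \<omega>)" if s: "s \<in> R" for s
  proof -
    \<comment> \<open>The martingale identity is linear, so the absolute value at time
      \<open>s\<close> is resolved by the sign of \<open>X s\<close>, which is known at
      \<open>s\<close>.\<close>
    define P where "P = {\<omega>\<in>E s. 0 < X s \<omega>}"
    define P' where "P' = E s - P"
    have [measurable]: "X s \<in> borel_measurable (F s)" "E s \<in> sets (F s)" using Rb[OF s] EF[OF s] by (auto intro: XF)
    have PF: "P \<in> sets (F s)"
    proof -
      have "P = E s \<inter> {\<omega>\<in>space (F s). 0 < X s \<omega>}" using sets.sets_into_space[OF EF[OF s]] by (auto simp: P_def)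
      then show ?thesis by simp
    qed
    then have P'F: "P' \<in> sets (F s)" by (auto simp: P'_def)
    have PM: "P \<in> events" "P' \<in> events" using PF P'F sets_F_subset by auto
    have mart: "(LINT \<omega>|M. X t \<omega> * indicator U \<omega>) = (LINT \<omega>|M. X s \<omega> * indicator U \<omega>)" if U: "U \<in> sets (F s)" for U
    proof -
      have UM: "U \<in> events" using U sets_F_subset by auto
      have "(LINT \<omega>|M. (I t \<omega> - I s \<omega>) * indicator U \<omega>) = 0" using Rb[OF s] r by (intro I_martingale U) auto
      moreover have "(\<lambda>\<omega>. (I t \<omega> - I s \<omega>) * indicator U \<omega>) = (\<lambda>\<omega>. X t \<omega> * indicator U \<omega> - X s \<omega> * indicator U \<omega>)"
        by (auto simp: X_def algebra_simps)
      moreover have "integrable M (\<lambda>\<omega>. X t \<omega> * indicator U \<omega>)" "integrable M (\<lambda>\<omega>. X s \<omega> * indicator U \<omega>)"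
        using iX[of t] iX[of s] r Rb[OF s] by (auto intro!: integrable_real_mult_indicator[OF UM])
      ultimately show ?thesis by simp
    qed
    have Xt: "integrable M (\<lambda>\<omega>. X t \<omega> * indicator U \<omega>)" "integrable M (\<lambda>\<omega>. X s \<omega> * indicator U \<omega>)" "integrable M (\<lambda>\<omega>. \<bar>X t \<omega>\<bar> * indicator U \<omega>)"
      if "U \<in> events" for U
      using iX[of t] iX[of s] r Rb[OF s] by (auto intro!: integrable_real_mult_indicator[OF that])
    have "l * prob (E s) = (LINT \<omega>|M. l * indicator (E s) \<omega>)" using EM[OF s] by simp
    also have "\<dots> \<le> (LINT \<omega>|M. X s \<omega> * indicator P \<omega> - X s \<omega> * indicator P' \<omega>)"
    proof (rule integral_mono)
      show "integrable M (\<lambda>\<omega>. l * indicator (E s) \<omega>)" using EM[OF s] by (simp add: emeasure_eq_measure)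
      show "integrable M (\<lambda>\<omega>. X s \<omega> * indicator P \<omega> - X s \<omega> * indicator P' \<omega>)"
        by (intro Bochner_Integration.integrable_diff Xt PM)
      fix \<omega>
      show "l * indicator (E s) \<omega> \<le> X s \<omega> * indicator P \<omega> - X s \<omega> * indicator P' \<omega>"
        by (auto simp: indicator_def P_def P'_def E_def)
    qed
    also have "\<dots> = (LINT \<omega>|M. X t \<omega> * indicator P \<omega> - X t \<omega> * indicator P' \<omega>)"
      using mart[OF PF] mart[OF P'F] Xt[OF PM(1)] Xt[OF PM(2)] by simp
    also have "\<dots> \<le> (LINT \<omega>|M. \<bar>X t \<omega>\<bar> * indicator (E s) \<omega>)"
    proof (rule integral_mono)
      show "integrable M (\<lambda>\<omega>. X t \<omega> * indicator P \<omega> - X t \<omega> * indicator P' \<omega>)"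
        by (intro Bochner_Integration.integrable_diff Xt PM)
      show "integrable M (\<lambda>\<omega>. \<bar>X t \<omega>\<bar> * indicator (E s) \<omega>)" by (rule Xt(3)[OF EM[OF s]])
      show "X t \<omega> * indicator P \<omega> - X t \<omega> * indicator P' \<omega> \<le> \<bar>X t \<omega>\<bar> * indicator (E s) \<omega>" for \<omega>
        by (auto simp: indicator_def P_def P'_def)
    qed
    finally show ?thesis .
  qed
  have disj: "disjoint_family_on E R"
    unfolding disjoint_family_on_def
  proof (intro ballI impI)
    fix m n assume "m \<in> R" "n \<in> R" "m \<noteq> n"
    then consider "m < n" | "n < m" by linarith
    then show "E m \<inter> E n = {}"
      by cases (use \<open>m \<in> R\<close> \<open>n \<in> R\<close> in \<open>auto simp: E_def not_le\<close>)
  qed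
  have un: "{\<omega>\<in>space M. \<exists>s\<in>R. l < \<bar>I s \<omega> - I r \<omega>\<bar>} = (\<Union>s\<in>R. E s)"
  proof (intro set_eqI iffI)
    fix \<omega> assume "\<omega> \<in> {\<omega>\<in>space M. \<exists>s\<in>R. l < \<bar>I s \<omega> - I r \<omega>\<bar>}"
    then have \<omega>: "\<omega> \<in> space M" and ne: "{s\<in>R. l < \<bar>X s \<omega>\<bar>} \<noteq> {}" by (auto simp: X_def)
    define s where "s = Min {s\<in>R. l < \<bar>X s \<omega>\<bar>}"
    have "s \<in> {s\<in>R. l < \<bar>X s \<omega>\<bar>}" unfolding s_def using R ne by (intro Min_in) auto
    moreover have "\<bar>X u \<omega>\<bar> \<le> l" if "u \<in> R" "u < s" for u
    proof (rule ccontr)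
      assume "\<not> \<bar>X u \<omega>\<bar> \<le> l"
      then have "s \<le> u" unfolding s_def using R that by (intro Min_le) auto
      then show False using that by simp
    qed
    ultimately show "\<omega> \<in> (\<Union>s\<in>R. E s)" using \<omega> by (auto simp: E_def)
  qed (auto simp: E_def X_def)
  have "l * prob {\<omega>\<in>space M. \<exists>s\<in>R. l < \<bar>I s \<omega> - I r \<omega>\<bar>} = (\<Sum>s\<in>R. l * prob (E s))"
    unfolding un sum_distrib_left[symmetric]
    by (subst finite_measure_finite_Union[OF R(1) _ disj]) (use EM in auto)
  also have "\<dots> \<le> (\<Sum>s\<in>R. LINT \<omega>|M. \<bar>X t \<omega>\<bar> * indicator (E s) \<omega>)" by (intro sum_mono le)
  also have "\<dots> = (LINT \<omega>|M. (\<Sum>s\<in>R. \<bar>X t \<omega>\<bar> * indicator (E s) \<omega>))"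
    using iX[of t] r EM by (intro Bochner_Integration.integral_sum[symmetric] integrable_real_mult_indicator integrable_abs) auto
  also have "\<dots> = (LINT \<omega>|M. \<bar>X t \<omega>\<bar> * indicator (\<Union>s\<in>R. E s) \<omega>)"
    unfolding sum_distrib_left[symmetric] indicator_UN_disjoint[OF R(1) disj] ..
  also have "\<dots> \<le> (LINT \<omega>|M. \<bar>X t \<omega>\<bar>)"
  proof (rule integral_mono)
    show "integrable M (\<lambda>\<omega>. \<bar>X t \<omega>\<bar> * indicator (\<Union>s\<in>R. E s) \<omega>)"
      using iX[of t] r EM R by (intro integrable_real_mult_indicator integrable_abs) auto
    show "integrable M (\<lambda>\<omega>. \<bar>X t \<omega>\<bar>)" using iX[of t] r by simp
  qed (auto simp: indicator_def)
  finally show ?thesis by (simp add: X_def)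
qed

end

section \<open>Estimates in Lp for every positive exponent\<close>

lemma Lp_norm_le:
  assumes p: "0 < p" and e: "0 \<le> e" and I: "(\<integral>\<^sup>+x. ennreal (\<bar>f x\<bar> powr p) \<partial>M) \<le> ennreal (e powr p)"
  shows "Lp_norm (ennreal p) M f \<le> ennreal e"
proof -
  define J where "J = (\<integral>\<^sup>+x. ennreal (\<bar>f x\<bar> powr p) \<partial>M)"
  have J: "J \<le> ennreal (e powr p)" using I by (simp add: J_def)
  then have fin: "J \<noteq> \<infinity>" by (metis ennreal_neq_top infinity_ennreal_def top.extremum_uniqueI)
  have "enn2real J \<le> e powr p" using J by (metis enn2real_leI powr_ge_zero)
  then have "enn2real J powr (1 / p) \<le> (e powr p) powr (1 / p)" using p by (intro powr_mono2) auto
  also have "\<dots> = e" using p e by (simp add: powr_powr)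
  finally have "ennreal (enn2real J powr (1 / p)) \<le> ennreal e" by (rule ennreal_leI)
  then show ?thesis using p fin by (simp add: Lp_norm_def Let_def J_def[symmetric])
qed

lemma Lp_space_iff:
  assumes p: "0 < p"
  shows "f \<in> Lp_space (ennreal p) M \<longleftrightarrow> f \<in> borel_measurable M \<and> (\<integral>\<^sup>+x. ennreal (\<bar>f x\<bar> powr p) \<partial>M) < \<infinity>"
  using p by (auto simp: Lp_space_def Lp_norm_def Let_def less_top)

text \<open>The estimate |a + b|^p <= 2^p (|a|^p + |b|^p) follows from comparison with the larger of
  the two and covers \<open>p < 1\<close>, where the triangle inequality fails.\<close>

lemma Lp_space_add:
  assumes p: "0 < p" and f: "f \<in> Lp_space (ennreal p) M" and g: "g \<in> Lp_space (ennreal p) M"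
  shows "(\<lambda>x. f x + g x) \<in> Lp_space (ennreal p) M"
proof -
  have [measurable]: "f \<in> borel_measurable M" "g \<in> borel_measurable M"
    and fin: "(\<integral>\<^sup>+x. ennreal (\<bar>f x\<bar> powr p) \<partial>M) < \<infinity>" "(\<integral>\<^sup>+x. ennreal (\<bar>g x\<bar> powr p) \<partial>M) < \<infinity>"
    using f g by (auto simp: Lp_space_iff[OF p])
  have le: "ennreal (\<bar>a + b\<bar> powr p) \<le> ennreal (2 powr p) * (ennreal (\<bar>a\<bar> powr p) + ennreal (\<bar>b\<bar> powr p))" for a b :: real
  proof -
    have "\<bar>a + b\<bar> powr p \<le> (2 * max \<bar>a\<bar> \<bar>b\<bar>) powr p" using p by (intro powr_mono2) auto
    also have "\<dots> = 2 powr p * (max \<bar>a\<bar> \<bar>b\<bar>) powr p" by (intro powr_mult)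
    also have "\<dots> \<le> 2 powr p * (\<bar>a\<bar> powr p + \<bar>b\<bar> powr p)" by (intro mult_left_mono) (auto simp: max_def)
    finally have "ennreal (\<bar>a + b\<bar> powr p) \<le> ennreal (2 powr p * (\<bar>a\<bar> powr p + \<bar>b\<bar> powr p))" by (rule ennreal_leI)
    also have "\<dots> = ennreal (2 powr p) * (ennreal (\<bar>a\<bar> powr p) + ennreal (\<bar>b\<bar> powr p))"
      by (simp add: ennreal_mult)
    finally show ?thesis .
  qed
  have "(\<integral>\<^sup>+x. ennreal (\<bar>f x + g x\<bar> powr p) \<partial>M) \<le> (\<integral>\<^sup>+x. ennreal (2 powr p) * (ennreal (\<bar>f x\<bar> powr p) + ennreal (\<bar>g x\<bar> powr p)) \<partial>M)"
    by (intro nn_integral_mono le)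
  also have "\<dots> = ennreal (2 powr p) * ((\<integral>\<^sup>+x. ennreal (\<bar>f x\<bar> powr p) \<partial>M) + (\<integral>\<^sup>+x. ennreal (\<bar>g x\<bar> powr p) \<partial>M))"
    by (simp add: nn_integral_cmult nn_integral_add)
  also have "\<dots> < \<infinity>" using fin by (simp add: ennreal_mult_less_top)
  finally show ?thesis by (simp add: Lp_space_iff[OF p])
qed

section \<open>Maximal inequality up to the terminal time and the limit\<close>

context hoelder_brownian begin

text \<open>By continuity of paths and strictness of the inequality, exceeding the level somewhere
  is detected at a rational time. The finite bounds do not depend on the set of times and pass to
  the increasing union.\<close>

lemma doob_maximal:
  assumes r: "0 \<le> r" "r < T" and l: "0 < l" and e: "0 \<le> e"
    and moment: "\<And>t. r \<le> t \<Longrightarrow> t < T \<Longrightarrow> (\<integral>\<^sup>+\<omega>. ennreal \<bar>I t \<omega> - I r \<omega>\<bar> \<partial>M) \<le> ennreal e"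
  shows "{\<omega>\<in>space M. \<exists>s\<in>{r..<T}. l < \<bar>I s \<omega> - I r \<omega>\<bar>} \<in> events"
    and "prob {\<omega>\<in>space M. \<exists>s\<in>{r..<T}. l < \<bar>I s \<omega> - I r \<omega>\<bar>} \<le> e / l"
proof -
  define R where "R m = (\<lambda>i. real_of_rat (nat_to_rat_surj i)) ` {..<m} \<inter> {r..<T}" for m :: nat
  define E where "E m = {\<omega>\<in>space M. \<exists>s\<in>R m. l < \<bar>I s \<omega> - I r \<omega>\<bar>}" for m
  have fin: "finite (R m)" for m by (simp add: R_def)
  have Rb: "r \<le> s" "s < T" if "s \<in> R m" for s m using that by (auto simp: R_def)
  have un: "{\<omega>\<in>space M. \<exists>s\<in>{r..<T}. l < \<bar>I s \<omega> - I r \<omega>\<bar>} = (\<Union>m. E m)"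
  proof (intro set_eqI iffI)
    fix \<omega> assume "\<omega> \<in> {\<omega>\<in>space M. \<exists>s\<in>{r..<T}. l < \<bar>I s \<omega> - I r \<omega>\<bar>}"
    then obtain s where \<omega>: "\<omega> \<in> space M" and s: "r \<le> s" "s < T" "l < \<bar>I s \<omega> - I r \<omega>\<bar>" by auto
    have "((\<lambda>t. \<bar>I t \<omega> - I r \<omega>\<bar>) \<longlongrightarrow> \<bar>I s \<omega> - I r \<omega>\<bar>) (at s within {0..<T})"
      using continuous_I[OF \<omega>] s r by (intro tendsto_intros) (auto simp: continuous_on)
    then have "eventually (\<lambda>t. l < \<bar>I t \<omega> - I r \<omega>\<bar>) (at s within {0..<T})" using s(3) by (rule order_tendstoD)
    then obtain d where d: "0 < d" "\<And>t. t \<in> {0..<T} \<Longrightarrow> t \<noteq> s \<Longrightarrow> dist t s < d \<Longrightarrow> l < \<bar>I t \<omega> - I r \<omega>\<bar>"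
      unfolding eventually_at by blast
    \<comment> \<open>A rational time slightly to the right of \<open>s\<close> stays below
      \<open>T\<close> and still exceeds the level.\<close>
    have "s < min (s + d) T" using d s by simp
    then obtain q where q: "q \<in> \<rat>" "s < q" "q < min (s + d) T" using Rats_dense_in_real by blast
    then obtain i where i: "q = real_of_rat (nat_to_rat_surj i)" by (metis Rats_cases surj_nat_to_rat_surj surj_def)
    have "l < \<bar>I q \<omega> - I r \<omega>\<bar>" using q s r by (intro d(2)) (auto simp: dist_real_def)
    moreover have "q \<in> R (Suc i)" using i q s by (auto simp: R_def)
    ultimately show "\<omega> \<in> (\<Union>m. E m)" using \<omega> by (auto simp: E_def)
  next
    fix \<omega> assume "\<omega> \<in> (\<Union>m. E m)"
    then show "\<omega> \<in> {\<omega>\<in>space M. \<exists>s\<in>{r..<T}. l < \<bar>I s \<omega> - I r \<omega>\<bar>}" using Rb by (fastforce simp: E_def)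
  qed
  have Em: "E m \<in> events" for m
    unfolding E_def
  proof (rule sets.sets_Collect_finite_Ex[OF _ fin])
    fix s assume "s \<in> R m"
    then have [measurable]: "I s \<in> borel_measurable M" "I r \<in> borel_measurable M" using Rb[of s m] r by auto
    show "{\<omega>\<in>space M. l < \<bar>I s \<omega> - I r \<omega>\<bar>} \<in> events" by measurable
  qed
  show "{\<omega>\<in>space M. \<exists>s\<in>{r..<T}. l < \<bar>I s \<omega> - I r \<omega>\<bar>} \<in> events" unfolding un using Em by auto
  have P: "prob (E m) \<le> e / l" for m
  proof -
    define t where "t = Max (insert r (R m))"
    have "t \<in> insert r (R m)" unfolding t_def using fin by (intro Max_in) auto
    then have t: "r \<le> t" "t < T" using Rb r by auto
    have "R m \<subseteq> {r..t}" using Rb fin by (auto simp: t_def)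
    then have "l * prob (E m) \<le> (LINT \<omega>|M. \<bar>I t \<omega> - I r \<omega>\<bar>)"
      unfolding E_def by (rule doob_maximal_finite[OF fin _ r(1) t l])
    also have "\<dots> \<le> e"
    proof -
      have i: "integrable M (\<lambda>\<omega>. \<bar>I t \<omega> - I r \<omega>\<bar>)" using r t by (intro integrable_abs integrable_I_diff)
      have "ennreal (LINT \<omega>|M. \<bar>I t \<omega> - I r \<omega>\<bar>) \<le> ennreal e"
        using moment[OF t] nn_integral_eq_integral[OF i] by simp
      then show ?thesis using e by (simp add: ennreal_le_iff)
    qed
    finally show ?thesis using l by (simp add: pos_le_divide_eq mult.commute)
  qed
  have "incseq E" by (force simp: incseq_def E_def R_def)
  then have "(\<lambda>m. prob (E m)) \<longlonglongrightarrow> prob (\<Union>m. E m)" using Em by (intro finite_Lim_measure_incseq) auto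
  then show "prob {\<omega>\<in>space M. \<exists>s\<in>{r..<T}. l < \<bar>I s \<omega> - I r \<omega>\<bar>} \<le> e / l"
    unfolding un by (rule LIMSEQ_le_const2) (use P in auto)
qed

text \<open>Times \<open>s k\<close> are chosen with mean oscillation at most 4^(-k) afterwards. At
  the level 2^(-k) the maximal inequality gives exceptional probabilities of at most 2^(-k), which
  are summable, so by Borel-Cantelli almost every path is Cauchy at \<open>T\<close>.\<close>

lemma I_convergent_AE: "AE \<omega> in M. \<exists>L. ((\<lambda>t. I t \<omega>) \<longlongrightarrow> L) (at_left T)"
proof -
  have "\<exists>s. 0 \<le> s \<and> s < T \<and> (\<forall>t. s \<le> t \<longrightarrow> t < T \<longrightarrow> (\<integral>\<^sup>+\<omega>. ennreal \<bar>I t \<omega> - I s \<omega>\<bar> \<partial>M) \<le> ennreal ((1/4) ^ k))" for k :: nat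
  proof -
    have "0 < (1/4 :: real) ^ k" by simp
    from I_moment_small[OF zero_less_one this] obtain s where s: "0 \<le> s" "s < T"
      "\<And>r t. s \<le> r \<Longrightarrow> r \<le> t \<Longrightarrow> t < T \<Longrightarrow> (\<integral>\<^sup>+\<omega>. ennreal (\<bar>I t \<omega> - I r \<omega>\<bar> powr 1) \<partial>M) \<le> ennreal ((1/4) ^ k)"
      by blast
    then show ?thesis using s(3)[OF order_refl] by (intro exI[of _ s]) simp
  qed
  then obtain s where s: "\<And>k. 0 \<le> s k" "\<And>k. s k < T"
    "\<And>k t. s k \<le> t \<Longrightarrow> t < T \<Longrightarrow> (\<integral>\<^sup>+\<omega>. ennreal \<bar>I t \<omega> - I (s k) \<omega>\<bar> \<partial>M) \<le> ennreal ((1/4) ^ k)" by metis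
  define E where "E k = {\<omega>\<in>space M. \<exists>t\<in>{s k..<T}. (1/2) ^ k < \<bar>I t \<omega> - I (s k) \<omega>\<bar>}" for k
  have Em: "E k \<in> events" for k unfolding E_def by (rule doob_maximal(1)[OF s(1,2) _ _ s(3)]) auto
  have "prob (E k) \<le> (1/2) ^ k" for k
  proof -
    \<comment> \<open>The moment rate is the square of the level, so that their quotient is again
      summable.\<close>
    have "prob (E k) \<le> (1/4) ^ k / (1/2) ^ k" unfolding E_def by (rule doob_maximal(2)[OF s(1,2) _ _ s(3)]) auto
    also have "\<dots> = (1/2) ^ k" by (simp flip: power_divide)
    finally show ?thesis .
  qed
  then have "summable (\<lambda>k. prob (E k))" by (intro summable_comparison_test'[OF summable_geometric[of "1/2"]]) auto
  then have "AE \<omega> in M. eventually (\<lambda>k. \<omega> \<in> space M - E k) sequentially"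
    using Em by (intro borel_cantelli_AE1) (auto simp: emeasure_eq_measure)
  then show ?thesis
  proof eventually_elim
    case (elim \<omega>)
    have cauchy: "cauchy_filter (filtermap (\<lambda>t. I t \<omega>) (at_left T))"
      unfolding cauchy_filter_metric_filtermap
    proof (intro allI impI)
      fix e :: real assume e: "0 < e"
      have "(\<lambda>k. (1/2 :: real) ^ k) \<longlonglongrightarrow> 0" by (rule LIMSEQ_realpow_zero) auto
      then have "eventually (\<lambda>k. (1/2 :: real) ^ k < e / 2) sequentially" using e by (intro order_tendstoD) auto
      from eventually_conj[OF this elim] obtain k where k: "(1/2 :: real) ^ k < e / 2" "\<omega> \<in> space M - E k"
        by (auto simp: eventually_sequentially)
      have b: "\<bar>I t \<omega> - I (s k) \<omega>\<bar> < e / 2" if "s k < t" "t < T" for t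
      proof -
        have "\<not> (1/2) ^ k < \<bar>I t \<omega> - I (s k) \<omega>\<bar>" using k(2) that unfolding E_def by (auto simp del: not_less)
        then show ?thesis using k(1) by linarith
      qed
      have "dist (I x \<omega>) (I y \<omega>) < e" if "s k < x \<and> x < T" "s k < y \<and> y < T" for x y
        using b[of x] b[of y] that unfolding dist_real_def by linarith
      moreover have "eventually (\<lambda>t. s k < t \<and> t < T) (at_left T)"
        using s(2)[of k] by (auto simp: eventually_at_left)
      ultimately show "\<exists>P. eventually P (at_left T) \<and> (\<forall>x y. P x \<and> P y \<longrightarrow> dist (I x \<omega>) (I y \<omega>) < e)"
        by (intro exI[of _ "\<lambda>t. s k < t \<and> t < T"]) auto
    qed
    have "\<exists>L\<in>UNIV. filtermap (\<lambda>t. I t \<omega>) (at_left T) \<le> nhds L"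
      by (rule complete_UNIV[unfolded complete_uniform, rule_format, OF _ _ cauchy]) (simp_all add: filtermap_bot_iff)
    then show ?case by (auto simp: filterlim_def)
  qed
qed

definition z :: "nat \<Rightarrow> real" where "z n = T - T / (Suc n)"

text \<open>Taking the limit along a fixed sequence gives a measurable function on the whole space;
  wherever the left limit at \<open>T\<close> exists, it coincides with this value.\<close>

definition I_limit :: "'a \<Rightarrow> real" where "I_limit \<omega> = lim (\<lambda>n. I (z n) \<omega>)"

lemma z_bounds: "0 \<le> z n" "z n < T"
  using T_pos by (auto simp: z_def pos_divide_le_eq mult_le_cancel_left1)

lemma filterlim_z: "filterlim z (at_left T) sequentially"
proof (rule filterlim_at_withinI)
  have "(\<lambda>n. T * inverse (real (Suc n))) \<longlonglongrightarrow> T * 0" by (intro tendsto_mult_left LIMSEQ_inverse_real_of_nat)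
  then have "(\<lambda>n. T - T * inverse (real (Suc n))) \<longlonglongrightarrow> T - T * 0" by (intro tendsto_diff tendsto_const)
  then show "z \<longlonglongrightarrow> T" by (simp add: z_def[abs_def] divide_inverse)
qed (use z_bounds in auto)

lemma borel_measurable_I_limit [measurable]: "I_limit \<in> borel_measurable M"
  unfolding I_limit_def[abs_def] by (intro borel_measurable_lim_metric measurable_I_M z_bounds)

lemma I_limit_AE: "AE \<omega> in M. ((\<lambda>t. I t \<omega>) \<longlongrightarrow> I_limit \<omega>) (at_left T)"
  using I_convergent_AE
proof eventually_elim
  case (elim \<omega>)
  then obtain L where L: "((\<lambda>t. I t \<omega>) \<longlongrightarrow> L) (at_left T)" by blast
  have "(\<lambda>n. I (z n) \<omega>) \<longlonglongrightarrow> L" by (rule filterlim_compose[OF L filterlim_z])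
  then have "I_limit \<omega> = L" unfolding I_limit_def by (rule limI)
  then show ?case using L by simp
qed

text \<open>Fatou's lemma applied to the Cauchy estimate, the later time running to \<open>T\<close>
  along \<open>z\<close>.\<close>

lemma I_limit_moment:
  assumes p: "0 < p" and e: "0 < e"
  obtains s0 where "0 \<le> s0" "s0 < T"
    "\<And>t. s0 \<le> t \<Longrightarrow> t < T \<Longrightarrow> (\<integral>\<^sup>+\<omega>. ennreal (\<bar>I t \<omega> - I_limit \<omega>\<bar> powr p) \<partial>M) \<le> ennreal e"
proof -
  obtain s0 where s0: "0 \<le> s0" "s0 < T"
    "\<And>s t. s0 \<le> s \<Longrightarrow> s \<le> t \<Longrightarrow> t < T \<Longrightarrow> (\<integral>\<^sup>+\<omega>. ennreal (\<bar>I t \<omega> - I s \<omega>\<bar> powr p) \<partial>M) \<le> ennreal e"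
    using I_moment_small[OF p e] by blast
  have "(\<integral>\<^sup>+\<omega>. ennreal (\<bar>I t \<omega> - I_limit \<omega>\<bar> powr p) \<partial>M) \<le> ennreal e" if t: "s0 \<le> t" "t < T" for t
  proof -
    have [measurable]: "I t \<in> borel_measurable M" "\<And>n. I (z n) \<in> borel_measurable M"
      using s0 t z_bounds by auto
    have "(\<integral>\<^sup>+\<omega>. ennreal (\<bar>I t \<omega> - I_limit \<omega>\<bar> powr p) \<partial>M) = (\<integral>\<^sup>+\<omega>. liminf (\<lambda>n. ennreal (\<bar>I (z n) \<omega> - I t \<omega>\<bar> powr p)) \<partial>M)"
    proof (rule nn_integral_cong_AE)
      show "AE \<omega> in M. ennreal (\<bar>I t \<omega> - I_limit \<omega>\<bar> powr p) = liminf (\<lambda>n. ennreal (\<bar>I (z n) \<omega> - I t \<omega>\<bar> powr p))"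
        using I_limit_AE
      proof eventually_elim
        case (elim \<omega>)
        have "(\<lambda>n. I (z n) \<omega>) \<longlonglongrightarrow> I_limit \<omega>" by (rule filterlim_compose[OF elim filterlim_z])
        then have "(\<lambda>n. ennreal (\<bar>I (z n) \<omega> - I t \<omega>\<bar> powr p)) \<longlonglongrightarrow> ennreal (\<bar>I_limit \<omega> - I t \<omega>\<bar> powr p)"
          using p by (intro tendsto_ennrealI tendsto_powr' tendsto_intros) auto
        from lim_imp_Liminf[OF _ this] show ?case by (simp add: abs_minus_commute)
      qed
    qed
    also have "\<dots> \<le> liminf (\<lambda>n. \<integral>\<^sup>+\<omega>. ennreal (\<bar>I (z n) \<omega> - I t \<omega>\<bar> powr p) \<partial>M)" by (rule nn_integral_liminf) measurable
    also have "\<dots> \<le> liminf (\<lambda>n. ennreal e)"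
    proof (rule Liminf_mono)
      have "eventually (\<lambda>u. t < u \<and> u < T) (at_left T)" using t by (auto simp: eventually_at_left)
      then have "eventually (\<lambda>n. t < z n \<and> z n < T) sequentially" by (rule eventually_compose_filterlim[OF _ filterlim_z])
      then show "eventually (\<lambda>n. (\<integral>\<^sup>+\<omega>. ennreal (\<bar>I (z n) \<omega> - I t \<omega>\<bar> powr p) \<partial>M) \<le> ennreal e) sequentially"
        by eventually_elim (use s0(3) t in auto)
    qed
    also have "\<dots> = ennreal e" by (simp add: Liminf_const)
    finally show ?thesis .
  qed
  then show ?thesis using s0(1,2) by (intro that[of s0])
qed

lemma I_in_Lp:
  assumes p: "0 < p" and t: "0 \<le> t" "t < T"
  shows "I t \<in> Lp_space (ennreal p) M"
proof -
  obtain B where B: "0 \<le> B" "\<And>s t. 0 \<le> s \<Longrightarrow> s \<le> t \<Longrightarrow> t < T \<Longrightarrow> (\<integral>\<^sup>+\<omega>. ennreal (\<bar>I t \<omega> - I s \<omega>\<bar> powr p) \<partial>M) \<le> ennreal B"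
    using I_powr_moment_finite[OF p] by blast
  have m: "I t \<in> borel_measurable M" "I 0 \<in> borel_measurable M" using t by auto
  have "(\<integral>\<^sup>+\<omega>. ennreal (\<bar>I t \<omega> - I 0 \<omega>\<bar> powr p) \<partial>M) < \<infinity>"
    using B(2)[OF order_refl t] by (rule le_less_trans) simp
  then have 1: "(\<lambda>\<omega>. I t \<omega> - I 0 \<omega>) \<in> Lp_space (ennreal p) M" using m by (simp add: Lp_space_iff[OF p])
  have "(\<integral>\<^sup>+\<omega>. ennreal (\<bar>I 0 \<omega>\<bar> powr p) \<partial>M) = (\<integral>\<^sup>+\<omega>. ennreal (\<bar>v T 0\<bar> powr p) \<partial>M)"
    by (intro nn_integral_cong) (simp add: I_0 Z_def W_0)
  then have 2: "I 0 \<in> Lp_space (ennreal p) M" using m by (simp add: Lp_space_iff[OF p] emeasure_space_1)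
  from Lp_space_add[OF p 1 2] show ?thesis by simp
qed

lemma I_limit_in_Lp:
  assumes p: "0 < p" shows "I_limit \<in> Lp_space (ennreal p) M"
proof -
  obtain s0 where s0: "0 \<le> s0" "s0 < T"
    "\<And>t. s0 \<le> t \<Longrightarrow> t < T \<Longrightarrow> (\<integral>\<^sup>+\<omega>. ennreal (\<bar>I t \<omega> - I_limit \<omega>\<bar> powr p) \<partial>M) \<le> ennreal 1"
    using I_limit_moment[OF p zero_less_one] by blast
  have m: "I s0 \<in> borel_measurable M" using s0 by auto
  have "(\<integral>\<^sup>+\<omega>. ennreal (\<bar>I_limit \<omega> - I s0 \<omega>\<bar> powr p) \<partial>M) < \<infinity>"
    using s0(3)[OF order_refl s0(2)] unfolding abs_minus_commute[of "I s0 _"] by (rule le_less_trans) simp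
  then have "(\<lambda>\<omega>. I_limit \<omega> - I s0 \<omega>) \<in> Lp_space (ennreal p) M" using m by (simp add: Lp_space_iff[OF p])
  from Lp_space_add[OF p this I_in_Lp[OF p s0(1,2)]] show ?thesis by simp
qed

lemma I_tendsto_Lp:
  assumes p: "0 < p"
  shows "((\<lambda>t. Lp_norm (ennreal p) M (\<lambda>\<omega>. I t \<omega> - I_limit \<omega>)) \<longlongrightarrow> 0) (at_left T)"
proof (rule order_tendstoI)
  fix a :: ennreal assume "0 < a"
  then obtain b where b: "0 < b" "b < a" using dense by blast
  \<comment> \<open>The comparison level \<open>b\<close> lies strictly below \<open>a\<close>,
    hence is finite and may be replaced by a real number; strictness also turns the weak norm
    estimate into the required strict one.\<close>
  define e where "e = enn2real b"
  have be: "b = ennreal e" using b unfolding e_def by (metis ennreal_enn2real order_less_le_trans top_greatest)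
  have e: "0 < e" using b(1) be by simp
  then have "0 < e powr p" by simp
  from I_limit_moment[OF p this] obtain s0 where s0: "0 \<le> s0" "s0 < T"
    "\<And>t. s0 \<le> t \<Longrightarrow> t < T \<Longrightarrow> (\<integral>\<^sup>+\<omega>. ennreal (\<bar>I t \<omega> - I_limit \<omega>\<bar> powr p) \<partial>M) \<le> ennreal (e powr p)" by blast
  have "eventually (\<lambda>t. s0 < t \<and> t < T) (at_left T)" using s0 by (auto simp: eventually_at_left)
  then show "eventually (\<lambda>t. Lp_norm (ennreal p) M (\<lambda>\<omega>. I t \<omega> - I_limit \<omega>) < a) (at_left T)"
  proof eventually_elim
    case (elim t)
    then have "Lp_norm (ennreal p) M (\<lambda>\<omega>. I t \<omega> - I_limit \<omega>) \<le> ennreal e" using e p by (intro Lp_norm_le s0(3)) auto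
    then show ?case using b be by simp
  qed
qed simp

lemma frac_int_process_in_Lp:
  assumes p: "0 < p" and t: "0 \<le> t" "t < T"
  shows "frac_int_process T ((1 - \<theta>) / 2) (Z_process M T W g) t \<in> Lp_space (ennreal p) M"
proof -
  have "frac_int_process T ((1 - \<theta>) / 2) (Z_process M T W g) t = I t" using t by (auto simp: frac_int_process_eq)
  then show ?thesis using I_in_Lp[OF p t] by simp
qed

lemma frac_int_process_eventually_eq:
  "eventually (\<lambda>t. frac_int_process T ((1 - \<theta>) / 2) (Z_process M T W g) t = I t) (at_left T)"
proof -
  have "eventually (\<lambda>t. 0 < t \<and> t < T) (at_left T)" using T_pos by (auto simp: eventually_at_left)
  then show ?thesis by eventually_elim (auto simp: frac_int_process_eq)
qed

lemma frac_int_process_limit: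
  assumes p: "0 < p"
  shows "\<exists>L\<in>Lp_space (ennreal p) M.
    ((\<lambda>t. Lp_norm (ennreal p) M (\<lambda>\<omega>. frac_int_process T ((1 - \<theta>) / 2) (Z_process M T W g) t \<omega> - L \<omega>)) \<longlongrightarrow> 0) (at_left T) \<and>
    (AE \<omega> in M. ((\<lambda>t. frac_int_process T ((1 - \<theta>) / 2) (Z_process M T W g) t \<omega>) \<longlongrightarrow> L \<omega>) (at_left T))"
proof (intro bexI[OF _ I_limit_in_Lp[OF p]] conjI)
  have "eventually (\<lambda>t. Lp_norm (ennreal p) M (\<lambda>\<omega>. I t \<omega> - I_limit \<omega>) =
      Lp_norm (ennreal p) M (\<lambda>\<omega>. frac_int_process T ((1 - \<theta>) / 2) (Z_process M T W g) t \<omega> - I_limit \<omega>)) (at_left T)"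
    using frac_int_process_eventually_eq by eventually_elim simp
  from Lim_transform_eventually[OF I_tendsto_Lp[OF p] this]
  show "((\<lambda>t. Lp_norm (ennreal p) M (\<lambda>\<omega>. frac_int_process T ((1 - \<theta>) / 2) (Z_process M T W g) t \<omega> - I_limit \<omega>)) \<longlongrightarrow> 0) (at_left T)" .
  show "AE \<omega> in M. ((\<lambda>t. frac_int_process T ((1 - \<theta>) / 2) (Z_process M T W g) t \<omega>) \<longlongrightarrow> I_limit \<omega>) (at_left T)"
    using I_limit_AE
  proof eventually_elim
    case (elim \<omega>)
    have "eventually (\<lambda>t. I t \<omega> = frac_int_process T ((1 - \<theta>) / 2) (Z_process M T W g) t \<omega>) (at_left T)"
      using frac_int_process_eventually_eq by eventually_elim simp
    then show ?case by (rule Lim_transform_eventually[OF elim])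
  qed
qed

end

theorem theorem4:
  fixes M :: "'a measure" and T :: real and W :: "real \<Rightarrow> 'a \<Rightarrow> real"
  assumes "0 < T"
    and "complete_measure M"
    and "brownian_motion M T W"
    and "sets M = sets (aug_filtration M T W T)"
  shows "(\<forall>g\<in>C_Y. maximal_oscillation M T (grad_process M T W g)) \<and>
    (\<forall>\<theta>\<in>{0<..<1}. \<forall>p\<in>{0<..}. \<forall>g\<in>Hoelder \<theta> 2.
       (\<lambda>t \<omega>. frac_int_process T ((1 - \<theta>) / 2) (Z_process M T W g) t \<omega> - Z_process M T W g 0 \<omega>)
         \<in> BMO M (aug_filtration M T W) T p (\<lambda>t \<omega>. gbm W t \<omega> powr \<theta>) \<and>
       (\<forall>t\<in>{0..<T}.
          frac_int_process T ((1 - \<theta>) / 2) (Z_process M T W g) t \<in> Lp_space (ennreal p) M) \<and>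
       (\<exists>L\<in>Lp_space (ennreal p) M.
          ((\<lambda>t. Lp_norm (ennreal p) M
                  (\<lambda>\<omega>. frac_int_process T ((1 - \<theta>) / 2) (Z_process M T W g) t \<omega> - L \<omega>)) \<longlongrightarrow> 0)
            (at_left T) \<and>
          (AE \<omega> in M.
             ((\<lambda>t. frac_int_process T ((1 - \<theta>) / 2) (Z_process M T W g) t \<omega>) \<longlongrightarrow> L \<omega>)
               (at_left T))))"
proof -
  have "prob_space M" using assms(3) by (simp add: brownian_motion_def)
  then have bm: "brownian M T W" using assms(1,3) by (simp add: brownian_def brownian_axioms_def)
  show ?thesis
  proof (rule conjI)
    show "\<forall>g\<in>C_Y. maximal_oscillation M T (grad_process M T W g)"
      using brownian.maximal_oscillation_grad[OF bm] by blast
  next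
    have hb: "hoelder_brownian M T W g \<theta>" if "\<theta> \<in> {0<..<1}" "g \<in> Hoelder \<theta> 2" for \<theta> g
      using that bm by (simp add: hoelder_brownian_def hoelder_brownian_axioms_def)
    note parts = hoelder_brownian.BMO_I[OF hb] hoelder_brownian.frac_int_process_in_Lp[OF hb] hoelder_brownian.frac_int_process_limit[OF hb]
    show "\<forall>\<theta>\<in>{0<..<1}. \<forall>p\<in>{0<..}. \<forall>g\<in>Hoelder \<theta> 2.
       (\<lambda>t \<omega>. frac_int_process T ((1 - \<theta>) / 2) (Z_process M T W g) t \<omega> - Z_process M T W g 0 \<omega>)
         \<in> BMO M (aug_filtration M T W) T p (\<lambda>t \<omega>. gbm W t \<omega> powr \<theta>) \<and>
       (\<forall>t\<in>{0..<T}.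
          frac_int_process T ((1 - \<theta>) / 2) (Z_process M T W g) t \<in> Lp_space (ennreal p) M) \<and>
       (\<exists>L\<in>Lp_space (ennreal p) M.
          ((\<lambda>t. Lp_norm (ennreal p) M
                  (\<lambda>\<omega>. frac_int_process T ((1 - \<theta>) / 2) (Z_process M T W g) t \<omega> - L \<omega>)) \<longlongrightarrow> 0)
            (at_left T) \<and>
          (AE \<omega> in M.
             ((\<lambda>t. frac_int_process T ((1 - \<theta>) / 2) (Z_process M T W g) t \<omega>) \<longlongrightarrow> L \<omega>)
               (at_left T)))"
      by (intro ballI conjI parts) simp_all
  qed
qed

end
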